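(* Let $\mu$ be a fixed probability measure on $[a,b]$ with $\mu\ll\mathscr{L}$, whose density $m=\frac{d\mu}{d\mathscr{L}}$ satisfies $0<\operatorname{ess\,inf} m$, $\operatorname{ess\,sup} m<\infty$ and $\partial_x m\in L^1$. (1) If $u_0 m-\alpha\,\partial_x\big((\partial_x u_0)\,m\big)\in L^2$, then there exists a unique variational solution with initial velocity $u_0$, and the map $u_0 m-\alpha\,\partial_x\big((\partial_x u_0)\,m\big)\mapsto \Phi_t$ is continuous with respect to the $L^2$ topology. (2) If $u_0 m\in L^2$, then there exists a unique regularized variational solution with initial velocity $u_0$, and the map $u_0\mapsto\Phi_t$ is continuous with respect to the $L^2$ topology. Here $\Phi_t$ denotes the minimizer entering the definition of the respective solution.
   Context: Fix reals $a<b$ and a regularization parameter $\alpha\ge 0$; function spaces are on $[a,b]$ and $\mathscr{L}$ is Lebesgue measure. The Helly space is $\mathscr{H}=\{\Phi:[a,b]\to[a,b]\ :\ \Phi \text{ monotone (non-decreasing)},\ \Phi(a)=a,\ \Phi(b)=b\}$. The negative entropy of a probability measure $\nu$ is $\mathsf{Ent}(\nu)=\int \frac{d\nu}{d\mathscr{L}}\log\frac{d\nu}{d\mathscr{L}}\,d\mathscr{L}$ if $\nu\ll\mathscr{L}$ and $+\infty$ otherwise; $\Phi_\#\mu$ denotes the pushforward. For a linear functional $f$ set, for $\Phi\in\mathscr{H}$, $F_\alpha^{f,\mu}(\Phi)=\int_a^b\frac{(\Phi(x)-x)^2}{2}\,d\mu(x)+\alpha\,\mathsf{Ent}(\Phi_\#\mu)-f(\Phi)$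 (for $\alpha=0$ the entropy term is absent). For a velocity $w$ define $f_\alpha^{w}(\Phi)=\int_a^b \Phi\, w+\alpha\,\partial_x\Phi\,\partial_x w\,d\mu-\int_a^b\alpha\,\partial_x\Phi\,d\mu$. For $\Phi\in\mathscr{H}$ not weakly differentiable this is understood via integration by parts, i.e. $f_\alpha^w(\Phi)=\int_a^b\Phi\,[\,w m-\alpha\partial_x(m\,\partial_x w)+\alpha\,\partial_x m\,]\,dx+\alpha[m\,(\partial_x w)\Phi]_a^b-\alpha[m\Phi]_a^b$, the boundary terms being constants independent of $\Phi\in\mathscr{H}$. A variational solution with (measurable) initial velocity $u_0:[a,b]\to\mathbb{R}$ is a pair $u:[a,b]\times\mathbb{R}_+\to\mathbb{R}$, $\rho:\mathbb{R}_+\to\{\text{probability measures on }[a,b]\}$ such that, for $\Phi_t\in\mathscr{H}$ a minimizer of $F_\alpha^{f_\alpha^{tu_0},\mu}$ for each $t$, with $t\mapsto\Phi_t$ weakly differentiable as a map into $L^2(\mu)$ (derivative $\dot\Phi_t$), one has $\rho_t=(\Phi_t)_\#\mu$ and $$u(y,t)=\begin{cases}\dot\Phi_t(\Phi_t^{-1}(y)) & \text{if }\#\Phi_t^{-1}(y)=1,\\ 0&\text{if }\#\Phi_t^{-1}(y)=0,\\ \frac{1}{\mu(\Phi_t^{-1}(y))}\int_{\Phi_t^{-1}(y)}\dot\Phi_t\,d\mu&\text{otherwise,}\end{cases}$$ where $\#$ is set cardinality. It is a regularized variational solution if instead $\Phi_t$ minimizes $F_\alpha^{f,\mu}$ with $f(\Phi)=t\int_a^b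 u_0\Phi\,d\mu+f_\alpha^{0}(\Phi)$. *)

theory Defs
  imports "HOL-Probability.Probability"
begin

definition leb :: "real \<Rightarrow> real \<Rightarrow> real measure" where
  "leb a b = restrict_space lborel {a..b}"

definition L2 :: "'a measure \<Rightarrow> ('a \<Rightarrow> real) set" where
  "L2 M = {f. f \<in> borel_measurable M \<and> integrable M (\<lambda>x. (f x)\<^sup>2)}"

definition L2_norm :: "'a measure \<Rightarrow> ('a \<Rightarrow> real) \<Rightarrow> real" where
  "L2_norm M f = sqrt (\<integral>x. (f x)\<^sup>2 \<partial>M)"

definition ess_inf :: "'a measure \<Rightarrow> ('a \<Rightarrow> ereal) \<Rightarrow> ereal" where
  "ess_inf M f = - esssup M (\<lambda>x. - f x)"

text \<open>The density of \<open>\<mu>\<close> with respect to Lebesgue measure on \<open>[a,b]\<close> (determined up to null sets).\<close>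

definition dens :: "real \<Rightarrow> real \<Rightarrow> real measure \<Rightarrow> real \<Rightarrow> real" where
  "dens a b \<mu> x = enn2real (RN_deriv (leb a b) \<mu> x)"

definition test_functions :: "real set \<Rightarrow> (real \<Rightarrow> real) set" where
  "test_functions S = {\<phi>. (\<forall>n x. (deriv ^^ n) \<phi> differentiable (at x)) \<and>
     (\<exists>K. compact K \<and> K \<subseteq> S \<and> (\<forall>x. x \<notin> K \<longrightarrow> \<phi> x = 0))}"

definition locally_integrable :: "real set \<Rightarrow> (real \<Rightarrow> real) \<Rightarrow> bool" where
  "locally_integrable S f \<longleftrightarrow> (\<forall>K. compact K \<and> K \<subseteq> S \<longrightarrow> set_integrable lborel K f)"

definition is_weak_deriv :: "real set \<Rightarrow> (real \<Rightarrow> real) \<Rightarrow> (real \<Rightarrow> real) \<Rightarrow> bool" where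
  "is_weak_deriv S f g \<longleftrightarrow> locally_integrable S f \<and> locally_integrable S g \<and>
     (\<forall>\<phi>\<in>test_functions S.
        (LINT x:S|lborel. f x * deriv \<phi> x) = - (LINT x:S|lborel. g x * \<phi> x))"

definition weakly_differentiable :: "real set \<Rightarrow> (real \<Rightarrow> real) \<Rightarrow> bool" where
  "weakly_differentiable S f \<longleftrightarrow> (\<exists>g. is_weak_deriv S f g)"

text \<open>Some representative of the weak derivative; it is unique up to null sets, and unspecified if
  the function is not weakly differentiable.\<close>

definition weak_deriv :: "real set \<Rightarrow> (real \<Rightarrow> real) \<Rightarrow> real \<Rightarrow> real" where
  "weak_deriv S f = (SOME g. is_weak_deriv S f g)"

text \<open>Weak derivative of a curve \<open>\<Phi>\<close> into \<open>L\<^sup>2(\<mu>)\<close>. The identity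
  \<open>\<integral> \<phi>'(t) \<Phi>\<^sub>t dt = - \<integral> \<phi>(t) D\<^sub>t dt\<close> between Bochner integrals is tested against every \<open>\<psi> \<in> L\<^sup>2(\<mu>)\<close>.
  Weak measurability of the curves is contained in \<^const>\<open>is_weak_deriv\<close>; it agrees with Bochner
  measurability by separability, so the two norm conditions express local Bochner integrability.
  No joint measurability of representatives is asked for.\<close>

definition is_weak_L2_deriv ::
    "'a measure \<Rightarrow> real set \<Rightarrow> (real \<Rightarrow> 'a \<Rightarrow> real) \<Rightarrow> (real \<Rightarrow> 'a \<Rightarrow> real) \<Rightarrow> bool" where
  "is_weak_L2_deriv \<mu> S \<Phi> D \<longleftrightarrow>
     (\<forall>t\<in>S. \<Phi> t \<in> L2 \<mu> \<and> D t \<in> L2 \<mu>) \<and>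
     locally_integrable S (\<lambda>t. L2_norm \<mu> (\<Phi> t)) \<and>
     locally_integrable S (\<lambda>t. L2_norm \<mu> (D t)) \<and>
     (\<forall>\<psi>\<in>L2 \<mu>. is_weak_deriv S (\<lambda>t. \<integral>x. \<Phi> t x * \<psi> x \<partial>\<mu>) (\<lambda>t. \<integral>x. D t x * \<psi> x \<partial>\<mu>))"

text \<open>Boundary values of a function with integrable weak derivative, i.e. those of its continuous
  representative, as limits of one-sided averages.\<close>

definition trace_left :: "real \<Rightarrow> (real \<Rightarrow> real) \<Rightarrow> real" where
  "trace_left a g = Lim (at_right 0) (\<lambda>h. (LINT x:{a..a + h}|lborel. g x) / h)"

definition trace_right :: "real \<Rightarrow> (real \<Rightarrow> real) \<Rightarrow> real" where
  "trace_right b g = Lim (at_right 0) (\<lambda>h. (LINT x:{b - h..b}|lborel. g x) / h)"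

definition helly :: "real \<Rightarrow> real \<Rightarrow> (real \<Rightarrow> real) set" where
  "helly a b = {\<Phi>. \<Phi> \<in> {a..b} \<rightarrow> {a..b} \<and> mono_on {a..b} \<Phi> \<and> \<Phi> a = a \<and> \<Phi> b = b}"

definition pushforward :: "real \<Rightarrow> real \<Rightarrow> (real \<Rightarrow> real) \<Rightarrow> real measure \<Rightarrow> real measure" where
  "pushforward a b \<Phi> \<mu> = distr \<mu> (restrict_space borel {a..b}) \<Phi>"

text \<open>The integral is taken in the extended sense; its negative part is always finite because
  \<open>s ln s \<ge> - 1 / e\<close>.\<close>

definition Ent :: "real \<Rightarrow> real \<Rightarrow> real measure \<Rightarrow> ereal" where
  "Ent a b \<nu> =
     (if absolutely_continuous (leb a b) \<nu>
      then enn2ereal (\<integral>\<^sup>+x. ennreal (dens a b \<nu> x * ln (dens a b \<nu> x)) \<partial>leb a b)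
         - enn2ereal (\<integral>\<^sup>+x. ennreal (- (dens a b \<nu> x * ln (dens a b \<nu> x))) \<partial>leb a b)
      else \<infinity>)"

definition F_fun :: "real \<Rightarrow> real \<Rightarrow> real \<Rightarrow> real measure \<Rightarrow> ((real \<Rightarrow> real) \<Rightarrow> real) \<Rightarrow>
    (real \<Rightarrow> real) \<Rightarrow> ereal" where
  "F_fun a b \<alpha> \<mu> f \<Phi> =
     ereal (\<integral>x. (\<Phi> x - x)\<^sup>2 / 2 \<partial>\<mu>)
     + (if \<alpha> = 0 then 0 else ereal \<alpha> * Ent a b (pushforward a b \<Phi> \<mu>))
     - ereal (f \<Phi>)"

definition minimizer :: "real \<Rightarrow> real \<Rightarrow> real \<Rightarrow> real measure \<Rightarrow> ((real \<Rightarrow> real) \<Rightarrow> real) \<Rightarrow>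
    (real \<Rightarrow> real) \<Rightarrow> bool" where
  "minimizer a b \<alpha> \<mu> f \<Phi> \<longleftrightarrow>
     \<Phi> \<in> helly a b \<and> (\<forall>\<Psi>\<in>helly a b. F_fun a b \<alpha> \<mu> f \<Phi> \<le> F_fun a b \<alpha> \<mu> f \<Psi>)"

text \<open>The function \<open>w m - \<alpha> \<partial>\<^sub>x((\<partial>\<^sub>x w) m)\<close>. For \<open>\<alpha> = 0\<close> the (possibly unspecified) derivatives
  drop out.\<close>

definition source :: "real \<Rightarrow> real \<Rightarrow> real \<Rightarrow> real measure \<Rightarrow> (real \<Rightarrow> real) \<Rightarrow> real \<Rightarrow> real" where
  "source a b \<alpha> \<mu> w x = w x * dens a b \<mu> x
     - \<alpha> * weak_deriv {a<..<b} (\<lambda>y. weak_deriv {a<..<b} w y * dens a b \<mu> y) x"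

text \<open>Weak differentiability of an element of the Helly space on the closed interval: the values
  \<open>\<Phi>(a) = a\<close>, \<open>\<Phi>(b) = b\<close> have to be attained continuously. A jump at an endpoint is a singular part
  of \<open>\<partial>\<^sub>x\<Phi>\<close> like a jump in the interior; it is invisible to test functions on \<open>(a,b)\<close> but is seen by
  the integration by parts with boundary values \<open>\<Phi>(a)\<close>, \<open>\<Phi>(b)\<close>.\<close>

definition weakly_differentiable_closed :: "real \<Rightarrow> real \<Rightarrow> (real \<Rightarrow> real) \<Rightarrow> bool" where
  "weakly_differentiable_closed a b \<Phi> \<longleftrightarrow> weakly_differentiable {a<..<b} \<Phi> \<and>
     (\<Phi> \<longlongrightarrow> \<Phi> a) (at_right a) \<and> (\<Phi> \<longlongrightarrow> \<Phi> b) (at_left b)"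

definition f_vel :: "real \<Rightarrow> real \<Rightarrow> real \<Rightarrow> real measure \<Rightarrow> (real \<Rightarrow> real) \<Rightarrow>
    (real \<Rightarrow> real) \<Rightarrow> real" where
  "f_vel a b \<alpha> \<mu> w \<Phi> =
    (let I = {a<..<b}; m = dens a b \<mu>; dw = weak_deriv I w; d\<Phi> = weak_deriv I \<Phi> in
     if weakly_differentiable_closed a b \<Phi>
     then (\<integral>x. \<Phi> x * w x + \<alpha> * d\<Phi> x * dw x \<partial>\<mu>) - (\<integral>x. \<alpha> * d\<Phi> x \<partial>\<mu>)
     else (\<integral>x. \<Phi> x * (source a b \<alpha> \<mu> w x + \<alpha> * weak_deriv I m x) \<partial>leb a b)
        + \<alpha> * (trace_right b (\<lambda>x. dw x * m x) * \<Phi> b - trace_left a (\<lambda>x. dw x * m x) * \<Phi> a)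
        - \<alpha> * (trace_right b m * \<Phi> b - trace_left a m * \<Phi> a))"

text \<open>\<open>D\<close> stands for the time derivative of \<open>\<Phi>\<close> at a fixed time. Note that \<^term>\<open>card\<close> is 0 on
  infinite sets, so the case of an empty fibre is tested by \<open>S = {}\<close>.\<close>

definition velocity :: "real \<Rightarrow> real \<Rightarrow> real measure \<Rightarrow> (real \<Rightarrow> real) \<Rightarrow> (real \<Rightarrow> real) \<Rightarrow>
    real \<Rightarrow> real" where
  "velocity a b \<mu> \<Phi> D y =
    (let S = {x \<in> {a..b}. \<Phi> x = y} in
     if card S = 1 then D (the_elem S)
     else if S = {} then 0
     else (LINT x:S|\<mu>. D x) / measure \<mu> S)"

text \<open>Solutions driven by a time-dependent family \<open>f\<close> of functionals.\<close>

definition solution_for :: "real \<Rightarrow> real \<Rightarrow> real \<Rightarrow> real measure \<Rightarrow>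
    (real \<Rightarrow> (real \<Rightarrow> real) \<Rightarrow> real) \<Rightarrow>
    (real \<Rightarrow> real \<Rightarrow> real) \<Rightarrow> (real \<Rightarrow> real measure) \<Rightarrow> bool" where
  "solution_for a b \<alpha> \<mu> f u \<rho> \<longleftrightarrow>
     (\<exists>\<Phi> D. (\<forall>t\<ge>0. minimizer a b \<alpha> \<mu> (f t) (\<Phi> t)) \<and>
            is_weak_L2_deriv \<mu> {0<..} \<Phi> D \<and>
            (\<forall>t\<ge>0. \<rho> t = pushforward a b (\<Phi> t) \<mu>) \<and>
            (\<forall>t\<ge>0. \<forall>y\<in>{a..b}. u y t = velocity a b \<mu> (\<Phi> t) (D t) y))"

definition f_var :: "real \<Rightarrow> real \<Rightarrow> real \<Rightarrow> real measure \<Rightarrow> (real \<Rightarrow> real) \<Rightarrow> real \<Rightarrow>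
    (real \<Rightarrow> real) \<Rightarrow> real" where
  "f_var a b \<alpha> \<mu> u0 t = f_vel a b \<alpha> \<mu> (\<lambda>x. t * u0 x)"

definition f_reg :: "real \<Rightarrow> real \<Rightarrow> real \<Rightarrow> real measure \<Rightarrow> (real \<Rightarrow> real) \<Rightarrow> real \<Rightarrow>
    (real \<Rightarrow> real) \<Rightarrow> real" where
  "f_reg a b \<alpha> \<mu> u0 t \<Phi> = t * (\<integral>x. u0 x * \<Phi> x \<partial>\<mu>) + f_vel a b \<alpha> \<mu> (\<lambda>x. 0) \<Phi>"

definition variational_solution :: "real \<Rightarrow> real \<Rightarrow> real \<Rightarrow> real measure \<Rightarrow> (real \<Rightarrow> real) \<Rightarrow>
    (real \<Rightarrow> real \<Rightarrow> real) \<Rightarrow> (real \<Rightarrow> real measure) \<Rightarrow> bool" where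
  "variational_solution a b \<alpha> \<mu> u0 = solution_for a b \<alpha> \<mu> (f_var a b \<alpha> \<mu> u0)"

definition regularized_variational_solution :: "real \<Rightarrow> real \<Rightarrow> real \<Rightarrow> real measure \<Rightarrow>
    (real \<Rightarrow> real) \<Rightarrow> (real \<Rightarrow> real \<Rightarrow> real) \<Rightarrow> (real \<Rightarrow> real measure) \<Rightarrow> bool" where
  "regularized_variational_solution a b \<alpha> \<mu> u0 = solution_for a b \<alpha> \<mu> (f_reg a b \<alpha> \<mu> u0)"

text \<open>A velocity is identified with another one if they agree \<open>\<rho>\<^sub>t\<close>-almost everywhere for almost every
  \<open>t\<close>: the time derivative is only an element of \<open>L\<^sup>2(\<mu>)\<close>, defined for almost every time.\<close>

definition ex_unique_solution ::
    "((real \<Rightarrow> real \<Rightarrow> real) \<Rightarrow> (real \<Rightarrow> real measure) \<Rightarrow> bool) \<Rightarrow> bool" where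
  "ex_unique_solution sol \<longleftrightarrow> (\<exists>u \<rho>. sol u \<rho>) \<and>
     (\<forall>u \<rho> u' \<rho>'. sol u \<rho> \<and> sol u' \<rho>' \<longrightarrow>
        (\<forall>t\<ge>0. \<rho> t = \<rho>' t) \<and>
        (AE t in lborel. t > 0 \<longrightarrow> (AE y in \<rho> t. u y t = u' y t)))"

text \<open>Initial velocities with \<open>u\<^sub>0 m - \<alpha> \<partial>\<^sub>x((\<partial>\<^sub>x u\<^sub>0) m) \<in> L\<^sup>2\<close>, including the existence of the weak
  derivatives that occur.\<close>

definition admissible :: "real \<Rightarrow> real \<Rightarrow> real \<Rightarrow> real measure \<Rightarrow> (real \<Rightarrow> real) set" where
  "admissible a b \<alpha> \<mu> = {u0. u0 \<in> borel_measurable (leb a b) \<and>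
     (\<alpha> > 0 \<longrightarrow> weakly_differentiable {a<..<b} u0 \<and>
        weakly_differentiable {a<..<b} (\<lambda>x. weak_deriv {a<..<b} u0 x * dens a b \<mu> x)) \<and>
     source a b \<alpha> \<mu> u0 \<in> L2 (leb a b)}"

definition admissible_reg :: "real \<Rightarrow> real \<Rightarrow> real measure \<Rightarrow> (real \<Rightarrow> real) set" where
  "admissible_reg a b \<mu> = {u0. u0 \<in> borel_measurable (leb a b) \<and>
     (\<lambda>x. u0 x * dens a b \<mu> x) \<in> L2 (leb a b)}"

text \<open>Continuity in \<open>L\<^sup>2\<close>, at \<open>u0 \<in> U\<close>, of the assignment sending \<open>g v\<close>, \<open>v \<in> U\<close>, to the minimizer for
  \<open>f v\<close>. As it quantifies over all minimizers, it contains that the minimizer depends, up to null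
  sets, on the class of \<open>g v\<close> only.\<close>

definition minimizer_continuous_at :: "real \<Rightarrow> real \<Rightarrow> real \<Rightarrow> real measure \<Rightarrow>
    (real \<Rightarrow> real) set \<Rightarrow> ((real \<Rightarrow> real) \<Rightarrow> real \<Rightarrow> real) \<Rightarrow>
    ((real \<Rightarrow> real) \<Rightarrow> (real \<Rightarrow> real) \<Rightarrow> real) \<Rightarrow> (real \<Rightarrow> real) \<Rightarrow> bool" where
  "minimizer_continuous_at a b \<alpha> \<mu> U g f u0 \<longleftrightarrow>
     (\<forall>\<epsilon>>0. \<exists>\<delta>>0. \<forall>v\<in>U. L2_norm (leb a b) (\<lambda>x. g v x - g u0 x) < \<delta> \<longrightarrow>
        (\<forall>\<Phi> \<Psi>. minimizer a b \<alpha> \<mu> (f u0) \<Phi> \<and> minimizer a b \<alpha> \<mu> (f v) \<Psi> \<longrightarrow>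
           L2_norm (leb a b) (\<lambda>x. \<Psi> x - \<Phi> x) < \<epsilon>))"

end

theory Submission
  imports Defs
begin

text \<open>
  Why the theorem holds. On the Helly space both functionals are, up to an additive constant, the pairing
  of \<open>\<Phi>\<close> with a fixed integrable function that is affine in time: \<open>t s + \<alpha> m'\<close>, where \<open>s\<close> is
  \<open>u\<^sub>0 m - \<alpha> \<partial>\<^sub>x((\<partial>\<^sub>x u\<^sub>0) m)\<close> in the first part and \<open>u\<^sub>0 m\<close> in the second
  (\<open>f_var_linear\<close>, \<open>f_reg_linear\<close>). For \<open>\<Phi>\<close> without a weak derivative this is the definition once the
  boundary terms are known to be constants. For the others it is an integration by parts up to the
  endpoints, which needs boundary values of \<open>p = (\<partial>\<^sub>x w) m\<close>. They exist because \<open>(w, p)\<close> solves a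
  linear system with bounded coefficients and integrable right side, so that \<open>w\<close> and \<open>p\<close> are bounded
  (\<open>linear_system_bounded\<close>), and because a monotone \<open>\<Phi>\<close> with a weak derivative and without jumps at the
  endpoints is absolutely continuous on the closed interval (\<open>helly_antiderivative\<close>).

  It remains to minimize an energy that consists of the quadratic transport cost, the entropy of the push
  forward and a linear term. The entropy is lower semicontinuous, because its Legendre dual expresses it as a
  supremum over continuous test functions (\<open>Ent_ge_dual\<close>, \<open>Ent_le_dual\<close>), and it is convex in \<open>\<Phi>\<close>: for
  strictly increasing \<open>\<Phi>\<close> it is the supremum over partitions of the entropies that see only the masses of
  the cells and the lengths of their images, and these are convex because the logarithm is concave
  (\<open>Ent_midpoint\<close>). Maps with flat pieces have infinite entropy. The quadratic cost therefore makes
  the energy uniformly convex along midpoints. Hence minimizing sequences are Cauchy sequences in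
  \<open>L\<^sup>2(\<mu>)\<close> and a minimizer exists (\<open>ex_energy_minimizer\<close>), and the distance of two minimizers is bounded by
  that of their linear terms (\<open>energy_minimizer_stability\<close>). This gives uniqueness up to null sets,
  continuous dependence on the data, and a Lipschitz bound in time.

  A Lipschitz curve in \<open>L\<^sup>2\<close> has a weak derivative: its difference quotients along dyadic partitions are a
  bounded martingale in the Hilbert space \<open>L\<^sup>2\<close> over time and space and converge
  (\<open>Lipschitz_curve_weak_derivative\<close>). So solutions exist. They are unique because the push forward depends
  only on the class of \<open>\<Phi>\<^sub>t\<close>, the weak derivative is determined for almost every time
  (\<open>weak_L2_deriv_unique\<close>), and the velocity, although defined through pointwise fibres, is determined by
  the classes of \<open>\<Phi>\<^sub>t\<close> and its derivative almost everywhere with respect to the push forward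
  (\<open>velocity_cong_AE\<close>).\<close>


section \<open>Square-integrable functions\<close>

lemma L2D: assumes "f \<in> L2 M"
  shows "f \<in> borel_measurable M" "integrable M (\<lambda>x. (f x)\<^sup>2)"
  using assms by (auto simp: L2_def)

lemma L2_norm_nonneg [simp]: "0 \<le> L2_norm M f"
  by (simp add: L2_norm_def)

lemma L2_norm_power2: "(L2_norm M f)\<^sup>2 = (\<integral>x. (f x)\<^sup>2 \<partial>M)"
  by (simp add: L2_norm_def)

lemma L2_mult_integrable:
  assumes "f \<in> L2 M" "g \<in> L2 M"
  shows "integrable M (\<lambda>x. f x * g x)"
proof (rule Bochner_Integration.integrable_bound)
  show "integrable M (\<lambda>x. (f x)\<^sup>2 + (g x)\<^sup>2)"
    using L2D(2)[OF assms(1)] L2D(2)[OF assms(2)] by auto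
  show "(\<lambda>x. f x * g x) \<in> borel_measurable M"
    using L2D(1)[OF assms(1)] L2D(1)[OF assms(2)] by auto
  have "\<bar>u * v\<bar> \<le> u\<^sup>2 + v\<^sup>2" for u v :: real
    using sum_squares_bound[of "\<bar>u\<bar>" "\<bar>v\<bar>"] mult_nonneg_nonneg[of "\<bar>u\<bar>" "\<bar>v\<bar>"]
    unfolding power2_abs abs_mult by linarith
  then show "AE x in M. norm (f x * g x) \<le> norm ((f x)\<^sup>2 + (g x)\<^sup>2)" by simp
qed

lemma L2_lincomb:
  assumes "f \<in> L2 M" "g \<in> L2 M"
  shows "(\<lambda>x. r * f x + s * g x) \<in> L2 M"
proof -
  have "integrable M (\<lambda>x. r\<^sup>2 * (f x)\<^sup>2 + (2 * r * s) * (f x * g x) + s\<^sup>2 * (g x)\<^sup>2)"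
    using L2D(2)[OF assms(1)] L2D(2)[OF assms(2)] L2_mult_integrable[OF assms] by auto
  also have "(\<lambda>x. r\<^sup>2 * (f x)\<^sup>2 + (2 * r * s) * (f x * g x) + s\<^sup>2 * (g x)\<^sup>2)
     = (\<lambda>x. (r * f x + s * g x)\<^sup>2)" by (auto simp: power2_eq_square algebra_simps)
  finally show ?thesis using L2D(1)[OF assms(1)] L2D(1)[OF assms(2)] by (auto simp: L2_def)
qed

lemma L2_diff: "f \<in> L2 M \<Longrightarrow> g \<in> L2 M \<Longrightarrow> (\<lambda>x. f x - g x) \<in> L2 M"
  using L2_lincomb[of f M g 1 "-1"] by simp

lemma L2_scale: "f \<in> L2 M \<Longrightarrow> (\<lambda>x. r * f x) \<in> L2 M"
  using L2_lincomb[of f M f r 0] by simp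

lemma L2_bounded:
  assumes "finite_measure M" "f \<in> borel_measurable M" "AE x in M. \<bar>f x\<bar> \<le> K"
  shows "f \<in> L2 M"
proof -
  have "AE x in M. norm ((f x)\<^sup>2) \<le> K\<^sup>2"
    using assms(3) by eventually_elim (auto simp: abs_le_square_iff[symmetric])
  then show ?thesis
    using assms finite_measure.integrable_const_bound[of M "\<lambda>x. (f x)\<^sup>2" "K\<^sup>2"] by (auto simp: L2_def)
qed

lemma L2_integrable:
  assumes "finite_measure M" "f \<in> L2 M"
  shows "integrable M f"
  using finite_measure.square_integrable_imp_integrable[OF assms(1) L2D[OF assms(2)]] .

lemma L2_Cauchy_Schwarz:
  assumes f: "f \<in> L2 M" and g: "g \<in> L2 M"
  shows "\<bar>\<integral>x. f x * g x \<partial>M\<bar> \<le> L2_norm M f * L2_norm M g"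
proof -
  define A B C where "A = (\<integral>x. (f x)\<^sup>2 \<partial>M)" and "B = (\<integral>x. f x * g x \<partial>M)" and "C = (\<integral>x. (g x)\<^sup>2 \<partial>M)"
  have AC: "A \<ge> 0" "C \<ge> 0" by (auto simp: A_def C_def)
  have key: "0 \<le> A - 2 * r * B + r\<^sup>2 * C" for r
  proof -
    have "0 \<le> (\<integral>x. (f x - r * g x)\<^sup>2 \<partial>M)" by simp
    also have "\<dots> = (\<integral>x. (f x)\<^sup>2 - (2 * r) * (f x * g x) + r\<^sup>2 * (g x)\<^sup>2 \<partial>M)"
      by (intro Bochner_Integration.integral_cong) (auto simp: power2_eq_square algebra_simps)
    also have "\<dots> = A - 2 * r * B + r\<^sup>2 * C"
      using L2D(2)[OF f] L2D(2)[OF g] L2_mult_integrable[OF f g] by (simp add: A_def B_def C_def)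
    finally show ?thesis .
  qed
  have "B\<^sup>2 \<le> A * C"
  proof (cases "C = 0")
    case True
    have "B = 0"
    proof (rule ccontr)
      assume "B \<noteq> 0"
      with key[of "(A + 1) / (2 * B)"] True AC show False by (simp add: field_simps)
    qed
    then show ?thesis using True by simp
  next
    case False
    with AC have "C > 0" by simp
    with key[of "B / C"] show ?thesis by (simp add: field_simps power2_eq_square)
  qed
  then have "\<bar>B\<bar> \<le> sqrt (A * C)" by (simp add: real_le_rsqrt)
  then show ?thesis by (simp add: L2_norm_def A_def B_def C_def real_sqrt_mult)
qed

lemma L2_norm_triangle:
  assumes f: "f \<in> L2 M" and g: "g \<in> L2 M"
  shows "L2_norm M f \<le> L2_norm M (\<lambda>x. f x - g x) + L2_norm M g"
proof -
  let ?h = "\<lambda>x. f x - g x"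
  have h: "?h \<in> L2 M" using L2_diff[OF f g] .
  have "(L2_norm M f)\<^sup>2 = (\<integral>x. (?h x)\<^sup>2 + 2 * (?h x * g x) + (g x)\<^sup>2 \<partial>M)"
    unfolding L2_norm_power2 by (intro Bochner_Integration.integral_cong) (auto simp: power2_eq_square algebra_simps)
  also have "\<dots> = (L2_norm M ?h)\<^sup>2 + 2 * (\<integral>x. ?h x * g x \<partial>M) + (L2_norm M g)\<^sup>2"
    unfolding L2_norm_power2 using L2D(2)[OF h] L2D(2)[OF g] L2_mult_integrable[OF h g] by simp
  also have "\<dots> \<le> (L2_norm M ?h + L2_norm M g)\<^sup>2"
    using L2_Cauchy_Schwarz[OF h g] by (simp add: power2_eq_square algebra_simps)
  finally show ?thesis by (rule power2_le_imp_le) simp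
qed

text \<open>On a finite measure space a Cauchy sequence in \<open>L\<^sup>2\<close> is one in \<open>L\<^sup>1\<close>, by the Cauchy-Schwarz
  inequality against the constant one.\<close>

lemma L2_Cauchy_AE_convergent_subseq:
  fixes f :: "nat \<Rightarrow> 'a \<Rightarrow> real"
  assumes fin: "finite_measure M" and f: "\<And>n. f n \<in> L2 M"
    and C: "\<And>e. e > 0 \<Longrightarrow> \<exists>N. \<forall>m\<ge>N. \<forall>n\<ge>N. (\<integral>x. (f m x - f n x)\<^sup>2 \<partial>M) < e"
  obtains r where "strict_mono r" "AE x in M. convergent (\<lambda>k. f (r k) x)"
proof -
  interpret finite_measure M by fact
  define B where "B = L2_norm M (\<lambda>x. 1)"
  have B: "B \<ge> 0" by (simp add: B_def)
  have one: "(\<lambda>x. 1) \<in> L2 M" by (rule L2_bounded[OF fin, where K=1]) auto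
  have "\<exists>N. \<forall>i\<ge>N. \<forall>j\<ge>N. (LINT x|M. norm (f i x - f j x)) < e" if e: "e > 0" for e
  proof -
    obtain N where N: "\<And>m n. m \<ge> N \<Longrightarrow> n \<ge> N \<Longrightarrow> (\<integral>x. (f m x - f n x)\<^sup>2 \<partial>M) < (e / (B + 1))\<^sup>2"
      using C[of "(e / (B + 1))\<^sup>2"] e B by auto
    have "(LINT x|M. norm (f i x - f j x)) < e" if "i \<ge> N" "j \<ge> N" for i j
    proof -
      have a: "(\<lambda>x. \<bar>f i x - f j x\<bar>) \<in> L2 M" using L2_diff[OF f f, of i j] by (auto simp: L2_def)
      have "L2_norm M (\<lambda>x. \<bar>f i x - f j x\<bar>) \<le> e / (B + 1)"
        unfolding L2_norm_def using N[OF that] e B by (intro real_le_lsqrt) auto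
      then have "L2_norm M (\<lambda>x. \<bar>f i x - f j x\<bar>) * B \<le> e / (B + 1) * B"
        using B by (rule mult_right_mono)
      also have "\<dots> < e" using e B by (simp add: field_simps)
      finally show ?thesis using L2_Cauchy_Schwarz[OF a one] by (simp add: B_def)
    qed
    then show ?thesis by blast
  qed
  from cauchy_L1_AE_cauchy_subseq[OF L2_integrable[OF fin f] this]
  obtain r where "strict_mono r" "AE x in M. Cauchy (\<lambda>i. f (r i) x)" by metis
  then show thesis using that by (auto simp: Cauchy_convergent_iff)
qed

text \<open>Completeness of \<open>L\<^sup>2\<close>; Fatou's lemma identifies the almost everywhere limit as the limit in \<open>L\<^sup>2\<close>.\<close>

lemma L2_complete:
  fixes f :: "nat \<Rightarrow> 'a \<Rightarrow> real"
  assumes fin: "finite_measure M" and f: "\<And>n. f n \<in> L2 M"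
    and C: "\<And>e. e > 0 \<Longrightarrow> \<exists>N. \<forall>m\<ge>N. \<forall>n\<ge>N. (\<integral>x. (f m x - f n x)\<^sup>2 \<partial>M) < e"
  obtains g where "g \<in> L2 M" "(\<lambda>n. L2_norm M (\<lambda>x. f n x - g x)) \<longlonglongrightarrow> 0"
proof -
  obtain r where r: "strict_mono r" and conv: "AE x in M. convergent (\<lambda>k. f (r k) x)"
    using L2_Cauchy_AE_convergent_subseq[OF fin f C] by blast
  have fm [measurable]: "f n \<in> borel_measurable M" for n using L2D(1)[OF f] .
  define g where "g x = lim (\<lambda>k. f (r k) x)" for x
  have gm [measurable]: "g \<in> borel_measurable M" unfolding g_def by measurable
  have lim: "AE x in M. (\<lambda>k. f (r k) x) \<longlonglongrightarrow> g x"
    using conv by eventually_elim (simp add: g_def convergent_LIMSEQ_iff)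
  have bound: "integrable M (\<lambda>x. (f n x - g x)\<^sup>2) \<and> (\<integral>x. (f n x - g x)\<^sup>2 \<partial>M) \<le> e"
    if e: "e > 0" and N: "\<forall>m\<ge>N. \<forall>n\<ge>N. (\<integral>x. (f m x - f n x)\<^sup>2 \<partial>M) < e" and n: "n \<ge> N" for e N n
  proof -
    have "(\<integral>\<^sup>+x. ennreal ((f n x - g x)\<^sup>2) \<partial>M) = (\<integral>\<^sup>+x. liminf (\<lambda>k. ennreal ((f n x - f (r k) x)\<^sup>2)) \<partial>M)"
    proof (rule nn_integral_cong_AE, use lim in eventually_elim)
      case (elim x)
      have "(\<lambda>k. ennreal ((f n x - f (r k) x)\<^sup>2)) \<longlonglongrightarrow> ennreal ((f n x - g x)\<^sup>2)"
        by (intro tendsto_ennrealI tendsto_power tendsto_diff elim tendsto_const)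
      then show ?case by (rule lim_imp_Liminf[OF sequentially_bot, symmetric])
    qed
    also have "\<dots> \<le> liminf (\<lambda>k. \<integral>\<^sup>+x. ennreal ((f n x - f (r k) x)\<^sup>2) \<partial>M)"
      by (rule nn_integral_liminf) auto
    also have "\<dots> \<le> ennreal e"
    proof (rule Liminf_le)
      have "(\<integral>\<^sup>+x. ennreal ((f n x - f (r k) x)\<^sup>2) \<partial>M) \<le> ennreal e" if "k \<ge> N" for k
      proof -
        have "(\<integral>\<^sup>+x. ennreal ((f n x - f (r k) x)\<^sup>2) \<partial>M) = ennreal (\<integral>x. (f n x - f (r k) x)\<^sup>2 \<partial>M)"
          using L2D(2)[OF L2_diff[OF f f]] by (intro nn_integral_eq_integral) auto
        moreover have "r k \<ge> N" using seq_suble[OF r, of k] that by simp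
        ultimately show ?thesis using N n by (simp add: ennreal_leI less_imp_le)
      qed
      then show "\<forall>\<^sub>F k in sequentially. (\<integral>\<^sup>+x. ennreal ((f n x - f (r k) x)\<^sup>2) \<partial>M) \<le> ennreal e"
        by (auto simp: eventually_sequentially)
    qed simp
    finally have *: "(\<integral>\<^sup>+x. ennreal ((f n x - g x)\<^sup>2) \<partial>M) \<le> ennreal e" .
    then have i: "integrable M (\<lambda>x. (f n x - g x)\<^sup>2)"
      by (intro integrableI_bounded) (auto simp: le_less_trans[OF _ ennreal_less_top])
    moreover have "(\<integral>x. (f n x - g x)\<^sup>2 \<partial>M) \<le> e"
      using * e nn_integral_eq_integral[OF i] by (simp add: ennreal_le_iff)
    ultimately show ?thesis ..
  qed
  have gL: "g \<in> L2 M"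
  proof -
    obtain N where N: "\<forall>m\<ge>N. \<forall>n\<ge>N. (\<integral>x. (f m x - f n x)\<^sup>2 \<partial>M) < 1" using C[of 1] by auto
    have "(\<lambda>x. f N x - g x) \<in> L2 M" using bound[OF _ N, of N] by (auto simp: L2_def)
    from L2_diff[OF f[of N] this] show ?thesis by simp
  qed
  have "(\<lambda>n. \<integral>x. (f n x - g x)\<^sup>2 \<partial>M) \<longlonglongrightarrow> 0"
  proof (rule LIMSEQ_I)
    fix e :: real assume e: "e > 0"
    obtain N where N: "\<forall>m\<ge>N. \<forall>n\<ge>N. (\<integral>x. (f m x - f n x)\<^sup>2 \<partial>M) < e / 2" using C[of "e/2"] e by auto
    show "\<exists>no. \<forall>n\<ge>no. norm ((\<integral>x. (f n x - g x)\<^sup>2 \<partial>M) - 0) < e"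
    proof (intro exI allI impI)
      fix n assume "n \<ge> N"
      from bound[OF _ N this] e have "(\<integral>x. (f n x - g x)\<^sup>2 \<partial>M) \<le> e / 2" by simp
      with e show "norm ((\<integral>x. (f n x - g x)\<^sup>2 \<partial>M) - 0) < e" by simp
    qed
  qed
  then have "(\<lambda>n. L2_norm M (\<lambda>x. f n x - g x)) \<longlonglongrightarrow> 0"
    unfolding L2_norm_def using tendsto_real_sqrt by fastforce
  with gL that show thesis by blast
qed

section \<open>Test functions and weak derivatives\<close>

definition smooth :: "(real \<Rightarrow> real) \<Rightarrow> bool" where
  "smooth f \<longleftrightarrow> (\<forall>n x. (deriv ^^ n) f differentiable (at x))"

text \<open>Smoothness is the weakest property that implies differentiability and passes to the derivative.\<close>

lemma smooth_coinduct:
  assumes "P f" and step: "\<And>f. P f \<Longrightarrow> (\<forall>x. f differentiable (at x)) \<and> P (deriv f)"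
  shows "smooth f"
proof -
  have "(\<forall>x. (deriv ^^ n) f differentiable (at x))" if "P f" for n f
    using that
  proof (induction n arbitrary: f)
    case 0 then show ?case using step by auto
  next
    case (Suc n)
    from step[OF Suc.prems] Suc.IH[of "deriv f"] show ?case
      unfolding funpow_Suc_right o_def by blast
  qed
  then show ?thesis using assms(1) by (auto simp: smooth_def)
qed

lemma smooth_differentiable: "smooth f \<Longrightarrow> f differentiable (at x)"
  unfolding smooth_def by (metis funpow_0)

lemma smooth_funpow: "smooth f \<Longrightarrow> smooth ((deriv ^^ k) f)"
  unfolding smooth_def by (metis funpow_add o_apply)

lemma smooth_deriv: "smooth f \<Longrightarrow> smooth (deriv f)"
  using smooth_funpow[of f 1] by simp

lemma smooth_has_deriv: "smooth f \<Longrightarrow> (f has_real_derivative deriv f x) (at x)"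
  using smooth_differentiable[of f x] by (simp add: DERIV_deriv_iff_real_differentiable)

lemma smooth_continuous: "smooth f \<Longrightarrow> continuous_on A f"
  using smooth_differentiable differentiable_imp_continuous_within
  by (meson continuous_at_imp_continuous_on)

lemma smooth_lincomb:
  assumes "smooth f" "smooth g"
  shows "smooth (\<lambda>x. r * f x + s * g x)"
proof (rule smooth_coinduct[where P = "\<lambda>h. \<exists>f g. smooth f \<and> smooth g \<and> h = (\<lambda>x. r * f x + s * g x)"])
  fix h assume "\<exists>f g. smooth f \<and> smooth g \<and> h = (\<lambda>x. r * f x + s * g x)"
  then obtain f g where fg: "smooth f" "smooth g" and h: "h = (\<lambda>x. r * f x + s * g x)" by blast
  have d: "(h has_real_derivative (r * deriv f x + s * deriv g x)) (at x)" for x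
    unfolding h using smooth_has_deriv[OF fg(1)] smooth_has_deriv[OF fg(2)]
    by (auto intro!: derivative_eq_intros)
  then have "deriv h = (\<lambda>x. r * deriv f x + s * deriv g x)" by (auto intro: DERIV_imp_deriv)
  with d fg show "(\<forall>x. h differentiable (at x)) \<and> (\<exists>f g. smooth f \<and> smooth g \<and> deriv h = (\<lambda>x. r * f x + s * g x))"
    using smooth_deriv by (auto simp: real_differentiable_def)
qed (use assms in blast)

lemma smooth_compose_affine:
  assumes "smooth f"
  shows "smooth (\<lambda>x. f (r * x + s))"
proof (rule smooth_coinduct[where P = "\<lambda>h. \<exists>f c. smooth f \<and> h = (\<lambda>x. c * f (r * x + s))"])
  fix h assume "\<exists>f c. smooth f \<and> h = (\<lambda>x. c * f (r * x + s))"
  then obtain f c where f: "smooth f" and h: "h = (\<lambda>x. c * f (r * x + s))" by blast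
  have d: "(h has_real_derivative ((c * r) * deriv f (r * x + s))) (at x)" for x
    unfolding h by (auto intro!: derivative_eq_intros DERIV_chain2[OF smooth_has_deriv[OF f]])
  then have "deriv h = (\<lambda>x. (c * r) * deriv f (r * x + s))" by (auto intro: DERIV_imp_deriv)
  with d f show "(\<forall>x. h differentiable (at x)) \<and> (\<exists>f c. smooth f \<and> deriv h = (\<lambda>x. c * f (r * x + s)))"
    using smooth_deriv by (auto simp: real_differentiable_def)
qed (use assms in \<open>auto intro!: exI[of _ f] exI[of _ 1]\<close>)

text \<open>Sums of products of smooth functions are closed under differentiation by the product rule.\<close>

inductive sum_of_smooth_products :: "(real \<Rightarrow> real) \<Rightarrow> bool" where
  product: "smooth f \<Longrightarrow> smooth g \<Longrightarrow> sum_of_smooth_products (\<lambda>x. f x * g x)"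
| plus: "sum_of_smooth_products f \<Longrightarrow> sum_of_smooth_products g \<Longrightarrow> sum_of_smooth_products (\<lambda>x. f x + g x)"

lemma smooth_mult:
  assumes "smooth f" "smooth g"
  shows "smooth (\<lambda>x. f x * g x)"
proof (rule smooth_coinduct[where P = sum_of_smooth_products])
  have "(\<forall>x. h differentiable (at x)) \<and> sum_of_smooth_products (deriv h)" if "sum_of_smooth_products h" for h
    using that
  proof induction
    case (product f g)
    have d: "((\<lambda>x. f x * g x) has_real_derivative (deriv f x * g x + f x * deriv g x)) (at x)" for x
      using smooth_has_deriv[OF product(1)] smooth_has_deriv[OF product(2)]
      by (auto intro!: derivative_eq_intros)
    then have "deriv (\<lambda>x. f x * g x) = (\<lambda>x. deriv f x * g x + f x * deriv g x)"
      by (auto intro: DERIV_imp_deriv)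
    with d product show ?case
      using smooth_deriv by (auto simp: real_differentiable_def intro!: sum_of_smooth_products.intros)
  next
    case (plus f g)
    have d: "((\<lambda>x. f x + g x) has_real_derivative (deriv f x + deriv g x)) (at x)" for x
      using plus by (auto intro!: derivative_eq_intros simp: DERIV_deriv_iff_real_differentiable)
    then have "deriv (\<lambda>x. f x + g x) = (\<lambda>x. deriv f x + deriv g x)"
      by (auto intro: DERIV_imp_deriv)
    with d plus show ?case
      by (auto simp: real_differentiable_def intro!: sum_of_smooth_products.intros)
  qed
  then show "sum_of_smooth_products h \<Longrightarrow> (\<forall>x. h differentiable (at x)) \<and> sum_of_smooth_products (deriv h)" for h
    by blast
qed (use assms sum_of_smooth_products.product in blast)

definition flat :: "real \<Rightarrow> real" where
  "flat x = (if x > 0 then exp (- (1 / x)) else 0)"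

lemma poly_div_exp_tendsto_0: "((\<lambda>y. poly p y / exp y) \<longlongrightarrow> 0) at_top" for p :: "real poly"
proof -
  have "((\<lambda>y. \<Sum>i\<le>degree p. coeff p i * (y ^ i / exp y)) \<longlongrightarrow> (\<Sum>i\<le>degree p. coeff p i * 0)) at_top"
    by (intro tendsto_sum tendsto_mult tendsto_const tendsto_power_div_exp_0)
  then show ?thesis by (simp add: poly_altdef sum_divide_distrib)
qed

text \<open>All derivatives of \<open>exp (- 1 / x)\<close> have the form \<open>p (1 / x) exp (- 1 / x)\<close> with a polynomial \<open>p\<close>,
  and they vanish at the origin because the exponential decays faster.\<close>

lemma smooth_flat: "smooth flat"
proof (rule smooth_coinduct[where P = "\<lambda>h. \<exists>p. h = (\<lambda>x. if x > 0 then poly p (1 / x) * exp (- (1 / x)) else 0)"])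
  fix h :: "real \<Rightarrow> real"
  assume "\<exists>p. h = (\<lambda>x. if x > 0 then poly p (1 / x) * exp (- (1 / x)) else 0)"
  then obtain p where h: "h = (\<lambda>x. if x > 0 then poly p (1 / x) * exp (- (1 / x)) else 0)" by blast
  define q where "q = [:0,0,1:] * (p - pderiv p)"
  have d: "(h has_real_derivative (if x > 0 then poly q (1 / x) * exp (- (1 / x)) else 0)) (at x)" for x
  proof (cases x "0 :: real" rule: linorder_cases)
    case less
    have "((\<lambda>_. 0) has_real_derivative 0) (at x)" by simp
    then have "(h has_real_derivative 0) (at x)"
      by (rule has_field_derivative_transform_within_open[where S = "{..<0}"]) (use less h in auto)
    then show ?thesis using less by simp
  next
    case greater
    have "((\<lambda>x. poly p (1 / x) * exp (- (1 / x))) has_real_derivative (poly q (1 / x) * exp (- (1 / x)))) (at x)"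
      using greater
      by (auto intro!: derivative_eq_intros simp: q_def field_simps power2_eq_square)
    then have "(h has_real_derivative (poly q (1 / x) * exp (- (1 / x)))) (at x)"
      by (rule has_field_derivative_transform_within_open[where S = "{0<..}"]) (use greater h in auto)
    then show ?thesis using greater by simp
  next
    case equal
    have "((\<lambda>y. poly (pCons 0 p) y / exp y) \<longlongrightarrow> 0) at_top" by (rule poly_div_exp_tendsto_0)
    then have "((\<lambda>e. poly (pCons 0 p) (inverse e) / exp (inverse e)) \<longlongrightarrow> 0) (at_right 0)"
      by (rule filterlim_compose) (rule filterlim_inverse_at_top_right)
    then have "((\<lambda>e. (h (0 + e) - h 0) / e) \<longlongrightarrow> 0) (at_right 0)"
      by (rule Lim_transform_eventually)
         (auto simp: eventually_at_filter h exp_minus field_simps intro!: always_eventually)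
    moreover have "((\<lambda>e. (h (0 + e) - h 0) / e) \<longlongrightarrow> 0) (at_left 0)"
      by (rule Lim_transform_eventually[where f = "\<lambda>_. 0"])
         (auto simp: eventually_at_filter h intro!: always_eventually)
    ultimately have "((\<lambda>e. (h (0 + e) - h 0) / e) \<longlongrightarrow> 0) (at 0)"
      by (simp add: filterlim_at_split)
    then have "(h has_real_derivative 0) (at 0)" by (simp add: DERIV_def)
    with equal show ?thesis by simp
  qed
  then have "deriv h = (\<lambda>x. if x > 0 then poly q (1 / x) * exp (- (1 / x)) else 0)"
    by (intro ext DERIV_imp_deriv)
  with d show "(\<forall>x. h differentiable (at x)) \<and>
      (\<exists>p. deriv h = (\<lambda>x. if x > 0 then poly p (1 / x) * exp (- (1 / x)) else 0))"
    unfolding real_differentiable_def by blast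
qed (auto simp: flat_def intro!: exI[of _ 1])

text \<open>The factor \<open>Suc n\<close> sharpens the edges: the bumps converge to the indicator of the open interval.\<close>

definition bump :: "real \<Rightarrow> real \<Rightarrow> nat \<Rightarrow> real \<Rightarrow> real" where
  "bump p q n x = flat (real (Suc n) * (x - p)) * flat (real (Suc n) * (q - x))"

lemma smooth_bump: "smooth (bump p q n)"
proof -
  have "smooth (\<lambda>x. flat (real (Suc n) * x + (- (real (Suc n) * p))) * flat ((- real (Suc n)) * x + real (Suc n) * q))"
    by (intro smooth_mult smooth_compose_affine smooth_flat)
  then show ?thesis unfolding bump_def by (simp add: algebra_simps)
qed

lemma bump_bounds: "0 \<le> bump p q n x" "bump p q n x \<le> 1"
  by (auto simp: bump_def flat_def intro!: mult_le_one)

lemma bump_pos: "p < x \<Longrightarrow> x < q \<Longrightarrow> 0 < bump p q n x"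
  by (simp add: bump_def flat_def)

lemma bump_outside: "x \<notin> {p<..<q} \<Longrightarrow> bump p q n x = 0"
  by (auto simp: bump_def flat_def zero_less_mult_iff not_less)

lemma bump_tendsto: "(\<lambda>n. bump p q n x) \<longlonglongrightarrow> indicator {p<..<q} x"
proof (cases "x \<in> {p<..<q}")
  case True
  have *: "(\<lambda>n. flat (real (Suc n) * y)) \<longlonglongrightarrow> 1" if "y > 0" for y
  proof -
    have "(\<lambda>n. exp (- ((1 / y) * inverse (real (Suc n))))) \<longlonglongrightarrow> exp (- ((1 / y) * 0))"
      by (intro tendsto_intros LIMSEQ_inverse_real_of_nat)
    then show ?thesis using that by (simp del: of_nat_Suc add: flat_def field_simps)
  qed
  have "(\<lambda>n. flat (real (Suc n) * (x - p)) * flat (real (Suc n) * (q - x))) \<longlonglongrightarrow> 1 * 1"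
    using True by (intro tendsto_mult *) auto
  then show ?thesis using True by (simp add: bump_def)
next
  case False
  then show ?thesis by (simp add: bump_outside)
qed

lemma test_functions_iff:
  "\<phi> \<in> test_functions S \<longleftrightarrow> smooth \<phi> \<and> (\<exists>K. compact K \<and> K \<subseteq> S \<and> (\<forall>x. x \<notin> K \<longrightarrow> \<phi> x = 0))"
  by (auto simp: test_functions_def smooth_def)

lemma bump_test_function: "{p..q} \<subseteq> S \<Longrightarrow> bump p q n \<in> test_functions S"
  using smooth_bump bump_outside[of _ p q n]
  by (auto simp: test_functions_iff intro!: exI[of _ "{p..q}"])

lemma test_functions_lincomb:
  assumes "f \<in> test_functions S" "g \<in> test_functions S"
  shows "(\<lambda>x. r * f x + s * g x) \<in> test_functions S"
proof -
  from assms obtain K L where "compact K" "K \<subseteq> S" "\<forall>x. x \<notin> K \<longrightarrow> f x = 0"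
    "compact L" "L \<subseteq> S" "\<forall>x. x \<notin> L \<longrightarrow> g x = 0" by (auto simp: test_functions_iff)
  then show ?thesis using assms
    by (auto simp: test_functions_iff intro!: smooth_lincomb exI[of _ "K \<union> L"])
qed

lemma test_function_bounded:
  assumes "\<phi> \<in> test_functions S" shows "\<exists>B. \<forall>x. \<bar>\<phi> x\<bar> \<le> B"
proof -
  from assms obtain K where K: "smooth \<phi>" "compact K" "\<forall>x. x \<notin> K \<longrightarrow> \<phi> x = 0"
    by (auto simp: test_functions_iff)
  have "bounded (\<phi> ` K)" by (intro compact_imp_bounded compact_continuous_image smooth_continuous K)
  then obtain B where "\<forall>x\<in>K. \<bar>\<phi> x\<bar> \<le> B" by (auto simp: bounded_iff)
  with K have "\<bar>\<phi> x\<bar> \<le> max B 0" for x by (cases "x \<in> K") fastforce+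
  then show ?thesis by blast
qed

lemma test_function_deriv:
  assumes "\<phi> \<in> test_functions S" shows "deriv \<phi> \<in> test_functions S"
proof -
  from assms obtain K where K: "smooth \<phi>" "compact K" "K \<subseteq> S" "\<forall>x. x \<notin> K \<longrightarrow> \<phi> x = 0"
    by (auto simp: test_functions_iff)
  have "deriv \<phi> x = 0" if "x \<notin> K" for x
  proof -
    have "((\<lambda>_. 0) has_real_derivative 0) (at x)" by simp
    then have "(\<phi> has_real_derivative 0) (at x)"
      by (rule has_field_derivative_transform_within_open[where S = "- K"])
         (use K that in \<open>auto intro: compact_imp_closed\<close>)
    then show ?thesis by (rule DERIV_imp_deriv)
  qed
  then show ?thesis using K smooth_deriv by (auto simp: test_functions_iff)
qed

lemma test_function_measurable: "\<phi> \<in> test_functions S \<Longrightarrow> \<phi> \<in> borel_measurable borel"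
  by (auto simp: test_functions_iff intro!: borel_measurable_continuous_onI smooth_continuous)

text \<open>Products with test functions only see a compact set, where local integrability applies.\<close>

lemma test_function_set_integrable:
  assumes "locally_integrable S g" "\<phi> \<in> test_functions S"
  shows "set_integrable lborel S (\<lambda>x. g x * \<phi> x)"
proof -
  from assms obtain K where K: "compact K" "K \<subseteq> S" "\<forall>x. x \<notin> K \<longrightarrow> \<phi> x = 0"
    by (auto simp: test_functions_iff)
  obtain B where B: "\<And>x. \<bar>\<phi> x\<bar> \<le> B" using test_function_bounded[OF assms(2)] by blast
  have "set_integrable lborel K g" using assms K by (auto simp: locally_integrable_def)
  then have i: "integrable lborel (\<lambda>x. indicator K x * g x)" by (simp add: set_integrable_def)
  have [measurable]: "\<phi> \<in> borel_measurable borel" using assms(2) by (rule test_function_measurable)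
  have eq: "indicator K x * g x * \<phi> x = indicator S x * (g x * \<phi> x)" for x
    using K by (cases "x \<in> K") auto
  have "integrable lborel (\<lambda>x. indicator K x * g x * \<phi> x)"
  proof (rule Bochner_Integration.integrable_bound)
    show "integrable lborel (\<lambda>x. B * (indicator K x * g x))" using i by simp
    show "AE x in lborel. norm (indicator K x * g x * \<phi> x) \<le> norm (B * (indicator K x * g x))"
      using B order_trans[OF abs_ge_zero B]
      by (auto intro!: AE_I2 mult_right_mono simp: abs_mult mult.commute order_trans[OF abs_ge_zero B])
  qed (use borel_measurable_integrable[OF i] in measurable)
  then show ?thesis by (simp add: set_integrable_def eq)
qed

text \<open>The indicator of an interval is a bounded limit of test functions.\<close>

lemma weak_null_interval_integral:
  assumes loc: "locally_integrable S g"
    and null: "\<And>\<phi>. \<phi> \<in> test_functions S \<Longrightarrow> (LINT x:S|lborel. g x * \<phi> x) = 0"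
    and S: "{p..q} \<subseteq> S"
  shows "(LINT x:{p..q}|lborel. g x) = 0"
proof -
  have "set_integrable lborel {p..q} g" using loc S by (auto simp: locally_integrable_def)
  then have i: "integrable lborel (\<lambda>x. indicator {p..q} x * g x)" by (simp add: set_integrable_def)
  have m: "bump p q n \<in> borel_measurable borel" for n
    using bump_test_function[OF S] test_function_measurable by blast
  have "(\<lambda>n. LINT x|lborel. indicator {p..q} x * g x * bump p q n x) \<longlonglongrightarrow>
      (LINT x|lborel. indicator {p..q} x * g x * indicator {p<..<q} x)"
  proof (rule integral_dominated_convergence)
    show "integrable lborel (\<lambda>x. norm (indicator {p..q} x * g x))" using i by (rule integrable_norm)
    show "AE x in lborel. (\<lambda>n. indicator {p..q} x * g x * bump p q n x) \<longlonglongrightarrow> indicator {p..q} x * g x * indicator {p<..<q} x"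
      by (intro AE_I2 tendsto_mult tendsto_const bump_tendsto)
    show "AE x in lborel. norm (indicator {p..q} x * g x * bump p q n x) \<le> norm (indicator {p..q} x * g x)" for n
      using bump_bounds by (auto intro!: AE_I2 mult_left_le simp: abs_mult)
  qed (use borel_measurable_integrable[OF i] m in measurable)
  moreover have "(LINT x|lborel. indicator {p..q} x * g x * bump p q n x) = 0" for n
  proof -
    have "(LINT x|lborel. indicator {p..q} x * g x * bump p q n x) = (LINT x:S|lborel. g x * bump p q n x)"
      unfolding set_lebesgue_integral_def
    proof (intro Bochner_Integration.integral_cong refl)
      fix x show "indicator {p..q} x * g x * bump p q n x = indicator S x *\<^sub>R (g x * bump p q n x)"
        using S bump_outside[of x p q n] by (cases "x \<in> {p..q}") (auto split: split_indicator)
    qed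
    then show ?thesis using null[OF bump_test_function[OF S]] by simp
  qed
  ultimately have "(LINT x|lborel. indicator {p..q} x * g x * indicator {p<..<q} x) = 0"
    by (simp add: LIMSEQ_const_iff)
  moreover have "(LINT x|lborel. indicator {p..q} x * g x * indicator {p<..<q} x) = (LINT x|lborel. indicator {p..q} x * g x)"
  proof (rule integral_cong_AE)
    have "AE x in lborel. x \<noteq> p \<and> x \<noteq> q" using AE_lborel_singleton[of p] AE_lborel_singleton[of q] by auto
    then show "AE x in lborel. indicator {p..q} x * g x * indicator {p<..<q} x = indicator {p..q} x * g x"
      by eventually_elim (auto split: split_indicator)
  qed (use borel_measurable_integrable[OF i] in measurable)
  ultimately show ?thesis by (simp add: set_lebesgue_integral_def)
qed

text \<open>The Borel sets over which the integral vanishes are closed under complements and disjoint unions.\<close>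

lemma integrable_null_if_interval_integrals:
  fixes f :: "real \<Rightarrow> real"
  assumes f: "integrable lborel f" and null: "\<And>p q. p \<le> q \<Longrightarrow> (LINT x:{p..q}|lborel. f x) = 0"
  shows "AE x in lborel. f x = 0"
proof (rule sigma_finite_measure.density_zero[OF sigma_finite_lborel f])
  have si: "set_integrable lborel B f" if "B \<in> sets borel" for B
    using f that unfolding set_integrable_def by (intro integrable_mult_indicator) auto
  have all: "(LINT x|lborel. f x) = 0"
  proof -
    have "(\<lambda>n::nat. LINT x:{- real n..real n}|lborel. f x) \<longlonglongrightarrow> (LINT x|lborel. f x)"
      unfolding set_lebesgue_integral_def
    proof (rule integral_dominated_convergence)
      show "integrable lborel (\<lambda>x. norm (f x))" using f by (rule integrable_norm)
      show "AE x in lborel. (\<lambda>n. indicator {- real n..real n} x *\<^sub>R f x) \<longlonglongrightarrow> f x"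
      proof (rule AE_I2, rule tendsto_eventually)
        fix x :: real
        have "indicator {- real n..real n} x *\<^sub>R f x = f x" if "n \<ge> nat \<lceil>\<bar>x\<bar>\<rceil>" for n
          using that by (auto simp: indicator_def; linarith)
        then show "\<forall>\<^sub>F n in sequentially. indicator {- real n..real n} x *\<^sub>R f x = f x"
          unfolding eventually_sequentially by blast
      qed
    qed (use borel_measurable_integrable[OF f] in \<open>auto split: split_indicator\<close>)
    moreover have "(LINT x:{- real n..real n}|lborel. f x) = 0" for n by (rule null) simp
    ultimately show ?thesis by (simp add: LIMSEQ_const_iff)
  qed
  fix A :: "real set" assume "A \<in> sets lborel"
  then have "A \<in> sets borel" by simp
  then show "(LINT x:A|lborel. f x) = 0"
  proof (induction rule: borel_set_induct)
    case (interval p q)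
    then show ?case by (rule null)
  next
    case (compl B)
    have "(LINT x:(- B) \<union> B|lborel. f x) = (LINT x:- B|lborel. f x) + (LINT x:B|lborel. f x)"
      by (rule set_integral_Un) (use compl.hyps in \<open>auto intro: si\<close>)
    then show ?case using compl.IH all by (simp add: set_lebesgue_integral_def)
  next
    case (union B)
    have "(LINT x:(\<Union>i. B i)|lborel. f x) = (\<Sum>i. LINT x:B i|lborel. f x)"
      by (rule lebesgue_integral_countable_add)
         (use union.hyps in \<open>auto intro: si simp: disjoint_family_on_def\<close>)
    then show ?case using union.IH by simp
  qed (simp add: set_lebesgue_integral_def)
qed

text \<open>Countably many compact intervals with rational endpoints cover an open set, so a single null set
  serves for all of them.\<close>

lemma locally_null_if_interval_integrals:
  assumes S: "open S" and loc: "locally_integrable S g"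
    and null: "\<And>p q. p < q \<Longrightarrow> {p..q} \<subseteq> S \<Longrightarrow> (LINT x:{p..q}|lborel. g x) = 0"
  shows "AE x in lborel. x \<in> S \<longrightarrow> g x = 0"
proof -
  have one: "AE x in lborel. x \<in> {p..q} \<longrightarrow> g x = 0" if pq: "{p..q} \<subseteq> S" for p q
  proof -
    have "set_integrable lborel {p..q} g" using loc pq by (auto simp: locally_integrable_def)
    then have "integrable lborel (\<lambda>x. indicator {p..q} x * g x)" by (simp add: set_integrable_def)
    then have "AE x in lborel. indicator {p..q} x * g x = 0"
    proof (rule integrable_null_if_interval_integrals)
      fix u v :: real
      have "(LINT x:{u..v}|lborel. indicator {p..q} x * g x) = (LINT x:{max p u..min q v}|lborel. g x)"
        unfolding set_lebesgue_integral_def by (intro Bochner_Integration.integral_cong) (auto split: split_indicator)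
      also have "\<dots> = 0"
      proof (cases "max p u < min q v")
        case True then show ?thesis using pq by (intro null) auto
      next
        case False
        then have "{max p u..min q v} \<subseteq> {max p u}" by auto
        then have "AE x in lborel. x \<notin> {max p u..min q v}"
          using AE_lborel_singleton[of "max p u"] by (auto elim!: eventually_mono)
        then show ?thesis unfolding set_lebesgue_integral_def
          by (intro integral_eq_zero_AE) (auto elim!: eventually_mono)
      qed
      finally show "(LINT x:{u..v}|lborel. indicator {p..q} x * g x) = 0" .
    qed
    then show ?thesis by eventually_elim (auto split: split_indicator_asm)
  qed
  define C where "C = {(p, q). p \<in> \<rat> \<and> q \<in> \<rat> \<and> {p..q} \<subseteq> S}"
  have "countable C" by (rule countable_subset[of _ "\<rat> \<times> \<rat>"]) (auto simp: C_def countable_rat)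
  then have "AE x in lborel. \<forall>(p, q)\<in>C. x \<in> {p..q} \<longrightarrow> g x = 0"
    by (subst AE_ball_countable) (auto simp: C_def intro!: one[unfolded atLeastAtMost_iff])
  then show ?thesis
  proof eventually_elim
    case (elim x)
    show ?case
    proof
      assume "x \<in> S"
      with S obtain e where e: "e > 0" "ball x e \<subseteq> S" by (auto simp: open_contains_ball)
      obtain p where p: "p \<in> \<rat>" "x - e < p" "p < x" using Rats_dense_in_real[of "x - e" x] e by auto
      obtain q where q: "q \<in> \<rat>" "x < q" "q < x + e" using Rats_dense_in_real[of x "x + e"] e by auto
      have "{p..q} \<subseteq> S" using e(2) p q by (auto simp: dist_real_def subset_eq)
      with elim p q have "x \<in> {p..q} \<longrightarrow> g x = 0" by (auto simp: C_def)
      then show "g x = 0" using p q by auto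
    qed
  qed
qed

lemma fundamental_lemma_calculus_of_variations:
  assumes "open S" "locally_integrable S g"
    and "\<And>\<phi>. \<phi> \<in> test_functions S \<Longrightarrow> (LINT x:S|lborel. g x * \<phi> x) = 0"
  shows "AE x in lborel. x \<in> S \<longrightarrow> g x = 0"
  using assms by (intro locally_null_if_interval_integrals weak_null_interval_integral) auto

lemma locally_integrable_diff:
  assumes "locally_integrable S f" "locally_integrable S g"
  shows "locally_integrable S (\<lambda>x. f x - g x)"
  using assms by (auto simp: locally_integrable_def)

lemma weak_deriv_unique:
  assumes "open S" "is_weak_deriv S f g" "is_weak_deriv S f h"
  shows "AE x in lborel. x \<in> S \<longrightarrow> g x = h x"
proof -
  have l: "locally_integrable S g" "locally_integrable S h" using assms by (auto simp: is_weak_deriv_def)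
  have "AE x in lborel. x \<in> S \<longrightarrow> g x - h x = 0"
  proof (rule fundamental_lemma_calculus_of_variations[OF assms(1)])
    fix \<phi> assume \<phi>: "\<phi> \<in> test_functions S"
    have "(LINT x:S|lborel. (g x - h x) * \<phi> x) = (LINT x:S|lborel. g x * \<phi> x) - (LINT x:S|lborel. h x * \<phi> x)"
      using test_function_set_integrable[OF l(1) \<phi>] test_function_set_integrable[OF l(2) \<phi>]
      by (simp add: left_diff_distrib)
    also have "\<dots> = 0" using assms(2,3) \<phi> unfolding is_weak_deriv_def by fastforce
    finally show "(LINT x:S|lborel. (g x - h x) * \<phi> x) = 0" .
  qed (use l locally_integrable_diff in auto)
  then show ?thesis by eventually_elim auto
qed

lemma test_function_support:
  assumes "a < b" and \<phi>: "\<phi> \<in> test_functions {a<..<b}"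
  obtains c d where "a < c" "c < d" "d < b" "\<And>x. x \<notin> {c<..<d} \<Longrightarrow> \<phi> x = 0"
proof -
  from \<phi> obtain K where K: "compact K" "K \<subseteq> {a<..<b}" "\<And>x. x \<notin> K \<Longrightarrow> \<phi> x = 0"
    by (auto simp: test_functions_iff)
  show thesis
  proof (cases "K = {}")
    case True
    then have "\<phi> x = 0" for x using K by auto
    then show thesis using \<open>a < b\<close>
      by (intro that[of "(2 * a + b) / 3" "(a + 2 * b) / 3"]) (auto simp: field_simps)
  next
    case False
    define c d where "c = Inf K" and "d = Sup K"
    have bdd: "bdd_below K" "bdd_above K"
      using compact_imp_bounded[OF K(1)] by (auto simp: bounded_imp_bdd_below bounded_imp_bdd_above)
    have "c \<in> K" "d \<in> K" unfolding c_def d_def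
      using closed_contains_Inf[OF False] closed_contains_Sup[OF False] bdd compact_imp_closed[OF K(1)] by auto
    then have cd: "a < c" "c < b" "a < d" "d < b" using K(2) by auto
    have Kcd: "c \<le> x \<and> x \<le> d" if "x \<in> K" for x
      unfolding c_def d_def using bdd that by (auto intro: cInf_lower cSup_upper)
    with \<open>c \<in> K\<close> have "c \<le> d" by auto
    show thesis
    proof (rule that)
      show "a < (a + c) / 2" "(d + b) / 2 < b" "(a + c) / 2 < (d + b) / 2"
        using cd \<open>c \<le> d\<close> by auto
      show "\<phi> x = 0" if "x \<notin> {(a + c) / 2<..<(d + b) / 2}" for x
      proof (rule K(3))
        show "x \<notin> K" using that cd Kcd[of x] by (auto simp: field_simps)
      qed
    qed
  qed
qed

text \<open>The antiderivative that vanishes left of the support also vanishes right of it, because the integral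
  is zero.\<close>

lemma test_function_antiderivative:
  assumes ab: "a < b" and \<phi>: "\<phi> \<in> test_functions {a<..<b}" and zero: "(LINT x:{a<..<b}|lborel. \<phi> x) = 0"
  obtains \<psi> where "\<psi> \<in> test_functions {a<..<b}" "deriv \<psi> = \<phi>"
proof -
  have sm: "smooth \<phi>" using \<phi> by (auto simp: test_functions_iff)
  obtain c d where cd: "a < c" "c < d" "d < b" and out: "\<And>x. x \<notin> {c<..<d} \<Longrightarrow> \<phi> x = 0"
    using test_function_support[OF ab \<phi>] by blast
  have "\<exists>F. \<forall>x :: real. -\<infinity> < ereal x \<longrightarrow> ereal x < \<infinity> \<longrightarrow> (F has_vector_derivative \<phi> x) (at x)"
    by (rule einterval_antiderivative)
       (use smooth_continuous[OF sm, of UNIV] in \<open>auto simp: continuous_on_eq_continuous_at\<close>)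
  then obtain F where F: "\<And>x. (F has_vector_derivative \<phi> x) (at x)" by auto
  have FTC: "(LINT x:{u..v}|lborel. \<phi> x) = F v - F u" if "u \<le> v" for u v
    unfolding set_lebesgue_integral_def
    by (rule integral_FTC_atLeastAtMost[OF that])
       (use F smooth_continuous[OF sm] in \<open>auto intro: has_vector_derivative_at_within\<close>)
  define \<psi> where "\<psi> x = F x - F c" for x
  have \<psi>': "(\<psi> has_real_derivative \<phi> x) (at x)" for x
    unfolding \<psi>_def has_real_derivative_iff_has_vector_derivative
    using F[of x] by (auto intro!: derivative_eq_intros)
  then have d\<psi>: "deriv \<psi> = \<phi>" by (auto intro: DERIV_imp_deriv)
  have "smooth \<psi>"
    unfolding smooth_def
  proof (intro allI)
    fix n x show "(deriv ^^ n) \<psi> differentiable (at x)"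
    proof (cases n)
      case 0 then show ?thesis using \<psi>' by (auto simp: real_differentiable_def)
    next
      case (Suc k)
      then show ?thesis using sm d\<psi> by (simp add: funpow_Suc_right smooth_def del: funpow.simps)
    qed
  qed
  moreover have "\<psi> x = 0" if "x \<notin> {c..d}" for x
  proof (cases "x \<le> c")
    case True
    have "(LINT t:{x..c}|lborel. \<phi> t) = 0"
      unfolding set_lebesgue_integral_def
      by (intro integral_eq_zero_AE AE_I2) (use out in \<open>auto split: split_indicator\<close>)
    then show ?thesis using FTC[OF True] by (simp add: \<psi>_def)
  next
    case False
    have "(LINT t:{c..x}|lborel. \<phi> t) = (LINT x:{a<..<b}|lborel. \<phi> x)"
      unfolding set_lebesgue_integral_def
      by (intro Bochner_Integration.integral_cong refl)
         (use out cd False that in \<open>auto split: split_indicator\<close>)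
    then show ?thesis using FTC[of c x] False zero by (simp add: \<psi>_def)
  qed
  ultimately have "\<psi> \<in> test_functions {a<..<b}"
    using cd by (auto simp: test_functions_iff intro!: exI[of _ "{c..d}"])
  with d\<psi> show thesis using that by blast
qed

lemma locally_integrable_const: "locally_integrable S (\<lambda>x. c)"
  unfolding locally_integrable_def set_integrable_def
  by (auto intro!: integrable_scaleR_left integrable_real_indicator emeasure_compact_finite
           intro: borel_compact)

text \<open>Subtracting from a test function its integral times a fixed bump of integral one yields a
  derivative, so a function without weak derivative integrates every test function as a constant does.\<close>

lemma weak_deriv_zero_imp_const:
  assumes ab: "a < b" and k: "is_weak_deriv {a<..<b} k (\<lambda>x. 0)"
  shows "\<exists>c. AE x in lborel. x \<in> {a<..<b} \<longrightarrow> k x = c"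
proof -
  let ?S = "{a<..<b}"
  have loc: "locally_integrable ?S k" using k by (simp add: is_weak_deriv_def)
  note si = test_function_set_integrable[OF loc]
  have si1: "set_integrable lborel ?S \<phi>" if "\<phi> \<in> test_functions ?S" for \<phi>
    using test_function_set_integrable[OF locally_integrable_const[of _ 1] that] by simp
  \<comment> \<open>Any interval with closure inside \<open>]a,b[\<close> could carry the bump.\<close>
  define p q where "p = (2 * a + b) / 3" and "q = (a + 2 * b) / 3"
  have pq: "a < p" "p < q" "q < b" using ab by (auto simp: p_def q_def field_simps)
  let ?B = "bump p q 0"
  have B: "?B \<in> test_functions ?S" using pq by (intro bump_test_function) auto
  define I where "I = (LINT x:?S|lborel. ?B x)"
  have "I \<noteq> 0"
  proof
    assume "I = 0"
    moreover have "integrable lborel (\<lambda>x. indicator ?S x *\<^sub>R ?B x)" using si1[OF B] by (simp add: set_integrable_def)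
    ultimately have "AE x in lborel. indicator ?S x *\<^sub>R ?B x = 0"
      unfolding I_def set_lebesgue_integral_def
      by (subst (asm) integral_nonneg_eq_0_iff_AE) (use bump_bounds in auto)
    then have "AE x in lborel. x \<notin> {p<..<q}"
    proof eventually_elim
      case (elim x) then show ?case using bump_pos[of p x q 0] pq by (auto split: split_indicator_asm)
    qed
    then have "{p<..<q} \<in> null_sets lborel"
      by (subst (asm) AE_iff_null_sets[symmetric]) auto
    then show False using pq by (simp add: null_sets_def)
  qed
  define c where "c = (LINT x:?S|lborel. k x * ?B x) / I"
  have "AE x in lborel. x \<in> ?S \<longrightarrow> k x - c = 0"
  proof (rule fundamental_lemma_calculus_of_variations)
    show "locally_integrable ?S (\<lambda>x. k x - c)" by (rule locally_integrable_diff[OF loc locally_integrable_const])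
    fix \<phi> assume \<phi>: "\<phi> \<in> test_functions ?S"
    define J where "J = (LINT x:?S|lborel. \<phi> x)"
    define r where "r = - J / I"
    define \<eta> where "\<eta> = (\<lambda>x. 1 * \<phi> x + r * ?B x)"
    have \<eta>: "\<eta> \<in> test_functions ?S" unfolding \<eta>_def by (rule test_functions_lincomb[OF \<phi> B])
    have "(LINT x:?S|lborel. \<eta> x) = (LINT x:?S|lborel. \<phi> x) + (LINT x:?S|lborel. r * ?B x)"
      unfolding \<eta>_def mult_1 by (intro set_integral_add set_integrable_mult_right si1[OF \<phi>] si1[OF B])
    also have "\<dots> = J + r * I" by (simp only: set_integral_mult_right J_def I_def)
    also have "\<dots> = 0" using \<open>I \<noteq> 0\<close> by (simp add: r_def)
    finally obtain \<psi> where \<psi>: "\<psi> \<in> test_functions ?S" "deriv \<psi> = \<eta>"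
      using test_function_antiderivative[OF ab \<eta>] by metis
    have "(LINT x:?S|lborel. k x * \<eta> x) = 0"
      using k \<psi> unfolding is_weak_deriv_def by (auto simp: set_lebesgue_integral_def)
    moreover have "(LINT x:?S|lborel. k x * \<eta> x) =
        (LINT x:?S|lborel. k x * \<phi> x + r * (k x * ?B x))"
      by (simp add: \<eta>_def algebra_simps)
    moreover have "\<dots> = (LINT x:?S|lborel. k x * \<phi> x) + (LINT x:?S|lborel. r * (k x * ?B x))"
      by (intro set_integral_add set_integrable_mult_right si[OF \<phi>] si[OF B])
    ultimately have "(LINT x:?S|lborel. k x * \<phi> x) + r * (LINT x:?S|lborel. k x * ?B x) = 0" by simp
    then have *: "(LINT x:?S|lborel. k x * \<phi> x) = c * J" by (simp add: c_def r_def)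
    have "(LINT x:?S|lborel. (k x - c) * \<phi> x) = (LINT x:?S|lborel. k x * \<phi> x) - (LINT x:?S|lborel. c * \<phi> x)"
      unfolding left_diff_distrib by (rule set_integral_diff) (use si[OF \<phi>] si1[OF \<phi>] in auto)
    also have "\<dots> = 0" using * by (simp add: J_def)
    finally show "(LINT x:?S|lborel. (k x - c) * \<phi> x) = 0" .
  qed auto
  then show ?thesis by (intro exI[of _ c]) (auto elim!: eventually_mono)
qed

section \<open>Antiderivatives of integrable functions\<close>

text \<open>Absolute continuity in its integral form. The set is a parameter because an antiderivative lives on the
  open interval at first and is extended to the closed one when its derivative is integrable.\<close>

definition antiderivative_on :: "real set \<Rightarrow> (real \<Rightarrow> real) \<Rightarrow> (real \<Rightarrow> real) \<Rightarrow> bool" where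
  "antiderivative_on S F f \<longleftrightarrow> (\<forall>x y. x \<le> y \<and> {x..y} \<subseteq> S \<longrightarrow>
     set_integrable lborel {x..y} f \<and> F y - F x = (LINT t:{x..y}|lborel. f t))"

lemma antiderivative_onD:
  assumes "antiderivative_on S F f" "x \<le> y" "{x..y} \<subseteq> S"
  shows "set_integrable lborel {x..y} f" "F y - F x = (LINT t:{x..y}|lborel. f t)"
  using assms unfolding antiderivative_on_def by blast+

lemma antiderivative_on_subset: "antiderivative_on S F f \<Longrightarrow> T \<subseteq> S \<Longrightarrow> antiderivative_on T F f"
  unfolding antiderivative_on_def by (meson order_trans)

lemma antiderivative_continuous_Icc:
  assumes F: "antiderivative_on {c..d} F f"
  shows "continuous_on {c..d} F"
proof (cases "c \<le> d")
  case True
  have i: "set_integrable lborel {c..d} f" using antiderivative_onD(1)[OF F True] by simp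
  have eq: "F x = F c + integral {c..x} f" if "x \<in> {c..d}" for x
  proof -
    have "{c..x} \<subseteq> {c..d}" using that by auto
    with antiderivative_onD[OF F, of c x] that show ?thesis
      by (simp add: set_borel_integral_eq_integral)
  qed
  have "f integrable_on {c..d}" using set_borel_integral_eq_integral(1)[OF i] .
  then have "continuous_on {c..d} (\<lambda>x. F c + integral {c..x} f)"
    by (intro continuous_on_add continuous_on_const indefinite_integral_continuous_1)
  moreover have "continuous_on {c..d} F = continuous_on {c..d} (\<lambda>x. F c + integral {c..x} f)"
    by (rule continuous_on_cong[OF refl]) (rule eq)
  ultimately show ?thesis by simp
qed simp

lemma antiderivative_continuous:
  assumes F: "antiderivative_on S F f" and S: "open S"
  shows "continuous_on S F"
proof -
  have "continuous (at x) F" if "x \<in> S" for x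
  proof -
    obtain e where e: "e > 0" "cball x e \<subseteq> S" using S \<open>x \<in> S\<close> by (auto simp: open_contains_cball)
    then have "{x - e..x + e} \<subseteq> S" by (simp add: cball_eq_atLeastAtMost)
    from antiderivative_continuous_Icc[OF antiderivative_on_subset[OF F this]]
    have "continuous_on {x - e<..<x + e} F" by (rule continuous_on_subset) auto
    then show ?thesis using e by (simp add: continuous_on_eq_continuous_at)
  qed
  then show ?thesis by (simp add: S continuous_on_eq_continuous_at)
qed

text \<open>Both sides of the triangle decomposition of \<open>(\<integral> f)(\<integral> g)\<close> are computed by Fubini's theorem.\<close>

lemma antiderivative_by_parts:
  assumes cd: "c \<le> d" and F: "antiderivative_on {c..d} F f" and G: "antiderivative_on {c..d} G g"
  shows "set_integrable lborel {c..d} (\<lambda>x. f x * G x)"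
    and "set_integrable lborel {c..d} (\<lambda>x. F x * g x)"
    and "(LINT x:{c..d}|lborel. f x * G x) + (LINT x:{c..d}|lborel. F x * g x) = F d * G d - F c * G c"
proof -
  have fi: "set_integrable lborel {c..d} f" and gi: "set_integrable lborel {c..d} g"
    using antiderivative_onD(1)[OF F cd] antiderivative_onD(1)[OF G cd] by auto
  have prod_int: "set_integrable lborel {c..d} (\<lambda>x. f x * G x)"
    if fi: "set_integrable lborel {c..d} f" and G: "antiderivative_on {c..d} G g" for f g G
  proof -
    have cont: "continuous_on {c..d} G" by (rule antiderivative_continuous_Icc[OF G])
    then have "bounded (G ` {c..d})" by (intro compact_imp_bounded compact_continuous_image) auto
    then obtain B where "\<forall>y\<in>G ` {c..d}. norm y \<le> B" unfolding bounded_iff by blast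
    then have B: "\<bar>G x\<bar> \<le> B" if "x \<in> {c..d}" for x using that by simp
    have m: "(\<lambda>x. indicator {c..d} x *\<^sub>R G x) \<in> borel_measurable borel"
      using borel_measurable_continuous_on_indicator[OF _ cont] by simp
    have "integrable lborel (\<lambda>x. (indicator {c..d} x *\<^sub>R f x) * (indicator {c..d} x *\<^sub>R G x))"
    proof (rule Bochner_Integration.integrable_bound)
      show "integrable lborel (\<lambda>x. B * (indicator {c..d} x *\<^sub>R f x))"
        using fi by (auto simp: set_integrable_def)
      show "(\<lambda>x. (indicator {c..d} x *\<^sub>R f x) * (indicator {c..d} x *\<^sub>R G x)) \<in> borel_measurable lborel"
        by (rule borel_measurable_times)
           (use borel_measurable_integrable[OF fi[unfolded set_integrable_def]] m in simp_all)
      have "\<bar>f x\<bar> * \<bar>G x\<bar> \<le> \<bar>B\<bar> * \<bar>f x\<bar>" if "x \<in> {c..d}" for x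
      proof -
        have "\<bar>G x\<bar> \<le> \<bar>B\<bar>" using B[OF that] by linarith
        then have "\<bar>f x\<bar> * \<bar>G x\<bar> \<le> \<bar>f x\<bar> * \<bar>B\<bar>" by (rule mult_left_mono) simp
        then show ?thesis by (simp only: mult.commute)
      qed
      then show "AE x in lborel. norm ((indicator {c..d} x *\<^sub>R f x) * (indicator {c..d} x *\<^sub>R G x))
          \<le> norm (B * (indicator {c..d} x *\<^sub>R f x))"
        by (auto simp: abs_mult split: split_indicator)
    qed
    moreover have "(\<lambda>x. (indicator {c..d} x *\<^sub>R f x) * (indicator {c..d} x *\<^sub>R G x))
       = (\<lambda>x. indicator {c..d} x *\<^sub>R (f x * G x))" by (auto split: split_indicator)
    ultimately show ?thesis by (simp add: set_integrable_def)
  qed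
  show 1: "set_integrable lborel {c..d} (\<lambda>x. f x * G x)" by (rule prod_int[OF fi G])
  show 2: "set_integrable lborel {c..d} (\<lambda>x. F x * g x)" using prod_int[OF gi F] by (simp add: mult.commute)
  define f1 g1 where "f1 x = indicator {c..d} x * f x" and "g1 x = indicator {c..d} x * g x" for x
  have f1: "integrable lborel f1" and g1: "integrable lborel g1"
    using fi gi by (auto simp: set_integrable_def f1_def[abs_def] g1_def[abs_def])
  note [measurable] = borel_measurable_integrable[OF f1] borel_measurable_integrable[OF g1]
  have H: "integrable (lborel \<Otimes>\<^sub>M lborel) (\<lambda>(x, y). f1 x * g1 y)"
  proof (rule lborel_pair.Fubini_integrable)
    show "integrable lborel (\<lambda>x. \<integral>y. norm ((\<lambda>(x, y). f1 x * g1 y) (x, y)) \<partial>lborel)"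
      using integrable_norm[OF f1] by (simp add: abs_mult)
    show "AE x in lborel. integrable lborel (\<lambda>y. (\<lambda>(x, y). f1 x * g1 y) (x, y))" using g1 by simp
  qed measurable
  \<comment> \<open>The square is cut along its diagonal; the integral of \<open>g1\<close> over a vertical section of the lower
    triangle is an increment of \<open>G\<close>, and likewise for \<open>F\<close> in the upper one.\<close>
  define H1 where "H1 = (\<lambda>(x, y). (if y \<le> x then f1 x * g1 y else 0))"
  define H2 where "H2 = (\<lambda>(x, y). (if x < y then f1 x * g1 y else 0))"
  have H1: "integrable (lborel \<Otimes>\<^sub>M lborel) H1" and H2: "integrable (lborel \<Otimes>\<^sub>M lborel) H2"
    unfolding H1_def H2_def by (rule Bochner_Integration.integrable_bound[OF H]; auto)+
  have sum: "(\<integral>z. H1 z \<partial>(lborel \<Otimes>\<^sub>M lborel)) + (\<integral>z. H2 z \<partial>(lborel \<Otimes>\<^sub>M lborel))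
     = (\<integral>z. (\<lambda>(x, y). f1 x * g1 y) z \<partial>(lborel \<Otimes>\<^sub>M lborel))"
    by (subst Bochner_Integration.integral_add[OF H1 H2, symmetric])
       (auto simp: H1_def H2_def intro!: Bochner_Integration.integral_cong)
  have "(\<integral>z. (\<lambda>(x, y). f1 x * g1 y) z \<partial>(lborel \<Otimes>\<^sub>M lborel)) = (\<integral>x. (\<integral>y. f1 x * g1 y \<partial>lborel) \<partial>lborel)"
    using lborel_pair.integral_fst[OF H] by simp
  also have "\<dots> = (\<integral>x. f1 x \<partial>lborel) * (\<integral>y. g1 y \<partial>lborel)" by simp
  also have "\<dots> = (F d - F c) * (G d - G c)"
    using antiderivative_onD(2)[OF F cd] antiderivative_onD(2)[OF G cd]
    by (simp add: set_lebesgue_integral_def f1_def[abs_def] g1_def[abs_def])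
  finally have total: "(\<integral>z. (\<lambda>(x, y). f1 x * g1 y) z \<partial>(lborel \<Otimes>\<^sub>M lborel)) = (F d - F c) * (G d - G c)" .
  have "(\<integral>z. H1 z \<partial>(lborel \<Otimes>\<^sub>M lborel)) = (\<integral>x. (\<integral>y. (if y \<le> x then f1 x * g1 y else 0) \<partial>lborel) \<partial>lborel)"
    using lborel_pair.integral_fst[OF H1[unfolded H1_def]] by (simp add: H1_def)
  also have "\<dots> = (LINT x:{c..d}|lborel. f x * (G x - G c))"
    unfolding set_lebesgue_integral_def
  proof (rule Bochner_Integration.integral_cong[OF refl])
    fix x
    show "(\<integral>y. (if y \<le> x then f1 x * g1 y else 0) \<partial>lborel) = indicator {c..d} x *\<^sub>R (f x * (G x - G c))"
    proof (cases "x \<in> {c..d}")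
      case True
      have "(\<integral>y. (if y \<le> x then f1 x * g1 y else 0) \<partial>lborel) = (\<integral>y. f x * (indicator {c..x} y * g y) \<partial>lborel)"
        by (rule Bochner_Integration.integral_cong) (use True in \<open>auto simp: f1_def g1_def split: split_indicator\<close>)
      also have "\<dots> = f x * (G x - G c)"
        using antiderivative_onD(2)[OF G, of c x] True by (simp add: set_lebesgue_integral_def)
      finally show ?thesis using True by simp
    qed (auto simp: f1_def cong: if_cong)
  qed
  also have "\<dots> = (LINT x:{c..d}|lborel. f x * G x) - (LINT x:{c..d}|lborel. f x * G c)"
    unfolding right_diff_distrib by (rule set_integral_diff) (use 1 fi in auto)
  finally have one: "(\<integral>z. H1 z \<partial>(lborel \<Otimes>\<^sub>M lborel)) = (LINT x:{c..d}|lborel. f x * G x) - (F d - F c) * G c"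
    using antiderivative_onD(2)[OF F cd] by simp
  have "(\<integral>z. H2 z \<partial>(lborel \<Otimes>\<^sub>M lborel)) = (\<integral>y. (\<integral>x. (if x < y then f1 x * g1 y else 0) \<partial>lborel) \<partial>lborel)"
    using lborel_pair.integral_snd[OF H2[unfolded H2_def]] by (simp add: H2_def)
  also have "\<dots> = (LINT y:{c..d}|lborel. (F y - F c) * g y)"
    unfolding set_lebesgue_integral_def
  proof (rule Bochner_Integration.integral_cong[OF refl])
    fix y
    show "(\<integral>x. (if x < y then f1 x * g1 y else 0) \<partial>lborel) = indicator {c..d} y *\<^sub>R ((F y - F c) * g y)"
    proof (cases "y \<in> {c..d}")
      case True
      have "(\<integral>x. (if x < y then f1 x * g1 y else 0) \<partial>lborel) = (\<integral>x. g y * (indicator {c..y} x * f x) \<partial>lborel)"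
      proof (rule integral_cong_AE)
        show "AE x in lborel. (if x < y then f1 x * g1 y else 0) = g y * (indicator {c..y} x * f x)"
          using AE_lborel_singleton[of y]
          by eventually_elim (use True in \<open>auto simp: f1_def g1_def split: split_indicator\<close>)
        have eq: "(\<lambda>x. g y * (indicator {c..y} x * f x)) = (\<lambda>x. g y * (indicator {..y} x * f1 x))"
          using True by (auto simp: f1_def split: split_indicator)
        show "(\<lambda>x. g y * (indicator {c..y} x * f x)) \<in> borel_measurable lborel"
          unfolding eq by measurable
      qed simp
      also have "\<dots> = g y * (F y - F c)"
        using antiderivative_onD(2)[OF F, of c y] True by (simp add: set_lebesgue_integral_def)
      finally show ?thesis using True by simp
    qed (auto simp: g1_def cong: if_cong)
  qed
  also have "\<dots> = (LINT x:{c..d}|lborel. F x * g x) - (LINT x:{c..d}|lborel. F c * g x)"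
    unfolding left_diff_distrib by (rule set_integral_diff) (use 2 gi in auto)
  finally have two: "(\<integral>z. H2 z \<partial>(lborel \<Otimes>\<^sub>M lborel)) = (LINT x:{c..d}|lborel. F x * g x) - F c * (G d - G c)"
    using antiderivative_onD(2)[OF G cd] by simp
  show "(LINT x:{c..d}|lborel. f x * G x) + (LINT x:{c..d}|lborel. F x * g x) = F d * G d - F c * G c"
    using sum total one two by (simp add: algebra_simps)
qed

lemma smooth_antiderivative: "smooth \<phi> \<Longrightarrow> antiderivative_on S \<phi> (deriv \<phi>)"
  unfolding antiderivative_on_def set_integrable_def set_lebesgue_integral_def
proof (intro allI impI conjI)
  fix x y :: real assume s: "smooth \<phi>" and xy: "x \<le> y \<and> {x..y} \<subseteq> S"
  have c: "continuous_on {x..y} (deriv \<phi>)" by (rule smooth_continuous[OF smooth_deriv[OF s]])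
  show "integrable lborel (\<lambda>t. indicator {x..y} t *\<^sub>R deriv \<phi> t)"
    using borel_integrable_atLeastAtMost'[OF c] by (simp add: set_integrable_def)
  show "\<phi> y - \<phi> x = (LINT t|lborel. indicator {x..y} t *\<^sub>R deriv \<phi> t)"
    by (rule integral_FTC_atLeastAtMost[symmetric])
       (use xy c smooth_has_deriv[OF s] in \<open>auto simp: has_real_derivative_iff_has_vector_derivative
          intro: has_vector_derivative_at_within\<close>)
qed

lemma locally_integrable_antiderivative:
  assumes "antiderivative_on S F f" "open S"
  shows "locally_integrable S F"
  unfolding locally_integrable_def set_integrable_def
proof (intro allI impI borel_integrable_compact)
  fix K assume "compact K \<and> K \<subseteq> S"
  then show "compact K" "continuous_on K F"
    by (auto intro: continuous_on_subset[OF antiderivative_continuous[OF assms]])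
qed

lemma antiderivative_is_weak_deriv:
  assumes ab: "a < b" and F: "antiderivative_on {a<..<b} F f" and f: "locally_integrable {a<..<b} f"
  shows "is_weak_deriv {a<..<b} F f"
  unfolding is_weak_deriv_def
proof (intro conjI ballI f locally_integrable_antiderivative[OF F])
  fix \<phi> assume \<phi>: "\<phi> \<in> test_functions {a<..<b}"
  then have s: "smooth \<phi>" by (simp add: test_functions_iff)
  obtain c d where cd: "a < c" "c < d" "d < b" and out: "\<And>x. x \<notin> {c<..<d} \<Longrightarrow> \<phi> x = 0"
    using test_function_support[OF ab \<phi>] by blast
  have out': "deriv \<phi> x = 0" if "x \<notin> {c..d}" for x
  proof -
    have "((\<lambda>_. 0) has_real_derivative 0) (at x)" by simp
    then have "(\<phi> has_real_derivative 0) (at x)"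
      by (rule has_field_derivative_transform_within_open[where S = "- {c..d}"]) (use that out in auto)
    then show ?thesis by (rule DERIV_imp_deriv)
  qed
  have "antiderivative_on {c..d} F f" by (rule antiderivative_on_subset[OF F]) (use cd in auto)
  from antiderivative_by_parts(3)[OF _ this smooth_antiderivative[OF s]] cd out
  have "(LINT x:{c..d}|lborel. f x * \<phi> x) + (LINT x:{c..d}|lborel. F x * deriv \<phi> x) = 0" by simp
  moreover have "(LINT x:{c..d}|lborel. f x * \<phi> x) = (LINT x:{a<..<b}|lborel. f x * \<phi> x)"
    unfolding set_lebesgue_integral_def
    by (intro Bochner_Integration.integral_cong refl) (use cd out in \<open>auto split: split_indicator\<close>)
  moreover have "(LINT x:{c..d}|lborel. F x * deriv \<phi> x) = (LINT x:{a<..<b}|lborel. F x * deriv \<phi> x)"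
    unfolding set_lebesgue_integral_def
    by (intro Bochner_Integration.integral_cong refl) (use cd out' in \<open>auto split: split_indicator\<close>)
  ultimately show "(LINT x:{a<..<b}|lborel. F x * deriv \<phi> x) = - (LINT x:{a<..<b}|lborel. f x * \<phi> x)" by simp
qed simp

lemma ex_antiderivative:
  assumes f: "locally_integrable {a<..<b} f" and c: "a < c" "c < b"
  obtains F where "antiderivative_on {a<..<b} F f"
proof
  define F where "F x = (if c \<le> x then LINT t:{c..x}|lborel. f t else - (LINT t:{x..c}|lborel. f t))" for x
  have i: "set_integrable lborel {x..y} f" if "{x..y} \<subseteq> {a<..<b}" for x y
    using f that by (auto simp: locally_integrable_def)
  have split: "(LINT t:{x..z}|lborel. f t) = (LINT t:{x..y}|lborel. f t) + (LINT t:{y..z}|lborel. f t)"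
    if "a < x" "x \<le> y" "y \<le> z" "z < b" for x y z
  proof -
    have "{x..z} = {x..y} \<union> {y..z}" using that by auto
    moreover have "(LINT t:{x..y} \<union> {y..z}|lborel. f t) = (LINT t:{x..y}|lborel. f t) + (LINT t:{y..z}|lborel. f t)"
      using AE_lborel_singleton[of y] that
      by (intro set_integral_Un_AE i) (auto elim!: eventually_mono)
    ultimately show ?thesis by simp
  qed
  show "antiderivative_on {a<..<b} F f"
    unfolding antiderivative_on_def
  proof (intro allI impI conjI)
    fix x y assume xy: "x \<le> y \<and> {x..y} \<subseteq> {a<..<b}"
    then have ab: "a < x" "y < b" by auto
    show "set_integrable lborel {x..y} f" using xy i by blast
    show "F y - F x = (LINT t:{x..y}|lborel. f t)"
      using split[of c x y] split[of x c y] split[of x y c] xy ab c by (auto simp: F_def)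
  qed
qed

text \<open>The difference of \<open>f\<close> and an antiderivative of \<open>g\<close> has weak derivative zero, so it is constant almost
  everywhere.\<close>

lemma weak_deriv_representative:
  assumes ab: "a < b" and fg: "is_weak_deriv {a<..<b} f g"
  obtains F where "antiderivative_on {a<..<b} F g" "AE x in lborel. x \<in> {a<..<b} \<longrightarrow> f x = F x"
proof -
  let ?S = "{a<..<b}"
  have lf: "locally_integrable ?S f" and lg: "locally_integrable ?S g" using fg by (auto simp: is_weak_deriv_def)
  obtain F where F: "antiderivative_on ?S F g"
    using ex_antiderivative[OF lg, of "(a + b) / 2"] ab by auto
  have wF: "is_weak_deriv ?S F g" by (rule antiderivative_is_weak_deriv[OF ab F lg])
  then have lF: "locally_integrable ?S F" by (simp add: is_weak_deriv_def)
  have "is_weak_deriv ?S (\<lambda>x. f x - F x) (\<lambda>x. 0)"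
    unfolding is_weak_deriv_def
  proof (intro conjI ballI locally_integrable_diff lf lF locally_integrable_const)
    fix \<phi> assume \<phi>: "\<phi> \<in> test_functions ?S"
    have "(LINT x:?S|lborel. (f x - F x) * deriv \<phi> x) =
       (LINT x:?S|lborel. f x * deriv \<phi> x) - (LINT x:?S|lborel. F x * deriv \<phi> x)"
      unfolding left_diff_distrib
      by (rule set_integral_diff) (intro test_function_set_integrable lf lF test_function_deriv[OF \<phi>])+
    also have "\<dots> = 0" using fg wF \<phi> unfolding is_weak_deriv_def by simp
    finally show "(LINT x:?S|lborel. (f x - F x) * deriv \<phi> x) = - (LINT x:?S|lborel. 0 * \<phi> x)" by simp
  qed
  from weak_deriv_zero_imp_const[OF ab this] obtain c
    where c: "AE x in lborel. x \<in> ?S \<longrightarrow> f x - F x = c" by blast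
  show thesis
  proof (rule that)
    show "antiderivative_on ?S (\<lambda>x. F x + c) g" using F by (simp add: antiderivative_on_def)
    show "AE x in lborel. x \<in> ?S \<longrightarrow> f x = F x + c" using c by eventually_elim auto
  qed
qed

section \<open>A dual formula for the entropy\<close>

lemma space_leb [simp]: "space (leb a b) = {a..b}"
  by (simp add: leb_def space_restrict_space)

lemma sets_leb: "sets (leb a b) = sets (restrict_space borel {a..b})"
  by (simp add: leb_def sets_restrict_space)

lemma borel_measurable_leb: "f \<in> borel_measurable borel \<Longrightarrow> f \<in> borel_measurable (leb a b)"
  unfolding leb_def by (rule measurable_restrict_space1) simp

lemma emeasure_leb: "A \<in> sets borel \<Longrightarrow> A \<subseteq> {a..b} \<Longrightarrow> emeasure (leb a b) A = emeasure lborel A"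
  unfolding leb_def by (rule emeasure_restrict_space) auto

lemma finite_measure_leb: "finite_measure (leb a b)"
  by (rule finite_measureI) (simp add: emeasure_leb emeasure_lborel_Icc_eq)

lemma AE_leb_iff: "(AE x in leb a b. P x) \<longleftrightarrow> (AE x in lborel. x \<in> {a..b} \<longrightarrow> P x)"
  unfolding leb_def by (rule AE_restrict_space_iff) simp

lemma integral_leb: "(\<integral>x. f x \<partial>leb a b) = (LINT x:{a..b}|lborel. f x)" for f :: "real \<Rightarrow> real"
  unfolding leb_def set_lebesgue_integral_def by (subst integral_restrict_space) auto

lemma integrable_leb_iff: "integrable (leb a b) f \<longleftrightarrow> set_integrable lborel {a..b} f" for f :: "real \<Rightarrow> real"
  unfolding leb_def set_integrable_def by (subst integrable_restrict_space) auto

lemma measure_leb_space: "a \<le> b \<Longrightarrow> measure (leb a b) {a..b} = b - a"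
  by (simp add: measure_def emeasure_leb)

lemma dens_nonneg [simp]: "0 \<le> dens a b \<nu> x"
  by (simp add: dens_def)

lemma dens_measurable [measurable]: "dens a b \<nu> \<in> borel_measurable (leb a b)"
  unfolding dens_def by measurable

lemma density_dens:
  assumes fin: "finite_measure \<nu>" and s: "sets \<nu> = sets (leb a b)" and ac: "absolutely_continuous (leb a b) \<nu>"
  shows "density (leb a b) (\<lambda>x. ennreal (dens a b \<nu> x)) = \<nu>"
proof -
  interpret L: finite_measure "leb a b" by (rule finite_measure_leb)
  interpret N: finite_measure \<nu> by fact
  have "AE x in leb a b. RN_deriv (leb a b) \<nu> x \<noteq> \<infinity>"
    by (rule L.RN_deriv_finite[OF N.sigma_finite_measure_axioms ac s])
  then have "AE x in leb a b. ennreal (dens a b \<nu> x) = RN_deriv (leb a b) \<nu> x"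
    by eventually_elim (auto simp: dens_def less_top)
  then have "density (leb a b) (\<lambda>x. ennreal (dens a b \<nu> x)) = density (leb a b) (RN_deriv (leb a b) \<nu>)"
    by (intro density_cong) auto
  also have "\<dots> = \<nu>" by (rule L.density_RN_deriv[OF ac s])
  finally show ?thesis .
qed

text \<open>Young's inequality for the Legendre pair \<open>s ln s\<close> and \<open>exp (p - 1)\<close>.\<close>

lemma entropy_Young:
  fixes s p :: real assumes "s \<ge> 0"
  shows "s * p \<le> s * ln s + exp (p - 1)"
proof (cases "s = 0")
  case False
  with assms have s: "s > 0" by simp
  have "s * (1 + (p - 1 - ln s)) \<le> s * exp (p - 1 - ln s)"
    using s by (intro mult_left_mono exp_ge_add_one_self) auto
  also have "\<dots> = exp (p - 1)" using s by (simp add: exp_diff)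
  finally show ?thesis by (simp add: algebra_simps)
qed simp

lemma entropy_lower: "s \<ge> 0 \<Longrightarrow> - 1 \<le> s * ln s" for s :: real
proof -
  assume "s \<ge> 0"
  then have "- (s * ln s) \<le> exp (- 1)" using entropy_Young[of s 0] by simp
  also have "exp (- 1) \<le> (1 :: real)" by simp
  finally show ?thesis by simp
qed

text \<open>The negative part of \<open>s ln s\<close> is bounded, so the integral is infinite exactly if the integrand is not
  integrable.\<close>

lemma Ent_finite_iff:
  assumes ac: "absolutely_continuous (leb a b) \<nu>"
  shows "Ent a b \<nu> \<noteq> \<infinity> \<longleftrightarrow> integrable (leb a b) (\<lambda>x. dens a b \<nu> x * ln (dens a b \<nu> x))"
    and "integrable (leb a b) (\<lambda>x. dens a b \<nu> x * ln (dens a b \<nu> x)) \<Longrightarrow>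
      Ent a b \<nu> = ereal (\<integral>x. dens a b \<nu> x * ln (dens a b \<nu> x) \<partial>leb a b)"
proof -
  interpret L: finite_measure "leb a b" by (rule finite_measure_leb)
  let ?h = "\<lambda>x. dens a b \<nu> x * ln (dens a b \<nu> x)"
  let ?p = "\<integral>\<^sup>+x. ennreal (?h x) \<partial>leb a b" and ?n = "\<integral>\<^sup>+x. ennreal (- ?h x) \<partial>leb a b"
  have "?n \<le> (\<integral>\<^sup>+x. ennreal 1 \<partial>leb a b)"
  proof (intro nn_integral_mono ennreal_leI)
    fix x
    show "- ?h x \<le> 1" using entropy_lower[of "dens a b \<nu> x"] by simp
  qed
  also have "\<dots> < \<infinity>" by (simp add: emeasure_leb emeasure_lborel_Icc_eq)
  finally have n: "?n < \<infinity>" .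
  have E: "Ent a b \<nu> = enn2ereal ?p - enn2ereal ?n" using ac by (simp add: Ent_def)
  have fin: "integrable (leb a b) ?h \<longleftrightarrow> ?p < \<infinity>"
    unfolding real_integrable_def using n by (auto simp: less_top)
  obtain n' where n': "?n = ennreal n'" "n' \<ge> 0" using n by (cases ?n) auto
  show "Ent a b \<nu> \<noteq> \<infinity> \<longleftrightarrow> integrable (leb a b) ?h"
  proof (cases ?p)
    case (real r)
    then show ?thesis unfolding fin E n' by (simp add: n'(2) enn2ereal_ennreal)
  next
    case top
    then show ?thesis unfolding fin E n' by (simp add: n'(2) enn2ereal_ennreal)
  qed
  assume i: "integrable (leb a b) ?h"
  then have "?p < \<infinity>" by (simp add: fin)
  then obtain p' where p': "?p = ennreal p'" "p' \<ge> 0" by (cases ?p) auto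
  show "Ent a b \<nu> = ereal (\<integral>x. ?h x \<partial>leb a b)"
    unfolding E real_lebesgue_integral_def[OF i] p' n' using p'(2) n'(2) by (simp add: enn2ereal_ennreal)
qed

text \<open>Young's inequality integrated. The left side, as a functional of the test function, is the Legendre dual
  form of the entropy and is continuous in the measure, which the entropy itself is not.\<close>

lemma Ent_ge_dual:
  assumes prob: "prob_space \<nu>" and s: "sets \<nu> = sets (leb a b)" and E: "Ent a b \<nu> \<le> ereal M"
    and \<phi>: "\<phi> \<in> borel_measurable (leb a b)" and B: "\<And>x. \<bar>\<phi> x\<bar> \<le> B"
  shows "(\<integral>x. \<phi> x \<partial>\<nu>) - (\<integral>x. exp (\<phi> x - 1) \<partial>leb a b) \<le> M"
proof -
  interpret prob_space \<nu> by fact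
  interpret L: finite_measure "leb a b" by (rule finite_measure_leb)
  note [measurable] = \<phi>
  have ac: "absolutely_continuous (leb a b) \<nu>" using E by (auto simp: Ent_def split: if_splits)
  let ?n = "dens a b \<nu>"
  have i: "integrable (leb a b) (\<lambda>x. ?n x * ln (?n x))"
    using Ent_finite_iff(1)[OF ac] E by auto
  then have M: "(\<integral>x. ?n x * ln (?n x) \<partial>leb a b) \<le> M" using Ent_finite_iff(2)[OF ac] E by simp
  have d: "density (leb a b) (\<lambda>x. ennreal (?n x)) = \<nu>" by (rule density_dens[OF finite_measure_axioms s ac])
  have "\<phi> \<in> borel_measurable \<nu>" using \<phi> by (simp add: measurable_cong_sets[OF s refl])
  then have "integrable \<nu> \<phi>"
    by (intro integrable_const_bound[where B = B]) (use B in auto)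
  then have i2: "integrable (leb a b) (\<lambda>x. ?n x * \<phi> x)"
    by (subst (asm) d[symmetric], subst (asm) integrable_density) auto
  have i3: "integrable (leb a b) (\<lambda>x. exp (\<phi> x - 1))"
    by (rule L.integrable_const_bound[where B = "exp (B - 1)"]) (use B in \<open>auto simp: abs_le_iff\<close>)
  have "(\<integral>x. \<phi> x \<partial>\<nu>) = (\<integral>x. ?n x * \<phi> x \<partial>leb a b)"
    by (subst d[symmetric], subst integral_density) auto
  also have "\<dots> \<le> (\<integral>x. ?n x * ln (?n x) + exp (\<phi> x - 1) \<partial>leb a b)"
    by (rule integral_mono[OF i2]) (use i i3 entropy_Young in auto)
  also have "\<dots> = (\<integral>x. ?n x * ln (?n x) \<partial>leb a b) + (\<integral>x. exp (\<phi> x - 1) \<partial>leb a b)"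
    by (rule Bochner_Integration.integral_add[OF i i3])
  finally show ?thesis using M by simp
qed

lemma dual_bound_limit:
  fixes B M :: real
  assumes prob: "prob_space \<nu>" and s: "sets \<nu> = sets (leb a b)"
    and m: "\<And>n. \<psi> n \<in> borel_measurable (leb a b)" "\<phi> \<in> borel_measurable (leb a b)"
    and B: "\<And>n x. \<bar>\<psi> n x\<bar> \<le> B"
    and lim: "AE x in leb a b. (\<lambda>n. \<psi> n x) \<longlonglongrightarrow> \<phi> x" "AE x in \<nu>. (\<lambda>n. \<psi> n x) \<longlonglongrightarrow> \<phi> x"
    and le: "\<And>n. (\<integral>x. \<psi> n x \<partial>\<nu>) - (\<integral>x. exp (\<psi> n x - 1) \<partial>leb a b) \<le> M"
  shows "(\<integral>x. \<phi> x \<partial>\<nu>) - (\<integral>x. exp (\<phi> x - 1) \<partial>leb a b) \<le> M"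
proof -
  interpret prob_space \<nu> by fact
  interpret L: finite_measure "leb a b" by (rule finite_measure_leb)
  note [measurable] = m
  have [measurable]: "\<psi> n \<in> borel_measurable \<nu>" "\<phi> \<in> borel_measurable \<nu>" for n
    using m by (simp_all add: measurable_cong_sets[OF s refl])
  have "(\<lambda>n. \<integral>x. \<psi> n x \<partial>\<nu>) \<longlonglongrightarrow> (\<integral>x. \<phi> x \<partial>\<nu>)"
    by (rule integral_dominated_convergence[where w = "\<lambda>_. B"]) (use lim B in auto)
  moreover have "(\<lambda>n. \<integral>x. exp (\<psi> n x - 1) \<partial>leb a b) \<longlonglongrightarrow> (\<integral>x. exp (\<phi> x - 1) \<partial>leb a b)"
  proof (rule integral_dominated_convergence[where w = "\<lambda>_. exp (B - 1)"])
    show "AE x in leb a b. (\<lambda>n. exp (\<psi> n x - 1)) \<longlonglongrightarrow> exp (\<phi> x - 1)"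
      using lim(1) by eventually_elim (intro tendsto_intros)
    show "AE x in leb a b. norm (exp (\<psi> n x - 1)) \<le> exp (B - 1)" for n
      using B by (auto simp: abs_le_iff)
  qed auto
  ultimately have "(\<lambda>n. (\<integral>x. \<psi> n x \<partial>\<nu>) - (\<integral>x. exp (\<psi> n x - 1) \<partial>leb a b)) \<longlonglongrightarrow>
      (\<integral>x. \<phi> x \<partial>\<nu>) - (\<integral>x. exp (\<phi> x - 1) \<partial>leb a b)" by (rule tendsto_diff)
  then show ?thesis by (rule LIMSEQ_le_const2) (use le in auto)
qed

text \<open>A large multiple of the indicator of a small open neighbourhood of a null set violates the dual
  bound unless the null set has measure zero.\<close>

lemma dual_bound_imp_absolutely_continuous:
  fixes M :: real
  assumes ab: "a < b" and prob: "prob_space \<nu>" and s: "sets \<nu> = sets (leb a b)"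
    and dual: "\<And>\<phi> B. continuous_on UNIV \<phi> \<Longrightarrow> (\<And>x. \<bar>\<phi> x\<bar> \<le> B) \<Longrightarrow>
      (\<integral>x. \<phi> x \<partial>\<nu>) - (\<integral>x. exp (\<phi> x - 1) \<partial>leb a b) \<le> M"
  shows "absolutely_continuous (leb a b) \<nu>"
  unfolding absolutely_continuous_def
proof
  interpret prob_space \<nu> by fact
  interpret L: finite_measure "leb a b" by (rule finite_measure_leb)
  have sp: "space \<nu> = {a..b}" using sets_eq_imp_space_eq[OF s] by simp
  fix N assume N: "N \<in> null_sets (leb a b)"
  then have Ns: "N \<in> sets (leb a b)" and N0: "emeasure (leb a b) N = 0" by auto
  then have Nb: "N \<in> sets borel" "N \<subseteq> {a..b}"
    by (auto simp: sets_leb sets_restrict_space)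
  then have Nl: "emeasure lborel N = 0" using N0 by (simp add: emeasure_leb)
  show "N \<in> null_sets \<nu>"
  proof (rule ccontr)
    assume "N \<notin> null_sets \<nu>"
    then have "measure \<nu> N \<noteq> 0" using Ns s by (auto simp: null_sets_def emeasure_eq_measure)
    then have K: "measure \<nu> N > 0" by (simp add: zero_less_measure_iff)
    \<comment> \<open>With this height the first integral is at least \<open>\<bar>M\<bar> + (b - a) + 2\<close>; on a neighbourhood of measure at
      most \<open>exp (1 - l)\<close> the second one is at most \<open>b - a + 1\<close>.\<close>
    define l where "l = (\<bar>M\<bar> + (b - a) + 2) / measure \<nu> N"
    have l: "l > 0" using K ab by (simp add: l_def)
    obtain U where U: "open U" "N \<subseteq> U" "emeasure lborel (U - N) < ennreal (exp (1 - l))"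
      using outer_regular_lborel[OF Nb(1), of "exp (1 - l)"] by auto
    have Ub: "U \<in> sets borel" using U by auto
    have "emeasure lborel U \<le> emeasure lborel (U - N) + emeasure lborel N"
      by (rule order_trans[OF emeasure_mono emeasure_subadditive]) (use Ub Nb in auto)
    then have Um: "emeasure lborel U < ennreal (exp (1 - l))" using U(3) Nl by simp
    have ne: "- U \<noteq> {}"
    proof
      assume "- U = {}"
      then have "U = UNIV" by blast
      with Um show False by simp
    qed
    \<comment> \<open>Continuous functions that increase to \<open>l\<close> times the indicator of \<open>U\<close>.\<close>
    define \<psi> where "\<psi> n x = l * min 1 (real n * infdist x (- U))" for n x
    have lim: "(\<lambda>n. \<psi> n x) \<longlonglongrightarrow> l * indicator U x" for x
    proof (cases "x \<in> U")
      case True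
      have "infdist x (- U) \<noteq> 0"
        using True U(1) ne in_closed_iff_infdist_zero[of "- U" x] by auto
      then have d: "infdist x (- U) > 0" using infdist_nonneg[of x "- U"] by linarith
      obtain n0 :: nat where n0: "1 / infdist x (- U) < n0" using reals_Archimedean2 by blast
      have "\<psi> n x = l" if "n \<ge> n0" for n
      proof -
        have "1 / infdist x (- U) \<le> real n" using n0 that by linarith
        then have "1 \<le> real n * infdist x (- U)" using d by (simp add: field_simps)
        then show ?thesis by (simp add: \<psi>_def)
      qed
      then show ?thesis using True by (intro tendsto_eventually) (auto simp: eventually_sequentially)
    next
      case False
      then have "infdist x (- U) = 0" by simp
      then show ?thesis using False by (simp add: \<psi>_def)
    qed
    have cont: "continuous_on UNIV (\<psi> n)" for n unfolding \<psi>_def by (intro continuous_intros)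
    have bd: "\<bar>\<psi> n x\<bar> \<le> l" for n x
    proof -
      have "0 \<le> min 1 (real n * infdist x (- U))" by (simp add: infdist_nonneg)
      moreover have "min 1 (real n * infdist x (- U)) \<le> 1" by simp
      ultimately show ?thesis unfolding \<psi>_def using l by (simp add: abs_mult mult_left_le)
    qed
    have "(\<integral>x. l * indicator U x \<partial>\<nu>) - (\<integral>x. exp (l * indicator U x - 1) \<partial>leb a b) \<le> M"
    proof (rule dual_bound_limit[OF prob s, where \<psi> = \<psi>, OF _ _ bd])
      show "\<psi> n \<in> borel_measurable (leb a b)" for n
        using cont by (intro borel_measurable_leb borel_measurable_continuous_onI)
      show "(\<lambda>x. l * indicator U x) \<in> borel_measurable (leb a b)"
        by (intro borel_measurable_leb) (use Ub in measurable)
      show "(\<integral>x. \<psi> n x \<partial>\<nu>) - (\<integral>x. exp (\<psi> n x - 1) \<partial>leb a b) \<le> M" for n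
        by (rule dual[OF cont bd])
    qed (use lim in auto)
    moreover have "(\<integral>x. l * indicator U x \<partial>\<nu>) \<ge> l * measure \<nu> N"
    proof -
      have "U \<inter> {a..b} \<in> sets \<nu>" using Ub s by (auto simp: sets_leb sets_restrict_space)
      then have "measure \<nu> N \<le> measure \<nu> (U \<inter> {a..b})"
        using U Nb by (intro finite_measure_mono) auto
      then show ?thesis using l by (simp add: sp)
    qed
    moreover have "(\<integral>x. exp (l * indicator U x - 1) \<partial>leb a b) \<le> (b - a) + 1"
    proof -
      have Ui: "U \<inter> {a..b} \<in> sets (leb a b)" using Ub by (auto simp: sets_leb sets_restrict_space)
      have meas: "measure (leb a b) (U \<inter> {a..b}) \<le> exp (1 - l)"
      proof -
        have "emeasure (leb a b) (U \<inter> {a..b}) \<le> emeasure lborel U"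
          using Ub by (subst emeasure_leb) (auto intro!: emeasure_mono)
        with Um have "emeasure (leb a b) (U \<inter> {a..b}) \<le> ennreal (exp (1 - l))" by simp
        then show ?thesis by (simp add: L.emeasure_eq_measure)
      qed
      have "(\<integral>x. exp (l * indicator U x - 1) \<partial>leb a b) \<le> (\<integral>x. 1 + exp (l - 1) * indicator (U \<inter> {a..b}) x \<partial>leb a b)"
      proof (rule integral_mono)
        have "integrable (leb a b) (indicator (U \<inter> {a..b}) :: real \<Rightarrow> real)"
          using Ui L.emeasure_finite by (intro integrable_real_indicator) (auto simp: less_top[symmetric])
        then show "integrable (leb a b) (\<lambda>x. 1 + exp (l - 1) * indicator (U \<inter> {a..b}) x)" by simp
        show "integrable (leb a b) (\<lambda>x. exp (l * indicator U x - 1))"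
        proof (rule L.integrable_const_bound[where B = "exp (l - 1)"])
          show "AE x in leb a b. norm (exp (l * indicator U x - 1)) \<le> exp (l - 1)"
            using l by (auto split: split_indicator)
          have [measurable]: "U \<in> sets borel" by fact
          show "(\<lambda>x. exp (l * indicator U x - 1)) \<in> borel_measurable (leb a b)"
            by (rule borel_measurable_leb) measurable
        qed
        show "exp (l * indicator U x - 1) \<le> 1 + exp (l - 1) * indicator (U \<inter> {a..b}) x" if "x \<in> space (leb a b)" for x
          using that by (auto split: split_indicator)
      qed
      also have "\<dots> = (b - a) + exp (l - 1) * measure (leb a b) (U \<inter> {a..b})"
        using Ui L.emeasure_finite ab
        by (subst Bochner_Integration.integral_add) (auto simp: measure_leb_space less_top[symmetric] Int_absorb1 intro!: integrable_real_indicator)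
      also have "\<dots> \<le> (b - a) + exp (l - 1) * exp (1 - l)"
        using meas by (intro add_left_mono mult_left_mono) auto
      finally show ?thesis by (simp add: exp_add[symmetric])
    qed
    moreover have "l * measure \<nu> N = \<bar>M\<bar> + (b - a) + 2" using K by (simp add: l_def)
    ultimately show False by linarith
  qed
qed

text \<open>A bounded measurable function is almost everywhere a limit of continuous ones, which can be clamped
  to the same bounds; absolute continuity transfers the exceptional set to \<open>\<nu>\<close>.\<close>

lemma dual_bound_measurable:
  fixes M B :: real
  assumes prob: "prob_space \<nu>" and s: "sets \<nu> = sets (leb a b)"
    and ac: "absolutely_continuous (leb a b) \<nu>"
    and dual: "\<And>\<phi> B. continuous_on UNIV \<phi> \<Longrightarrow> (\<And>x. \<bar>\<phi> x\<bar> \<le> B) \<Longrightarrow>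
      (\<integral>x. \<phi> x \<partial>\<nu>) - (\<integral>x. exp (\<phi> x - 1) \<partial>leb a b) \<le> M"
    and \<phi>: "\<phi> \<in> borel_measurable (leb a b)" and B: "\<And>x. \<bar>\<phi> x\<bar> \<le> B"
  shows "(\<integral>x. \<phi> x \<partial>\<nu>) - (\<integral>x. exp (\<phi> x - 1) \<partial>leb a b) \<le> M"
proof -
  define \<phi>' where "\<phi>' x = indicator {a..b} x *\<^sub>R \<phi> x" for x
  have "\<phi>' \<in> borel_measurable lborel"
    using \<phi> unfolding \<phi>'_def leb_def by (subst (asm) borel_measurable_restrict_space_iff) auto
  then have "\<phi>' \<in> borel_measurable lebesgue" by (rule measurable_completion)
  then have "\<phi>' measurable_on UNIV" by (rule lebesgue_measurable_imp_measurable_on) simp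
  then obtain N g where N: "negligible N" and g: "\<And>n. continuous_on UNIV (g n)"
    and lim: "\<And>x. x \<notin> N \<Longrightarrow> (\<lambda>n. g n x) \<longlonglongrightarrow> \<phi>' x" by (auto simp: measurable_on_def)
  have "AE x in lebesgue. x \<notin> N" using N by (intro AE_not_in) (simp add: negligible_iff_null_sets)
  then have AEN: "AE x in lborel. x \<notin> N" by (simp add: AE_completion_iff)
  define \<psi> where "\<psi> n x = max (- B) (min B (g n x))" for n x
  have B0: "B \<ge> 0" using order_trans[OF abs_ge_zero B] .
  have lim2: "AE x in leb a b. (\<lambda>n. \<psi> n x) \<longlonglongrightarrow> \<phi> x"
    unfolding AE_leb_iff using AEN
  proof eventually_elim
    case (elim x)
    show ?case
    proof
      assume x: "x \<in> {a..b}"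
      have "(\<lambda>n. \<psi> n x) \<longlonglongrightarrow> max (- B) (min B (\<phi>' x))"
        unfolding \<psi>_def by (intro tendsto_max tendsto_min tendsto_const lim elim)
      moreover have "max (- B) (min B (\<phi>' x)) = \<phi> x" using B[of x] x by (auto simp: \<phi>'_def)
      ultimately show "(\<lambda>n. \<psi> n x) \<longlonglongrightarrow> \<phi> x" by simp
    qed
  qed
  have c: "continuous_on UNIV (\<psi> n)" for n
    unfolding \<psi>_def by (intro continuous_on_max continuous_on_min continuous_on_const g)
  have bd: "\<bar>\<psi> n x\<bar> \<le> B" for n x using B0 by (auto simp: \<psi>_def)
  show ?thesis
  proof (rule dual_bound_limit[OF prob s _ \<phi> bd lim2])
    show "\<psi> n \<in> borel_measurable (leb a b)" for n
      using c by (intro borel_measurable_leb borel_measurable_continuous_onI)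
    show "AE x in \<nu>. (\<lambda>n. \<psi> n x) \<longlonglongrightarrow> \<phi> x"
      by (rule absolutely_continuous_AE[OF s ac lim2])
    show "(\<integral>x. \<psi> n x \<partial>\<nu>) - (\<integral>x. exp (\<psi> n x - 1) \<partial>leb a b) \<le> M" for n
      by (rule dual[OF c bd])
  qed
qed

definition clamp_dens :: "nat \<Rightarrow> real \<Rightarrow> real" where
  "clamp_dens j s = min (max s (1 / real (Suc j))) (real (Suc j))"

lemma clamp_dens_tendsto:
  assumes "s \<ge> 0"
  shows "(\<lambda>j. s + s * ln (clamp_dens j s) - clamp_dens j s) \<longlonglongrightarrow> s * ln s"
proof (cases "s = 0")
  case True
  have "(\<lambda>j. 1 / real (Suc j)) \<longlonglongrightarrow> 0"
    using LIMSEQ_inverse_real_of_nat by (simp only: inverse_eq_divide)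
  from tendsto_minus[OF this] have "(\<lambda>j. - (1 / real (Suc j))) \<longlonglongrightarrow> 0" by simp
  moreover have "clamp_dens j 0 = 1 / real (Suc j)" for j
    by (simp add: clamp_dens_def min_def field_simps)
  ultimately show ?thesis using True by simp
next
  case False
  with assms have s: "s > 0" by simp
  obtain k :: nat where k: "max s (1 / s) < k" using reals_Archimedean2 by blast
  have "clamp_dens j s = s" if "j \<ge> k" for j
  proof -
    have "s < real (Suc j)" "1 / s < real (Suc j)" using k that by auto
    then show ?thesis using s by (simp add: clamp_dens_def field_simps)
  qed
  then have "\<forall>\<^sub>F j in sequentially. s + s * ln (clamp_dens j s) - clamp_dens j s = s * ln s"
    unfolding eventually_sequentially by (intro exI[of _ k]) simp
  then show ?thesis by (rule tendsto_eventually)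
qed

text \<open>This bound, uniform in the truncation level, is what Fatou's lemma needs.\<close>

lemma clamp_dens_lower:
  assumes "s \<ge> 0"
  shows "- 2 \<le> s + s * ln (clamp_dens j s) - clamp_dens j s"
proof -
  define J where "J = real (Suc j)"
  have J: "J \<ge> 1" "1 / J \<le> 1" by (auto simp: J_def)
  have q: "clamp_dens j s = min (max s (1 / J)) J" by (simp add: clamp_dens_def J_def)
  have inv: "1 / J \<le> J" using J by linarith
  consider "s < 1 / J" | "1 / J \<le> s" "s \<le> J" | "J < s" by linarith
  then show ?thesis
  proof cases
    case 1
    then have q': "clamp_dens j s = 1 / J" using inv by (simp add: q)
    have l: "0 \<le> ln J" "ln J \<le> J" using J ln_le_minus_one[of J] by auto
    have "s * ln J \<le> (1 / J) * J" using 1 assms l J by (intro mult_mono) auto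
    then have "s * ln J \<le> 1" using J by simp
    moreover have "s * ln (1 / J) = - (s * ln J)" using J by (simp add: ln_div)
    ultimately show ?thesis using assms J(2) unfolding q' by linarith
  next
    case 2
    then have "clamp_dens j s = s" by (simp add: q)
    moreover have "- 1 \<le> s * ln s" using entropy_lower assms by simp
    ultimately show ?thesis by simp
  next
    case 3
    then have "clamp_dens j s = J" using inv by (simp add: q)
    moreover have "s * ln J \<ge> 0" using J assms by simp
    ultimately show ?thesis using 3 by simp
  qed
qed

text \<open>The dual bound applied to \<open>1 + ln n\<close>, with the density \<open>n\<close> truncated away from zero and infinity,
  is the bound for the entropy.\<close>

lemma Ent_le_dual:
  fixes M :: real
  assumes ab: "a < b" and prob: "prob_space \<nu>" and s: "sets \<nu> = sets (leb a b)"
    and dual: "\<And>\<phi> B. continuous_on UNIV \<phi> \<Longrightarrow> (\<And>x. \<bar>\<phi> x\<bar> \<le> B) \<Longrightarrow>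
      (\<integral>x. \<phi> x \<partial>\<nu>) - (\<integral>x. exp (\<phi> x - 1) \<partial>leb a b) \<le> M"
  shows "Ent a b \<nu> \<le> ereal M"
proof -
  interpret prob_space \<nu> by fact
  interpret L: finite_measure "leb a b" by (rule finite_measure_leb)
  have ac: "absolutely_continuous (leb a b) \<nu>"
    by (rule dual_bound_imp_absolutely_continuous[OF ab prob s dual])
  let ?n = "dens a b \<nu>" and ?c = "\<lambda>j x. clamp_dens j (dens a b \<nu> x)"
  have d: "density (leb a b) (\<lambda>x. ennreal (?n x)) = \<nu>" by (rule density_dens[OF finite_measure_axioms s ac])
  have c_bounds: "1 / real (Suc j) \<le> clamp_dens j t" "clamp_dens j t \<le> real (Suc j)" for j t
  proof -
    have "1 / real (Suc j) \<le> 1" "1 \<le> real (Suc j)" by auto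
    then have "1 / real (Suc j) \<le> real (Suc j)" by linarith
    then show "1 / real (Suc j) \<le> clamp_dens j t" "clamp_dens j t \<le> real (Suc j)"
      by (auto simp: clamp_dens_def)
  qed
  have c_pos: "clamp_dens j t > 0" for j t
    using c_bounds(1)[of j t] by (rule less_le_trans[rotated]) simp
  have [measurable]: "clamp_dens j \<in> borel_measurable borel" for j unfolding clamp_dens_def[abs_def] by measurable
  let ?h = "\<lambda>j x. ?n x + ?n x * ln (?c j x) - ?c j x"
  have n_int: "integrable (leb a b) ?n"
  proof -
    have "integrable \<nu> (\<lambda>x. 1 :: real)" by simp
    then show ?thesis by (subst (asm) d[symmetric], subst (asm) integrable_density) auto
  qed
  have bound: "integrable (leb a b) (?h j) \<and> (\<integral>x. ?h j x \<partial>leb a b) \<le> M" for j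
  proof -
    let ?\<phi> = "\<lambda>x. 1 + ln (?c j x)"
    have lnB: "\<bar>ln (clamp_dens j t)\<bar> \<le> ln (real (Suc j))" for t
    proof -
      have "ln (clamp_dens j t) \<le> ln (real (Suc j))" using c_bounds[of j t] c_pos[of j t] by simp
      moreover have "ln (1 / real (Suc j)) \<le> ln (clamp_dens j t)"
        using c_bounds(1)[of j t] c_pos[of j t] by (subst ln_le_cancel_iff) auto
      ultimately show ?thesis by (simp add: ln_div abs_le_iff)
    qed
    have B: "\<bar>?\<phi> x\<bar> \<le> 1 + ln (real (Suc j))" for x
      using lnB[of "?n x"] by linarith
    have "(\<integral>x. ?\<phi> x \<partial>\<nu>) - (\<integral>x. exp (?\<phi> x - 1) \<partial>leb a b) \<le> M"
      by (rule dual_bound_measurable[OF prob s ac dual _ B]) auto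
    moreover have "(\<integral>x. ?\<phi> x \<partial>\<nu>) = (\<integral>x. ?n x * ?\<phi> x \<partial>leb a b)"
      by (subst d[symmetric], subst integral_density) auto
    moreover have "(\<integral>x. exp (?\<phi> x - 1) \<partial>leb a b) = (\<integral>x. ?c j x \<partial>leb a b)" using c_pos by simp
    moreover have i1: "integrable (leb a b) (\<lambda>x. ?n x * ?\<phi> x)"
      by (rule Bochner_Integration.integrable_bound[where f = "\<lambda>x. (1 + ln (real (Suc j))) * ?n x"])
         (use n_int B in \<open>auto simp: abs_mult mult.commute intro!: AE_I2 mult_left_mono\<close>)
    moreover have i2: "integrable (leb a b) (?c j)"
      by (rule L.integrable_const_bound[where B = "real (Suc j)"])
         (use c_bounds c_pos in \<open>auto simp: abs_of_pos simp del: of_nat_Suc\<close>)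
    moreover have "(\<lambda>x. ?n x * ?\<phi> x - ?c j x) = ?h j" by (auto simp: algebra_simps)
    ultimately show ?thesis
      using Bochner_Integration.integrable_diff[OF i1 i2] Bochner_Integration.integral_diff[OF i1 i2] by simp
  qed
  let ?g = "\<lambda>x. ?n x * ln (?n x) + 2"
  have "(\<integral>\<^sup>+x. ennreal (?g x) \<partial>leb a b) = (\<integral>\<^sup>+x. liminf (\<lambda>j. ennreal (?h j x + 2)) \<partial>leb a b)"
  proof (rule nn_integral_cong)
    fix x
    have "(\<lambda>j. ennreal (?h j x + 2)) \<longlonglongrightarrow> ennreal (?g x)"
      by (intro tendsto_ennrealI tendsto_add tendsto_const clamp_dens_tendsto) simp
    then show "ennreal (?g x) = liminf (\<lambda>j. ennreal (?h j x + 2))"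
      by (rule lim_imp_Liminf[OF sequentially_bot, symmetric])
  qed
  also have "\<dots> \<le> liminf (\<lambda>j. \<integral>\<^sup>+x. ennreal (?h j x + 2) \<partial>leb a b)" by (rule nn_integral_liminf) measurable
  also have "\<dots> \<le> ennreal (M + 2 * (b - a))"
  proof (rule Liminf_le)
    have "(\<integral>\<^sup>+x. ennreal (?h j x + 2) \<partial>leb a b) \<le> ennreal (M + 2 * (b - a))" for j
    proof -
      have "(\<integral>\<^sup>+x. ennreal (?h j x + 2) \<partial>leb a b) = ennreal (\<integral>x. ?h j x + 2 \<partial>leb a b)"
      proof (rule nn_integral_eq_integral)
        show "AE x in leb a b. 0 \<le> ?h j x + 2"
        proof (rule AE_I2)
          show "0 \<le> ?h j x + 2" for x using clamp_dens_lower[of "?n x" j] by simp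
        qed
      qed (use bound[of j] in simp)
      also have "(\<integral>x. ?h j x + 2 \<partial>leb a b) = (\<integral>x. ?h j x \<partial>leb a b) + 2 * (b - a)"
        using bound[of j] ab by (subst Bochner_Integration.integral_add) (auto simp: measure_leb_space)
      finally show ?thesis using bound[of j] by (simp add: ennreal_leI)
    qed
    then show "\<forall>\<^sub>F j in sequentially. (\<integral>\<^sup>+x. ennreal (?h j x + 2) \<partial>leb a b) \<le> ennreal (M + 2 * (b - a))" by simp
  qed simp
  finally have le: "(\<integral>\<^sup>+x. ennreal (?g x) \<partial>leb a b) \<le> ennreal (M + 2 * (b - a))" .
  have g0: "?g x \<ge> 0" for x
    using entropy_lower[of "?n x"] by simp
  have gi: "integrable (leb a b) ?g"
    by (rule integrableI_nonneg) (use g0 le in \<open>auto simp: le_less_trans[OF _ ennreal_less_top]\<close>)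
  then have "integrable (leb a b) (\<lambda>x. ?g x - 2)" by (intro Bochner_Integration.integrable_diff) auto
  then have i: "integrable (leb a b) (\<lambda>x. ?n x * ln (?n x))" by simp
  have "ennreal (\<integral>x. ?g x \<partial>leb a b) \<le> ennreal (M + 2 * (b - a))"
    using le g0 by (subst (asm) nn_integral_eq_integral[OF gi]) auto
  moreover have eq: "(\<integral>x. ?g x \<partial>leb a b) = (\<integral>x. ?n x * ln (?n x) \<partial>leb a b) + 2 * (b - a)"
    using i ab by (subst Bochner_Integration.integral_add) (auto simp: measure_leb_space)
  moreover have "M + 2 * (b - a) \<ge> 0"
  proof -
    have "?h 0 x + 2 \<ge> 0" for x using clamp_dens_lower[of "?n x" 0] by simp
    then have "(\<integral>x. ?h 0 x + 2 \<partial>leb a b) \<ge> 0" by (intro integral_nonneg_AE AE_I2)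
    moreover have "(\<integral>x. ?h 0 x + 2 \<partial>leb a b) = (\<integral>x. ?h 0 x \<partial>leb a b) + 2 * (b - a)"
      using bound[of 0] ab by (subst Bochner_Integration.integral_add) (auto simp: measure_leb_space)
    ultimately show ?thesis using bound[of 0] by linarith
  qed
  ultimately have "(\<integral>x. ?n x * ln (?n x) \<partial>leb a b) \<le> M" by (simp add: ennreal_le_iff)
  then show ?thesis using Ent_finite_iff(2)[OF ac i] by simp
qed

section \<open>Partitions and push forwards under densities bounded above and below\<close>

lemma helly_measurable:
  assumes "\<Phi> \<in> helly a b" shows "\<Phi> \<in> borel_measurable (leb a b)"
proof -
  have "\<Phi> \<in> borel_measurable (restrict_space borel {a..b})"
    using assms by (intro borel_measurable_mono_on_fnc) (simp add: helly_def)
  then show ?thesis by (simp add: measurable_cong_sets[OF sets_leb refl])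
qed

lemma helly_bounds:
  assumes "\<Phi> \<in> helly a b" "x \<in> {a..b}" shows "a \<le> \<Phi> x" "\<Phi> x \<le> b" "\<bar>\<Phi> x\<bar> \<le> \<bar>a\<bar> + \<bar>b\<bar>"
proof -
  have "\<Phi> x \<in> {a..b}" using assms by (auto simp: helly_def)
  then show "a \<le> \<Phi> x" "\<Phi> x \<le> b" "\<bar>\<Phi> x\<bar> \<le> \<bar>a\<bar> + \<bar>b\<bar>" by auto
qed

lemma helly_mono: "\<Phi> \<in> helly a b \<Longrightarrow> a \<le> x \<Longrightarrow> x \<le> y \<Longrightarrow> y \<le> b \<Longrightarrow> \<Phi> x \<le> \<Phi> y"
  by (auto simp: helly_def mono_on_def)

lemma helly_midpoint:
  assumes "\<Phi> \<in> helly a b" "\<Psi> \<in> helly a b"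
  shows "(\<lambda>x. (\<Phi> x + \<Psi> x) / 2) \<in> helly a b"
proof -
  have "(\<Phi> x + \<Psi> x) / 2 \<in> {a..b}" if "x \<in> {a..b}" for x
    using helly_bounds[OF assms(1) that] helly_bounds[OF assms(2) that] by (auto simp: field_simps)
  then show ?thesis using assms
    by (auto simp: helly_def mono_on_def intro!: divide_right_mono add_mono)
qed

lemma helly_id: "a \<le> b \<Longrightarrow> (\<lambda>x. x) \<in> helly a b"
  by (auto simp: helly_def mono_on_def)

lemma sum_indicator_consecutive:
  fixes z f :: "nat \<Rightarrow> real"
  assumes z: "mono_on {..N} z" and k: "k < N" and y: "z k < y" "y \<le> z (Suc k)"
  shows "(\<Sum>i<N. indicator {z i<..z (Suc i)} y * f i) = f k"
proof -
  have "indicator {z i<..z (Suc i)} y * f i = (if i = k then f i else 0)" if "i < N" for i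
  proof (cases i k rule: linorder_cases)
    case less
    then have "z (Suc i) \<le> z k" using z k by (auto simp: mono_on_def)
    then show ?thesis using y less by auto
  next
    case greater
    then have "z (Suc k) \<le> z i" using z that by (auto simp: mono_on_def)
    then show ?thesis using y greater by auto
  qed (use y in auto)
  then have "(\<Sum>i<N. indicator {z i<..z (Suc i)} y * f i) = (\<Sum>i<N. if i = k then f i else 0)"
    by (intro sum.cong) auto
  then show ?thesis using k by simp
qed

lemma ex_consecutive_interval:
  fixes z :: "nat \<Rightarrow> real"
  assumes "z 0 < y" "y \<le> z N"
  obtains k where "k < N" "z k < y" "y \<le> z (Suc k)"
proof -
  define k where "k = (LEAST k. y \<le> z k)"
  have k: "y \<le> z k" "\<And>j. j < k \<Longrightarrow> \<not> y \<le> z j" "k \<le> N"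
    unfolding k_def using assms(2) by (auto intro: LeastI Least_le dest: not_less_Least)
  then obtain j where j: "k = Suc j" using assms(1) by (cases k) auto
  with k show thesis by (intro that[of j]) (auto simp: not_le)
qed

text \<open>The bounds make \<open>\<mu>\<close> comparable to Lebesgue measure: the two have the same null sets and the same
  square integrable functions.\<close>

locale bounded_density =
  fixes a b :: real and \<mu> :: "real measure" and c C :: real
  assumes ab: "a < b" and prob_mu: "prob_space \<mu>" and sets_mu: "sets \<mu> = sets (leb a b)"
    and ac_mu: "absolutely_continuous (leb a b) \<mu>" and c_pos: "0 < c"
    and dens_bounds: "AE x in leb a b. c \<le> dens a b \<mu> x \<and> dens a b \<mu> x \<le> C"
begin

sublocale prob_space \<mu> by (rule prob_mu)

abbreviation m where "m \<equiv> dens a b \<mu>"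

lemma space_mu: "space \<mu> = {a..b}"
  using sets_eq_imp_space_eq[OF sets_mu] by simp

lemma measurable_mu_iff: "f \<in> borel_measurable \<mu> \<longleftrightarrow> f \<in> borel_measurable (leb a b)"
  by (simp add: measurable_cong_sets[OF sets_mu refl])

lemma density_m: "density (leb a b) (\<lambda>x. ennreal (m x)) = \<mu>"
  by (rule density_dens[OF finite_measure_axioms sets_mu ac_mu])

lemma AE_mu_iff: "(AE x in \<mu>. P x) \<longleftrightarrow> (AE x in leb a b. P x)"
proof -
  have "(AE x in \<mu>. P x) \<longleftrightarrow> (AE x in leb a b. 0 < ennreal (m x) \<longrightarrow> P x)"
    by (subst density_m[symmetric], subst AE_density) auto
  also have "\<dots> \<longleftrightarrow> (AE x in leb a b. P x)"
  proof -
    have pos: "AE x in leb a b. 0 < ennreal (m x)" using dens_bounds c_pos by (auto elim!: eventually_mono)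
    show ?thesis
    proof
      assume "AE x in leb a b. 0 < ennreal (m x) \<longrightarrow> P x"
      with pos show "AE x in leb a b. P x" by eventually_elim auto
    qed (auto elim!: eventually_mono)
  qed
  finally show ?thesis .
qed

lemma integral_mu: "f \<in> borel_measurable (leb a b) \<Longrightarrow> (\<integral>x. f x \<partial>\<mu>) = (\<integral>x. f x * m x \<partial>leb a b)" for f :: "real \<Rightarrow> real"
  by (subst density_m[symmetric], subst integral_density) (auto simp: mult.commute)

lemma integrable_mu_iff:
  fixes f :: "real \<Rightarrow> real"
  assumes f: "f \<in> borel_measurable (leb a b)"
  shows "integrable \<mu> f \<longleftrightarrow> integrable (leb a b) f"
    and "integrable \<mu> f \<longleftrightarrow> integrable (leb a b) (\<lambda>x. f x * m x)"
proof -
  note [measurable] = f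
  show 1: "integrable \<mu> f \<longleftrightarrow> integrable (leb a b) (\<lambda>x. f x * m x)"
    by (subst (1) density_m[symmetric], subst integrable_density) (auto simp: mult.commute)
  show "integrable \<mu> f \<longleftrightarrow> integrable (leb a b) f"
    unfolding 1
  proof
    assume i: "integrable (leb a b) (\<lambda>x. f x * m x)"
    show "integrable (leb a b) f"
    proof (rule Bochner_Integration.integrable_bound)
      show "integrable (leb a b) (\<lambda>x. f x * m x / c)" using i by simp
      show "AE x in leb a b. norm (f x) \<le> norm (f x * m x / c)"
        using dens_bounds
      proof eventually_elim
        case (elim x)
        then have "\<bar>f x\<bar> * c \<le> \<bar>f x\<bar> * m x" by (intro mult_left_mono) auto
        then show ?case using c_pos by (simp add: abs_mult field_simps)
      qed
    qed simp
  next
    assume i: "integrable (leb a b) f"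
    show "integrable (leb a b) (\<lambda>x. f x * m x)"
    proof (rule Bochner_Integration.integrable_bound)
      show "integrable (leb a b) (\<lambda>x. C * f x)" using i by simp
      show "AE x in leb a b. norm (f x * m x) \<le> norm (C * f x)"
        using dens_bounds
      proof eventually_elim
        case (elim x)
        then have "\<bar>f x\<bar> * m x \<le> \<bar>f x\<bar> * \<bar>C\<bar>" by (intro mult_left_mono) auto
        then show ?case by (simp add: abs_mult mult.commute)
      qed
    qed simp
  qed
qed

lemma L2_mu_iff: "f \<in> L2 \<mu> \<longleftrightarrow> f \<in> L2 (leb a b)"
proof (cases "f \<in> borel_measurable (leb a b)")
  case True
  then have "(\<lambda>x. (f x)\<^sup>2) \<in> borel_measurable (leb a b)" by simp
  from integrable_mu_iff(1)[OF this] show ?thesis by (simp add: L2_def measurable_mu_iff)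
qed (simp add: L2_def measurable_mu_iff)

lemma L2_norm_leb_le:
  assumes f: "f \<in> L2 (leb a b)"
  shows "c * (L2_norm (leb a b) f)\<^sup>2 \<le> (L2_norm \<mu> f)\<^sup>2"
proof -
  have m2: "(\<lambda>x. (f x)\<^sup>2) \<in> borel_measurable (leb a b)" using L2D(1)[OF f] by simp
  have i: "integrable (leb a b) (\<lambda>x. (f x)\<^sup>2 * m x)"
    using integrable_mu_iff[OF m2] L2D(2)[OF f] by blast
  have "c * (\<integral>x. (f x)\<^sup>2 \<partial>leb a b) = (\<integral>x. (f x)\<^sup>2 * c \<partial>leb a b)" by simp
  also have "\<dots> \<le> (\<integral>x. (f x)\<^sup>2 * m x \<partial>leb a b)"
    by (rule integral_mono_AE) (use L2D(2)[OF f] i dens_bounds in \<open>auto intro!: mult_left_mono elim!: eventually_mono\<close>)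
  finally show ?thesis by (simp add: L2_norm_power2 integral_mu[OF m2])
qed

lemma measure_Ioc_bounds:
  assumes "a \<le> x" "x \<le> y" "y \<le> b"
  shows "c * (y - x) \<le> measure \<mu> {x<..y}" "measure \<mu> {x<..y} \<le> C * (y - x)"
proof -
  let ?i = "indicator {x<..y} :: real \<Rightarrow> real"
  have s: "{x<..y} \<in> sets (leb a b)" using assms by (auto simp: sets_leb sets_restrict_space intro!: image_eqI[of _ _ "{x<..y}"])
  have f: "emeasure (leb a b) {x<..y} < \<infinity>" using assms by (subst emeasure_leb) auto
  have meas: "measure (leb a b) {x<..y} = y - x"
    using assms by (subst measure_def, subst emeasure_leb) auto
  have i: "integrable (leb a b) ?i" using s f by (rule integrable_real_indicator)
  have im: "integrable (leb a b) (\<lambda>x. ?i x * m x)"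
    using integrable_mu_iff[OF borel_measurable_integrable[OF i]] i by blast
  have eq: "measure \<mu> {x<..y} = (\<integral>x. ?i x * m x \<partial>leb a b)"
    using integral_mu[OF borel_measurable_integrable[OF i]] s assms sets_mu
    by (simp add: space_mu Int_absorb2 subset_eq)
  have "c * (y - x) = (\<integral>x. ?i x * c \<partial>leb a b)" using meas assms by (simp add: Int_absorb2 subset_eq)
  also have "\<dots> \<le> (\<integral>x. ?i x * m x \<partial>leb a b)"
  proof (rule integral_mono_AE)
    show "AE x in leb a b. ?i x * c \<le> ?i x * m x"
      using dens_bounds by eventually_elim (auto split: split_indicator)
  qed (use i im in auto)
  finally show "c * (y - x) \<le> measure \<mu> {x<..y}" by (simp add: eq)
  have "(\<integral>x. ?i x * m x \<partial>leb a b) \<le> (\<integral>x. ?i x * C \<partial>leb a b)"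
  proof (rule integral_mono_AE)
    show "AE x in leb a b. ?i x * m x \<le> ?i x * C"
      using dens_bounds by eventually_elim (auto split: split_indicator)
  qed (use i im in auto)
  also have "\<dots> = C * (y - x)" using meas assms by (simp add: Int_absorb2 subset_eq)
  finally show "measure \<mu> {x<..y} \<le> C * (y - x)" by (simp add: eq)
qed

lemma helly_measurable_push:
  assumes "\<Phi> \<in> helly a b"
  shows "\<Phi> \<in> \<mu> \<rightarrow>\<^sub>M restrict_space borel {a..b}"
  using helly_measurable[OF assms] helly_bounds[OF assms]
  by (intro measurable_restrict_space2) (auto simp: measurable_mu_iff space_mu)

lemma pushforward_prob: "\<Phi> \<in> helly a b \<Longrightarrow> prob_space (pushforward a b \<Phi> \<mu>)"
  unfolding pushforward_def by (intro prob_space_distr helly_measurable_push)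

lemma sets_pushforward: "sets (pushforward a b \<Phi> \<mu>) = sets (leb a b)"
  by (simp add: pushforward_def sets_leb)

lemma integral_pushforward:
  fixes \<phi> :: "real \<Rightarrow> real"
  assumes "\<Phi> \<in> helly a b" "\<phi> \<in> borel_measurable (leb a b)"
  shows "(\<integral>y. \<phi> y \<partial>pushforward a b \<Phi> \<mu>) = (\<integral>x. \<phi> (\<Phi> x) \<partial>\<mu>)"
  unfolding pushforward_def
  using assms(2) by (intro integral_distr helly_measurable_push assms(1)) (simp add: measurable_cong_sets[OF sets_leb refl])

lemma measure_pushforward:
  assumes "\<Phi> \<in> helly a b" "A \<in> sets borel" "A \<subseteq> {a..b}"
  shows "measure (pushforward a b \<Phi> \<mu>) A = measure \<mu> {x \<in> {a..b}. \<Phi> x \<in> A}"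
  unfolding pushforward_def
  using assms(2,3) helly_measurable_push[OF assms(1)]
  by (subst measure_distr) (auto simp: space_mu sets_restrict_space vimage_def Int_def intro!: image_eqI[of _ _ A] arg_cong[where f = "measure \<mu>"])

definition gridpoint :: "nat \<Rightarrow> nat \<Rightarrow> real" where
  "gridpoint N i = a + (b - a) * (real i / real N)"

definition cell_mass :: "nat \<Rightarrow> nat \<Rightarrow> real" where
  "cell_mass N i = measure \<mu> {gridpoint N i<..gridpoint N (Suc i)}"

text \<open>The entropy of the measure that spreads the mass of each cell uniformly over the interval
  between the images of its endpoints.\<close>

definition cell_entropy :: "nat \<Rightarrow> (real \<Rightarrow> real) \<Rightarrow> real" where
  "cell_entropy N \<Phi> = (\<Sum>i<N. cell_mass N i *
     ln (cell_mass N i / (\<Phi> (gridpoint N (Suc i)) - \<Phi> (gridpoint N i))))"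

lemma gridpoint:
  assumes "N > 0"
  shows "gridpoint N 0 = a" "gridpoint N N = b" "strict_mono (gridpoint N)"
    "i \<le> N \<Longrightarrow> gridpoint N i \<in> {a..b}"
    "gridpoint N (Suc i) - gridpoint N i = (b - a) / N"
proof -
  show sm: "strict_mono (gridpoint N)"
    using ab assms by (auto simp: strict_mono_def gridpoint_def divide_strict_right_mono)
  show z: "gridpoint N 0 = a" "gridpoint N N = b" using assms by (auto simp: gridpoint_def)
  show "gridpoint N i \<in> {a..b}" if "i \<le> N"
    using monoD[OF strict_mono_mono[OF sm], of 0 i] monoD[OF strict_mono_mono[OF sm], of i N] that z by simp
  show "gridpoint N (Suc i) - gridpoint N i = (b - a) / N"
    using assms by (simp add: gridpoint_def field_simps)
qed

lemma cell_mass: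
  assumes N: "N > 0" and i: "i < N"
  shows "cell_mass N i > 0" "cell_mass N i \<le> C * (b - a) / N"
proof -
  have g: "a \<le> gridpoint N i" "gridpoint N i \<le> gridpoint N (Suc i)" "gridpoint N (Suc i) \<le> b"
    using gridpoint(4)[OF N, of i] gridpoint(4)[OF N, of "Suc i"] i strict_monoD[OF gridpoint(3)[OF N], of i "Suc i"] by auto
  have "0 < c * ((b - a) / N)" using c_pos ab N by simp
  then show "cell_mass N i > 0" using measure_Ioc_bounds(1)[OF g] gridpoint(5)[OF N, of i] unfolding cell_mass_def by simp
  show "cell_mass N i \<le> C * (b - a) / N"
    using measure_Ioc_bounds(2)[OF g] gridpoint(5)[OF N, of i] unfolding cell_mass_def by simp
qed

lemma measure_singleton: "measure \<mu> {x} = 0"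
proof (cases "x \<in> {a..b}")
  case True
  have "{x} \<in> null_sets (leb a b)"
    using True by (auto simp: null_sets_def emeasure_leb sets_leb sets_restrict_space intro!: image_eqI[of _ _ "{x}"])
  then have "{x} \<in> null_sets \<mu>" using ac_mu by (auto simp: absolutely_continuous_def)
  then show ?thesis by (auto simp: null_sets_def measure_def)
next
  case False
  then have "{x} \<notin> sets \<mu>" using sets.sets_into_space[of "{x}" \<mu>] by (auto simp: space_mu)
  then show ?thesis by (rule measure_notin_sets)
qed

lemma AE_mu_not_point: "AE x in \<mu>. x \<noteq> y"
  unfolding AE_mu_iff AE_leb_iff using AE_lborel_singleton[of y] by eventually_elim auto

lemma sets_Ioc: "a \<le> x \<Longrightarrow> y \<le> b \<Longrightarrow> {x<..y} \<in> sets \<mu>"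
  unfolding sets_mu by (auto simp: sets_leb sets_restrict_space intro!: image_eqI[of _ _ "{x<..y}"])

text \<open>The point \<open>a\<close> lies in none of the half-open cells; it is a null set.\<close>

lemma integral_cell_function:
  fixes f :: "nat \<Rightarrow> real"
  assumes N: "N > 0"
  shows "integrable \<mu> (\<lambda>x. \<Sum>i<N. indicator {gridpoint N i<..gridpoint N (Suc i)} x * f i)"
    and "(\<integral>x. (\<Sum>i<N. indicator {gridpoint N i<..gridpoint N (Suc i)} x * f i) \<partial>\<mu>) = (\<Sum>i<N. cell_mass N i * f i)"
proof -
  have s: "{gridpoint N i<..gridpoint N (Suc i)} \<in> sets \<mu>" if "i < N" for i
    using gridpoint(4)[OF N, of i] gridpoint(4)[OF N, of "Suc i"] that by (intro sets_Ioc) auto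
  have i: "integrable \<mu> (\<lambda>x. indicator {gridpoint N i<..gridpoint N (Suc i)} x * f i)" if "i < N" for i
    using s[OF that] by (intro integrable_mult_left integrable_real_indicator) (auto simp: less_top[symmetric])
  then show "integrable \<mu> (\<lambda>x. \<Sum>i<N. indicator {gridpoint N i<..gridpoint N (Suc i)} x * f i)"
    by (intro Bochner_Integration.integrable_sum) auto
  have "(\<integral>x. (\<Sum>i<N. indicator {gridpoint N i<..gridpoint N (Suc i)} x * f i) \<partial>\<mu>)
      = (\<Sum>i<N. \<integral>x. indicator {gridpoint N i<..gridpoint N (Suc i)} x * f i \<partial>\<mu>)"
    using i by (intro Bochner_Integration.integral_sum) auto
  also have "\<dots> = (\<Sum>i<N. cell_mass N i * f i)"
    using s sets.sets_into_space[OF s] by (intro sum.cong refl) (simp add: cell_mass_def Int_absorb2)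
  finally show "(\<integral>x. (\<Sum>i<N. indicator {gridpoint N i<..gridpoint N (Suc i)} x * f i) \<partial>\<mu>) = (\<Sum>i<N. cell_mass N i * f i)" .
qed

lemma mono_on_strict_mono: "strict_mono (z :: nat \<Rightarrow> real) \<Longrightarrow> mono_on A z"
  by (auto simp: mono_on_def strict_mono_less_eq)

lemma AE_cell:
  assumes N: "N > 0"
  shows "AE x in \<mu>. \<exists>k<N. gridpoint N k < x \<and> x \<le> gridpoint N (Suc k)"
proof -
  have "AE x in \<mu>. x \<in> {a..b}" using AE_space[of \<mu>] by (simp add: space_mu)
  with AE_mu_not_point[of a] show ?thesis
  proof eventually_elim
    case (elim x)
    then show ?case using gridpoint(1,2)[OF N] ex_consecutive_interval[of "gridpoint N" x N] by fastforce
  qed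
qed

lemma sum_cell_mass: assumes N: "N > 0" shows "(\<Sum>i<N. cell_mass N i) = 1"
proof -
  have "(\<Sum>i<N. cell_mass N i * 1) = (\<integral>x. (\<Sum>i<N. indicator {gridpoint N i<..gridpoint N (Suc i)} x * 1) \<partial>\<mu>)"
    by (rule integral_cell_function(2)[OF N, symmetric])
  also have "\<dots> = (\<integral>x. 1 \<partial>\<mu>)"
  proof (rule integral_cong_AE)
    show "AE x in \<mu>. (\<Sum>i<N. indicator {gridpoint N i<..gridpoint N (Suc i)} x * 1) = (1 :: real)"
      using AE_cell[OF N]
    proof eventually_elim
      case (elim x)
      then obtain k where k: "k < N" "gridpoint N k < x" "x \<le> gridpoint N (Suc k)" by blast
      show ?case
        by (rule sum_indicator_consecutive[where f = "\<lambda>_. 1", OF mono_on_strict_mono[OF gridpoint(3)[OF N]] k])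
    qed
    show "(\<lambda>x. \<Sum>i<N. indicator {gridpoint N i<..gridpoint N (Suc i)} x * (1 :: real)) \<in> borel_measurable \<mu>"
      using integral_cell_function(1)[OF N, of "\<lambda>_. 1"] by (rule borel_measurable_integrable)
  qed simp
  finally show ?thesis by (simp add: prob_space)
qed

text \<open>A flat piece of \<open>\<Phi>\<close> would give the push forward an atom, which finite entropy excludes.\<close>

lemma finite_entropy_strict_mono:
  assumes \<Phi>: "\<Phi> \<in> helly a b" and E: "Ent a b (pushforward a b \<Phi> \<mu>) \<noteq> \<infinity>"
    and xy: "a \<le> x" "x < y" "y \<le> b"
  shows "\<Phi> x < \<Phi> y"
proof (rule ccontr)
  assume "\<not> \<Phi> x < \<Phi> y"
  then have eq: "\<Phi> t = \<Phi> x" if "x < t" "t \<le> y" for t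
    using helly_mono[OF \<Phi>, of x t] helly_mono[OF \<Phi>, of t y] xy that by auto
  have \<Phi>x: "\<Phi> x \<in> {a..b}" using helly_bounds[OF \<Phi>, of x] xy by auto
  have ac: "absolutely_continuous (leb a b) (pushforward a b \<Phi> \<mu>)" using E by (auto simp: Ent_def split: if_splits)
  have "{\<Phi> x} \<in> null_sets (leb a b)"
    using \<Phi>x by (auto simp: null_sets_def emeasure_leb sets_leb sets_restrict_space intro!: image_eqI[of _ _ "{\<Phi> x}"])
  then have "{\<Phi> x} \<in> null_sets (pushforward a b \<Phi> \<mu>)" using ac by (auto simp: absolutely_continuous_def)
  then have "measure (pushforward a b \<Phi> \<mu>) {\<Phi> x} = 0" by (auto simp: null_sets_def measure_def)
  then have "measure \<mu> {t \<in> {a..b}. \<Phi> t \<in> {\<Phi> x}} = 0" using measure_pushforward[OF \<Phi>, of "{\<Phi> x}"] \<Phi>x by simp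
  moreover have "{x<..y} \<subseteq> {t \<in> {a..b}. \<Phi> t \<in> {\<Phi> x}}" using eq xy by auto
  moreover have "{t \<in> {a..b}. \<Phi> t \<in> {\<Phi> x}} \<in> sets \<mu>"
    using helly_measurable[OF \<Phi>, folded measurable_mu_iff] measurable_sets[of \<Phi> \<mu> borel "{\<Phi> x}"]
    by (simp add: space_mu vimage_def Int_def conj_commute)
  ultimately have "measure \<mu> {x<..y} \<le> 0" using finite_measure_mono by metis
  moreover have "c * (y - x) > 0" using c_pos xy by simp
  ultimately show False using measure_Ioc_bounds(1)[of x y] xy by simp
qed

text \<open>The dual bound tested with the step function equal to \<open>1 + ln r\<^sub>i\<close> between the images of the
  endpoints of the \<open>i\<close>-th cell, \<open>r\<^sub>i\<close> being the density of mass there.\<close>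

lemma cell_entropy_le_Ent:
  assumes N: "N > 0" and \<Phi>: "\<Phi> \<in> helly a b" and E: "Ent a b (pushforward a b \<Phi> \<mu>) \<le> ereal M"
  shows "cell_entropy N \<Phi> \<le> M"
proof -
  interpret L: finite_measure "leb a b" by (rule finite_measure_leb)
  have E': "Ent a b (pushforward a b \<Phi> \<mu>) \<noteq> \<infinity>" using E by auto
  note sm = finite_entropy_strict_mono[OF \<Phi> E']
  let ?g = "gridpoint N"
  note g = gridpoint[OF N]
  define z where "z i = \<Phi> (?g i)" for i
  define r where "r i = cell_mass N i / (z (Suc i) - z i)" for i
  have z_less: "z i < z (Suc i)" if "i < N" for i
    unfolding z_def using g(4)[of i] g(4)[of "Suc i"] that strict_monoD[OF g(3), of i "Suc i"] by (intro sm) auto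
  have z_mono: "mono_on {..N} z"
    unfolding mono_on_def z_def using g(4) monoD[OF strict_mono_mono[OF g(3)]] by (auto intro!: helly_mono[OF \<Phi>])
  have z0: "z 0 = a" "z N = b" using \<Phi> g by (auto simp: z_def helly_def)
  have z_in: "z i \<in> {a..b}" if "i \<le> N" for i
    using helly_bounds[OF \<Phi> g(4)[OF that]] by (simp add: z_def)
  have r_pos: "r i > 0" if "i < N" for i using cell_mass(1)[OF N that] z_less[OF that] by (simp add: r_def)
  define \<phi> where "\<phi> y = (\<Sum>i<N. indicator {z i<..z (Suc i)} y * (1 + ln (r i)))" for y
  have \<phi>m: "\<phi> \<in> borel_measurable borel" unfolding \<phi>_def[abs_def] by measurable
  have "\<bar>\<phi> y\<bar> \<le> (\<Sum>i<N. \<bar>1 + ln (r i)\<bar>)" for y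
  proof -
    have "\<bar>\<phi> y\<bar> \<le> (\<Sum>i<N. \<bar>indicator {z i<..z (Suc i)} y * (1 + ln (r i))\<bar>)"
      unfolding \<phi>_def by (rule sum_abs)
    also have "\<dots> \<le> (\<Sum>i<N. \<bar>1 + ln (r i)\<bar>)"
    proof (rule sum_mono)
      show "\<bar>indicator {z i<..z (Suc i)} y * (1 + ln (r i))\<bar> \<le> \<bar>1 + ln (r i)\<bar>" for i
        by (cases "y \<in> {z i<..z (Suc i)}") auto
    qed
    finally show ?thesis .
  qed
  from Ent_ge_dual[OF pushforward_prob[OF \<Phi>] sets_pushforward E borel_measurable_leb[OF \<phi>m] this]
  have dual: "(\<integral>x. \<phi> (\<Phi> x) \<partial>\<mu>) - (\<integral>y. exp (\<phi> y - 1) \<partial>leb a b) \<le> M"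
    by (simp add: integral_pushforward[OF \<Phi> borel_measurable_leb[OF \<phi>m]])
  have "(\<integral>x. \<phi> (\<Phi> x) \<partial>\<mu>) = (\<integral>x. (\<Sum>i<N. indicator {?g i<..?g (Suc i)} x * (1 + ln (r i))) \<partial>\<mu>)"
  proof (rule Bochner_Integration.integral_cong[OF refl])
    fix x assume "x \<in> space \<mu>"
    then have x: "x \<in> {a..b}" by (simp add: space_mu)
    have lt: "\<Phi> u < \<Phi> v \<longleftrightarrow> u < v" if "u \<in> {a..b}" "v \<in> {a..b}" for u v
      using sm[of u v] helly_mono[OF \<Phi>, of v u] that by (auto simp: not_less[symmetric])
    have "indicator {z i<..z (Suc i)} (\<Phi> x) = (indicator {?g i<..?g (Suc i)} x :: real)" if "i < N" for i
      using lt[OF g(4)[of i] x] lt[OF g(4)[of "Suc i"] x] that by (auto simp: z_def not_less[symmetric] split: split_indicator)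
    then show "\<phi> (\<Phi> x) = (\<Sum>i<N. indicator {?g i<..?g (Suc i)} x * (1 + ln (r i)))"
      unfolding \<phi>_def by (intro sum.cong) auto
  qed
  also have "\<dots> = (\<Sum>i<N. cell_mass N i * (1 + ln (r i)))" by (rule integral_cell_function(2)[OF N])
  also have "\<dots> = 1 + cell_entropy N \<Phi>"
    by (simp add: cell_entropy_def r_def z_def distrib_left sum.distrib sum_cell_mass[OF N])
  finally have 1: "(\<integral>x. \<phi> (\<Phi> x) \<partial>\<mu>) = 1 + cell_entropy N \<Phi>" .
  have s: "{z i<..z (Suc i)} \<in> sets (leb a b)" if "i < N" for i
    using z_in[of i] z_in[of "Suc i"] that sets_Ioc by (auto simp: sets_mu)
  have ii: "integrable (leb a b) (\<lambda>y. indicator {z i<..z (Suc i)} y * r i)" if "i < N" for i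
    using s[OF that] by (intro integrable_mult_left integrable_real_indicator) (auto simp: less_top[symmetric])
  have "(\<integral>y. exp (\<phi> y - 1) \<partial>leb a b) = (\<integral>y. (\<Sum>i<N. indicator {z i<..z (Suc i)} y * r i) \<partial>leb a b)"
  proof (rule integral_cong_AE)
    have "AE y in leb a b. y \<in> {a..b} \<and> y \<noteq> a"
      unfolding AE_leb_iff using AE_lborel_singleton[of a] by eventually_elim auto
    then show "AE y in leb a b. exp (\<phi> y - 1) = (\<Sum>i<N. indicator {z i<..z (Suc i)} y * r i)"
    proof eventually_elim
      case (elim y)
      then obtain k where k: "k < N" "z k < y" "y \<le> z (Suc k)"
        using ex_consecutive_interval[of z y N] z0 by auto
      show ?case unfolding \<phi>_def sum_indicator_consecutive[OF z_mono k] using r_pos[OF k(1)] by simp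
    qed
    show "(\<lambda>y. exp (\<phi> y - 1)) \<in> borel_measurable (leb a b)"
      by (rule borel_measurable_leb) (use \<phi>m in measurable)
    show "(\<lambda>y. \<Sum>i<N. indicator {z i<..z (Suc i)} y * r i) \<in> borel_measurable (leb a b)"
      by (rule borel_measurable_leb) measurable
  qed
  also have "\<dots> = (\<Sum>i<N. \<integral>y. indicator {z i<..z (Suc i)} y * r i \<partial>leb a b)"
    using ii by (intro Bochner_Integration.integral_sum) auto
  also have "\<dots> = (\<Sum>i<N. cell_mass N i)"
  proof (rule sum.cong[OF refl])
    fix i assume "i \<in> {..<N}"
    then have i: "i < N" by simp
    have sub: "{z i<..z (Suc i)} \<subseteq> {a..b}" using z_in[of i] z_in[of "Suc i"] i by auto
    have "measure (leb a b) {z i<..z (Suc i)} = z (Suc i) - z i"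
      using sub z_less[OF i] by (subst measure_def, subst emeasure_leb) auto
    then show "(\<integral>y. indicator {z i<..z (Suc i)} y * r i \<partial>leb a b) = cell_mass N i"
      using sub z_less[OF i] by (simp add: Int_absorb2 r_def)
  qed
  also have "\<dots> = 1" by (rule sum_cell_mass[OF N])
  finally show ?thesis using dual 1 by simp
qed

end

section \<open>Convexity and lower semicontinuity of the entropy\<close>

lemma ln_midpoint:
  fixes u v :: real assumes "u > 0" "v > 0"
  shows "(ln u + ln v) / 2 \<le> ln ((u + v) / 2)"
proof -
  have "u * v \<le> ((u + v) / 2)\<^sup>2"
    using zero_le_power2[of "u - v"] by (simp add: power2_eq_square field_simps)
  then have "ln (u * v) \<le> ln (((u + v) / 2)\<^sup>2)" using assms by (subst ln_le_cancel_iff) auto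
  then show ?thesis using assms by (simp add: ln_mult ln_realpow)
qed

context bounded_density
begin

text \<open>Conversely, mass spread over the images of the cells sees a continuous function up to its
  oscillation on these images. Long images are few and carry little mass, because a cell
  has mass at most \<open>C (b - a) / N\<close>.\<close>

lemma dual_le_cell_entropy:
  assumes N: "N > 0" and \<Phi>: "\<Phi> \<in> helly a b"
    and sm: "\<And>x y. a \<le> x \<Longrightarrow> x < y \<Longrightarrow> y \<le> b \<Longrightarrow> \<Phi> x < \<Phi> y"
    and cont: "continuous_on UNIV \<phi>" and B: "\<And>x. \<bar>\<phi> x\<bar> \<le> B" and ed: "0 < e" "0 < d"
    and unif: "\<And>u v. u \<in> {a..b} \<Longrightarrow> v \<in> {a..b} \<Longrightarrow> \<bar>u - v\<bar> < d \<Longrightarrow> \<bar>\<phi> u - \<phi> v\<bar> \<le> e"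
  shows "(\<integral>x. \<phi> (\<Phi> x) \<partial>\<mu>) \<le>
    cell_entropy N \<Phi> + (\<integral>y. exp (\<phi> y - 1) \<partial>leb a b) + e + 2 * B / d * (C * (b - a) / N * (b - a))"
proof -
  let ?g = "gridpoint N"
  note g = gridpoint[OF N]
  have B0: "B \<ge> 0" using order_trans[OF abs_ge_zero B] .
  \<comment> \<open>A slope that turns the bound \<open>2 B\<close> for the oscillation, valid on images of length at least \<open>d\<close>,
    into one that is linear in the length.\<close>
  define w where "w = 2 * B / d"
  have w: "w \<ge> 0" "w * d = 2 * B" using B0 ed by (auto simp: w_def)
  define z where "z i = \<Phi> (?g i)" for i
  define l where "l i = z (Suc i) - z i" for i
  define r where "r i = cell_mass N i / l i" for i
  have l_pos: "l i > 0" if "i < N" for i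
    unfolding z_def l_def using g(4)[of i] g(4)[of "Suc i"] that strict_monoD[OF g(3), of i "Suc i"] sm by auto
  have z0: "z 0 = a" "z N = b" using \<Phi> g by (auto simp: z_def helly_def)
  have z_in: "z i \<in> {a..b}" if "i \<le> N" for i
    using helly_bounds[OF \<Phi> g(4)[OF that]] by (simp add: z_def)
  note mass = cell_mass[OF N]
  have r_pos: "r i > 0" if "i < N" for i using mass(1)[OF that] l_pos[OF that] by (simp add: r_def)
  have contE: "continuous_on S (\<lambda>y. exp (\<phi> y - 1))" for S
    by (intro continuous_intros continuous_on_subset[OF cont]) auto
  have "\<exists>F. \<forall>x :: real. -\<infinity> < ereal x \<longrightarrow> ereal x < \<infinity> \<longrightarrow> (F has_vector_derivative exp (\<phi> x - 1)) (at x)"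
    by (rule einterval_antiderivative) (use contE[of UNIV] in \<open>auto simp: continuous_on_eq_continuous_at\<close>)
  then obtain G where G: "\<And>x. (G has_real_derivative exp (\<phi> x - 1)) (at x)"
    by (auto simp: has_real_derivative_iff_has_vector_derivative)
  have Gint: "(\<integral>y. exp (\<phi> y - 1) \<partial>leb a b) = G b - G a"
    unfolding integral_leb set_lebesgue_integral_def
    by (rule integral_FTC_atLeastAtMost)
       (use ab contE G in \<open>auto simp: has_real_derivative_iff_has_vector_derivative[symmetric] intro: has_field_derivative_at_within\<close>)
  define E where "E i = G (z (Suc i)) - G (z i)" for i
  define u where "u i = ln (r i) + E i / cell_mass N i + e + w * l i" for i
  have key: "\<phi> (\<Phi> x) \<le> u i" if i: "i < N" and x: "?g i < x" "x \<le> ?g (Suc i)" for i x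
  proof -
    have gx: "?g i \<in> {a..b}" "?g (Suc i) \<in> {a..b}" "x \<in> {a..b}"
      using g(4)[of i] g(4)[of "Suc i"] i x by auto
    have \<Phi>x: "z i \<le> \<Phi> x" "\<Phi> x \<le> z (Suc i)"
      unfolding z_def using gx x helly_mono[OF \<Phi>, of "?g i" x] helly_mono[OF \<Phi>, of x "?g (Suc i)"] by auto
    have "z i < z (Suc i)" using l_pos[OF i] by (simp add: l_def)
    \<comment> \<open>The mean value theorem replaces the average of \<open>exp (\<phi> - 1)\<close> over the image by a single value, to
      which Young's inequality applies.\<close>
    then obtain y where y: "z i < y" "y < z (Suc i)" "E i = l i * exp (\<phi> y - 1)"
      using MVT2[of "z i" "z (Suc i)" G "\<lambda>x. exp (\<phi> x - 1)"] G by (auto simp: E_def l_def)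
    have yin: "y \<in> {a..b}" "\<Phi> x \<in> {a..b}"
      using y \<Phi>x z_in[of i] z_in[of "Suc i"] i by auto
    have "\<phi> (\<Phi> x) \<le> \<phi> y + e + w * l i"
    proof (cases "\<bar>\<Phi> x - y\<bar> < d")
      case True
      have "0 \<le> w * l i" using w l_pos[OF i] by simp
      then show ?thesis using unif[OF yin(2,1) True] by linarith
    next
      case False
      have "\<bar>\<Phi> x - y\<bar> \<le> l i" using \<Phi>x y unfolding l_def by linarith
      with False have "d \<le> l i" by linarith
      then have "w * d \<le> w * l i" using w by (intro mult_left_mono) auto
      then show ?thesis using B[of y] B[of "\<Phi> x"] ed unfolding w by (simp add: abs_le_iff)
    qed
    moreover have "\<phi> y \<le> ln (r i) + E i / cell_mass N i"
    proof -
      have "r i * \<phi> y \<le> r i * (ln (r i) + exp (\<phi> y - 1) / r i)"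
        using entropy_Young[of "r i" "\<phi> y"] r_pos[OF i] by (simp add: distrib_left)
      then have "\<phi> y \<le> ln (r i) + exp (\<phi> y - 1) / r i" using r_pos[OF i] by (simp only: mult_le_cancel_left_pos)
      moreover have "exp (\<phi> y - 1) / r i = E i / cell_mass N i"
        using l_pos[OF i] mass(1)[OF i] by (simp add: y(3) r_def)
      ultimately show ?thesis by simp
    qed
    ultimately show ?thesis by (simp add: u_def)
  qed
  have "(\<integral>x. \<phi> (\<Phi> x) \<partial>\<mu>) \<le> (\<integral>x. (\<Sum>i<N. indicator {?g i<..?g (Suc i)} x * u i) \<partial>\<mu>)"
  proof (rule integral_mono_AE)
    show "integrable \<mu> (\<lambda>x. \<phi> (\<Phi> x))"
    proof (rule integrable_const_bound[where B = B])
      have "\<Phi> \<in> borel_measurable \<mu>" using helly_measurable[OF \<Phi>] by (simp add: measurable_mu_iff)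
      then show "(\<lambda>x. \<phi> (\<Phi> x)) \<in> borel_measurable \<mu>"
        using borel_measurable_continuous_onI[OF cont] by (rule measurable_compose)
    qed (use B in auto)
    show "AE x in \<mu>. \<phi> (\<Phi> x) \<le> (\<Sum>i<N. indicator {?g i<..?g (Suc i)} x * u i)"
      using AE_cell[OF N]
    proof eventually_elim
      case (elim x)
      then obtain k where k: "k < N" "?g k < x" "x \<le> ?g (Suc k)" by blast
      show ?case
        unfolding sum_indicator_consecutive[where f = u, OF mono_on_strict_mono[OF g(3)] k] by (rule key[OF k])
    qed
  qed (rule integral_cell_function(1)[OF N])
  also have "\<dots> = (\<Sum>i<N. cell_mass N i * u i)" by (rule integral_cell_function(2)[OF N])
  also have "\<dots> = (\<Sum>i<N. cell_mass N i * ln (r i) + E i + e * cell_mass N i + w * (cell_mass N i * l i))"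
  proof (rule sum.cong[OF refl])
    fix i assume "i \<in> {..<N}"
    then have "cell_mass N i > 0" using mass(1) by simp
    then show "cell_mass N i * u i = cell_mass N i * ln (r i) + E i + e * cell_mass N i + w * (cell_mass N i * l i)"
      by (simp add: u_def distrib_left)
  qed
  also have "\<dots> = cell_entropy N \<Phi> + (\<Sum>i<N. E i) + e + w * (\<Sum>i<N. cell_mass N i * l i)"
    by (simp add: sum.distrib sum_distrib_left[symmetric] sum_cell_mass[OF N] cell_entropy_def r_def l_def z_def)
  also have "(\<Sum>i<N. E i) = G b - G a"
    unfolding E_def using sum_lessThan_telescope[of "\<lambda>i. G (z i)" N] z0 by simp
  also have "w * (\<Sum>i<N. cell_mass N i * l i) \<le> w * (C * (b - a) / N * (b - a))"
  proof (rule mult_left_mono)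
    have "(\<Sum>i<N. cell_mass N i * l i) \<le> (\<Sum>i<N. C * (b - a) / N * l i)"
      using mass(2) l_pos by (intro sum_mono mult_right_mono) (auto intro: less_imp_le)
    also have "\<dots> = C * (b - a) / N * (\<Sum>i<N. l i)" by (rule sum_distrib_left[symmetric])
    also have "(\<Sum>i<N. l i) = b - a" unfolding l_def using sum_lessThan_telescope[of z N] z0 by simp
    finally show "(\<Sum>i<N. cell_mass N i * l i) \<le> C * (b - a) / N * (b - a)" .
  qed (rule w)
  finally show ?thesis by (simp add: Gint w_def)
qed

text \<open>With the preceding bound for fine partitions: for strictly increasing \<open>\<Phi>\<close> the entropy is the supremum
  of the cell entropies.\<close>

lemma Ent_le_if_cell_entropy_le:
  assumes \<Phi>: "\<Phi> \<in> helly a b"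
    and sm: "\<And>x y. a \<le> x \<Longrightarrow> x < y \<Longrightarrow> y \<le> b \<Longrightarrow> \<Phi> x < \<Phi> y"
    and M: "\<And>N. N > 0 \<Longrightarrow> cell_entropy N \<Phi> \<le> M"
  shows "Ent a b (pushforward a b \<Phi> \<mu>) \<le> ereal M"
proof (rule Ent_le_dual[OF ab pushforward_prob[OF \<Phi>] sets_pushforward])
  fix \<phi> :: "real \<Rightarrow> real" and B :: real assume cont: "continuous_on UNIV \<phi>" and B: "\<And>x. \<bar>\<phi> x\<bar> \<le> B"
  have m\<phi>: "\<phi> \<in> borel_measurable (leb a b)"
    using cont by (intro borel_measurable_leb borel_measurable_continuous_onI)
  have "(\<integral>x. \<phi> (\<Phi> x) \<partial>\<mu>) \<le> M + (\<integral>y. exp (\<phi> y - 1) \<partial>leb a b)"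
  proof (rule field_le_epsilon)
    fix e :: real assume e: "e > 0"
    have "uniformly_continuous_on {a..b} \<phi>"
      by (rule compact_uniformly_continuous[OF continuous_on_subset[OF cont]]) auto
    then obtain d where d: "d > 0" and unif: "\<And>u v. u \<in> {a..b} \<Longrightarrow> v \<in> {a..b} \<Longrightarrow> dist v u < d \<Longrightarrow> dist (\<phi> v) (\<phi> u) < e / 2"
      unfolding uniformly_continuous_on_def using e by (metis half_gt_zero)
    define K where "K = 2 * B / d * (C * (b - a) * (b - a))"
    obtain n :: nat where n: "2 * \<bar>K\<bar> / e < n" using reals_Archimedean2 by blast
    define N where "N = Suc n"
    have N: "N > 0" "2 * \<bar>K\<bar> / e < N" using n by (auto simp: N_def)
    have "(\<integral>x. \<phi> (\<Phi> x) \<partial>\<mu>) \<le> cell_entropy N \<Phi> + (\<integral>y. exp (\<phi> y - 1) \<partial>leb a b) + e / 2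
        + 2 * B / d * (C * (b - a) / N * (b - a))"
      by (rule dual_le_cell_entropy[OF N(1) \<Phi> sm cont B])
         (use e d unif in \<open>auto simp: dist_real_def abs_minus_commute intro: less_imp_le\<close>)
    moreover have "2 * B / d * (C * (b - a) / N * (b - a)) = K / N" by (simp add: K_def)
    moreover have "K / N \<le> e / 2"
    proof -
      have "2 * \<bar>K\<bar> < e * N" using N e by (simp add: field_simps)
      then have "K \<le> e / 2 * N" by (simp add: abs_if split: if_splits)
      then show ?thesis using N by (simp add: field_simps)
    qed
    ultimately show "(\<integral>x. \<phi> (\<Phi> x) \<partial>\<mu>) \<le> M + (\<integral>y. exp (\<phi> y - 1) \<partial>leb a b) + e"
      using M[OF N(1)] by linarith
  qed
  then show "(\<integral>x. \<phi> x \<partial>pushforward a b \<Phi> \<mu>) - (\<integral>x. exp (\<phi> x - 1) \<partial>leb a b) \<le> M"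
    by (simp add: integral_pushforward[OF \<Phi> m\<phi>])
qed

text \<open>Displacement convexity: the logarithm of the length of the image of a cell is concave in \<open>\<Phi>\<close>.\<close>

lemma Ent_midpoint:
  assumes \<Phi>: "\<Phi> \<in> helly a b" "Ent a b (pushforward a b \<Phi> \<mu>) \<le> ereal M"
    and \<Psi>: "\<Psi> \<in> helly a b" "Ent a b (pushforward a b \<Psi> \<mu>) \<le> ereal L"
  shows "Ent a b (pushforward a b (\<lambda>x. (\<Phi> x + \<Psi> x) / 2) \<mu>) \<le> ereal ((M + L) / 2)"
proof -
  have E: "Ent a b (pushforward a b \<Phi> \<mu>) \<noteq> \<infinity>" "Ent a b (pushforward a b \<Psi> \<mu>) \<noteq> \<infinity>"
    using \<Phi>(2) \<Psi>(2) by auto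
  note sm = finite_entropy_strict_mono[OF \<Phi>(1) E(1)] finite_entropy_strict_mono[OF \<Psi>(1) E(2)]
  show ?thesis
  proof (rule Ent_le_if_cell_entropy_le[OF helly_midpoint[OF \<Phi>(1) \<Psi>(1)]])
    show "(\<Phi> x + \<Psi> x) / 2 < (\<Phi> y + \<Psi> y) / 2" if "a \<le> x" "x < y" "y \<le> b" for x y
      using sm[OF that] by simp
    fix N :: nat assume N: "N > 0"
    let ?g = "gridpoint N"
    let ?l = "\<lambda>\<Phi> i. \<Phi> (?g (Suc i)) - \<Phi> (?g i)"
    have "cell_entropy N (\<lambda>x. (\<Phi> x + \<Psi> x) / 2) \<le> (\<Sum>i<N. (cell_mass N i * ln (cell_mass N i / ?l \<Phi> i)
      + cell_mass N i * ln (cell_mass N i / ?l \<Psi> i)) / 2)"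
      unfolding cell_entropy_def
    proof (rule sum_mono)
      fix i assume "i \<in> {..<N}"
      then have i: "i < N" by simp
      have mass: "cell_mass N i > 0" by (rule cell_mass(1)[OF N i])
      have g: "a \<le> ?g i" "?g i < ?g (Suc i)" "?g (Suc i) \<le> b"
        using gridpoint(4)[OF N, of i] gridpoint(4)[OF N, of "Suc i"] i strict_monoD[OF gridpoint(3)[OF N], of i "Suc i"] by auto
      have l: "?l \<Phi> i > 0" "?l \<Psi> i > 0" using sm(1)[OF g] sm(2)[OF g] by auto
      have eq: "(\<Phi> (?g (Suc i)) + \<Psi> (?g (Suc i))) / 2 - (\<Phi> (?g i) + \<Psi> (?g i)) / 2 = (?l \<Phi> i + ?l \<Psi> i) / 2"
        by (simp add: field_simps)
      have "cell_mass N i * ln (cell_mass N i / ((?l \<Phi> i + ?l \<Psi> i) / 2))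
          = cell_mass N i * (ln (cell_mass N i) - ln ((?l \<Phi> i + ?l \<Psi> i) / 2))"
        using mass l by (subst ln_div) auto
      also have "\<dots> \<le> cell_mass N i * (ln (cell_mass N i) - (ln (?l \<Phi> i) + ln (?l \<Psi> i)) / 2)"
        using ln_midpoint[OF l] mass by (intro mult_left_mono) auto
      also have "\<dots> = (cell_mass N i * ln (cell_mass N i / ?l \<Phi> i) + cell_mass N i * ln (cell_mass N i / ?l \<Psi> i)) / 2"
        using mass l by (simp add: ln_div field_simps)
      finally show "cell_mass N i * ln (cell_mass N i / ((\<Phi> (?g (Suc i)) + \<Psi> (?g (Suc i))) / 2 - (\<Phi> (?g i) + \<Psi> (?g i)) / 2))
        \<le> (cell_mass N i * ln (cell_mass N i / ?l \<Phi> i) + cell_mass N i * ln (cell_mass N i / ?l \<Psi> i)) / 2"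
        unfolding eq .
    qed
    also have "\<dots> = (cell_entropy N \<Phi> + cell_entropy N \<Psi>) / 2"
      by (simp add: cell_entropy_def sum.distrib sum_divide_distrib[symmetric])
    also have "\<dots> \<le> (M + L) / 2"
      using cell_entropy_le_Ent[OF N \<Phi>] cell_entropy_le_Ent[OF N \<Psi>] by simp
    finally show "cell_entropy N (\<lambda>x. (\<Phi> x + \<Psi> x) / 2) \<le> (M + L) / 2" .
  qed
qed

text \<open>In the dual formula each test function contributes a quantity that converges along the sequence.\<close>

lemma Ent_lower_semicontinuous:
  assumes \<Phi>n: "\<And>n. \<Phi>n n \<in> helly a b" and \<Phi>: "\<Phi> \<in> helly a b"
    and lim: "AE x in \<mu>. (\<lambda>n. \<Phi>n n x) \<longlonglongrightarrow> \<Phi> x" and Mn: "Mn \<longlonglongrightarrow> M"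
    and E: "\<And>n. Ent a b (pushforward a b (\<Phi>n n) \<mu>) \<le> ereal (Mn n)"
  shows "Ent a b (pushforward a b \<Phi> \<mu>) \<le> ereal M"
proof (rule Ent_le_dual[OF ab pushforward_prob[OF \<Phi>] sets_pushforward])
  fix \<phi> :: "real \<Rightarrow> real" and B :: real assume cont: "continuous_on UNIV \<phi>" and B: "\<And>x. \<bar>\<phi> x\<bar> \<le> B"
  have b\<phi> [measurable]: "\<phi> \<in> borel_measurable borel" using cont by (rule borel_measurable_continuous_onI)
  have m\<phi>: "\<phi> \<in> borel_measurable (leb a b)" by (rule borel_measurable_leb) fact
  have [measurable]: "\<Phi>n n \<in> borel_measurable \<mu>" "\<Phi> \<in> borel_measurable \<mu>" for n
    using helly_measurable \<Phi>n \<Phi> by (auto simp: measurable_mu_iff)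
  have "(\<lambda>n. \<integral>x. \<phi> (\<Phi>n n x) \<partial>\<mu>) \<longlonglongrightarrow> (\<integral>x. \<phi> (\<Phi> x) \<partial>\<mu>)"
  proof (rule integral_dominated_convergence[where w = "\<lambda>_. B"])
    show "AE x in \<mu>. (\<lambda>n. \<phi> (\<Phi>n n x)) \<longlonglongrightarrow> \<phi> (\<Phi> x)"
      using lim by eventually_elim
        (rule isCont_tendsto_compose, use cont in \<open>auto simp: continuous_on_eq_continuous_at\<close>)
  qed (use B in auto)
  then have "(\<lambda>n. (\<integral>x. \<phi> (\<Phi>n n x) \<partial>\<mu>) - (\<integral>x. exp (\<phi> x - 1) \<partial>leb a b)) \<longlonglongrightarrow>
      (\<integral>x. \<phi> (\<Phi> x) \<partial>\<mu>) - (\<integral>x. exp (\<phi> x - 1) \<partial>leb a b)" by (intro tendsto_diff tendsto_const)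
  then have "(\<integral>x. \<phi> (\<Phi> x) \<partial>\<mu>) - (\<integral>x. exp (\<phi> x - 1) \<partial>leb a b) \<le> M"
  proof (rule LIMSEQ_le[OF _ Mn])
    show "\<exists>N. \<forall>n\<ge>N. (\<integral>x. \<phi> (\<Phi>n n x) \<partial>\<mu>) - (\<integral>x. exp (\<phi> x - 1) \<partial>leb a b) \<le> Mn n"
      using Ent_ge_dual[OF pushforward_prob[OF \<Phi>n] sets_pushforward E m\<phi> B]
      by (simp add: integral_pushforward[OF \<Phi>n m\<phi>])
  qed
  then show "(\<integral>x. \<phi> x \<partial>pushforward a b \<Phi> \<mu>) - (\<integral>x. exp (\<phi> x - 1) \<partial>leb a b) \<le> M"
    by (simp add: integral_pushforward[OF \<Phi> m\<phi>])
qed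

text \<open>The dual bound for the test function zero.\<close>

lemma Ent_lower_bound:
  assumes \<Phi>: "\<Phi> \<in> helly a b"
  shows "ereal (- (b - a)) \<le> Ent a b (pushforward a b \<Phi> \<mu>)"
proof (rule ereal_le_real)
  fix M assume M: "Ent a b (pushforward a b \<Phi> \<mu>) \<le> ereal M"
  have e: "(b - a) * exp (- 1) \<le> b - a" using ab by (intro mult_left_le) auto
  have "- (b - a) \<le> - ((b - a) * exp (- 1))" by (rule le_imp_neg_le[OF e])
  also have "\<dots> \<le> M"
    using Ent_ge_dual[OF pushforward_prob[OF \<Phi>] sets_pushforward M, of "\<lambda>_. 0" 0] ab
    by (simp add: measure_leb_space)
  finally have "- (b - a) \<le> M" .
  then show "ereal (- (b - a)) \<le> ereal M" by simp
qed

lemma Ent_id_finite: "Ent a b (pushforward a b (\<lambda>x. x) \<mu>) \<noteq> \<infinity>"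
proof -
  interpret L: finite_measure "leb a b" by (rule finite_measure_leb)
  have "pushforward a b (\<lambda>x. x) \<mu> = \<mu>"
    unfolding pushforward_def by (rule distr_id2) (simp add: sets_mu sets_leb)
  moreover have "integrable (leb a b) (\<lambda>x. m x * ln (m x))"
  proof (rule L.integrable_const_bound[where B = "\<bar>C\<bar> * (\<bar>ln c\<bar> + \<bar>ln C\<bar>)"])
    show "AE x in leb a b. norm (m x * ln (m x)) \<le> \<bar>C\<bar> * (\<bar>ln c\<bar> + \<bar>ln C\<bar>)"
      using dens_bounds
    proof eventually_elim
      case (elim x)
      then have "ln c \<le> ln (m x)" "ln (m x) \<le> ln C" using c_pos by auto
      then have "\<bar>ln (m x)\<bar> \<le> \<bar>ln c\<bar> + \<bar>ln C\<bar>" by linarith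
      moreover have "\<bar>m x\<bar> \<le> \<bar>C\<bar>" using elim c_pos by linarith
      ultimately show ?case by (simp only: real_norm_def abs_mult) (intro mult_mono, auto)
    qed
  qed measurable
  ultimately show ?thesis using Ent_finite_iff(1)[OF ac_mu] by simp
qed

end

section \<open>Weak derivatives of Lipschitz curves\<close>

lemma integrable_pair_mult:
  fixes f :: "'a \<Rightarrow> real" and g :: "'b \<Rightarrow> real"
  assumes "sigma_finite_measure M" "sigma_finite_measure N"
    and f: "integrable M f" and g: "integrable N g"
  shows "integrable (M \<Otimes>\<^sub>M N) (\<lambda>(x, y). f x * g y)"
    and "(\<integral>z. (\<lambda>(x, y). f x * g y) z \<partial>(M \<Otimes>\<^sub>M N)) = (\<integral>x. f x \<partial>M) * (\<integral>y. g y \<partial>N)"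
proof -
  interpret pair_sigma_finite M N using assms(1,2) by (simp add: pair_sigma_finite_def)
  note [measurable] = borel_measurable_integrable[OF f] borel_measurable_integrable[OF g]
  show i: "integrable (M \<Otimes>\<^sub>M N) (\<lambda>(x, y). f x * g y)"
  proof (rule Fubini_integrable)
    show "integrable M (\<lambda>x. \<integral>y. norm ((\<lambda>(x, y). f x * g y) (x, y)) \<partial>N)"
      using integrable_norm[OF f] by (simp add: abs_mult)
    show "AE x in M. integrable N (\<lambda>y. (\<lambda>(x, y). f x * g y) (x, y))" using g by simp
  qed measurable
  show "(\<integral>z. (\<lambda>(x, y). f x * g y) z \<partial>(M \<Otimes>\<^sub>M N)) = (\<integral>x. f x \<partial>M) * (\<integral>y. g y \<partial>N)"
    using integral_fst[OF i] by simp
qed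

text \<open>Functions of time and space are treated on the product of \<open>M\<close> with a half-open unit interval of times,
  which the cells of its partitions cover without overlap.\<close>

locale unit_interval_times = finite_measure M for M :: "'a measure" +
  fixes t0 :: real
begin

definition T where "T = restrict_space lborel {t0..<t0 + 1}"

definition cell :: "nat \<Rightarrow> nat \<Rightarrow> real set" where
  "cell N k = {t0 + k / N..<t0 + Suc k / N}"

text \<open>A function that is constant in time on each cell.\<close>

definition cellfun :: "nat \<Rightarrow> (nat \<Rightarrow> 'a \<Rightarrow> real) \<Rightarrow> real \<times> 'a \<Rightarrow> real" where
  "cellfun N v = (\<lambda>(t, x). \<Sum>k<N. indicator (cell N k) t * v k x)"

lemma space_T: "space T = {t0..<t0 + 1}"
  by (simp add: T_def space_restrict_space)

lemma sets_T: "A \<in> sets borel \<Longrightarrow> A \<subseteq> {t0..<t0 + 1} \<Longrightarrow> A \<in> sets T"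
  by (auto simp: T_def sets_restrict_space intro!: image_eqI[of _ _ A])

sublocale T: finite_measure T
  by (rule finite_measureI) (simp add: T_def emeasure_restrict_space space_restrict_space)

sublocale P: pair_sigma_finite T M ..

lemma finite_P: "finite_measure (T \<Otimes>\<^sub>M M)"
  by (rule finite_measure_pair_measure) unfold_locales

lemma cell_subset: "k < N \<Longrightarrow> cell N k \<subseteq> {t0..<t0 + 1}"
proof -
  assume k: "k < N"
  then have "real (Suc k) / N \<le> 1" by simp
  then show ?thesis by (auto simp: cell_def)
qed

lemma cell_measure: assumes "k < N" shows "cell N k \<in> sets T" "measure T (cell N k) = 1 / N"
proof -
  show s: "cell N k \<in> sets T" using cell_subset[OF assms] by (intro sets_T) (auto simp: cell_def)
  have "measure T (cell N k) = measure lborel (cell N k)"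
    unfolding T_def using cell_subset[OF assms] by (intro measure_restrict_space) auto
  also have "\<dots> = 1 / N" using assms by (simp add: cell_def field_simps)
  finally show "measure T (cell N k) = 1 / N" .
qed

lemma cell_index:
  assumes t: "t \<in> {t0..<t0 + 1}" and N: "N > 0"
  shows "nat \<lfloor>N * (t - t0)\<rfloor> < N" "t \<in> cell N k \<longleftrightarrow> k = nat \<lfloor>N * (t - t0)\<rfloor>"
proof -
  have "0 \<le> N * (t - t0)" "N * (t - t0) < N" using t N by auto
  then show "nat \<lfloor>N * (t - t0)\<rfloor> < N" by linarith
  have "t \<in> cell N k \<longleftrightarrow> real k \<le> N * (t - t0) \<and> N * (t - t0) < real k + 1"
    using N by (auto simp: cell_def field_simps)
  also have "\<dots> \<longleftrightarrow> \<lfloor>N * (t - t0)\<rfloor> = int k" by (simp add: floor_eq_iff)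
  also have "\<dots> \<longleftrightarrow> k = nat \<lfloor>N * (t - t0)\<rfloor>" using \<open>0 \<le> N * (t - t0)\<close> by auto
  finally show "t \<in> cell N k \<longleftrightarrow> k = nat \<lfloor>N * (t - t0)\<rfloor>" .
qed

lemma cellfun_eq:
  assumes t: "t \<in> {t0..<t0 + 1}" and N: "N > 0"
  shows "cellfun N v (t, x) = v (nat \<lfloor>N * (t - t0)\<rfloor>) x"
proof -
  have "(\<Sum>k<N. indicator (cell N k) t * v k x) = (\<Sum>k<N. if k = nat \<lfloor>N * (t - t0)\<rfloor> then v k x else 0)"
    using cell_index(2)[OF t N] by (intro sum.cong) (auto simp: indicator_def)
  then show ?thesis using cell_index(1)[OF t N] by (simp add: cellfun_def)
qed

lemma cellfun_integral:
  assumes v: "\<And>k. k < N \<Longrightarrow> integrable M (v k)"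
  shows "integrable (T \<Otimes>\<^sub>M M) (cellfun N v)"
    and "(\<integral>z. cellfun N v z \<partial>(T \<Otimes>\<^sub>M M)) = (\<Sum>k<N. (\<integral>x. v k x \<partial>M)) / N"
proof -
  have i1: "integrable T (indicator (cell N k) :: real \<Rightarrow> real)" if "k < N" for k
    using cell_measure(1)[OF that] by (intro integrable_real_indicator) (auto simp: less_top[symmetric])
  note ii = integrable_pair_mult[OF T.sigma_finite_measure_axioms sigma_finite_measure_axioms i1 v]
  have eq: "cellfun N v = (\<lambda>z. \<Sum>k<N. (\<lambda>(t, x). indicator (cell N k) t * v k x) z)"
    by (auto simp: cellfun_def)
  show "integrable (T \<Otimes>\<^sub>M M) (cellfun N v)" unfolding eq
    by (intro Bochner_Integration.integrable_sum ii(1)) auto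
  have "(\<integral>z. cellfun N v z \<partial>(T \<Otimes>\<^sub>M M)) = (\<Sum>k<N. \<integral>z. (\<lambda>(t, x). indicator (cell N k) t * v k x) z \<partial>(T \<Otimes>\<^sub>M M))"
    unfolding eq by (intro Bochner_Integration.integral_sum ii(1)) auto
  also have "\<dots> = (\<Sum>k<N. (1 / N) * (\<integral>x. v k x \<partial>M))"
  proof (rule sum.cong[OF refl])
    fix k assume "k \<in> {..<N}"
    then have k: "k < N" by simp
    have "(\<integral>t. indicator (cell N k) t \<partial>T) = 1 / N"
      using cell_measure[OF k] cell_subset[OF k] by (simp add: space_T Int_absorb2)
    then show "(\<integral>z. (\<lambda>(t, x). indicator (cell N k) t * v k x) z \<partial>(T \<Otimes>\<^sub>M M)) = (1 / N) * (\<integral>x. v k x \<partial>M)"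
      using ii(2)[OF k k] by simp
  qed
  also have "\<dots> = (\<Sum>k<N. (\<integral>x. v k x \<partial>M)) / N" by (simp add: sum_divide_distrib)
  finally show "(\<integral>z. cellfun N v z \<partial>(T \<Otimes>\<^sub>M M)) = (\<Sum>k<N. (\<integral>x. v k x \<partial>M)) / N" .
qed

lemma space_P: "z \<in> space (T \<Otimes>\<^sub>M M) \<Longrightarrow> fst z \<in> {t0..<t0 + 1}"
  by (auto simp: space_pair_measure space_T)

lemma cellfun_mult:
  assumes v: "\<And>k. k < N \<Longrightarrow> v k \<in> L2 M" and w: "\<And>k. k < N \<Longrightarrow> w k \<in> L2 M" and N: "N > 0"
  shows "integrable (T \<Otimes>\<^sub>M M) (\<lambda>z. cellfun N v z * cellfun N w z)"
    and "(\<integral>z. cellfun N v z * cellfun N w z \<partial>(T \<Otimes>\<^sub>M M)) = (\<Sum>k<N. (\<integral>x. v k x * w k x \<partial>M)) / N"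
proof -
  have i: "integrable M (\<lambda>x. v k x * w k x)" if "k < N" for k
    by (rule L2_mult_integrable[OF v[OF that] w[OF that]])
  have eq: "cellfun N v z * cellfun N w z = cellfun N (\<lambda>k x. v k x * w k x) z" if "z \<in> space (T \<Otimes>\<^sub>M M)" for z
    using space_P[OF that] N by (cases z) (simp add: cellfun_eq)
  show "integrable (T \<Otimes>\<^sub>M M) (\<lambda>z. cellfun N v z * cellfun N w z)"
    using cellfun_integral(1)[OF i] by (subst Bochner_Integration.integrable_cong[OF refl eq]) auto
  show "(\<integral>z. cellfun N v z * cellfun N w z \<partial>(T \<Otimes>\<^sub>M M)) = (\<Sum>k<N. (\<integral>x. v k x * w k x \<partial>M)) / N"
    using cellfun_integral(2)[OF i] by (subst Bochner_Integration.integral_cong[OF refl eq]) auto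
qed

lemma cellfun_L2:
  assumes v: "\<And>k. k < N \<Longrightarrow> v k \<in> L2 M" and N: "N > 0"
  shows "cellfun N v \<in> L2 (T \<Otimes>\<^sub>M M)"
proof -
  have "integrable M (v k)" if "k < N" for k
    by (rule L2_integrable[OF finite_measure_axioms v[OF that]])
  then have "cellfun N v \<in> borel_measurable (T \<Otimes>\<^sub>M M)"
    by (intro borel_measurable_integrable cellfun_integral(1))
  then show ?thesis using cellfun_mult(1)[OF v v N] by (auto simp: L2_def power2_eq_square)
qed

lemma cellfun_refine:
  assumes z: "z \<in> space (T \<Otimes>\<^sub>M M)" and N: "N > 0" and r: "r > 0"
  shows "cellfun N v z = cellfun (N * r) (\<lambda>k. v (k div r)) z"
proof -
  obtain t x where tx: "z = (t, x)" by (cases z)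
  have t: "t \<in> {t0..<t0 + 1}" using space_P[OF z] tx by simp
  have nn: "0 \<le> real (N * r) * (t - t0)" using t by simp
  have "\<lfloor>real N * (t - t0)\<rfloor> = \<lfloor>real (N * r) * (t - t0) / real r\<rfloor>" using r by simp
  also have "\<dots> = \<lfloor>real (N * r) * (t - t0)\<rfloor> div int r"
    using floor_divide_real_eq_div[of "int r" "real (N * r) * (t - t0)"] by simp
  finally have "nat \<lfloor>real N * (t - t0)\<rfloor> = nat \<lfloor>real (N * r) * (t - t0)\<rfloor> div r"
    using nn by (simp add: nat_div_distrib)
  then show ?thesis unfolding tx using t N r by (simp add: cellfun_eq del: of_nat_mult)
qed

end

text \<open>The difference quotients of a Lipschitz curve along the dyadic partitions of a unit interval form
  a martingale with values in \<open>L\<^sup>2\<close>: their differences are orthogonal, so bounded norms force convergence.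
  The limit is the derivative of the curve.\<close>

locale Lipschitz_curve = unit_interval_times M t0 for M :: "'a measure" and t0 +
  fixes X :: "real \<Rightarrow> 'a \<Rightarrow> real" and K :: real
  assumes X_L2: "\<And>t. t \<in> {t0..t0 + 1} \<Longrightarrow> X t \<in> L2 M"
    and X_Lipschitz: "\<And>s t. s \<in> {t0..t0 + 1} \<Longrightarrow> t \<in> {t0..t0 + 1} \<Longrightarrow> L2_norm M (\<lambda>x. X t x - X s x) \<le> K * \<bar>t - s\<bar>"
begin

definition incr :: "nat \<Rightarrow> nat \<Rightarrow> 'a \<Rightarrow> real" where
  "incr n k x = X (t0 + Suc k / 2 ^ n) x - X (t0 + k / 2 ^ n) x"

definition dquot :: "nat \<Rightarrow> nat \<Rightarrow> 'a \<Rightarrow> real" where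
  "dquot n k x = 2 ^ n * incr n k x"

definition dq where "dq n = cellfun (2 ^ n) (dquot n)"

lemma dyadic_in: "k \<le> 2 ^ n \<Longrightarrow> t0 + real k / 2 ^ n \<in> {t0..t0 + 1}"
proof -
  assume "k \<le> 2 ^ n"
  then have "real k \<le> 2 ^ n" by (metis of_nat_le_iff of_nat_numeral of_nat_power)
  then show ?thesis by simp
qed

lemma incr_L2: "k < 2 ^ n \<Longrightarrow> incr n k \<in> L2 M"
  unfolding incr_def using dyadic_in[of k n] dyadic_in[of "Suc k" n] by (intro L2_diff X_L2) auto

lemma dquot_L2: "k < 2 ^ n \<Longrightarrow> dquot n k \<in> L2 M"
  unfolding dquot_def by (intro L2_scale incr_L2)

lemma dq_L2: "dq n \<in> L2 (T \<Otimes>\<^sub>M M)"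
  unfolding dq_def by (intro cellfun_L2 dquot_L2) auto

lemma incr_sum:
  assumes "n \<le> n'"
  shows "(\<Sum>i<2 ^ (n' - n). incr n' (j * 2 ^ (n' - n) + i) x) = incr n j x"
proof -
  define r :: nat where "r = 2 ^ (n' - n)"
  have rn: "real r * 2 ^ n = 2 ^ n'" using assms by (simp add: r_def power_add[symmetric])
  have "(\<Sum>i<r. incr n' (j * r + i) x) = (\<Sum>i<r. X (t0 + (j * r + Suc i) / 2 ^ n') x - X (t0 + (j * r + i) / 2 ^ n') x)"
    by (simp add: incr_def)
  also have "\<dots> = X (t0 + (j * r + r) / 2 ^ n') x - X (t0 + (j * r) / 2 ^ n') x"
    using sum_lessThan_telescope[of "\<lambda>i. X (t0 + real (j * r + i) / 2 ^ n') x" r] by simp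
  also have "real (j * r + r) / 2 ^ n' = Suc j / 2 ^ n"
    unfolding rn[symmetric] by (simp add: r_def field_simps)
  also have "real (j * r) / 2 ^ n' = j / 2 ^ n"
    unfolding rn[symmetric] by (simp add: r_def field_simps)
  finally show ?thesis by (simp add: incr_def r_def)
qed

text \<open>On each coarse cell the fine difference quotients average to the coarse one.\<close>

lemma dq_orthogonal:
  assumes "n \<le> n'"
  shows "(\<integral>z. dq n' z * dq n z \<partial>(T \<Otimes>\<^sub>M M)) = (\<integral>z. (dq n z)\<^sup>2 \<partial>(T \<Otimes>\<^sub>M M))"
proof -
  define r :: nat where "r = 2 ^ (n' - n)"
  have r: "r > 0" "2 ^ n * r = (2 ^ n' :: nat)" using assms by (simp_all add: r_def power_add[symmetric])
  have div_less: "k div r < 2 ^ n" if "k < 2 ^ n'" for k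
    using that r by (simp add: less_mult_imp_div_less)
  have "(\<integral>z. dq n' z * dq n z \<partial>(T \<Otimes>\<^sub>M M)) =
      (\<integral>z. cellfun (2 ^ n') (dquot n') z * cellfun (2 ^ n') (\<lambda>k. dquot n (k div r)) z \<partial>(T \<Otimes>\<^sub>M M))"
    by (rule Bochner_Integration.integral_cong[OF refl]) (use cellfun_refine[of _ "2 ^ n" r "dquot n"] r in \<open>simp add: dq_def\<close>)
  also have "\<dots> = (\<Sum>k<2 ^ n'. (\<integral>x. dquot n' k x * dquot n (k div r) x \<partial>M)) / (2 ^ n' :: nat)"
    by (rule cellfun_mult(2)) (use div_less in \<open>auto intro: dquot_L2\<close>)
  also have "\<dots> = (\<Sum>k<2 ^ n * r. (\<integral>x. incr n' k x * dquot n (k div r) x \<partial>M))"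
    unfolding r by (simp add: sum_divide_distrib dquot_def[of n'] mult.assoc)
  also have "\<dots> = (\<Sum>j<2 ^ n. \<Sum>k=j * r..<j * r + r. (\<integral>x. incr n' k x * dquot n (k div r) x \<partial>M))"
    by (rule sum.nat_group[symmetric])
  also have "\<dots> = (\<Sum>j<2 ^ n. (\<integral>x. incr n j x * dquot n j x \<partial>M))"
  proof (rule sum.cong[OF refl])
    fix j :: nat assume "j \<in> {..<2 ^ n}"
    then have j: "j < 2 ^ n" by simp
    have less: "j * r + i < 2 ^ n'" if "i < r" for i
    proof -
      have "j * r + i < Suc j * r" using that by simp
      also have "\<dots> \<le> 2 ^ n * r" using j by (intro mult_right_mono) auto
      finally show ?thesis using r by simp
    qed
    have "(\<Sum>k=j * r..<j * r + r. (\<integral>x. incr n' k x * dquot n (k div r) x \<partial>M))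
       = (\<Sum>i<r. (\<integral>x. incr n' (j * r + i) x * dquot n j x \<partial>M))"
    proof -
      have "(\<Sum>k=j * r..<j * r + r. (\<integral>x. incr n' k x * dquot n (k div r) x \<partial>M))
        = (\<Sum>i<r. (\<integral>x. incr n' (j * r + i) x * dquot n ((j * r + i) div r) x \<partial>M))"
        by (rule sum.reindex_bij_witness[of _ "\<lambda>i. j * r + i" "\<lambda>k. k - j * r"]) auto
      then show ?thesis using r(1) by simp
    qed
    also have "\<dots> = (\<integral>x. (\<Sum>i<r. incr n' (j * r + i) x * dquot n j x) \<partial>M)"
      by (rule Bochner_Integration.integral_sum[symmetric])
         (use less j in \<open>auto intro!: L2_mult_integrable incr_L2 dquot_L2\<close>)
    also have "\<dots> = (\<integral>x. incr n j x * dquot n j x \<partial>M)"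
      using incr_sum[OF assms, of j] by (simp add: sum_distrib_right[symmetric] r_def)
    finally show "(\<Sum>k=j * r..<j * r + r. (\<integral>x. incr n' k x * dquot n (k div r) x \<partial>M)) = (\<integral>x. incr n j x * dquot n j x \<partial>M)" .
  qed
  also have "\<dots> = (\<Sum>j<2 ^ n. (\<integral>x. dquot n j x * dquot n j x \<partial>M)) / (2 ^ n :: nat)"
    by (simp add: sum_divide_distrib dquot_def mult.assoc)
  also have "\<dots> = (\<integral>z. dq n z * dq n z \<partial>(T \<Otimes>\<^sub>M M))"
    unfolding dq_def by (rule cellfun_mult(2)[symmetric]) (auto intro: dquot_L2)
  finally show ?thesis by (simp add: power2_eq_square)
qed

lemma dq_bounded: "(\<integral>z. (dq n z)\<^sup>2 \<partial>(T \<Otimes>\<^sub>M M)) \<le> K\<^sup>2"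
proof -
  have "(\<integral>x. dquot n k x * dquot n k x \<partial>M) \<le> K\<^sup>2" if "k < 2 ^ n" for k
  proof -
    have "L2_norm M (incr n k) \<le> K * \<bar>(t0 + Suc k / 2 ^ n) - (t0 + k / 2 ^ n)\<bar>"
      unfolding incr_def using that dyadic_in[of k n] dyadic_in[of "Suc k" n] by (intro X_Lipschitz) auto
    also have "(t0 + Suc k / 2 ^ n) - (t0 + k / 2 ^ n) = 1 / 2 ^ n" by (simp add: field_simps)
    finally have "2 ^ n * L2_norm M (incr n k) \<le> K" by (simp add: field_simps)
    then have "(2 ^ n * L2_norm M (incr n k))\<^sup>2 \<le> K\<^sup>2" by (intro power_mono) auto
    moreover have "(\<integral>x. dquot n k x * dquot n k x \<partial>M) = (2 ^ n)\<^sup>2 * (\<integral>x. (incr n k x)\<^sup>2 \<partial>M)"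
      by (subst integral_mult_right_zero[symmetric]) (simp add: dquot_def power2_eq_square mult_ac)
    ultimately show ?thesis by (simp add: L2_norm_power2 power_mult_distrib)
  qed
  then have "(\<Sum>k<2 ^ n. (\<integral>x. dquot n k x * dquot n k x \<partial>M)) \<le> (\<Sum>k<(2 ^ n :: nat). K\<^sup>2)"
    by (intro sum_mono) auto
  then have "(\<Sum>k<2 ^ n. (\<integral>x. dquot n k x * dquot n k x \<partial>M)) / (2 ^ n :: nat) \<le> K\<^sup>2"
    by (simp add: divide_le_eq mult.commute)
  moreover have "(\<integral>z. dq n z * dq n z \<partial>(T \<Otimes>\<^sub>M M)) = (\<Sum>k<2 ^ n. (\<integral>x. dquot n k x * dquot n k x \<partial>M)) / (2 ^ n :: nat)"
    unfolding dq_def by (rule cellfun_mult(2)) (auto intro: dquot_L2)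
  ultimately show ?thesis by (simp add: power2_eq_square)
qed

lemma dq_diff:
  assumes "n \<le> n'"
  shows "(\<integral>z. (dq n' z - dq n z)\<^sup>2 \<partial>(T \<Otimes>\<^sub>M M)) = (\<integral>z. (dq n' z)\<^sup>2 \<partial>(T \<Otimes>\<^sub>M M)) - (\<integral>z. (dq n z)\<^sup>2 \<partial>(T \<Otimes>\<^sub>M M))"
proof -
  have "(\<integral>z. (dq n' z - dq n z)\<^sup>2 \<partial>(T \<Otimes>\<^sub>M M)) = (\<integral>z. (dq n' z)\<^sup>2 - 2 * (dq n' z * dq n z) + (dq n z)\<^sup>2 \<partial>(T \<Otimes>\<^sub>M M))"
    by (rule Bochner_Integration.integral_cong) (auto simp: power2_eq_square algebra_simps)
  also have "\<dots> = (\<integral>z. (dq n' z)\<^sup>2 \<partial>(T \<Otimes>\<^sub>M M)) - 2 * (\<integral>z. dq n' z * dq n z \<partial>(T \<Otimes>\<^sub>M M)) + (\<integral>z. (dq n z)\<^sup>2 \<partial>(T \<Otimes>\<^sub>M M))"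
    using L2D(2)[OF dq_L2[of n']] L2D(2)[OF dq_L2[of n]] L2_mult_integrable[OF dq_L2[of n'] dq_L2[of n]] by simp
  finally show ?thesis by (simp add: dq_orthogonal[OF assms])
qed

lemma dq_limit:
  obtains g where "g \<in> L2 (T \<Otimes>\<^sub>M M)" "(\<lambda>n. L2_norm (T \<Otimes>\<^sub>M M) (\<lambda>z. dq n z - g z)) \<longlonglongrightarrow> 0"
proof -
  let ?A = "\<lambda>n. \<integral>z. (dq n z)\<^sup>2 \<partial>(T \<Otimes>\<^sub>M M)"
  have "?A n \<le> ?A n'" if "n \<le> n'" for n n'
  proof -
    have "0 \<le> (\<integral>z. (dq n' z - dq n z)\<^sup>2 \<partial>(T \<Otimes>\<^sub>M M))" by simp
    then show ?thesis unfolding dq_diff[OF that] by simp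
  qed
  then have "incseq ?A" by (simp add: incseq_def)
  then have "convergent ?A" using dq_bounded by (intro Bseq_mono_convergent BseqI'[of _ "K\<^sup>2"]) (auto simp: incseq_def)
  then have C: "Cauchy ?A" by (rule convergent_Cauchy)
  have "\<exists>N. \<forall>n'\<ge>N. \<forall>n\<ge>N. (\<integral>z. (dq n' z - dq n z)\<^sup>2 \<partial>(T \<Otimes>\<^sub>M M)) < e" if "e > 0" for e
  proof -
    obtain N where N: "\<And>m n. m \<ge> N \<Longrightarrow> n \<ge> N \<Longrightarrow> \<bar>?A m - ?A n\<bar> < e"
      using C \<open>e > 0\<close> unfolding Cauchy_def dist_real_def by blast
    have "(\<integral>z. (dq n' z - dq n z)\<^sup>2 \<partial>(T \<Otimes>\<^sub>M M)) < e" if "n' \<ge> N" "n \<ge> N" for n n'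
    proof (cases "n \<le> n'")
      case True
      then show ?thesis using N[OF that] unfolding dq_diff[OF True] by simp
    next
      case False
      then have le: "n' \<le> n" by simp
      have "(\<integral>z. (dq n' z - dq n z)\<^sup>2 \<partial>(T \<Otimes>\<^sub>M M)) = (\<integral>z. (dq n z - dq n' z)\<^sup>2 \<partial>(T \<Otimes>\<^sub>M M))"
        by (simp add: power2_commute)
      then show ?thesis using N[OF that] unfolding dq_diff[OF le] by simp
    qed
    then show ?thesis by blast
  qed
  from L2_complete[OF finite_P dq_L2 this] show thesis using that by blast
qed

text \<open>At a dyadic time \<open>s n\<close> the pairing of the \<open>n\<close>-th difference quotient telescopes to an increment of the
  curve. The times \<open>s n\<close> approach \<open>t\<close> from below.\<close>

lemma limit_pairing:
  assumes g: "g \<in> L2 (T \<Otimes>\<^sub>M M)" and lim: "(\<lambda>n. L2_norm (T \<Otimes>\<^sub>M M) (\<lambda>z. dq n z - g z)) \<longlonglongrightarrow> 0"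
    and \<psi>: "\<psi> \<in> L2 M" and t: "t \<in> {t0..t0 + 1}"
  shows "(\<integral>z. indicator {..<t} (fst z) * (g z * \<psi> (snd z)) \<partial>(T \<Otimes>\<^sub>M M)) = (\<integral>x. (X t x - X t0 x) * \<psi> x \<partial>M)"
proof -
  let ?P = "T \<Otimes>\<^sub>M M"
  define k where "k n = nat \<lfloor>2 ^ n * (t - t0)\<rfloor>" for n :: nat
  define s where "s n = t0 + k n / 2 ^ n" for n
  have k: "real (k n) \<le> 2 ^ n * (t - t0)" "2 ^ n * (t - t0) < real (k n) + 1" for n
  proof -
    have "real (nat \<lfloor>y\<rfloor>) \<le> y \<and> y < real (nat \<lfloor>y\<rfloor>) + 1" if "0 \<le> y" for y :: real using that by linarith
    then show "real (k n) \<le> 2 ^ n * (t - t0)" "2 ^ n * (t - t0) < real (k n) + 1" using t by (auto simp: k_def)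
  qed
  have k_le: "k n \<le> 2 ^ n" for n
  proof -
    have "real (k n) \<le> 2 ^ n * (t - t0)" by (rule k)
    also have "\<dots> \<le> 2 ^ n * 1" using t by (intro mult_left_mono) auto
    finally have "real (k n) \<le> real (2 ^ n)" by simp
    then show ?thesis by (simp only: of_nat_le_iff)
  qed
  have s: "s n \<le> t" "t - s n \<le> 1 / 2 ^ n" "s n \<in> {t0..t0 + 1}" for n
  proof -
    show "s n \<le> t" using k(1)[of n] by (simp add: s_def field_simps)
    have "t - t0 < (real (k n) + 1) / 2 ^ n" using k(2)[of n] by (simp add: pos_less_divide_eq mult.commute)
    then show "t - s n \<le> 1 / 2 ^ n" by (simp add: s_def add_divide_distrib)
    show "s n \<in> {t0..t0 + 1}" unfolding s_def by (rule dyadic_in[OF k_le])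
  qed
  have "(\<lambda>n. (1 / 2) ^ n :: real) \<longlonglongrightarrow> 0" by (rule LIMSEQ_power_zero) simp
  then have pow: "(\<lambda>n. 1 / 2 ^ n :: real) \<longlonglongrightarrow> 0" by (simp add: power_one_over)
  have s_lim: "s \<longlonglongrightarrow> t"
  proof (rule LIM_zero_cancel, rule Lim_null_comparison[OF _ pow])
    show "\<forall>\<^sub>F n in sequentially. norm (s n - t) \<le> 1 / 2 ^ n"
      using s by (auto simp: abs_le_iff)
  qed
  define v where "v n j x = (if j < k n then \<psi> x else 0)" for n j x
  have v_L2: "v n j \<in> L2 M" for n j
  proof -
    have "(\<lambda>x. 0) \<in> L2 M" using L2_scale[OF \<psi>, of 0] by simp
    then show ?thesis unfolding v_def using \<psi> by (cases "j < k n") simp_all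
  qed
  define h where "h n = cellfun (2 ^ n) (v n)" for n
  have h_eq: "h n z = indicator {..<s n} (fst z) * \<psi> (snd z)" if "z \<in> space ?P" for n z
  proof -
    obtain r x where z: "z = (r, x)" by (cases z)
    have r: "r \<in> {t0..<t0 + 1}" using space_P[OF that] z by simp
    have "nat \<lfloor>2 ^ n * (r - t0)\<rfloor> < k n \<longleftrightarrow> 2 ^ n * (r - t0) < k n"
      using r by (auto simp: nat_less_iff floor_less_iff)
    also have "\<dots> \<longleftrightarrow> r < s n" by (auto simp: s_def field_simps)
    finally show ?thesis using cellfun_eq[OF r, of "2 ^ n" "v n" x] by (simp add: h_def v_def z)
  qed
  have h_L2: "h n \<in> L2 ?P" for n unfolding h_def by (intro cellfun_L2 v_L2) simp
  define \<Psi> where "\<Psi> = cellfun 1 (\<lambda>_. \<psi>)"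
  have \<Psi>_L2: "\<Psi> \<in> L2 ?P" unfolding \<Psi>_def by (intro cellfun_L2 \<psi>) simp
  have \<Psi>_eq: "\<Psi> z = \<psi> (snd z)" if "z \<in> space ?P" for z
    using cellfun_eq[of "fst z" 1 "\<lambda>_. \<psi>" "snd z"] space_P[OF that] by (simp add: \<Psi>_def)
  have h_norm: "L2_norm ?P (h n) \<le> L2_norm ?P \<Psi>" for n
    unfolding L2_norm_def
  proof (intro real_sqrt_le_mono integral_mono L2D(2)[OF h_L2] L2D(2)[OF \<Psi>_L2])
    fix z assume "z \<in> space ?P"
    then show "(h n z)\<^sup>2 \<le> (\<Psi> z)\<^sup>2" by (simp add: h_eq \<Psi>_eq split: split_indicator)
  qed
  have pair: "(\<integral>z. dq n z * h n z \<partial>?P) = (\<integral>x. (X (s n) x - X t0 x) * \<psi> x \<partial>M)" for n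
  proof -
    have "(\<integral>z. dq n z * h n z \<partial>?P) = (\<Sum>j<2 ^ n. (\<integral>x. dquot n j x * v n j x \<partial>M)) / (2 ^ n :: nat)"
      unfolding dq_def h_def by (rule cellfun_mult(2)) (auto intro: dquot_L2 v_L2)
    also have "\<dots> = (\<Sum>j<2 ^ n. (\<integral>x. incr n j x * v n j x \<partial>M))"
      by (simp add: sum_divide_distrib dquot_def mult.assoc)
    also have "\<dots> = (\<Sum>j<2 ^ n. if j < k n then (\<integral>x. incr n j x * \<psi> x \<partial>M) else 0)"
      by (intro sum.cong refl) (simp add: v_def)
    also have "\<dots> = (\<Sum>j<k n. (\<integral>x. incr n j x * \<psi> x \<partial>M))"
      by (rule sum.mono_neutral_cong_right) (use k_le[of n] in auto)
    also have "\<dots> = (\<integral>x. (\<Sum>j<k n. incr n j x * \<psi> x) \<partial>M)"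
      by (rule Bochner_Integration.integral_sum[symmetric])
         (use k_le[of n] \<psi> in \<open>auto intro!: L2_mult_integrable incr_L2\<close>)
    also have "(\<lambda>x. \<Sum>j<k n. incr n j x * \<psi> x) = (\<lambda>x. (X (s n) x - X t0 x) * \<psi> x)"
    proof
      fix x
      have "(\<Sum>j<k n. incr n j x) = X (s n) x - X t0 x"
        using sum_lessThan_telescope[of "\<lambda>j. X (t0 + real j / 2 ^ n) x" "k n"] by (simp add: incr_def s_def)
      then show "(\<Sum>j<k n. incr n j x * \<psi> x) = (X (s n) x - X t0 x) * \<psi> x"
        by (simp add: sum_distrib_right[symmetric])
    qed
    finally show ?thesis .
  qed
  have lim1: "(\<lambda>n. \<integral>z. dq n z * h n z \<partial>?P) \<longlonglongrightarrow> (\<integral>x. (X t x - X t0 x) * \<psi> x \<partial>M)"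
    unfolding pair
  proof (rule LIM_zero_cancel, rule Lim_null_comparison)
    have "norm ((\<integral>x. (X (s n) x - X t0 x) * \<psi> x \<partial>M) - (\<integral>x. (X t x - X t0 x) * \<psi> x \<partial>M)) \<le> \<bar>s n - t\<bar> * (\<bar>K\<bar> * L2_norm M \<psi>)" for n
    proof -
      have t0: "t0 \<in> {t0..t0 + 1}" by simp
      have "(\<integral>x. (X (s n) x - X t0 x) * \<psi> x \<partial>M) - (\<integral>x. (X t x - X t0 x) * \<psi> x \<partial>M)
        = (\<integral>x. (X (s n) x - X t0 x) * \<psi> x - (X t x - X t0 x) * \<psi> x \<partial>M)"
        by (rule Bochner_Integration.integral_diff[symmetric])
           (intro L2_mult_integrable L2_diff X_L2 s t t0 \<psi>)+
      also have "\<dots> = (\<integral>x. (X (s n) x - X t x) * \<psi> x \<partial>M)"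
        by (rule Bochner_Integration.integral_cong) (auto simp: algebra_simps)
      also have "norm \<dots> \<le> L2_norm M (\<lambda>x. X (s n) x - X t x) * L2_norm M \<psi>"
        using L2_Cauchy_Schwarz[OF L2_diff[OF X_L2[OF s(3)] X_L2[OF t]] \<psi>] by simp
      also have "\<dots> \<le> (K * \<bar>s n - t\<bar>) * L2_norm M \<psi>"
        by (intro mult_right_mono X_Lipschitz s t) simp
      also have "\<dots> \<le> (\<bar>K\<bar> * \<bar>s n - t\<bar>) * L2_norm M \<psi>"
        by (intro mult_right_mono) auto
      finally show ?thesis by (simp add: mult_ac)
    qed
    then show "\<forall>\<^sub>F n in sequentially. norm ((\<integral>x. (X (s n) x - X t0 x) * \<psi> x \<partial>M) - (\<integral>x. (X t x - X t0 x) * \<psi> x \<partial>M)) \<le> \<bar>s n - t\<bar> * (\<bar>K\<bar> * L2_norm M \<psi>)"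
      by simp
    have "(\<lambda>n. \<bar>s n - t\<bar>) \<longlonglongrightarrow> 0" using s_lim by (simp add: LIM_zero tendsto_rabs_zero)
    then show "(\<lambda>n. \<bar>s n - t\<bar> * (\<bar>K\<bar> * L2_norm M \<psi>)) \<longlonglongrightarrow> 0"
      by (rule tendsto_mult_left_zero)
  qed
  have gm: "g \<in> borel_measurable ?P" using L2D(1)[OF g] .
  have "(\<lambda>n. \<integral>z. g z * h n z \<partial>?P) \<longlonglongrightarrow> (\<integral>z. indicator {..<t} (fst z) * (g z * \<psi> (snd z)) \<partial>?P)"
  proof (rule integral_dominated_convergence[where w = "\<lambda>z. \<bar>g z * \<Psi> z\<bar>"])
    show "integrable ?P (\<lambda>z. \<bar>g z * \<Psi> z\<bar>)" using L2_mult_integrable[OF g \<Psi>_L2] by simp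
    show "(\<lambda>z. g z * h n z) \<in> borel_measurable ?P" for n
      using L2D(1)[OF h_L2] gm by simp
    have "(\<lambda>z. indicator {..<t} (fst z) * (g z * \<Psi> z)) \<in> borel_measurable ?P"
    proof -
      have "fst \<in> borel_measurable ?P"
        using measurable_fst[of T M] unfolding T_def by (rule measurable_compose) (simp add: measurable_restrict_space1)
      then have "(\<lambda>z. indicator {..<t} (fst z) :: real) \<in> borel_measurable ?P"
        by (rule measurable_compose) simp
      then show ?thesis using gm L2D(1)[OF \<Psi>_L2] by simp
    qed
    then show "(\<lambda>z. indicator {..<t} (fst z) * (g z * \<psi> (snd z))) \<in> borel_measurable ?P"
      by (rule measurable_cong[THEN iffD1, rotated]) (simp add: \<Psi>_eq)
    show "AE z in ?P. (\<lambda>n. g z * h n z) \<longlonglongrightarrow> indicator {..<t} (fst z) * (g z * \<psi> (snd z))"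
    proof (rule AE_I2)
      fix z assume z: "z \<in> space ?P"
      have "\<forall>\<^sub>F n in sequentially. (indicator {..<s n} (fst z) :: real) = indicator {..<t} (fst z)"
      proof (cases "fst z < t")
        case True
        then have "\<forall>\<^sub>F n in sequentially. fst z < s n" using s_lim by (intro order_tendstoD(1))
        then show ?thesis using True by (auto elim!: eventually_mono)
      next
        case False
        then have "\<not> fst z < s n" for n using s(1)[of n] by simp
        then show ?thesis using False by simp
      qed
      then have "\<forall>\<^sub>F n in sequentially. g z * h n z = indicator {..<t} (fst z) * (g z * \<psi> (snd z))"
        using z by (auto simp: h_eq elim!: eventually_mono)
      then show "(\<lambda>n. g z * h n z) \<longlonglongrightarrow> indicator {..<t} (fst z) * (g z * \<psi> (snd z))"
        by (rule tendsto_eventually)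
    qed
    show "AE z in ?P. norm (g z * h n z) \<le> \<bar>g z * \<Psi> z\<bar>" for n
      by (rule AE_I2) (auto simp: h_eq \<Psi>_eq abs_mult split: split_indicator)
  qed
  moreover have "(\<lambda>n. (\<integral>z. dq n z * h n z \<partial>?P) - (\<integral>z. g z * h n z \<partial>?P)) \<longlonglongrightarrow> 0"
  proof (rule Lim_null_comparison)
    have "norm ((\<integral>z. dq n z * h n z \<partial>?P) - (\<integral>z. g z * h n z \<partial>?P)) \<le> L2_norm ?P (\<lambda>z. dq n z - g z) * L2_norm ?P \<Psi>" for n
    proof -
      have "(\<integral>z. dq n z * h n z \<partial>?P) - (\<integral>z. g z * h n z \<partial>?P) = (\<integral>z. dq n z * h n z - g z * h n z \<partial>?P)"
        by (rule Bochner_Integration.integral_diff[symmetric]) (intro L2_mult_integrable dq_L2 g h_L2)+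
      also have "\<dots> = (\<integral>z. (dq n z - g z) * h n z \<partial>?P)" by (simp add: left_diff_distrib)
      also have "norm \<dots> \<le> L2_norm ?P (\<lambda>z. dq n z - g z) * L2_norm ?P (h n)"
        using L2_Cauchy_Schwarz[OF L2_diff[OF dq_L2 g] h_L2] by simp
      also have "\<dots> \<le> L2_norm ?P (\<lambda>z. dq n z - g z) * L2_norm ?P \<Psi>"
        using h_norm by (intro mult_left_mono) auto
      finally show ?thesis .
    qed
    then show "\<forall>\<^sub>F n in sequentially. norm ((\<integral>z. dq n z * h n z \<partial>?P) - (\<integral>z. g z * h n z \<partial>?P)) \<le> L2_norm ?P (\<lambda>z. dq n z - g z) * L2_norm ?P \<Psi>"
      by simp
    show "(\<lambda>n. L2_norm ?P (\<lambda>z. dq n z - g z) * L2_norm ?P \<Psi>) \<longlonglongrightarrow> 0"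
      using lim by (rule tendsto_mult_left_zero)
  qed
  ultimately have "(\<lambda>n. ((\<integral>z. dq n z * h n z \<partial>?P) - (\<integral>z. g z * h n z \<partial>?P)) + (\<integral>z. g z * h n z \<partial>?P))
      \<longlonglongrightarrow> 0 + (\<integral>z. indicator {..<t} (fst z) * (g z * \<psi> (snd z)) \<partial>?P)"
    by (intro tendsto_add)
  then have "(\<lambda>n. \<integral>z. dq n z * h n z \<partial>?P) \<longlonglongrightarrow> (\<integral>z. indicator {..<t} (fst z) * (g z * \<psi> (snd z)) \<partial>?P)" by simp
  from LIMSEQ_unique[OF this lim1] show ?thesis .
qed

lemma derivative_on_unit_interval:
  "\<exists>D. (\<forall>t\<in>{t0..<t0 + 1}. D t \<in> L2 M) \<and> set_integrable lborel {t0..<t0 + 1} (\<lambda>t. L2_norm M (D t)) \<and>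
     (\<forall>\<psi>\<in>L2 M. set_integrable lborel {t0..<t0 + 1} (\<lambda>t. \<integral>x. D t x * \<psi> x \<partial>M) \<and>
       (\<forall>t\<in>{t0..t0 + 1}. (LINT r:{t0..<t}|lborel. \<integral>x. D r x * \<psi> x \<partial>M) = (\<integral>x. (X t x - X t0 x) * \<psi> x \<partial>M)))"
proof -
  let ?P = "T \<Otimes>\<^sub>M M"
  obtain g where g: "g \<in> L2 ?P" and lim: "(\<lambda>n. L2_norm ?P (\<lambda>z. dq n z - g z)) \<longlonglongrightarrow> 0"
    using dq_limit by blast
  have gm [measurable]: "g \<in> borel_measurable ?P" using L2D(1)[OF g] .
  have sec: "(\<lambda>x. g (t, x)) \<in> borel_measurable M" if "t \<in> {t0..<t0 + 1}" for t
    using measurable_Pair2[OF gm, of t] that by (simp add: space_T)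
  \<comment> \<open>Only almost every time section of the limit is square integrable; the others are replaced by zero.\<close>
  define good where "good t \<longleftrightarrow> integrable M (\<lambda>x. (g (t, x))\<^sup>2)" for t
  have good_pred [measurable]: "Measurable.pred T good"
    unfolding good_def[abs_def] by measurable
  have AE_good: "AE t in T. good t"
    using P.AE_integrable_fst'[OF L2D(2)[OF g]] by (simp add: good_def)
  define D where "D t x = (if good t then g (t, x) else 0)" for t x
  have D_L2: "D t \<in> L2 M" if "t \<in> {t0..<t0 + 1}" for t
    using sec[OF that] by (cases "good t") (auto simp: D_def[abs_def] good_def L2_def)
  have set_T: "set_integrable lborel {t0..<t0 + 1} d \<longleftrightarrow> integrable T d" for d :: "real \<Rightarrow> real"
    unfolding T_def set_integrable_def by (subst integrable_restrict_space) auto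
  have "integrable T (\<lambda>t. L2_norm M (D t))"
  proof (rule Bochner_Integration.integrable_bound)
    have i: "integrable T (\<lambda>t. \<integral>x. (g (t, x))\<^sup>2 \<partial>M)" using P.integrable_fst'[OF L2D(2)[OF g]] .
    then show "integrable T (\<lambda>t. 1 + (\<integral>x. (g (t, x))\<^sup>2 \<partial>M))" by simp
    have eq: "L2_norm M (D t) = sqrt (\<integral>x. (g (t, x))\<^sup>2 \<partial>M)" for t
      by (cases "good t") (auto simp: L2_norm_def D_def good_def not_integrable_integral_eq)
    show "(\<lambda>t. L2_norm M (D t)) \<in> borel_measurable T" unfolding eq using borel_measurable_integrable[OF i] by simp
    have "sqrt y \<le> 1 + y" if "y \<ge> 0" for y
      using that by (intro real_le_lsqrt) (auto simp: power2_eq_square algebra_simps)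
    then show "AE t in T. norm (L2_norm M (D t)) \<le> norm (1 + (\<integral>x. (g (t, x))\<^sup>2 \<partial>M))"
      unfolding eq by (intro AE_I2) simp
  qed
  moreover have "integrable T (\<lambda>t. \<integral>x. D t x * \<psi> x \<partial>M) \<and>
      (\<forall>t\<in>{t0..t0 + 1}. (LINT r:{t0..<t}|lborel. \<integral>x. D r x * \<psi> x \<partial>M) = (\<integral>x. (X t x - X t0 x) * \<psi> x \<partial>M))"
    if \<psi>: "\<psi> \<in> L2 M" for \<psi>
  proof -
    note [measurable] = L2D(1)[OF \<psi>]
    define \<Psi> where "\<Psi> = cellfun 1 (\<lambda>_. \<psi>)"
    have \<Psi>_L2: "\<Psi> \<in> L2 ?P" unfolding \<Psi>_def by (intro cellfun_L2 \<psi>) simp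
    have \<Psi>_eq: "\<Psi> z = \<psi> (snd z)" if "z \<in> space ?P" for z
      using cellfun_eq[of "fst z" 1 "\<lambda>_. \<psi>" "snd z"] space_P[OF that] by (simp add: \<Psi>_def)
    have ip: "integrable ?P (\<lambda>z. g z * \<psi> (snd z))"
      using L2_mult_integrable[OF g \<Psi>_L2] by (rule Bochner_Integration.integrable_cong[THEN iffD1, rotated 2]) (simp_all add: \<Psi>_eq)
    define e where "e t = (\<integral>x. g (t, x) * \<psi> x \<partial>M)" for t
    have ie: "integrable T e" using P.integrable_fst'[OF ip] by (simp add: e_def[abs_def])
    have d_eq: "(\<integral>x. D t x * \<psi> x \<partial>M) = (if good t then e t else 0)" for t by (simp add: D_def e_def)
    have dm: "(\<lambda>t. \<integral>x. D t x * \<psi> x \<partial>M) \<in> borel_measurable T"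
      unfolding d_eq using borel_measurable_integrable[OF ie] by measurable
    have AE_eq: "AE t in T. (\<integral>x. D t x * \<psi> x \<partial>M) = e t"
      using AE_good by eventually_elim (simp add: d_eq)
    have id: "integrable T (\<lambda>t. \<integral>x. D t x * \<psi> x \<partial>M)"
      using ie by (subst integrable_cong_AE[OF dm borel_measurable_integrable[OF ie] AE_eq])
    have "(LINT r:{t0..<t}|lborel. \<integral>x. D r x * \<psi> x \<partial>M) = (\<integral>x. (X t x - X t0 x) * \<psi> x \<partial>M)"
      if t: "t \<in> {t0..t0 + 1}" for t
    proof -
      have tm: "(\<lambda>r. indicator {..<t} r :: real) \<in> borel_measurable T"
        unfolding T_def by (rule measurable_restrict_space1) simp
      have "(LINT r:{t0..<t}|lborel. \<integral>x. D r x * \<psi> x \<partial>M) =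
          (LINT r|lborel. indicator {t0..<t0 + 1} r *\<^sub>R (indicator {..<t} r * (\<integral>x. D r x * \<psi> x \<partial>M)))"
        unfolding set_lebesgue_integral_def using t
        by (intro Bochner_Integration.integral_cong) (auto split: split_indicator)
      also have "\<dots> = (\<integral>r. indicator {..<t} r * (\<integral>x. D r x * \<psi> x \<partial>M) \<partial>T)"
        unfolding T_def by (subst integral_restrict_space) auto
      also have "\<dots> = (\<integral>r. indicator {..<t} r * e r \<partial>T)"
        by (rule integral_cong_AE)
           (use dm tm borel_measurable_integrable[OF ie] AE_eq in \<open>auto elim!: eventually_mono\<close>)
      also have "\<dots> = (\<integral>r. (\<integral>x. indicator {..<t} r * (g (r, x) * \<psi> x) \<partial>M) \<partial>T)" by (simp add: e_def)
      also have "\<dots> = (\<integral>z. indicator {..<t} (fst z) * (g z * \<psi> (snd z)) \<partial>?P)"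
      proof -
        have m: "(\<lambda>z. indicator {..<t} (fst z) :: real) \<in> borel_measurable ?P"
          by (rule measurable_compose[OF measurable_fst[of T M] tm])
        have "integrable ?P (\<lambda>z. indicator {..<t} (fst z) * (g z * \<psi> (snd z)))"
          by (rule Bochner_Integration.integrable_bound[OF ip])
             (use m borel_measurable_integrable[OF ip] in \<open>auto split: split_indicator\<close>)
        from P.integral_fst'[OF this] show ?thesis by simp
      qed
      also have "\<dots> = (\<integral>x. (X t x - X t0 x) * \<psi> x \<partial>M)" by (rule limit_pairing[OF g lim \<psi> t])
      finally show ?thesis .
    qed
    with id show ?thesis by blast
  qed
  ultimately show ?thesis using D_L2 unfolding set_T by (intro exI[of _ D]) blast
qed

end

text \<open>The derivatives on the intervals \<open>[j, j + 1[\<close> are glued together. Paired with a fixed function, the curve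
  has a scalar antiderivative, for which integration by parts against test functions is available.\<close>

lemma Lipschitz_curve_weak_derivative:
  assumes fin: "finite_measure M" and X: "\<And>t. t \<ge> 0 \<Longrightarrow> X t \<in> L2 M"
    and Lip: "\<And>s t. s \<ge> 0 \<Longrightarrow> t \<ge> 0 \<Longrightarrow> L2_norm M (\<lambda>x. X t x - X s x) \<le> K * \<bar>t - s\<bar>"
  shows "\<exists>D. is_weak_L2_deriv M {0<..} X D"
proof -
  interpret finite_measure M by fact
  define unit_deriv where "unit_deriv j D \<longleftrightarrow> (\<forall>t\<in>{real j..<real j + 1}. D t \<in> L2 M) \<and>
     set_integrable lborel {real j..<real j + 1} (\<lambda>t. L2_norm M (D t)) \<and>
     (\<forall>\<psi>\<in>L2 M. set_integrable lborel {real j..<real j + 1} (\<lambda>t. \<integral>x. D t x * \<psi> x \<partial>M) \<and>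
       (\<forall>t\<in>{real j..real j + 1}. (LINT r:{real j..<t}|lborel. \<integral>x. D r x * \<psi> x \<partial>M) =
         (\<integral>x. (X t x - X (real j) x) * \<psi> x \<partial>M)))" for j :: nat and D :: "real \<Rightarrow> 'a \<Rightarrow> real"
  have "\<exists>D. unit_deriv j D" for j :: nat
  proof -
    interpret Lipschitz_curve M "real j" X K
      by unfold_locales (use X Lip in auto)
    show ?thesis unfolding unit_deriv_def by (rule derivative_on_unit_interval)
  qed
  then obtain E where E: "\<And>j. unit_deriv j (E j)" by metis
  define D where "D t = E (nat \<lfloor>t\<rfloor>) t" for t
  have D_eq: "D t = E j t" if "t \<in> {real j..<real j + 1}" for j t
  proof -
    have "\<lfloor>t\<rfloor> = int j" using that by (simp add: floor_eq_iff)
    then show ?thesis by (simp add: D_def)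
  qed
  have D: "unit_deriv j D" for j
  proof -
    have i: "set_integrable lborel {real j..<real j + 1} (\<lambda>t. F (D t)) \<longleftrightarrow> set_integrable lborel {real j..<real j + 1} (\<lambda>t. F (E j t))"
      for F :: "('a \<Rightarrow> real) \<Rightarrow> real"
      by (rule set_integrable_cong) (auto simp: D_eq)
    have l: "(LINT r:{real j..<t}|lborel. F (D r)) = (LINT r:{real j..<t}|lborel. F (E j r))" if "t \<in> {real j..real j + 1}"
      for F :: "('a \<Rightarrow> real) \<Rightarrow> real" and t
    proof (rule set_lebesgue_integral_cong)
      show "\<forall>r. r \<in> {real j..<t} \<longrightarrow> F (D r) = F (E j r)" using that D_eq[of _ j] by auto
    qed simp
    show ?thesis
      using E[of j] D_eq[of _ j] unfolding unit_deriv_def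
      by (simp add: i[of "L2_norm M"] i[of "\<lambda>u. \<integral>x. u x * _ x \<partial>M"] l[of _ "\<lambda>u. \<integral>x. u x * _ x \<partial>M"])
  qed
  have D_L2: "D t \<in> L2 M" if "t \<ge> 0" for t
  proof -
    have "t \<in> {real (nat \<lfloor>t\<rfloor>)..<real (nat \<lfloor>t\<rfloor>) + 1}" using that by (auto; linarith)
    then show ?thesis using D[of "nat \<lfloor>t\<rfloor>"] by (auto simp: unit_deriv_def)
  qed
  have Suc_Un: "{0..<real (Suc n)} = {0..<real n} \<union> {real n..<real n + 1}" for n by auto
  have chain: "set_integrable lborel {0..<real n} d"
    if "\<And>j. set_integrable lborel {real j..<real j + 1} d" for n and d :: "real \<Rightarrow> real"
  proof (induction n)
    case (Suc n)
    show ?case unfolding Suc_Un by (rule set_integrable_Un) (use Suc that in auto)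
  qed simp
  have loc: "locally_integrable {0<..} d"
    if d: "\<And>j. set_integrable lborel {real j..<real j + 1} d" for d :: "real \<Rightarrow> real"
    unfolding locally_integrable_def
  proof (intro allI impI)
    fix K :: "real set" assume K: "compact K \<and> K \<subseteq> {0<..}"
    then obtain R where R: "\<And>x. x \<in> K \<Longrightarrow> \<bar>x\<bar> \<le> R"
      using compact_imp_bounded[of K] unfolding bounded_iff by auto
    obtain n :: nat where n: "R < n" using reals_Archimedean2 by blast
    have "K \<subseteq> {0..<real n}"
    proof
      fix x assume "x \<in> K"
      then show "x \<in> {0..<real n}" using R[of x] n K by (auto simp: subset_eq abs_le_iff intro: less_imp_le)
    qed
    then show "set_integrable lborel K d"
      using K by (intro set_integrable_subset[OF chain[OF d]]) (auto intro: borel_compact)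
  qed
  have X_norm_cont: "continuous_on {0<..} (\<lambda>t. L2_norm M (X t))"
  proof (rule continuous_on_subset[of "{0..}"])
    have "\<bar>L2_norm M (X t) - L2_norm M (X s)\<bar> \<le> K * \<bar>t - s\<bar>" if "s \<ge> 0" "t \<ge> 0" for s t
      using L2_norm_triangle[OF X[OF that(1)] X[OF that(2)]] L2_norm_triangle[OF X[OF that(2)] X[OF that(1)]]
        Lip[OF that] Lip[OF that(2,1)] by (simp add: abs_minus_commute)
    then have "\<bar>K\<bar>-lipschitz_on {0..} (\<lambda>t. L2_norm M (X t))"
      by (intro lipschitz_onI)
         (force simp: dist_real_def abs_minus_commute intro: order_trans[OF _ mult_right_mono[of K "\<bar>K\<bar>"]])+
    then show "continuous_on {0..} (\<lambda>t. L2_norm M (X t))" by (rule lipschitz_on_continuous_on)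
  qed auto
  have "is_weak_deriv {0<..} (\<lambda>t. \<integral>x. X t x * \<psi> x \<partial>M) (\<lambda>t. \<integral>x. D t x * \<psi> x \<partial>M)"
    if \<psi>: "\<psi> \<in> L2 M" for \<psi>
  proof -
    define c d where "c t = (\<integral>x. X t x * \<psi> x \<partial>M)" and "d t = (\<integral>x. D t x * \<psi> x \<partial>M)" for t
    have d: "set_integrable lborel {real j..<real j + 1} d"
      and cd: "t \<in> {real j..real j + 1} \<Longrightarrow> (LINT r:{real j..<t}|lborel. d r) = c t - c (real j)" for j t
    proof -
      show "set_integrable lborel {real j..<real j + 1} d"
        using D[of j] \<psi> by (simp add: unit_deriv_def d_def[abs_def])
      assume t: "t \<in> {real j..real j + 1}"
      then have "(LINT r:{real j..<t}|lborel. d r) = (\<integral>x. (X t x - X (real j) x) * \<psi> x \<partial>M)"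
        using D[of j] \<psi> unfolding unit_deriv_def d_def by blast
      also have "\<dots> = c t - c (real j)"
        unfolding left_diff_distrib c_def using t
        by (intro Bochner_Integration.integral_diff L2_mult_integrable X \<psi>) auto
      finally show "(LINT r:{real j..<t}|lborel. d r) = c t - c (real j)" .
    qed
    have from_0: "(LINT r:{0..<t}|lborel. d r) = c t - c 0" if "0 \<le> t" "t \<le> real n" for n t
      using that
    proof (induction n arbitrary: t)
      case 0
      then show ?case by (simp add: set_lebesgue_integral_def)
    next
      case (Suc n)
      show ?case
      proof (cases "t \<le> real n")
        case False
        then have "{0..<t} = {0..<real n} \<union> {real n..<t}" by auto
        then have "(LINT r:{0..<t}|lborel. d r) = (LINT r:{0..<real n}|lborel. d r) + (LINT r:{real n..<t}|lborel. d r)"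
          using set_integral_Un[of "{0..<real n}" "{real n..<t}" lborel d] chain[OF d, of n]
            set_integrable_subset[OF d[of n], of "{real n..<t}"] Suc.prems by auto
        then show ?thesis using Suc.IH[of "real n"] cd[of t n] False Suc.prems by simp
      qed (use Suc in simp)
    qed
    have anti: "antiderivative_on {0<..} c d"
      unfolding antiderivative_on_def
    proof (intro allI impI conjI)
      fix x y :: real assume xy: "x \<le> y \<and> {x..y} \<subseteq> {0<..}"
      then have x0: "0 < x" by auto
      obtain n :: nat where n: "y < n" using reals_Archimedean2 by blast
      show i: "set_integrable lborel {x..y} d"
        by (rule set_integrable_subset[OF chain[OF d, of n]]) (use xy x0 n in auto)
      have "(LINT r:{0..<y}|lborel. d r) = (LINT r:{0..<x} \<union> {x..<y}|lborel. d r)"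
        using xy x0 by (intro arg_cong2[where f = "\<lambda>A. set_lebesgue_integral lborel A"]) auto
      also have "\<dots> = (LINT r:{0..<x}|lborel. d r) + (LINT r:{x..<y}|lborel. d r)"
        by (rule set_integral_Un) (use xy x0 n in \<open>auto intro!: set_integrable_subset[OF chain[OF d, of n]]\<close>)
      also have "(LINT r:{x..<y}|lborel. d r) = (LINT r:{x..y}|lborel. d r)"
      proof (rule set_integral_cong_set)
        show "AE r in lborel. (r \<in> {x..y}) = (r \<in> {x..<y})"
          using AE_lborel_singleton[of y] by eventually_elim auto
        have "set_integrable lborel {x..<y} d" by (rule set_integrable_subset[OF i]) auto
        then show "set_borel_measurable lborel {x..<y} d" "set_borel_measurable lborel {x..y} d"
          using i unfolding set_borel_measurable_def set_integrable_def by (blast intro: borel_measurable_integrable)+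
      qed
      finally show "c y - c x = (LINT r:{x..y}|lborel. d r)"
        using from_0[of y n] from_0[of x n] xy x0 n by simp
    qed
    show ?thesis
      unfolding is_weak_deriv_def c_def[symmetric] d_def[symmetric]
    proof (intro conjI ballI)
      show "locally_integrable {0<..} c" by (rule locally_integrable_antiderivative[OF anti]) simp
      show ld: "locally_integrable {0<..} d" by (rule loc[OF d])
      fix \<phi> assume \<phi>: "\<phi> \<in> test_functions {0<..}"
      then obtain C where C: "smooth \<phi>" "compact C" "C \<subseteq> {0<..}" "\<And>x. x \<notin> C \<Longrightarrow> \<phi> x = 0"
        by (auto simp: test_functions_iff)
      obtain R where R: "\<And>x. x \<in> C \<Longrightarrow> \<bar>x\<bar> \<le> R" "R > 0"
        using compact_imp_bounded[OF C(2)] unfolding bounded_pos by auto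
      have "C \<subseteq> {0<..<R + 1}"
      proof
        fix x assume "x \<in> C"
        then show "x \<in> {0<..<R + 1}" using R(1)[of x] C(3) by auto
      qed
      then have \<phi>R: "\<phi> \<in> test_functions {0<..<R + 1}" using C by (auto simp: test_functions_iff)
      have "is_weak_deriv {0<..<R + 1} c d"
      proof (rule antiderivative_is_weak_deriv)
        show "antiderivative_on {0<..<R + 1} c d" by (rule antiderivative_on_subset[OF anti]) auto
        show "locally_integrable {0<..<R + 1} d" using ld unfolding locally_integrable_def
          by (meson greaterThanLessThan_subseteq_greaterThanLessThan order_trans subset_iff greaterThanLessThan_iff greaterThan_iff)
      qed (use R in simp)
      then have "(LINT x:{0<..<R + 1}|lborel. c x * deriv \<phi> x) = - (LINT x:{0<..<R + 1}|lborel. d x * \<phi> x)"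
        using \<phi>R by (simp add: is_weak_deriv_def)
      moreover have restrict: "(LINT x:{0<..<R + 1}|lborel. u x * \<eta> x) = (LINT x:{0<..}|lborel. u x * \<eta> x)"
        if \<eta>: "\<eta> \<in> test_functions {0<..<R + 1}" for u \<eta>
      proof -
        obtain L where "L \<subseteq> {0<..<R + 1}" "\<And>x. x \<notin> L \<Longrightarrow> \<eta> x = 0" using \<eta> by (auto simp: test_functions_iff)
        then have z: "\<eta> x = 0" if "x \<notin> {0<..<R + 1}" for x using that by blast
        have eq: "indicator {0<..<R + 1} x *\<^sub>R (u x * \<eta> x) = indicator {0<..} x *\<^sub>R (u x * \<eta> x)" for x
          using z[of x] by (auto split: split_indicator)
        show ?thesis unfolding set_lebesgue_integral_def
          by (rule Bochner_Integration.integral_cong[OF refl]) (rule eq)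
      qed
      ultimately show "(LINT x:{0<..}|lborel. c x * deriv \<phi> x) = - (LINT x:{0<..}|lborel. d x * \<phi> x)"
        using restrict[OF test_function_deriv[OF \<phi>R]] restrict[OF \<phi>R] by simp
    qed
  qed
  then have "is_weak_L2_deriv M {0<..} X D"
    unfolding is_weak_L2_deriv_def
  proof (intro conjI ballI)
    show "X t \<in> L2 M" if "t \<in> {0<..}" for t using X that by simp
    show "D t \<in> L2 M" if "t \<in> {0<..}" for t using D_L2 that by simp
    show "locally_integrable {0<..} (\<lambda>t. L2_norm M (D t))"
      by (rule loc) (use D in \<open>simp add: unit_deriv_def\<close>)
    show "locally_integrable {0<..} (\<lambda>t. L2_norm M (X t))"
      unfolding locally_integrable_def set_integrable_def
    proof (intro allI impI borel_integrable_compact)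
      fix C :: "real set" assume "compact C \<and> C \<subseteq> {0<..}"
      then show "compact C" "continuous_on C (\<lambda>t. L2_norm M (X t))"
        using continuous_on_subset[OF X_norm_cont] by auto
    qed
  qed
  then show ?thesis by blast
qed

section \<open>Existence and stability of minimizers\<close>

text \<open>The upper limit is monotone with the right boundary values, also at points without convergence.\<close>

lemma helly_AE_limit:
  assumes \<Phi>: "\<And>n. \<Phi> n \<in> helly a b" and ab: "a \<le> b"
  obtains \<Psi> where "\<Psi> \<in> helly a b"
    "\<And>x. x \<in> {a..b} \<Longrightarrow> convergent (\<lambda>n. \<Phi> n x) \<Longrightarrow> (\<lambda>n. \<Phi> n x) \<longlonglongrightarrow> \<Psi> x"
proof
  define L where "L x = limsup (\<lambda>n. ereal (\<Phi> n x))" for x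
  define \<Psi> where "\<Psi> x = real_of_ereal (L x)" for x
  have L_bounds: "ereal a \<le> L x" "L x \<le> ereal b" if "x \<in> {a..b}" for x
  proof -
    have "ereal a \<le> liminf (\<lambda>n. ereal (\<Phi> n x))"
      by (rule Liminf_bounded) (use helly_bounds(1)[OF \<Phi> that] in simp)
    also have "\<dots> \<le> L x" unfolding L_def by (rule Liminf_le_Limsup) simp
    finally show "ereal a \<le> L x" .
    show "L x \<le> ereal b" unfolding L_def
      by (rule Limsup_bounded) (use helly_bounds(2)[OF \<Phi> that] in simp)
  qed
  have L_real: "L x = ereal (\<Psi> x)" if "x \<in> {a..b}" for x
    using L_bounds[OF that] unfolding \<Psi>_def by (cases "L x") auto
  show "\<Psi> \<in> helly a b"
    unfolding helly_def
  proof (intro CollectI conjI)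
    show "\<Psi> \<in> {a..b} \<rightarrow> {a..b}"
    proof
      fix x assume x: "x \<in> {a..b}"
      then show "\<Psi> x \<in> {a..b}" using L_bounds[OF x] unfolding L_real[OF x] by simp
    qed
    show "mono_on {a..b} \<Psi>"
    proof (rule mono_onI)
      fix x y assume xy: "x \<in> {a..b}" "y \<in> {a..b}" "x \<le> y"
      have "L x \<le> L y" unfolding L_def
        by (rule Limsup_mono) (use xy helly_mono[OF \<Phi>, of x y] in auto)
      then show "\<Psi> x \<le> \<Psi> y" unfolding L_real[OF xy(1)] L_real[OF xy(2)] by simp
    qed
    have "\<Phi> n a = a" "\<Phi> n b = b" for n using \<Phi>[of n] by (auto simp: helly_def)
    then show "\<Psi> a = a" "\<Psi> b = b" by (auto simp: \<Psi>_def L_def Limsup_const)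
  qed
  fix x assume x: "x \<in> {a..b}" and "convergent (\<lambda>n. \<Phi> n x)"
  then obtain l where l: "(\<lambda>n. \<Phi> n x) \<longlonglongrightarrow> l" by (auto simp: convergent_def)
  then have "(\<lambda>n. ereal (\<Phi> n x)) \<longlonglongrightarrow> ereal l" by simp
  then have "L x = ereal l" unfolding L_def by (intro lim_imp_Limsup) simp_all
  with l show "(\<lambda>n. \<Phi> n x) \<longlonglongrightarrow> \<Psi> x" by (simp add: \<Psi>_def)
qed

locale regularized_density = bounded_density +
  fixes \<alpha> :: real
  assumes alpha: "\<alpha> \<ge> 0"
begin

definition entropy_term :: "(real \<Rightarrow> real) \<Rightarrow> ereal" where
  "entropy_term \<Phi> = (if \<alpha> = 0 then 0 else ereal \<alpha> * Ent a b (pushforward a b \<Phi> \<mu>))"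

text \<open>The functional to be minimized, with the linear part in the form of a pairing with an integrable
  function; every functional that occurs differs from one of these by a constant.\<close>

definition energy :: "(real \<Rightarrow> real) \<Rightarrow> (real \<Rightarrow> real) \<Rightarrow> ereal" where
  "energy g \<Phi> = ereal (\<integral>x. (\<Phi> x - x)\<^sup>2 / 2 \<partial>\<mu>) + entropy_term \<Phi> - ereal (\<integral>x. \<Phi> x * g x \<partial>leb a b)"

definition energy_minimizer :: "(real \<Rightarrow> real) \<Rightarrow> (real \<Rightarrow> real) \<Rightarrow> bool" where
  "energy_minimizer g \<Phi> \<longleftrightarrow> \<Phi> \<in> helly a b \<and> (\<forall>\<Psi>\<in>helly a b. energy g \<Phi> \<le> energy g \<Psi>)"

lemma entropy_term_zero: "\<alpha> = 0 \<Longrightarrow> entropy_term \<Phi> = 0"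
  unfolding entropy_term_def by simp

lemma entropy_term_le_iff:
  "\<alpha> > 0 \<Longrightarrow> entropy_term \<Phi> \<le> ereal s \<longleftrightarrow> Ent a b (pushforward a b \<Phi> \<mu>) \<le> ereal (s / \<alpha>)"
  by (cases "Ent a b (pushforward a b \<Phi> \<mu>)") (auto simp: entropy_term_def field_simps)

lemma entropy_term_lower:
  assumes "\<Phi> \<in> helly a b"
  shows "ereal (- (\<alpha> * (b - a))) \<le> entropy_term \<Phi>"
proof (cases "\<alpha> = 0")
  case False
  have "ereal (- (\<alpha> * (b - a))) = ereal \<alpha> * ereal (- (b - a))" by (simp add: algebra_simps)
  also have "\<dots> \<le> ereal \<alpha> * Ent a b (pushforward a b \<Phi> \<mu>)"
    using alpha by (intro ereal_mult_left_mono Ent_lower_bound[OF assms]) auto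
  finally show ?thesis using False by (simp add: entropy_term_def)
next
  case True
  show ?thesis unfolding entropy_term_zero[OF True] by (simp add: True zero_ereal_def)
qed

lemma entropy_term_id: "entropy_term (\<lambda>x. x) \<noteq> \<infinity>"
  using Ent_id_finite alpha by (auto simp: entropy_term_def ereal_mult_eq_PInfty)

lemma entropy_term_midpoint:
  assumes \<Phi>: "\<Phi> \<in> helly a b" "entropy_term \<Phi> \<le> ereal s"
    and \<Psi>: "\<Psi> \<in> helly a b" "entropy_term \<Psi> \<le> ereal r"
  shows "entropy_term (\<lambda>x. (\<Phi> x + \<Psi> x) / 2) \<le> ereal ((s + r) / 2)"
proof (cases "\<alpha> = 0")
  case True
  show ?thesis using \<Phi>(2) \<Psi>(2) by (simp add: entropy_term_zero[OF True])
next
  case False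
  with alpha have a: "\<alpha> > 0" by simp
  have eq: "(s + r) / 2 / \<alpha> = (s / \<alpha> + r / \<alpha>) / 2" by (simp add: add_divide_distrib)
  show ?thesis
    unfolding entropy_term_le_iff[OF a] eq
    by (rule Ent_midpoint) (use \<Phi> \<Psi> in \<open>simp_all add: entropy_term_le_iff[OF a]\<close>)
qed

lemma entropy_term_lower_semicontinuous:
  assumes \<Phi>n: "\<And>n. \<Phi>n n \<in> helly a b" and \<Phi>: "\<Phi> \<in> helly a b"
    and lim: "AE x in \<mu>. (\<lambda>n. \<Phi>n n x) \<longlonglongrightarrow> \<Phi> x" and s: "s \<longlonglongrightarrow> r"
    and le: "\<And>n. entropy_term (\<Phi>n n) \<le> ereal (s n)"
  shows "entropy_term \<Phi> \<le> ereal r"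
proof (cases "\<alpha> = 0")
  case True
  have "0 \<le> s n" for n using le[of n] by (simp add: entropy_term_zero[OF True])
  then have "0 \<le> r" using LIMSEQ_le_const[OF s] by blast
  then show ?thesis by (simp add: entropy_term_zero[OF True])
next
  case False
  with alpha have a: "\<alpha> > 0" by simp
  have "(\<lambda>n. s n / \<alpha>) \<longlonglongrightarrow> r / \<alpha>" using s by (intro tendsto_divide tendsto_const) (use a in auto)
  from Ent_lower_semicontinuous[OF \<Phi>n \<Phi> lim this] show ?thesis
    using le by (simp add: entropy_term_le_iff[OF a])
qed

lemma helly_L2: "\<Phi> \<in> helly a b \<Longrightarrow> \<Phi> \<in> L2 \<mu>"
  using helly_measurable[of \<Phi>] helly_bounds(3)[of \<Phi>]
  by (intro L2_bounded[where K = "\<bar>a\<bar> + \<bar>b\<bar>"] finite_measure_axioms) (auto simp: measurable_mu_iff space_mu intro!: AE_I2)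

lemma helly_integrable_mult:
  assumes \<Phi>: "\<Phi> \<in> helly a b" and g: "integrable (leb a b) g"
  shows "integrable (leb a b) (\<lambda>x. \<Phi> x * g x)"
proof (rule Bochner_Integration.integrable_bound)
  show "integrable (leb a b) (\<lambda>x. (\<bar>a\<bar> + \<bar>b\<bar>) * g x)" using g by simp
  show "(\<lambda>x. \<Phi> x * g x) \<in> borel_measurable (leb a b)"
    using helly_measurable[OF \<Phi>] borel_measurable_integrable[OF g] by simp
  show "AE x in leb a b. norm (\<Phi> x * g x) \<le> norm ((\<bar>a\<bar> + \<bar>b\<bar>) * g x)"
    using helly_bounds(3)[OF \<Phi>] by (intro AE_I2) (auto simp: abs_mult intro!: mult_right_mono)
qed

definition transport :: "(real \<Rightarrow> real) \<Rightarrow> real" where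
  "transport \<Phi> = (\<integral>x. (\<Phi> x - x)\<^sup>2 / 2 \<partial>\<mu>)"

lemma transport_midpoint:
  assumes "\<Phi> \<in> helly a b" "\<Psi> \<in> helly a b"
  shows "transport (\<lambda>x. (\<Phi> x + \<Psi> x) / 2) = (transport \<Phi> + transport \<Psi>) / 2 - (\<integral>x. (\<Phi> x - \<Psi> x)\<^sup>2 \<partial>\<mu>) / 8"
proof -
  have i: "integrable \<mu> (\<lambda>x. (\<Phi> x - x)\<^sup>2)" if "\<Phi> \<in> helly a b" for \<Phi>
    using L2D(2)[OF L2_diff[OF helly_L2[OF that] helly_L2[OF helly_id]]] ab by auto
  have id: "integrable \<mu> (\<lambda>x. (\<Phi> x - \<Psi> x)\<^sup>2)"
    using L2D(2)[OF L2_diff[OF helly_L2[OF assms(1)] helly_L2[OF assms(2)]]] .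
  have "transport (\<lambda>x. (\<Phi> x + \<Psi> x) / 2)
    = (\<integral>x. ((\<Phi> x - x)\<^sup>2 / 2) / 2 + ((\<Psi> x - x)\<^sup>2 / 2) / 2 - (\<Phi> x - \<Psi> x)\<^sup>2 / 8 \<partial>\<mu>)"
    unfolding transport_def
    by (rule Bochner_Integration.integral_cong) (auto simp: power2_eq_square field_simps)
  also have "\<dots> = (transport \<Phi> + transport \<Psi>) / 2 - (\<integral>x. (\<Phi> x - \<Psi> x)\<^sup>2 \<partial>\<mu>) / 8"
    using i[OF assms(1)] i[OF assms(2)] id by (simp add: transport_def add_divide_distrib)
  finally show ?thesis .
qed

lemma linear_midpoint:
  assumes "\<Phi> \<in> helly a b" "\<Psi> \<in> helly a b" and g: "integrable (leb a b) g"
  shows "(\<integral>x. (\<Phi> x + \<Psi> x) / 2 * g x \<partial>leb a b) = ((\<integral>x. \<Phi> x * g x \<partial>leb a b) + (\<integral>x. \<Psi> x * g x \<partial>leb a b)) / 2"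
proof -
  have "(\<integral>x. (\<Phi> x + \<Psi> x) / 2 * g x \<partial>leb a b) = (\<integral>x. (\<Phi> x * g x + \<Psi> x * g x) / 2 \<partial>leb a b)"
    by (rule Bochner_Integration.integral_cong) (auto simp: field_simps)
  then show ?thesis
    using helly_integrable_mult[OF assms(1) g] helly_integrable_mult[OF assms(2) g] by simp
qed

lemma entropy_term_finite:
  assumes "\<Phi> \<in> helly a b" "entropy_term \<Phi> \<noteq> \<infinity>"
  obtains s where "entropy_term \<Phi> = ereal s"
  using assms entropy_term_lower[OF assms(1)] by (cases "entropy_term \<Phi>") auto

lemma energy_finite_iff: "energy g \<Phi> = \<infinity> \<longleftrightarrow> entropy_term \<Phi> = \<infinity>"
  by (cases "entropy_term \<Phi>") (auto simp: energy_def)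

text \<open>The quadratic term makes the energy uniformly convex along midpoints. Comparing each of two
  minimizers with their midpoint bounds their distance by the change of the linear term.\<close>

lemma energy_minimizer_stability:
  assumes \<Phi>: "energy_minimizer g \<Phi>" and \<Psi>: "energy_minimizer h \<Psi>"
    and gi: "integrable (leb a b) g" and hi: "integrable (leb a b) h"
  shows "(\<integral>x. (\<Phi> x - \<Psi> x)\<^sup>2 \<partial>\<mu>) \<le> 2 * (\<integral>x. (g x - h x) * (\<Phi> x - \<Psi> x) \<partial>leb a b)"
proof -
  have h\<Phi>: "\<Phi> \<in> helly a b" and h\<Psi>: "\<Psi> \<in> helly a b" using \<Phi> \<Psi> by (auto simp: energy_minimizer_def)
  let ?m = "\<lambda>x. (\<Phi> x + \<Psi> x) / 2"
  have hm: "?m \<in> helly a b" by (rule helly_midpoint[OF h\<Phi> h\<Psi>])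
  have fin: "entropy_term \<Xi> \<noteq> \<infinity>" if "energy_minimizer k \<Xi>" for k \<Xi>
  proof -
    have "energy k \<Xi> \<le> energy k (\<lambda>x. x)" using that helly_id[of a b] ab by (auto simp: energy_minimizer_def)
    moreover have "energy k (\<lambda>x. x) \<noteq> \<infinity>" using entropy_term_id by (simp add: energy_finite_iff)
    ultimately have "energy k \<Xi> \<noteq> \<infinity>" by auto
    then show ?thesis by (simp add: energy_finite_iff)
  qed
  obtain s where s: "entropy_term \<Phi> = ereal s" by (rule entropy_term_finite[OF h\<Phi> fin[OF \<Phi>]])
  obtain r where r: "entropy_term \<Psi> = ereal r" by (rule entropy_term_finite[OF h\<Psi> fin[OF \<Psi>]])
  have mid: "entropy_term ?m \<le> ereal ((s + r) / 2)"
    by (rule entropy_term_midpoint[OF h\<Phi> _ h\<Psi>]) (simp_all add: s r)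
  then obtain q where q: "entropy_term ?m = ereal q" using entropy_term_finite[OF hm] by fastforce
  have q_le: "q \<le> (s + r) / 2" using mid by (simp add: q)
  have "energy g \<Phi> \<le> energy g ?m" "energy h \<Psi> \<le> energy h ?m"
    using \<Phi> \<Psi> hm by (auto simp: energy_minimizer_def)
  then have 1: "transport \<Phi> + s - (\<integral>x. \<Phi> x * g x \<partial>leb a b) \<le> transport ?m + q - (\<integral>x. ?m x * g x \<partial>leb a b)"
    and 2: "transport \<Psi> + r - (\<integral>x. \<Psi> x * h x \<partial>leb a b) \<le> transport ?m + q - (\<integral>x. ?m x * h x \<partial>leb a b)"
    by (simp_all add: energy_def s r q transport_def)
  have "(\<integral>x. (g x - h x) * (\<Phi> x - \<Psi> x) \<partial>leb a b)
     = (\<integral>x. \<Phi> x * g x - \<Psi> x * g x - \<Phi> x * h x + \<Psi> x * h x \<partial>leb a b)"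
    by (rule Bochner_Integration.integral_cong) (auto simp: algebra_simps)
  also have "\<dots> = (\<integral>x. \<Phi> x * g x \<partial>leb a b) - (\<integral>x. \<Psi> x * g x \<partial>leb a b)
      - (\<integral>x. \<Phi> x * h x \<partial>leb a b) + (\<integral>x. \<Psi> x * h x \<partial>leb a b)"
    using helly_integrable_mult[OF h\<Phi> gi] helly_integrable_mult[OF h\<Psi> gi]
      helly_integrable_mult[OF h\<Phi> hi] helly_integrable_mult[OF h\<Psi> hi] by simp
  finally have lin: "(\<integral>x. (g x - h x) * (\<Phi> x - \<Psi> x) \<partial>leb a b) = \<dots>" .
  show ?thesis
    using 1 2 q_le unfolding lin transport_midpoint[OF h\<Phi> h\<Psi>] linear_midpoint[OF h\<Phi> h\<Psi> gi] linear_midpoint[OF h\<Phi> h\<Psi> hi]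
    by (simp add: field_simps)
qed

text \<open>By the same comparison a minimizing sequence is a Cauchy sequence in \<open>L\<^sup>2(\<mu>)\<close>, so no compactness is
  needed for the existence of a minimizer.\<close>

lemma ex_energy_minimizer:
  assumes gi: "integrable (leb a b) g"
  shows "\<exists>\<Phi>. energy_minimizer g \<Phi>"
proof -
  let ?l = "\<lambda>\<Phi>. \<integral>x. \<Phi> x * g x \<partial>leb a b"
  \<comment> \<open>On maps of finite entropy the energy is the real number \<open>J\<close>; the identity is one of them.\<close>
  define F where "F = {\<Phi> \<in> helly a b. entropy_term \<Phi> \<noteq> \<infinity>}"
  define J where "J \<Phi> = transport \<Phi> + real_of_ereal (entropy_term \<Phi>) - ?l \<Phi>" for \<Phi>
  have S: "entropy_term \<Phi> = ereal (real_of_ereal (entropy_term \<Phi>))" if "\<Phi> \<in> F" for \<Phi>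
    using that entropy_term_lower[of \<Phi>] by (cases "entropy_term \<Phi>") (auto simp: F_def)
  have J: "energy g \<Phi> = ereal (J \<Phi>)" if "\<Phi> \<in> F" for \<Phi>
    unfolding energy_def J_def by (subst S[OF that]) (simp add: transport_def)
  have ne: "(\<lambda>x. x) \<in> F" using helly_id[of a b] ab entropy_term_id by (simp add: F_def)
  have bdd: "bdd_below (J ` F)"
  proof (rule bdd_belowI2)
    fix \<Phi> assume \<Phi>: "\<Phi> \<in> F"
    then have h: "\<Phi> \<in> helly a b" by (simp add: F_def)
    have "0 \<le> transport \<Phi>" by (simp add: transport_def)
    moreover have "- (\<alpha> * (b - a)) \<le> real_of_ereal (entropy_term \<Phi>)"
    proof -
      obtain e where "entropy_term \<Phi> = ereal e" using S[OF \<Phi>] by blast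
      then show ?thesis using entropy_term_lower[OF h] by simp
    qed
    moreover have "?l \<Phi> \<le> (\<integral>x. (\<bar>a\<bar> + \<bar>b\<bar>) * \<bar>g x\<bar> \<partial>leb a b)"
    proof (rule integral_mono[OF helly_integrable_mult[OF h gi]])
      show "integrable (leb a b) (\<lambda>x. (\<bar>a\<bar> + \<bar>b\<bar>) * \<bar>g x\<bar>)" using gi by simp
      fix x assume "x \<in> space (leb a b)"
      then have "\<bar>\<Phi> x\<bar> \<le> \<bar>a\<bar> + \<bar>b\<bar>" using helly_bounds(3)[OF h] by simp
      then have "\<bar>\<Phi> x\<bar> * \<bar>g x\<bar> \<le> (\<bar>a\<bar> + \<bar>b\<bar>) * \<bar>g x\<bar>" by (intro mult_right_mono) auto
      then show "\<Phi> x * g x \<le> (\<bar>a\<bar> + \<bar>b\<bar>) * \<bar>g x\<bar>" by (simp add: abs_mult[symmetric])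
    qed
    ultimately show "- (\<alpha> * (b - a)) - (\<integral>x. (\<bar>a\<bar> + \<bar>b\<bar>) * \<bar>g x\<bar> \<partial>leb a b) \<le> J \<Phi>" by (simp add: J_def)
  qed
  define I where "I = Inf (J ` F)"
  have I_le: "I \<le> J \<Phi>" if "\<Phi> \<in> F" for \<Phi> unfolding I_def using that bdd by (intro cInf_lower) auto
  have "\<exists>\<Phi>\<in>F. J \<Phi> < I + 1 / Suc n" for n
  proof -
    have "Inf (J ` F) < I + 1 / Suc n" by (simp add: I_def)
    then show ?thesis using cInf_lessD[of "J ` F"] ne by auto
  qed
  then obtain P where P: "\<And>n. P n \<in> F" "\<And>n. J (P n) < I + 1 / Suc n" by metis
  have hP: "P n \<in> helly a b" for n using P(1)[of n] by (simp add: F_def)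
  have cauchy: "(\<integral>x. (P m x - P n x)\<^sup>2 \<partial>\<mu>) \<le> 4 * (1 / Suc m + 1 / Suc n)" for m n
  proof -
    let ?m = "\<lambda>x. (P m x + P n x) / 2"
    have mid: "entropy_term ?m \<le> ereal ((real_of_ereal (entropy_term (P m)) + real_of_ereal (entropy_term (P n))) / 2)"
      by (rule entropy_term_midpoint[OF hP eq_refl[OF S[OF P(1)]] hP eq_refl[OF S[OF P(1)]]])
    then have mF: "?m \<in> F" using helly_midpoint[OF hP hP] by (auto simp: F_def)
    obtain e where "entropy_term ?m = ereal e" using S[OF mF] by blast
    with mid have "real_of_ereal (entropy_term ?m) \<le> (real_of_ereal (entropy_term (P m)) + real_of_ereal (entropy_term (P n))) / 2"
      by simp
    then have "J ?m \<le> (J (P m) + J (P n)) / 2 - (\<integral>x. (P m x - P n x)\<^sup>2 \<partial>\<mu>) / 8"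
      unfolding J_def transport_midpoint[OF hP hP] linear_midpoint[OF hP hP gi] by (simp add: field_simps)
    moreover have "d \<le> 4 * (u + v)"
      if "I \<le> j" "j1 < I + u" "j2 < I + v" "j \<le> (j1 + j2) / 2 - d / 8" for j j1 j2 u v d :: real
      using that by argo
    ultimately show ?thesis using I_le[OF mF] P(2)[of m] P(2)[of n] by blast
  qed
  have "\<exists>N. \<forall>m\<ge>N. \<forall>n\<ge>N. (\<integral>x. (P m x - P n x)\<^sup>2 \<partial>\<mu>) < e" if e: "e > 0" for e
  proof -
    obtain N :: nat where N: "8 / e < N" using reals_Archimedean2 by blast
    have inv: "1 / Suc n < e / 8" if "n \<ge> N" for n
    proof -
      have "8 / e < Suc n" using N that by simp
      then show ?thesis using e by (simp add: field_simps)
    qed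
    have "(\<integral>x. (P m x - P n x)\<^sup>2 \<partial>\<mu>) < e" if "m \<ge> N" "n \<ge> N" for m n
      using cauchy[of m n] inv[OF that(1)] inv[OF that(2)] by argo
    then show ?thesis by blast
  qed
  from L2_Cauchy_AE_convergent_subseq[OF finite_measure_axioms helly_L2[OF hP] this]
  obtain r where r: "strict_mono r" "AE x in \<mu>. convergent (\<lambda>k. P (r k) x)" by blast
  obtain \<Phi> where \<Phi>: "\<Phi> \<in> helly a b"
    and lim0: "\<And>x. x \<in> {a..b} \<Longrightarrow> convergent (\<lambda>k. P (r k) x) \<Longrightarrow> (\<lambda>k. P (r k) x) \<longlonglongrightarrow> \<Phi> x"
    using helly_AE_limit[of "\<lambda>k. P (r k)" a b] hP ab by auto
  have lim: "AE x in \<mu>. (\<lambda>k. P (r k) x) \<longlonglongrightarrow> \<Phi> x"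
    using r(2) AE_space[of \<mu>] by eventually_elim (use lim0 in \<open>auto simp: space_mu\<close>)
  then have lim': "AE x in leb a b. (\<lambda>k. P (r k) x) \<longlonglongrightarrow> \<Phi> x" by (simp add: AE_mu_iff)
  note [measurable] = helly_measurable[OF hP, folded measurable_mu_iff] helly_measurable[OF \<Phi>, folded measurable_mu_iff]
    helly_measurable[OF hP] helly_measurable[OF \<Phi>] helly_measurable[OF helly_id, folded measurable_mu_iff]
  have idm [measurable]: "(\<lambda>x. x) \<in> borel_measurable \<mu>"
    using helly_measurable[OF helly_id[of a b]] ab by (simp add: measurable_mu_iff)
  have t_lim: "(\<lambda>k. transport (P (r k))) \<longlonglongrightarrow> transport \<Phi>"
    unfolding transport_def
  proof (rule integral_dominated_convergence[where w = "\<lambda>_. (b - a)\<^sup>2 / 2"])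
    show "AE x in \<mu>. (\<lambda>k. (P (r k) x - x)\<^sup>2 / 2) \<longlonglongrightarrow> (\<Phi> x - x)\<^sup>2 / 2"
      using lim by eventually_elim (intro tendsto_intros, auto)
    show "AE x in \<mu>. norm ((P (r k) x - x)\<^sup>2 / 2) \<le> (b - a)\<^sup>2 / 2" for k
    proof (rule AE_I2)
      fix x assume "x \<in> space \<mu>"
      then have x: "x \<in> {a..b}" by (simp add: space_mu)
      have "\<bar>P (r k) x - x\<bar> \<le> b - a" using helly_bounds[OF hP x, of "r k"] x by auto
      then have "(P (r k) x - x)\<^sup>2 \<le> (b - a)\<^sup>2" using ab by (simp add: abs_le_square_iff[symmetric])
      then show "norm ((P (r k) x - x)\<^sup>2 / 2) \<le> (b - a)\<^sup>2 / 2" by simp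
    qed
  qed auto
  have l_lim: "(\<lambda>k. ?l (P (r k))) \<longlonglongrightarrow> ?l \<Phi>"
  proof (rule integral_dominated_convergence[where w = "\<lambda>x. (\<bar>a\<bar> + \<bar>b\<bar>) * \<bar>g x\<bar>"])
    show "AE x in leb a b. (\<lambda>k. P (r k) x * g x) \<longlonglongrightarrow> \<Phi> x * g x"
      using lim' by eventually_elim (intro tendsto_intros)
    show "AE x in leb a b. norm (P (r k) x * g x) \<le> (\<bar>a\<bar> + \<bar>b\<bar>) * \<bar>g x\<bar>" for k
      using helly_bounds(3)[OF hP] by (intro AE_I2) (auto simp: abs_mult intro!: mult_right_mono)
  qed (use gi borel_measurable_integrable[OF gi] in \<open>auto intro!: borel_measurable_times\<close>)
  have J_lim: "(\<lambda>k. J (P (r k))) \<longlonglongrightarrow> I"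
  proof (rule tendsto_sandwich[of "\<lambda>_. I" _ _ "\<lambda>k. I + 1 / Suc (r k)"])
    have "(\<lambda>n. I + 1 / real (Suc n)) \<longlonglongrightarrow> I + 0"
      using LIMSEQ_inverse_real_of_nat by (intro tendsto_add tendsto_const) (simp only: inverse_eq_divide)
    then have "(\<lambda>n. I + 1 / real (Suc n)) \<longlonglongrightarrow> I" by simp
    from LIMSEQ_subseq_LIMSEQ[OF this r(1)] show "(\<lambda>k. I + 1 / real (Suc (r k))) \<longlonglongrightarrow> I" by (simp add: o_def)
    show "\<forall>\<^sub>F k in sequentially. J (P (r k)) \<le> I + 1 / real (Suc (r k))"
      using less_imp_le[OF P(2)] by (auto simp del: of_nat_Suc)
  qed (use I_le[OF P(1)] in auto)
  have "(\<lambda>k. J (P (r k)) - transport (P (r k)) + ?l (P (r k))) \<longlonglongrightarrow> I - transport \<Phi> + ?l \<Phi>"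
    by (intro tendsto_add tendsto_diff J_lim t_lim l_lim)
  moreover have "entropy_term (P (r k)) \<le> ereal (J (P (r k)) - transport (P (r k)) + ?l (P (r k)))" for k
    by (subst S[OF P(1)]) (simp add: J_def)
  ultimately have E: "entropy_term \<Phi> \<le> ereal (I - transport \<Phi> + ?l \<Phi>)"
    by (rule entropy_term_lower_semicontinuous[OF hP \<Phi> lim])
  then have F\<Phi>: "\<Phi> \<in> F" using \<Phi> by (auto simp: F_def)
  obtain e where "entropy_term \<Phi> = ereal e" using S[OF F\<Phi>] by blast
  with E have "J \<Phi> \<le> I" by (simp add: J_def)
  have "energy g \<Phi> \<le> energy g \<Psi>" if "\<Psi> \<in> helly a b" for \<Psi>
  proof (cases "\<Psi> \<in> F")
    case True
    then show ?thesis using \<open>J \<Phi> \<le> I\<close> I_le[OF True] by (simp add: J[OF F\<Phi>] J[OF True])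
  next
    case False
    then have "entropy_term \<Psi> = \<infinity>" using that by (simp add: F_def)
    then have "energy g \<Psi> = \<infinity>" by (simp add: energy_finite_iff)
    then show ?thesis by simp
  qed
  with \<Phi> show ?thesis by (auto simp: energy_minimizer_def)
qed

end

section \<open>Almost everywhere uniqueness of the velocity\<close>

context bounded_density
begin

lemma measure_mu_le:
  assumes A: "A \<in> sets (leb a b)"
  shows "measure \<mu> A \<le> C * measure (leb a b) A"
proof -
  interpret L: finite_measure "leb a b" by (rule finite_measure_leb)
  let ?i = "indicator A :: real \<Rightarrow> real"
  have i: "integrable (leb a b) ?i" using A by (intro integrable_real_indicator) (auto simp: less_top[symmetric])
  have im: "integrable (leb a b) (\<lambda>x. ?i x * m x)"
    using integrable_mu_iff[OF borel_measurable_integrable[OF i]] i by blast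
  have sub: "A \<inter> {a..b} = A" using sets.sets_into_space[OF A] by auto
  have "measure \<mu> A = (\<integral>x. ?i x * m x \<partial>leb a b)"
    using integral_mu[OF borel_measurable_integrable[OF i]] A sub by (simp add: space_mu)
  also have "\<dots> \<le> (\<integral>x. ?i x * C \<partial>leb a b)"
  proof (rule integral_mono_AE)
    show "AE x in leb a b. ?i x * m x \<le> ?i x * C"
      using dens_bounds by eventually_elim (auto split: split_indicator)
  qed (use i im in auto)
  also have "\<dots> = C * measure (leb a b) A" using sub by simp
  finally show ?thesis .
qed

abbreviation fibre :: "(real \<Rightarrow> real) \<Rightarrow> real \<Rightarrow> real set" where
  "fibre \<Phi> y \<equiv> {x \<in> {a..b}. \<Phi> x = y}"

lemma fibre_sets: assumes "\<Phi> \<in> helly a b" shows "fibre \<Phi> y \<in> sets \<mu>"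
  using measurable_sets[OF helly_measurable[OF assms, folded measurable_mu_iff], of "{y}"]
  by (simp add: space_mu vimage_def Int_def conj_commute)

lemma fibre_null_imp_subsingleton:
  assumes \<Phi>: "\<Phi> \<in> helly a b" and null: "measure \<mu> (fibre \<Phi> y) = 0"
    and x: "x \<in> fibre \<Phi> y" "z \<in> fibre \<Phi> y"
  shows "x = z"
proof -
  have "\<not> x < z" if x: "x \<in> fibre \<Phi> y" "z \<in> fibre \<Phi> y" for x z
  proof
    assume "x < z"
    have "{x<..z} \<subseteq> fibre \<Phi> y"
    proof
      fix t assume t: "t \<in> {x<..z}"
      then have "\<Phi> x \<le> \<Phi> t" "\<Phi> t \<le> \<Phi> z"
        using x helly_mono[OF \<Phi>, of x t] helly_mono[OF \<Phi>, of t z] by auto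
      then show "t \<in> fibre \<Phi> y" using x t by auto
    qed
    then have "measure \<mu> {x<..z} \<le> measure \<mu> (fibre \<Phi> y)"
      by (intro finite_measure_mono fibre_sets[OF \<Phi>])
    moreover have "0 < c * (z - x)" using \<open>x < z\<close> c_pos by simp
    ultimately show False using measure_Ioc_bounds(1)[of x z] x \<open>x < z\<close> null by simp
  qed
  from this[OF x] this[OF x(2,1)] show ?thesis by linarith
qed

text \<open>The image of a null set under \<open>\<Phi>\<close> need not be null, as flat pieces produce atoms. But the points with a
  singleton fibre in the null set are mapped, by monotonicity, into a union of open intervals whose
  preimage lies in any given neighbourhood of the null set.\<close>

lemma AE_pushforward_singleton_fibre:
  assumes \<Phi>: "\<Phi> \<in> helly a b" and N: "N \<in> null_sets \<mu>"
  shows "AE y in pushforward a b \<Phi> \<mu>. \<forall>x\<in>N. fibre \<Phi> y \<noteq> {x}"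
proof -
  let ?\<rho> = "pushforward a b \<Phi> \<mu>"
  interpret \<rho>: prob_space ?\<rho> by (rule pushforward_prob[OF \<Phi>])
  have sp: "space ?\<rho> = {a..b}" using sets_eq_imp_space_eq[OF sets_pushforward] by simp
  have Ns: "N \<in> sets (leb a b)" using N sets_mu by auto
  then have Nb: "N \<in> sets borel" "N \<subseteq> {a..b}" by (auto simp: sets_leb sets_restrict_space)
  have "AE x in leb a b. x \<notin> N" using AE_not_in[OF N] by (simp add: AE_mu_iff)
  then have "AE x in lborel. x \<notin> N" unfolding AE_leb_iff by eventually_elim (use Nb in auto)
  then have N0: "emeasure lborel N = 0" using Nb by (subst (asm) AE_iff_null_sets[symmetric]) auto
  define V where "V U = (\<Union>(p, q)\<in>{(p, q). p \<in> {a..b} \<and> q \<in> {a..b} \<and> {p<..<q} \<subseteq> U}. {\<Phi> p<..<\<Phi> q})" for U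
  have V_open: "open (V U)" for U unfolding V_def by auto
  have V_sets: "V U \<inter> {a..b} \<in> sets ?\<rho>" for U
    using V_open[of U] by (auto simp: sets_pushforward sets_leb sets_restrict_space)
  have V_measure: "measure ?\<rho> (V U \<inter> {a..b}) \<le> C * measure (leb a b) (U \<inter> {a..b})" if U: "open U" for U
  proof -
    have Us: "U \<inter> {a..b} \<in> sets (leb a b)" using U by (auto simp: sets_leb sets_restrict_space)
    have "{x \<in> {a..b}. \<Phi> x \<in> V U \<inter> {a..b}} \<subseteq> U \<inter> {a..b}"
    proof
      fix x assume "x \<in> {x \<in> {a..b}. \<Phi> x \<in> V U \<inter> {a..b}}"
      then obtain p q where x: "x \<in> {a..b}" and pq: "p \<in> {a..b}" "q \<in> {a..b}" "{p<..<q} \<subseteq> U" "\<Phi> p < \<Phi> x" "\<Phi> x < \<Phi> q"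
        by (auto simp: V_def)
      have "p < x" using helly_mono[OF \<Phi>, of x p] pq x by (auto simp: not_le[symmetric])
      moreover have "x < q" using helly_mono[OF \<Phi>, of q x] pq x by (auto simp: not_le[symmetric])
      ultimately show "x \<in> U \<inter> {a..b}" using pq x by auto
    qed
    then have "measure \<mu> {x \<in> {a..b}. \<Phi> x \<in> V U \<inter> {a..b}} \<le> measure \<mu> (U \<inter> {a..b})"
      using Us sets_mu by (intro finite_measure_mono) auto
    also have "\<dots> \<le> C * measure (leb a b) (U \<inter> {a..b})" by (rule measure_mu_le[OF Us])
    finally show ?thesis using V_open[of U] by (subst measure_pushforward[OF \<Phi>]) auto
  qed
  have "\<exists>U. open U \<and> N \<subseteq> U \<and> emeasure lborel (U - N) < ennreal (1 / Suc n)" for n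
    using outer_regular_lborel[OF Nb(1), of "1 / Suc n"] by (auto simp del: of_nat_Suc)
  then obtain U where U: "\<And>n. open (U n)" "\<And>n. N \<subseteq> U n" "\<And>n. emeasure lborel (U n - N) < ennreal (1 / Suc n)"
    by metis
  have U_measure: "measure (leb a b) (U n \<inter> {a..b}) \<le> 1 / Suc n" for n
  proof -
    interpret L: finite_measure "leb a b" by (rule finite_measure_leb)
    have Ub: "U n \<in> sets borel" using U(1) by simp
    have "emeasure (leb a b) (U n \<inter> {a..b}) \<le> emeasure lborel (U n)"
      using Ub by (subst emeasure_leb) (auto intro!: emeasure_mono)
    also have "\<dots> \<le> emeasure lborel (U n - N) + emeasure lborel N"
      by (rule order_trans[OF emeasure_mono emeasure_subadditive]) (use Ub Nb in auto)
    also have "\<dots> \<le> ennreal (1 / Suc n)" using U(3)[of n] N0 by simp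
    finally show ?thesis by (simp add: L.emeasure_eq_measure del: of_nat_Suc)
  qed
  define B where "B = (\<Inter>n. V (U n) \<inter> {a..b})"
  have B_sets: "B \<in> sets ?\<rho>" unfolding B_def using V_sets by (intro sets.countable_INT) auto
  have "measure ?\<rho> B \<le> \<bar>C\<bar> * (1 / Suc n)" for n
  proof -
    have "measure ?\<rho> B \<le> measure ?\<rho> (V (U n) \<inter> {a..b})"
      using V_sets by (intro \<rho>.finite_measure_mono) (auto simp: B_def)
    also have "\<dots> \<le> C * measure (leb a b) (U n \<inter> {a..b})" by (rule V_measure[OF U(1)])
    also have "\<dots> \<le> \<bar>C\<bar> * measure (leb a b) (U n \<inter> {a..b})" by (intro mult_right_mono) auto
    also have "\<dots> \<le> \<bar>C\<bar> * (1 / Suc n)" by (intro mult_left_mono U_measure) auto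
    finally show ?thesis .
  qed
  moreover have "(\<lambda>n. \<bar>C\<bar> * (1 / real (Suc n))) \<longlonglongrightarrow> \<bar>C\<bar> * 0"
    using LIMSEQ_inverse_real_of_nat by (intro tendsto_mult tendsto_const) (simp only: inverse_eq_divide)
  ultimately have "measure ?\<rho> B \<le> \<bar>C\<bar> * 0" by (intro LIMSEQ_le_const) auto
  then have "measure ?\<rho> B = 0" using measure_nonneg[of ?\<rho> B] by simp
  then have "B \<in> null_sets ?\<rho>" using B_sets by (auto simp: null_sets_def \<rho>.emeasure_eq_measure)
  then have notB: "AE y in ?\<rho>. y \<notin> B" by (rule AE_not_in)
  \<comment> \<open>At an endpoint the intervals are missing on one side; but a singleton fibre there belongs to a single
    value, which has mass zero.\<close>
  have ends: "AE y in ?\<rho>. fibre \<Phi> y \<noteq> {e}" if e: "e \<in> {a, b}" for e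
  proof (cases "fibre \<Phi> e = {e}")
    case True
    have "measure ?\<rho> {e} = measure \<mu> (fibre \<Phi> e)" using e ab by (subst measure_pushforward[OF \<Phi>]) auto
    also have "\<dots> = 0" unfolding True by (rule measure_singleton)
    finally have "{e} \<in> null_sets ?\<rho>"
      using e ab by (auto simp: null_sets_def \<rho>.emeasure_eq_measure sets_pushforward sets_leb sets_restrict_space intro!: image_eqI[of _ _ "{e}"])
    from AE_not_in[OF this] show ?thesis
    proof eventually_elim
      case (elim y)
      have "\<Phi> e = e" using \<Phi> e by (auto simp: helly_def)
      show ?case
      proof
        assume "fibre \<Phi> y = {e}"
        then have "e \<in> fibre \<Phi> y" by (rule equalityD2[THEN subsetD]) simp
        with \<open>\<Phi> e = e\<close> elim show False by simp
      qed
    qed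
  next
    case False
    have "\<Phi> e = e" using \<Phi> e by (auto simp: helly_def)
    have "fibre \<Phi> y \<noteq> {e}" for y
    proof
      assume y: "fibre \<Phi> y = {e}"
      then have "e \<in> fibre \<Phi> y" by (rule equalityD2[THEN subsetD]) simp
      with \<open>\<Phi> e = e\<close> have "y = e" by simp
      with y False show False by simp
    qed
    then show ?thesis by simp
  qed
  have enda: "AE y in ?\<rho>. fibre \<Phi> y \<noteq> {a}" and endb: "AE y in ?\<rho>. fibre \<Phi> y \<noteq> {b}" using ends by auto
  show ?thesis
    using notB enda endb AE_space[of ?\<rho>]
  proof eventually_elim
    case (elim y)
    show ?case
    proof (intro ballI notI)
      fix x assume x: "x \<in> N" and S: "fibre \<Phi> y = {x}"
      then have "x \<in> fibre \<Phi> y" by (intro equalityD2[OF S, THEN subsetD]) simp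
      then have xy: "x \<in> {a..b}" "\<Phi> x = y" by simp_all
      have "x \<noteq> a" "x \<noteq> b" using elim(2,3) S by metis+
      then have xab: "a < x" "x < b" using xy by auto
      have "y \<in> V (U n)" for n
      proof -
        have "x \<in> U n" using U(2)[of n] x by blast
        then obtain e where e: "e > 0" "ball x e \<subseteq> U n" using U(1)[of n] open_contains_ball by blast
        define p q where "p = max a (x - e)" and "q = min b (x + e)"
        have pq: "p \<in> {a..b}" "q \<in> {a..b}" "p < x" "x < q" using xab e by (auto simp: p_def q_def)
        have "{p<..<q} \<subseteq> ball x e" by (auto simp: p_def q_def dist_real_def)
        then have sub: "{p<..<q} \<subseteq> U n" using e(2) by (rule order_trans)
        have "p \<notin> fibre \<Phi> y" "q \<notin> fibre \<Phi> y" unfolding S using pq by auto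
        then have "\<Phi> p \<noteq> y" "\<Phi> q \<noteq> y" using pq by auto
        moreover have "\<Phi> p \<le> y" using helly_mono[OF \<Phi>, of p x] pq xy by simp
        moreover have "y \<le> \<Phi> q" using helly_mono[OF \<Phi>, of x q] pq xy by simp
        ultimately have "y \<in> {\<Phi> p<..<\<Phi> q}" by simp
        then show ?thesis unfolding V_def using pq sub by (intro UN_I[of "(p, q)"]) auto
      qed
      then have "y \<in> B" using elim sp by (auto simp: B_def)
      with elim show False by simp
    qed
  qed
qed

lemma pushforward_cong_AE:
  assumes "\<Phi> \<in> helly a b" "\<Psi> \<in> helly a b" "AE x in \<mu>. \<Phi> x = \<Psi> x"
  shows "pushforward a b \<Phi> \<mu> = pushforward a b \<Psi> \<mu>"
  unfolding pushforward_def using helly_measurable_push assms by (intro distr_cong_AE) auto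

text \<open>The velocity at \<open>y\<close> only depends on the classes of \<open>\<Phi>\<close> and \<open>D\<close>: fibres of positive measure enter
  through integrals, and the exceptional fibres that are single points have null image.\<close>

lemma velocity_cong_AE:
  assumes \<Phi>: "\<Phi> \<in> helly a b" and \<Psi>: "\<Psi> \<in> helly a b" and eq: "AE x in \<mu>. \<Phi> x = \<Psi> x"
    and D: "D \<in> borel_measurable \<mu>" and E: "E \<in> borel_measurable \<mu>" and DE: "AE x in \<mu>. D x = E x"
  shows "AE y in pushforward a b \<Phi> \<mu>. velocity a b \<mu> \<Phi> D y = velocity a b \<mu> \<Psi> E y"
proof -
  have "AE x in \<mu>. \<Phi> x = \<Psi> x \<and> D x = E x" using eq DE by eventually_elim auto
  then obtain N where Nsub: "\<And>x. x \<in> space \<mu> - N \<Longrightarrow> \<Phi> x = \<Psi> x \<and> D x = E x" and N: "N \<in> null_sets \<mu>"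
    by (rule AE_E3) blast
  have good: "\<Phi> x = \<Psi> x" "D x = E x" if "x \<in> {a..b}" "x \<notin> N" for x
    using that Nsub[of x] by (auto simp: space_mu)
  have \<rho>: "pushforward a b \<Psi> \<mu> = pushforward a b \<Phi> \<mu>" using pushforward_cong_AE[OF \<Phi> \<Psi> eq] by simp
  have AE_fibre: "AE x in \<mu>. x \<in> fibre \<Phi> y \<longleftrightarrow> x \<in> fibre \<Psi> y" for y using eq by eventually_elim auto
  have m_eq: "measure \<mu> (fibre \<Phi> y) = measure \<mu> (fibre \<Psi> y)" for y
    by (intro measure_eq_AE AE_fibre fibre_sets \<Phi> \<Psi>)
  have i_eq: "(LINT x:fibre \<Phi> y|\<mu>. D x) = (LINT x:fibre \<Psi> y|\<mu>. E x)" for y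
    unfolding set_lebesgue_integral_def
  proof (rule integral_cong_AE)
    show "AE x in \<mu>. indicator (fibre \<Phi> y) x *\<^sub>R D x = indicator (fibre \<Psi> y) x *\<^sub>R E x"
      using AE_fibre[of y] DE by eventually_elim (auto simp: indicator_def)
  qed (use D E fibre_sets[OF \<Phi>, of y] fibre_sets[OF \<Psi>, of y] in measurable)
  have pos: "card (fibre \<Xi> y) \<noteq> 1 \<and> fibre \<Xi> y \<noteq> {}" if "measure \<mu> (fibre \<Xi> y) \<noteq> 0" for \<Xi> y
  proof -
    have "fibre \<Xi> y \<noteq> {x}" for x
    proof
      assume "fibre \<Xi> y = {x}"
      with that show False by (simp only: measure_singleton)
    qed
    moreover have "fibre \<Xi> y \<noteq> {}"
    proof
      assume "fibre \<Xi> y = {}"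
      with that show False by (simp only: measure_empty)
    qed
    ultimately show ?thesis unfolding One_nat_def card_1_singleton_iff by blast
  qed
  show ?thesis
    using AE_pushforward_singleton_fibre[OF \<Phi> N] AE_pushforward_singleton_fibre[OF \<Psi> N, unfolded \<rho>]
  proof eventually_elim
    case (elim y)
    show ?case
    proof (cases "measure \<mu> (fibre \<Phi> y) = 0")
      case False
      then have "card (fibre \<Phi> y) \<noteq> 1" "fibre \<Phi> y \<noteq> {}" "card (fibre \<Psi> y) \<noteq> 1" "fibre \<Psi> y \<noteq> {}"
        using pos[of \<Phi> y] pos[of \<Psi> y] m_eq[of y] by auto
      moreover have "velocity a b \<mu> \<Xi> F y = (LINT x:fibre \<Xi> y|\<mu>. F x) / measure \<mu> (fibre \<Xi> y)"
        if "card (fibre \<Xi> y) \<noteq> 1" "fibre \<Xi> y \<noteq> {}" for \<Xi> F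
        unfolding velocity_def Let_def by (simp only: that if_False)
      ultimately show ?thesis by (simp only: i_eq m_eq not_False_eq_True)
    next
      case True
      have sing: "fibre \<Xi> y = {} \<or> (\<exists>x. fibre \<Xi> y = {x})" if "\<Xi> \<in> helly a b" "measure \<mu> (fibre \<Xi> y) = 0" for \<Xi>
        using fibre_null_imp_subsingleton[OF that] by blast
      have vel0: "velocity a b \<mu> \<Xi> F y = 0" if "fibre \<Xi> y = {}" for \<Xi> F
        unfolding velocity_def Let_def that by simp
      have vel1: "velocity a b \<mu> \<Xi> F y = F x" if "fibre \<Xi> y = {x}" for \<Xi> F x
        unfolding velocity_def Let_def that by simp
      have move: "fibre \<Psi> y = {x} \<and> D x = E x" if x: "fibre \<Phi> y = {x}" for x
      proof -
        have xs: "x \<in> {a..b}" "\<Phi> x = y" using x by auto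
        have "x \<notin> N" using elim(1) x by auto
        then have x\<Psi>: "x \<in> fibre \<Psi> y" and DEx: "D x = E x" using good[OF xs(1)] xs by auto
        have null: "measure \<mu> (fibre \<Psi> y) = 0" using True m_eq[of y] by simp
        have "fibre \<Psi> y = {x}"
        proof (rule set_eqI)
          show "z \<in> fibre \<Psi> y \<longleftrightarrow> z \<in> {x}" for z
            using fibre_null_imp_subsingleton[OF \<Psi> null x\<Psi>, of z] x\<Psi> by blast
        qed
        with DEx show ?thesis by blast
      qed
      show ?thesis
      proof (cases "fibre \<Phi> y = {}")
        case False
        then obtain x where x: "fibre \<Phi> y = {x}" using sing[OF \<Phi> True] by blast
        show ?thesis using vel1[OF x, of D] vel1[of \<Psi> x E] move[OF x] by simp
      next
        case empty: True
        have "fibre \<Psi> y = {}"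
        proof (rule ccontr)
          assume "fibre \<Psi> y \<noteq> {}"
          then obtain x where x: "fibre \<Psi> y = {x}" using sing[OF \<Psi>] True m_eq[of y] by auto
          then have xs: "x \<in> {a..b}" "\<Psi> x = y" by auto
          have "x \<notin> N" using elim(2) x by auto
          then have "x \<in> fibre \<Phi> y" using good[OF xs(1)] xs by auto
          then show False unfolding empty by (rule emptyE)
        qed
        then show ?thesis using vel0[OF empty, of D] vel0[of \<Psi> E] by simp
      qed
    qed
  qed
qed

end

text \<open>Half-lines with rational endpoints suffice, by continuity of the integral from the right.\<close>

lemma integrable_null_if_rational_halfline_integrals:
  fixes f :: "real \<Rightarrow> real"
  assumes f: "integrable lborel f" and null: "\<And>q. q \<in> \<rat> \<Longrightarrow> (LINT x:{..q}|lborel. f x) = 0"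
  shows "AE x in lborel. f x = 0"
proof (rule integrable_null_if_interval_integrals[OF f])
  have si: "set_integrable lborel B f" if "B \<in> sets borel" for B
    using f that unfolding set_integrable_def by (intro integrable_mult_indicator) auto
  have half: "(LINT x:{..q}|lborel. f x) = 0" for q
  proof -
    have "\<exists>r. r \<in> \<rat> \<and> q < r \<and> r < q + 1 / Suc n" for n
      using Rats_dense_in_real[of q "q + 1 / Suc n"] by auto
    then obtain r where r: "\<And>n. r n \<in> \<rat>" "\<And>n. q < r n" "\<And>n. r n < q + 1 / Suc n" by metis
    have r_lim: "r \<longlonglongrightarrow> q"
    proof (rule tendsto_sandwich[of "\<lambda>_. q" _ _ "\<lambda>n. q + 1 / Suc n"])
      have "(\<lambda>n. q + 1 / real (Suc n)) \<longlonglongrightarrow> q + 0"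
        using LIMSEQ_inverse_real_of_nat by (intro tendsto_add tendsto_const) (simp only: inverse_eq_divide)
      then show "(\<lambda>n. q + 1 / real (Suc n)) \<longlonglongrightarrow> q" by simp
      show "\<forall>\<^sub>F n in sequentially. q \<le> r n" "\<forall>\<^sub>F n in sequentially. r n \<le> q + 1 / real (Suc n)"
        using less_imp_le[OF r(2)] less_imp_le[OF r(3)] by (auto simp del: of_nat_Suc)
    qed simp
    have "(\<lambda>n. LINT x:{..r n}|lborel. f x) \<longlonglongrightarrow> (LINT x:{..q}|lborel. f x)"
      unfolding set_lebesgue_integral_def
    proof (rule integral_dominated_convergence)
      show "integrable lborel (\<lambda>x. norm (f x))" using f by (rule integrable_norm)
      show "AE x in lborel. (\<lambda>n. indicator {..r n} x *\<^sub>R f x) \<longlonglongrightarrow> indicator {..q} x *\<^sub>R f x"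
      proof (rule AE_I2)
        fix x
        have "\<forall>\<^sub>F n in sequentially. (indicator {..r n} x :: real) = indicator {..q} x"
        proof (cases "x \<le> q")
          case True
          then have "x \<le> r n" for n using r(2)[of n] by simp
          then show ?thesis using True by simp
        next
          case False
          then have "\<forall>\<^sub>F n in sequentially. r n < x" using r_lim by (intro order_tendstoD(2)) auto
          then show ?thesis using False by (auto elim!: eventually_mono)
        qed
        then have "\<forall>\<^sub>F n in sequentially. indicator {..r n} x *\<^sub>R f x = indicator {..q} x *\<^sub>R f x"
          by eventually_elim simp
        then show "(\<lambda>n. indicator {..r n} x *\<^sub>R f x) \<longlonglongrightarrow> indicator {..q} x *\<^sub>R f x" by (rule tendsto_eventually)
      qed
    qed (use borel_measurable_integrable[OF f] in \<open>auto split: split_indicator\<close>)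
    then show ?thesis using null[OF r(1)] by (simp add: LIMSEQ_const_iff)
  qed
  fix p q :: real assume pq: "p \<le> q"
  then have "{..q} = {..p} \<union> {p..q}" by auto
  then have "(LINT x:{..q}|lborel. f x) = (LINT x:{..p} \<union> {p..q}|lborel. f x)" by simp
  also have "\<dots> = (LINT x:{..p}|lborel. f x) + (LINT x:{p..q}|lborel. f x)"
    using AE_lborel_singleton[of p] by (intro set_integral_Un_AE si) (auto elim!: eventually_mono)
  finally show "(LINT x:{p..q}|lborel. f x) = 0" by (simp add: half)
qed

context bounded_density
begin

lemma L2_mu_null_if_rational_integrals:
  assumes h: "h \<in> L2 \<mu>" and null: "\<And>q. q \<in> \<rat> \<Longrightarrow> (\<integral>x. h x * indicator {..q} x \<partial>\<mu>) = 0"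
  shows "AE x in \<mu>. h x = 0"
proof -
  have hm: "h \<in> borel_measurable (leb a b)" using L2D(1)[OF h] by (simp add: measurable_mu_iff)
  have "integrable \<mu> h" by (rule L2_integrable[OF finite_measure_axioms h])
  then have "integrable (leb a b) (\<lambda>x. h x * m x)" using integrable_mu_iff(2)[OF hm] by simp
  then have i: "integrable lborel (\<lambda>x. indicator {a..b} x *\<^sub>R (h x * m x))"
    by (simp add: integrable_leb_iff set_integrable_def)
  have "AE x in lborel. indicator {a..b} x *\<^sub>R (h x * m x) = 0"
  proof (rule integrable_null_if_rational_halfline_integrals[OF i])
    fix q :: real assume q: "q \<in> \<rat>"
    have im: "(\<lambda>x. h x * indicator {..q} x) \<in> borel_measurable (leb a b)"
    proof -
      have "(\<lambda>x. indicator {..q} x :: real) \<in> borel_measurable (leb a b)" by (rule borel_measurable_leb) simp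
      then show ?thesis using hm by simp
    qed
    have "(LINT x:{..q}|lborel. indicator {a..b} x *\<^sub>R (h x * m x)) = (LINT x:{a..b}|lborel. h x * indicator {..q} x * m x)"
      unfolding set_lebesgue_integral_def by (intro Bochner_Integration.integral_cong) (auto split: split_indicator)
    also have "\<dots> = (\<integral>x. h x * indicator {..q} x \<partial>\<mu>)"
      by (simp add: integral_mu[OF im] integral_leb)
    finally show "(LINT x:{..q}|lborel. indicator {a..b} x *\<^sub>R (h x * m x)) = 0" using null[OF q] by simp
  qed
  then have "AE x in leb a b. h x * m x = 0"
    unfolding AE_leb_iff by eventually_elim auto
  with dens_bounds have "AE x in leb a b. h x = 0" by eventually_elim (use c_pos in auto)
  then show ?thesis by (simp add: AE_mu_iff)
qed

text \<open>Testing with the indicators of \<open>{..q}\<close>, \<open>q\<close> rational, involves only countably many null sets of times.\<close>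

lemma weak_L2_deriv_unique:
  assumes 1: "is_weak_L2_deriv \<mu> {0<..} X D" and 2: "is_weak_L2_deriv \<mu> {0<..} Y E"
    and XY: "\<And>t. t > 0 \<Longrightarrow> AE x in \<mu>. X t x = Y t x"
  shows "AE t in lborel. t > 0 \<longrightarrow> (AE x in \<mu>. D t x = E t x)"
proof -
  have L2: "X t \<in> L2 \<mu>" "D t \<in> L2 \<mu>" "Y t \<in> L2 \<mu>" "E t \<in> L2 \<mu>" if "t > 0" for t
    using 1 2 that by (auto simp: is_weak_L2_deriv_def)
  have ind: "(indicator {..q} :: real \<Rightarrow> real) \<in> L2 \<mu>" for q
  proof (rule L2_bounded[where K = 1])
    have "(indicator {..q} :: real \<Rightarrow> real) \<in> borel_measurable (leb a b)" by (rule borel_measurable_leb) simp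
    then show "(indicator {..q} :: real \<Rightarrow> real) \<in> borel_measurable \<mu>" by (simp add: measurable_mu_iff)
  qed (auto simp: finite_measure_axioms)
  have "AE t in lborel. t \<in> {0<..} \<longrightarrow> (\<integral>x. D t x * indicator {..q} x \<partial>\<mu>) = (\<integral>x. E t x * indicator {..q} x \<partial>\<mu>)" for q
  proof (rule weak_deriv_unique)
    let ?c = "\<lambda>X t. \<integral>x. X t x * indicator {..q} x \<partial>\<mu>"
    show w1: "is_weak_deriv {0<..} (?c X) (?c D)" using 1 ind by (auto simp: is_weak_L2_deriv_def)
    have w2: "is_weak_deriv {0<..} (?c Y) (?c E)" using 2 ind by (auto simp: is_weak_L2_deriv_def)
    have eq: "?c X t = ?c Y t" if "t > 0" for t
    proof (rule integral_cong_AE)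
      show "AE x in \<mu>. X t x * indicator {..q} x = Y t x * indicator {..q} x"
        using XY[OF that] by eventually_elim simp
    qed (use L2D(1)[OF L2(1)[OF that]] L2D(1)[OF L2(3)[OF that]] L2D(1)[OF ind[of q]] in auto)
    have "(LINT t:{0<..}|lborel. ?c X t * deriv \<phi> t) = (LINT t:{0<..}|lborel. ?c Y t * deriv \<phi> t)" for \<phi>
      by (rule set_lebesgue_integral_cong) (auto simp: eq)
    then show "is_weak_deriv {0<..} (?c X) (?c E)" using w1 w2 by (simp add: is_weak_deriv_def)
  qed simp
  then have "AE t in lborel. \<forall>q\<in>\<rat>. t \<in> {0<..} \<longrightarrow> (\<integral>x. D t x * indicator {..q} x \<partial>\<mu>) = (\<integral>x. E t x * indicator {..q} x \<partial>\<mu>)"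
    by (subst AE_ball_countable) (auto simp: countable_rat)
  then show ?thesis
  proof eventually_elim
    case (elim t)
    show ?case
    proof
      assume t: "t > 0"
      have "AE x in \<mu>. D t x - E t x = 0"
      proof (rule L2_mu_null_if_rational_integrals[OF L2_diff[OF L2(2)[OF t] L2(4)[OF t]]])
        fix q :: real assume "q \<in> \<rat>"
        then show "(\<integral>x. (D t x - E t x) * indicator {..q} x \<partial>\<mu>) = 0"
          unfolding left_diff_distrib using elim t
          by (subst Bochner_Integration.integral_diff) (auto intro!: L2_mult_integrable L2 ind)
      qed
      then show "AE x in \<mu>. D t x = E t x" by eventually_elim simp
    qed
  qed
qed

end

section \<open>Boundary values and extensions of antiderivatives\<close>

lemma weakly_differentiable_weak_deriv:
  "weakly_differentiable S f \<Longrightarrow> is_weak_deriv S f (weak_deriv S f)"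
  using someI_ex[of "is_weak_deriv S f"] by (simp add: weakly_differentiable_def weak_deriv_def)

lemma locally_integrable_mult_left: "locally_integrable S f \<Longrightarrow> locally_integrable S (\<lambda>x. r * f x)"
  by (auto simp: locally_integrable_def)

lemma is_weak_deriv_scale:
  assumes "is_weak_deriv S f g" shows "is_weak_deriv S (\<lambda>x. r * f x) (\<lambda>x. r * g x)"
  using assms by (auto simp: is_weak_deriv_def locally_integrable_mult_left mult.assoc)

lemma is_weak_deriv_zero: "is_weak_deriv S (\<lambda>x. 0) (\<lambda>x. 0)"
  by (simp add: is_weak_deriv_def locally_integrable_const)

lemma indicator_shrunk_interval_tendsto:
  "(\<lambda>n. indicator {a + 1 / real (Suc n)..b - 1 / real (Suc n)} x :: real) \<longlonglongrightarrow> indicator {a<..<b} x" for a b x :: real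
proof (rule tendsto_eventually)
  have inv: "(\<lambda>n. 1 / real (Suc n)) \<longlonglongrightarrow> 0"
    using LIMSEQ_inverse_real_of_nat by (simp only: inverse_eq_divide)
  show "\<forall>\<^sub>F n in sequentially. (indicator {a + 1 / real (Suc n)..b - 1 / real (Suc n)} x :: real) = indicator {a<..<b} x"
  proof (cases "x \<in> {a<..<b}")
    case True
    then have "\<forall>\<^sub>F n in sequentially. 1 / real (Suc n) < x - a" "\<forall>\<^sub>F n in sequentially. 1 / real (Suc n) < b - x"
      using order_tendstoD(2)[OF inv, of "x - a"] order_tendstoD(2)[OF inv, of "b - x"] by auto
    then show ?thesis by eventually_elim (use True in \<open>simp del: of_nat_Suc\<close>)
  next
    case False
    have "x \<notin> {a + 1 / real (Suc n)..b - 1 / real (Suc n)}" for n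
    proof -
      have "1 / real (Suc n) > 0" by simp
      then show ?thesis using False unfolding greaterThanLessThan_iff atLeastAtMost_iff by linarith
    qed
    then show ?thesis using False by (simp del: of_nat_Suc)
  qed
qed

lemma locally_integrable_set_borel_measurable:
  assumes f: "locally_integrable {a<..<b} f"
  shows "(\<lambda>x. indicator {a<..<b} x * f x) \<in> borel_measurable borel"
proof -
  define K where "K n = {a + 1 / real (Suc n)..b - 1 / real (Suc n)}" for n
  have "set_integrable lborel (K n) f" for n
  proof -
    have "1 / real (Suc n) > 0" by simp
    then have "K n \<subseteq> {a<..<b}"
      unfolding K_def subset_iff greaterThanLessThan_iff atLeastAtMost_iff by (intro allI impI conjI; linarith)
    then show ?thesis using f by (auto simp: locally_integrable_def K_def)
  qed
  then have m: "(\<lambda>x. indicator (K n) x * f x) \<in> borel_measurable borel" for n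
    by (auto simp: set_integrable_def dest: borel_measurable_integrable)
  show ?thesis
  proof (rule borel_measurable_LIMSEQ_metric[OF m])
    show "(\<lambda>n. indicator (K n) x * f x) \<longlonglongrightarrow> indicator {a<..<b} x * f x" for x
      unfolding K_def by (intro tendsto_mult indicator_shrunk_interval_tendsto tendsto_const)
  qed
qed

text \<open>Against a continuous weight \<open>g \<ge> 0\<close> a short interval contributes nonnegatively up to the oscillation
  of \<open>g\<close>; Bolzano's principle adds the contributions up. Indicators are limits of such weights.\<close>

lemma nonneg_if_interval_integrals_nonneg:
  fixes f :: "real \<Rightarrow> real"
  assumes f: "set_integrable lborel {u..v} f"
    and nonneg: "\<And>x y. u \<le> x \<Longrightarrow> x \<le> y \<Longrightarrow> y \<le> v \<Longrightarrow> 0 \<le> (LINT t:{x..y}|lborel. f t)"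
  shows "AE x in lborel. x \<in> {u..v} \<longrightarrow> 0 \<le> f x"
proof (cases "u \<le> v")
  case uv: True
  have fi: "set_integrable lborel {x..y} f" if "u \<le> x" "y \<le> v" for x y
    by (rule set_integrable_subset[OF f]) (use that in auto)
  have fm: "(\<lambda>x. indicator {u..v} x * f x) \<in> borel_measurable borel"
    using f by (auto simp: set_integrable_def dest: borel_measurable_integrable)
  have fgi: "set_integrable lborel {x..y} (\<lambda>t. f t * g t)"
    if xy: "u \<le> x" "y \<le> v" and g: "g \<in> borel_measurable borel" "\<And>t. \<bar>g t\<bar> \<le> 1" for x y and g :: "real \<Rightarrow> real"
  proof (rule set_integrable_bound[OF fi[OF xy]])
    have "(\<lambda>t. (indicator {x..y} t *\<^sub>R f t) * g t) \<in> borel_measurable borel"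
      using fi[OF xy] g(1) by (intro borel_measurable_times) (auto simp: set_integrable_def dest: borel_measurable_integrable)
    then show "set_borel_measurable lborel {x..y} (\<lambda>t. f t * g t)"
      by (simp add: set_borel_measurable_def mult.assoc)
    show "AE t in lborel. t \<in> {x..y} \<longrightarrow> norm (f t * g t) \<le> norm (f t)"
      using g(2) by (auto simp: abs_mult intro!: mult_left_le)
  qed
  have cont: "0 \<le> (LINT t:{u..v}|lborel. f t * g t)"
    if g: "continuous_on UNIV g" "\<And>t. 0 \<le> g t" "\<And>t. g t \<le> 1" for g
  proof -
    have gm: "g \<in> borel_measurable borel" using g(1) by (rule borel_measurable_continuous_onI)
    have gb: "\<bar>g t\<bar> \<le> 1" for t using g(2,3)[of t] by simp
    let ?F = "\<lambda>x y. LINT t:{x..y}|lborel. f t * g t" and ?A = "\<lambda>x y. LINT t:{x..y}|lborel. \<bar>f t\<bar>"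
    have split: "(LINT t:{x..z}|lborel. h t) = (LINT t:{x..y}|lborel. h t) + (LINT t:{y..z}|lborel. h t)"
      if "x \<le> y" "y \<le> z" and h: "set_integrable lborel {x..z} h" for x y z and h :: "real \<Rightarrow> real"
    proof -
      have "{x..z} = {x..y} \<union> {y..z}" using that by auto
      moreover have "(LINT t:{x..y} \<union> {y..z}|lborel. h t) = (LINT t:{x..y}|lborel. h t) + (LINT t:{y..z}|lborel. h t)"
        using AE_lborel_singleton[of y] that(1,2)
        by (intro set_integral_Un_AE set_integrable_subset[OF h]) (auto elim!: eventually_mono)
      ultimately show ?thesis by simp
    qed
    have "- e * ?A u v \<le> ?F u v" if e: "e > 0" for e
    proof -
      have "u \<le> u \<and> v \<le> v \<longrightarrow> - e * ?A u v \<le> ?F u v"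
      proof (rule Bolzano[OF uv, where P = "\<lambda>x y. u \<le> x \<and> y \<le> v \<longrightarrow> - e * ?A x y \<le> ?F x y"])
        fix x y z assume P: "u \<le> x \<and> y \<le> v \<longrightarrow> - e * ?A x y \<le> ?F x y" "u \<le> y \<and> z \<le> v \<longrightarrow> - e * ?A y z \<le> ?F y z"
          and xyz: "x \<le> y" "y \<le> z"
        show "u \<le> x \<and> z \<le> v \<longrightarrow> - e * ?A x z \<le> ?F x z"
        proof
          assume xz: "u \<le> x \<and> z \<le> v"
          have "?F x z = ?F x y + ?F y z" using xz by (intro split xyz fgi gm gb) auto
          moreover have "?A x z = ?A x y + ?A y z" using xz by (intro split xyz set_integrable_abs fi) auto
          ultimately show "- e * ?A x z \<le> ?F x z" using P xz xyz by (simp add: algebra_simps)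
        qed
      next
        fix s assume s: "u \<le> s" "s \<le> v"
        have "isCont g s" using g(1) by (simp add: continuous_on_eq_continuous_at)
        then obtain d where d: "d > 0" "\<And>t. \<bar>t - s\<bar> < d \<Longrightarrow> \<bar>g t - g s\<bar> < e"
          using e unfolding continuous_at_eps_delta by (auto simp: dist_real_def)
        show "\<exists>d>0. \<forall>x y. x \<le> s \<and> s \<le> y \<and> y - x < d \<longrightarrow> u \<le> x \<and> y \<le> v \<longrightarrow> - e * ?A x y \<le> ?F x y"
        proof (intro exI[of _ d] conjI d(1) allI impI)
          fix x y assume s: "x \<le> s \<and> s \<le> y \<and> y - x < d" and xy: "u \<le> x \<and> y \<le> v"
          have i1: "set_integrable lborel {x..y} (\<lambda>t. g s * f t)" using fi[of x y] xy by simp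
          have i2: "set_integrable lborel {x..y} (\<lambda>t. e * \<bar>f t\<bar>)" using set_integrable_abs[OF fi[of x y]] xy by simp
          have "- e * ?A x y \<le> g s * (LINT t:{x..y}|lborel. f t) - e * ?A x y"
            using nonneg[of x y] g(2)[of s] s xy by simp
          also have "\<dots> = (LINT t:{x..y}|lborel. g s * f t - e * \<bar>f t\<bar>)"
            using set_integral_diff(2)[OF i1 i2] by simp
          also have "\<dots> \<le> ?F x y"
          proof (rule set_integral_mono)
            show "set_integrable lborel {x..y} (\<lambda>t. g s * f t - e * \<bar>f t\<bar>)" by (rule set_integral_diff(1)[OF i1 i2])
            show "set_integrable lborel {x..y} (\<lambda>t. f t * g t)" using xy by (intro fgi gm gb) auto
            fix t assume t: "t \<in> {x..y}"
            have "\<bar>g t - g s\<bar> \<le> e" using d(2)[of t] s t by (auto intro: less_imp_le)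
            then have "\<bar>f t\<bar> * \<bar>g t - g s\<bar> \<le> \<bar>f t\<bar> * e" by (intro mult_left_mono) auto
            then have "\<bar>f t * (g t - g s)\<bar> \<le> e * \<bar>f t\<bar>" by (simp add: abs_mult mult.commute)
            then have "- (e * \<bar>f t\<bar>) \<le> f t * (g t - g s)" by linarith
            then show "g s * f t - e * \<bar>f t\<bar> \<le> f t * g t" by (simp add: algebra_simps)
          qed
          finally show "- e * ?A x y \<le> ?F x y" .
        qed
      qed
      then show ?thesis by simp
    qed
    note le = this
    have A0: "0 \<le> ?A u v" unfolding set_lebesgue_integral_def by (rule integral_nonneg_AE) auto
    show ?thesis
    proof (rule field_le_epsilon)
      fix e :: real assume e: "e > 0"
      have "e / (?A u v + 1) * ?A u v \<le> e" using e A0 by (simp add: field_simps)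
      then show "0 \<le> ?F u v + e" using le[of "e / (?A u v + 1)"] e A0 by simp
    qed
  qed
  have "AE x in lborel. 0 \<le> indicator {u..v} x * f x"
  proof (rule sigma_finite_measure.density_nonneg[OF sigma_finite_lborel])
    show "integrable lborel (\<lambda>x. indicator {u..v} x * f x)" using f by (simp add: set_integrable_def)
    fix A :: "real set" assume A: "A \<in> sets lborel"
    have "(indicator A :: real \<Rightarrow> real) \<in> borel_measurable lborel" using A by simp
    then have "(indicator A :: real \<Rightarrow> real) \<in> borel_measurable lebesgue" by (rule measurable_completion)
    then have "(indicator A :: real \<Rightarrow> real) measurable_on UNIV" by (rule lebesgue_measurable_imp_measurable_on) simp
    then obtain N g where N: "negligible N" and g: "\<And>n. continuous_on UNIV (g n)"
      and lim: "\<And>x. x \<notin> N \<Longrightarrow> (\<lambda>n. g n x) \<longlonglongrightarrow> (indicator A x :: real)" by (auto simp: measurable_on_def)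
    have "AE x in lebesgue. x \<notin> N" using N by (intro AE_not_in) (simp add: negligible_iff_null_sets)
    then have AEN: "AE x in lborel. x \<notin> N" by (simp add: AE_completion_iff)
    define h where "h n x = max 0 (min 1 (g n x))" for n x
    have h: "continuous_on UNIV (h n)" "0 \<le> h n x" "h n x \<le> 1" for n x
      unfolding h_def by (intro continuous_on_max continuous_on_min continuous_on_const g) auto
    have hm: "h n \<in> borel_measurable borel" for n using h(1) by (rule borel_measurable_continuous_onI)
    have "(\<lambda>n. LINT t:{u..v}|lborel. f t * h n t) \<longlonglongrightarrow> (LINT t:{u..v}|lborel. f t * indicator A t)"
      unfolding set_lebesgue_integral_def
    proof (rule integral_dominated_convergence[where w = "\<lambda>t. \<bar>indicator {u..v} t * f t\<bar>"])
      show "integrable lborel (\<lambda>t. \<bar>indicator {u..v} t * f t\<bar>)" using f by (auto simp: set_integrable_def intro!: integrable_abs)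
      show "AE x in lborel. (\<lambda>n. indicator {u..v} x *\<^sub>R (f x * h n x)) \<longlonglongrightarrow> indicator {u..v} x *\<^sub>R (f x * indicator A x)"
        using AEN
      proof eventually_elim
        case (elim x)
        have "(\<lambda>n. h n x) \<longlonglongrightarrow> max 0 (min 1 (indicator A x))"
          unfolding h_def by (intro tendsto_max tendsto_min tendsto_const lim elim)
        moreover have "max 0 (min 1 (indicator A x)) = (indicator A x :: real)" by (auto split: split_indicator)
        ultimately show ?case by (intro tendsto_scaleR tendsto_mult tendsto_const) simp
      qed
      have "(\<lambda>x. (indicator {u..v} x * f x) * indicator A x) \<in> borel_measurable borel"
        using borel_measurable_times[OF fm, of "indicator A"] A by simp
      then show "(\<lambda>x. indicator {u..v} x *\<^sub>R (f x * indicator A x)) \<in> borel_measurable lborel"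
        by (simp add: mult.assoc)
      show "(\<lambda>x. indicator {u..v} x *\<^sub>R (f x * h n x)) \<in> borel_measurable lborel" for n
        using borel_measurable_times[OF fm hm[of n]] by (simp add: mult.assoc)
      show "AE x in lborel. norm (indicator {u..v} x *\<^sub>R (f x * h n x)) \<le> \<bar>indicator {u..v} x * f x\<bar>" for n
        using h(2,3) by (intro AE_I2) (auto simp: abs_mult intro!: mult_left_le split: split_indicator)
    qed
    then have "0 \<le> (LINT t:{u..v}|lborel. f t * indicator A t)"
      by (rule LIMSEQ_le_const) (use cont h in blast)
    also have "\<dots> = (LINT x:A|lborel. indicator {u..v} x * f x)"
      unfolding set_lebesgue_integral_def by (rule Bochner_Integration.integral_cong) (auto split: split_indicator)
    finally show "0 \<le> (LINT x:A|lborel. indicator {u..v} x * f x)" .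
  qed
  then show ?thesis by eventually_elim (auto split: split_indicator_asm)
qed simp

lemma locally_integrable_measurable_leb:
  assumes f: "locally_integrable {a<..<b} f"
  shows "f \<in> borel_measurable (leb a b)"
proof -
  have "(\<lambda>x. indicator {a<..<b} x * f x + indicator {a} x * f a + (if a = b then 0 else indicator {b} x * f b)) \<in> borel_measurable borel"
    using locally_integrable_set_borel_measurable[OF f] by simp
  from borel_measurable_leb[OF this] show ?thesis
    by (rule measurable_cong[THEN iffD1, rotated]) (auto split: split_indicator)
qed

lemma AE_leb_open: "(AE x in lborel. x \<in> {a<..<b} \<longrightarrow> P x) \<Longrightarrow> AE x in leb a b. P x"
  unfolding AE_leb_iff
  by (elim eventually_rev_mp, rule eventually_rev_mp[OF AE_lborel_singleton[of a]], rule eventually_rev_mp[OF AE_lborel_singleton[of b]]) auto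

lemma AE_open_leb: "(AE x in leb a b. P x) \<Longrightarrow> AE x in lborel. x \<in> {a<..<b} \<longrightarrow> P x"
  unfolding AE_leb_iff by (erule eventually_mono) auto

lemma integrable_leb_open:
  fixes f :: "real \<Rightarrow> real"
  assumes "set_integrable lborel {a<..<b} f" shows "integrable (leb a b) f"
proof -
  have pt: "set_integrable lborel {x} f" for x
  proof -
    have "(\<lambda>t. indicator {x} t *\<^sub>R f t) = (\<lambda>t. indicator {x} t *\<^sub>R f x)" by (auto split: split_indicator)
    then show ?thesis by (simp add: set_integrable_def)
  qed
  have "set_integrable lborel ({a<..<b} \<union> ({a} \<union> {b})) f"
    by (intro set_integrable_Un assms pt) auto
  then have "set_integrable lborel {a..b} f" by (rule set_integrable_subset) auto
  then show ?thesis by (simp add: integrable_leb_iff)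
qed

lemma is_weak_deriv_cong:
  assumes w: "is_weak_deriv {a<..<b} f g"
    and f': "locally_integrable {a<..<b} f'" and ff': "AE x in lborel. x \<in> {a<..<b} \<longrightarrow> f x = f' x"
    and g': "locally_integrable {a<..<b} g'" and gg': "AE x in lborel. x \<in> {a<..<b} \<longrightarrow> g x = g' x"
  shows "is_weak_deriv {a<..<b} f' g'"
proof -
  have loc: "locally_integrable {a<..<b} f" "locally_integrable {a<..<b} g" using w by (auto simp: is_weak_deriv_def)
  have eq: "(LINT x:{a<..<b}|lborel. u x * \<phi> x) = (LINT x:{a<..<b}|lborel. v x * \<phi> x)"
    if "locally_integrable {a<..<b} u" "locally_integrable {a<..<b} v" "AE x in lborel. x \<in> {a<..<b} \<longrightarrow> u x = v x"
      "\<phi> \<in> test_functions {a<..<b}" for u v \<phi>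
    unfolding set_lebesgue_integral_def
  proof (rule integral_cong_AE)
    show "AE x in lborel. indicator {a<..<b} x *\<^sub>R (u x * \<phi> x) = indicator {a<..<b} x *\<^sub>R (v x * \<phi> x)"
      using that(3) by eventually_elim (auto split: split_indicator)
  qed (use test_function_set_integrable[OF that(1,4)] test_function_set_integrable[OF that(2,4)] in
       \<open>auto simp: set_integrable_def dest: borel_measurable_integrable\<close>)
  show ?thesis
    unfolding is_weak_deriv_def
  proof (intro conjI ballI f' g')
    fix \<phi> assume \<phi>: "\<phi> \<in> test_functions {a<..<b}"
    show "(LINT x:{a<..<b}|lborel. f' x * deriv \<phi> x) = - (LINT x:{a<..<b}|lborel. g' x * \<phi> x)"
      using w \<phi> eq[OF loc(1) f' ff' test_function_deriv[OF \<phi>]] eq[OF loc(2) g' gg' \<phi>] by (simp add: is_weak_deriv_def)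
  qed
qed

text \<open>Integrability up to the endpoints lets the antiderivative be written as an integral from \<open>a\<close>.\<close>

lemma antiderivative_extend:
  assumes ab: "a < b" and F: "antiderivative_on {a<..<b} F f" and f: "integrable (leb a b) f"
  obtains G where "antiderivative_on {a..b} G f" "\<And>x. x \<in> {a<..<b} \<Longrightarrow> G x = F x"
proof -
  have si: "set_integrable lborel {x..y} f" if "a \<le> x" "y \<le> b" for x y
    by (rule set_integrable_subset[OF f[unfolded integrable_leb_iff]]) (use that in auto)
  have split: "(LINT t:{x..z}|lborel. f t) = (LINT t:{x..y}|lborel. f t) + (LINT t:{y..z}|lborel. f t)"
    if "a \<le> x" "x \<le> y" "y \<le> z" "z \<le> b" for x y z
  proof -
    have "{x..z} = {x..y} \<union> {y..z}" using that by auto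
    moreover have "(LINT t:{x..y} \<union> {y..z}|lborel. f t) = (LINT t:{x..y}|lborel. f t) + (LINT t:{y..z}|lborel. f t)"
      using AE_lborel_singleton[of y] that
      by (intro set_integral_Un_AE si) (auto elim!: eventually_mono)
    ultimately show ?thesis by simp
  qed
  define x0 where "x0 = (a + b) / 2"
  have x0: "a < x0" "x0 < b" using ab by (auto simp: x0_def)
  define G where "G x = F x0 + ((LINT t:{a..x}|lborel. f t) - (LINT t:{a..x0}|lborel. f t))" for x
  show thesis
  proof
    show "antiderivative_on {a..b} G f"
      unfolding antiderivative_on_def
    proof (intro allI impI conjI)
      fix x y assume xy: "x \<le> y \<and> {x..y} \<subseteq> {a..b}"
      then show "set_integrable lborel {x..y} f" by (intro si) auto
      show "G y - G x = (LINT t:{x..y}|lborel. f t)" using split[of a x y] xy by (simp add: G_def)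
    qed
    fix x assume x: "x \<in> {a<..<b}"
    show "G x = F x"
    proof (cases "x \<le> x0")
      case True
      then have "F x0 - F x = (LINT t:{x..x0}|lborel. f t)" using x x0 by (intro antiderivative_onD(2)[OF F]) auto
      then show ?thesis using split[of a x x0] x x0 True by (simp add: G_def)
    next
      case False
      then have "F x - F x0 = (LINT t:{x0..x}|lborel. f t)" using x x0 by (intro antiderivative_onD(2)[OF F]) auto
      then show ?thesis using split[of a x0 x] x x0 False by (simp add: G_def)
    qed
  qed
qed

text \<open>The traces are the endpoint values of the continuous representative, by the fundamental theorem of calculus.\<close>

lemma average_at_endpoints:
  assumes ab: "a < b" and G: "continuous_on {a..b} G" and g: "g \<in> borel_measurable (leb a b)"
    and eq: "AE x in leb a b. g x = G x"
  shows "trace_left a g = G a" "trace_right b g = G b"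
proof -
  let ?I = "\<lambda>x. integral {a..x} G"
  have int_eq: "(LINT x:{u..v}|lborel. g x) = ?I v - ?I u" if "a \<le> u" "u \<le> v" "v \<le> b" for u v
  proof -
    have sub: "{u..v} \<subseteq> {a..b}" using that by auto
    have Gi: "set_integrable lborel {u..v} G"
      unfolding set_integrable_def by (rule borel_integrable_compact) (use continuous_on_subset[OF G sub] in auto)
    have "(LINT x:{u..v}|lborel. g x) = (LINT x:{u..v}|lborel. G x)"
      unfolding set_lebesgue_integral_def
    proof (rule integral_cong_AE)
      have "(\<lambda>x. indicator {a..b} x *\<^sub>R g x) \<in> borel_measurable borel"
        using g unfolding leb_def by (subst (asm) borel_measurable_restrict_space_iff) auto
      then have "(\<lambda>x. indicator {u..v} x *\<^sub>R (indicator {a..b} x *\<^sub>R g x)) \<in> borel_measurable borel" by simp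
      moreover have "(\<lambda>x. indicator {u..v} x *\<^sub>R (indicator {a..b} x *\<^sub>R g x)) = (\<lambda>x. indicator {u..v} x *\<^sub>R g x)"
        using sub by (auto split: split_indicator)
      ultimately show "(\<lambda>x. indicator {u..v} x *\<^sub>R g x) \<in> borel_measurable lborel" by simp
      show "(\<lambda>x. indicator {u..v} x *\<^sub>R G x) \<in> borel_measurable lborel"
        using Gi by (auto simp: set_integrable_def dest: borel_measurable_integrable)
      show "AE x in lborel. indicator {u..v} x *\<^sub>R g x = indicator {u..v} x *\<^sub>R G x"
        using eq unfolding AE_leb_iff by eventually_elim (use sub in \<open>auto split: split_indicator\<close>)
    qed
    also have "\<dots> = integral {u..v} G" by (rule set_borel_integral_eq_integral(2)[OF Gi])
    also have "\<dots> = ?I v - ?I u"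
      using Henstock_Kurzweil_Integration.integral_combine[of a u v G] that
        integrable_continuous_real[OF continuous_on_subset[OF G], of a v] by auto
    finally show ?thesis .
  qed
  have ev: "\<forall>\<^sub>F h in at_right 0. 0 < h \<and> h < b - a"
    using ab by (auto simp: eventually_at_right[of 0 1] intro!: exI[of _ "b - a"])
  have "(?I has_real_derivative G a) (at a within {a..b})"
    by (rule integral_has_real_derivative[OF G]) (use ab in auto)
  then have "((\<lambda>y. (?I y - ?I a) / (y - a)) \<longlongrightarrow> G a) (at a within {a..b})"
    by (simp add: has_field_derivative_iff)
  then have "((\<lambda>y. (?I y - ?I a) / (y - a)) \<longlongrightarrow> G a) (at_right a)"
    using ab by (simp add: at_within_Icc_at_right)
  then have "((\<lambda>h. (?I (a + h) - ?I a) / h) \<longlongrightarrow> G a) (at_right 0)"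
    by (subst (asm) at_right_to_0) (simp add: filterlim_filtermap add.commute)
  then have "((\<lambda>h. (LINT x:{a..a + h}|lborel. g x) / h) \<longlongrightarrow> G a) (at_right 0)"
    by (rule Lim_transform_eventually) (use ev in eventually_elim, subst int_eq, auto)
  then show "trace_left a g = G a" unfolding trace_left_def by (intro tendsto_Lim) auto
  have "(?I has_real_derivative G b) (at b within {a..b})"
    by (rule integral_has_real_derivative[OF G]) (use ab in auto)
  then have "((\<lambda>y. (?I y - ?I b) / (y - b)) \<longlongrightarrow> G b) (at b within {a..b})"
    by (simp add: has_field_derivative_iff)
  then have "((\<lambda>y. (?I y - ?I b) / (y - b)) \<longlongrightarrow> G b) (at_left b)"
    using ab by (simp add: at_within_Icc_at_left)
  then have "((\<lambda>h. (?I (b - h) - ?I b) / (- h)) \<longlongrightarrow> G b) (at_right 0)"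
    by (subst (asm) at_left_minus, subst (asm) at_right_to_0) (simp add: filterlim_filtermap)
  then have "((\<lambda>h. (LINT x:{b - h..b}|lborel. g x) / h) \<longlongrightarrow> G b) (at_right 0)"
  proof (rule Lim_transform_eventually)
    show "\<forall>\<^sub>F h in at_right 0. (?I (b - h) - ?I b) / (- h) = (LINT x:{b - h..b}|lborel. g x) / h"
      using ev by eventually_elim (subst int_eq, auto simp: field_simps)
  qed
  then show "trace_right b g = G b" unfolding trace_right_def by (intro tendsto_Lim) auto
qed

text \<open>A monotone function with a weak derivative has no jumps, and the weak derivative is nonnegative, so
  it is integrable up to the endpoints.\<close>

lemma helly_antiderivative:
  assumes ab: "a < b" and \<Phi>: "\<Phi> \<in> helly a b" and w: "weakly_differentiable_closed a b \<Phi>"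
  shows "integrable (leb a b) (weak_deriv {a<..<b} \<Phi>)" "antiderivative_on {a..b} \<Phi> (weak_deriv {a<..<b} \<Phi>)"
proof -
  let ?d = "weak_deriv {a<..<b} \<Phi>"
  have wd: "is_weak_deriv {a<..<b} \<Phi> ?d"
    using w by (auto simp: weakly_differentiable_closed_def intro: weakly_differentiable_weak_deriv)
  then have loc: "locally_integrable {a<..<b} ?d" by (simp add: is_weak_deriv_def)
  obtain F where F: "antiderivative_on {a<..<b} F ?d" and AE: "AE x in lborel. x \<in> {a<..<b} \<longrightarrow> \<Phi> x = F x"
    using weak_deriv_representative[OF ab wd] by blast
  have cont: "continuous_on {a<..<b} F" by (rule antiderivative_continuous[OF F]) simp
  have dense: "\<exists>t. u < t \<and> t < v \<and> \<Phi> t = F t" if uv: "a \<le> u" "u < v" "v \<le> b" for u v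
  proof (rule ccontr)
    assume neg: "\<not> ?thesis"
    have "AE x in lborel. x \<notin> {u<..<v}"
      using AE by eventually_elim (use neg uv in auto)
    then have "{u<..<v} \<in> null_sets lborel" by (subst (asm) AE_iff_null_sets[symmetric]) auto
    then show False using uv by (simp add: null_sets_def)
  qed
  have eq: "\<Phi> x = F x" if x: "x \<in> {a<..<b}" for x
  proof -
    have Fx: "(F \<longlongrightarrow> F x) (at x)" using cont x by (simp add: continuous_on_eq_continuous_at isCont_def)
    have "\<bar>\<Phi> x - F x\<bar> \<le> e" if e: "e > 0" for e
    proof -
      obtain d where d: "d > 0" "\<And>t. t \<noteq> x \<Longrightarrow> \<bar>t - x\<bar> < d \<Longrightarrow> \<bar>F t - F x\<bar> < e"
        using Fx e unfolding LIM_def by (auto simp: dist_real_def)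
      obtain t where t: "max a (x - d) < t" "t < x" "\<Phi> t = F t" using dense[of "max a (x - d)" x] x d by auto
      obtain s where s: "x < s" "s < min b (x + d)" "\<Phi> s = F s" using dense[of x "min b (x + d)"] x d by auto
      have "\<Phi> t \<le> \<Phi> x" "\<Phi> x \<le> \<Phi> s"
        using x t(1,2) s(1,2) helly_mono[OF \<Phi>, of t x] helly_mono[OF \<Phi>, of x s] by auto
      moreover have "\<bar>F t - F x\<bar> < e" "\<bar>F s - F x\<bar> < e" using d(2)[of t] d(2)[of s] t s by auto
      ultimately show ?thesis using t(3) s(3) by linarith
    qed
    then have "\<bar>\<Phi> x - F x\<bar> \<le> 0" by (rule field_le_epsilon[of _ 0, simplified]) auto
    then show ?thesis by simp
  qed
  have incr: "(LINT t:{x..y}|lborel. ?d t) = \<Phi> y - \<Phi> x" if "a < x" "x \<le> y" "y < b" for x y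
  proof -
    have "{x..y} \<subseteq> {a<..<b}" using that by auto
    then show ?thesis using antiderivative_onD(2)[OF F that(2)] eq[of x] eq[of y] that by simp
  qed
  have nonneg: "AE x in lborel. x \<in> {u..v} \<longrightarrow> 0 \<le> ?d x" if uv: "a < u" "v < b" for u v
  proof (rule nonneg_if_interval_integrals_nonneg)
    have "{u..v} \<subseteq> {a<..<b}" using uv by auto
    then show "set_integrable lborel {u..v} ?d" using loc by (simp add: locally_integrable_def)
    show "0 \<le> (LINT t:{x..y}|lborel. ?d t)" if "u \<le> x" "x \<le> y" "y \<le> v" for x y
      using incr[of x y] helly_mono[OF \<Phi>, of x y] uv that by auto
  qed
  have dm: "(\<lambda>x. indicator {a<..<b} x * ?d x) \<in> borel_measurable borel"
    by (rule locally_integrable_set_borel_measurable[OF loc])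
  define K where "K n = {a + 1 / real (Suc n)..b - 1 / real (Suc n)}" for n
  have inv_pos: "1 / real (Suc n) > 0" for n by simp
  have K_in: "a < a + 1 / real (Suc n)" "b - 1 / real (Suc n) < b" for n using inv_pos[of n] by linarith+
  have K_sub: "K n \<subseteq> {a<..<b}" for n
  proof
    fix x assume "x \<in> K n"
    then have "a + 1 / real (Suc n) \<le> x" "x \<le> b - 1 / real (Suc n)" unfolding K_def by simp_all
    then show "x \<in> {a<..<b}" using K_in[of n] unfolding greaterThanLessThan_iff by linarith
  qed
  have K_lim: "(\<lambda>n. indicator (K n) x :: real) \<longlonglongrightarrow> indicator {a<..<b} x" for x
    unfolding K_def by (rule indicator_shrunk_interval_tendsto)
  have K_bound: "(\<integral>\<^sup>+x. ennreal \<bar>indicator (K n) x * ?d x\<bar> \<partial>lborel) \<le> ennreal (b - a)" for n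
  proof -
    have si: "set_integrable lborel (K n) ?d"
      using loc K_sub[of n] by (simp add: locally_integrable_def K_def)
    have AEn: "AE x in lborel. \<bar>indicator (K n) x * ?d x\<bar> = indicator (K n) x * ?d x"
      using nonneg[OF K_in[of n]] by eventually_elim (auto simp: K_def split: split_indicator)
    have "(\<integral>\<^sup>+x. ennreal \<bar>indicator (K n) x * ?d x\<bar> \<partial>lborel) = (\<integral>\<^sup>+x. ennreal (indicator (K n) x * ?d x) \<partial>lborel)"
      by (rule nn_integral_cong_AE) (use AEn in \<open>auto elim!: eventually_mono\<close>)
    also have "\<dots> = ennreal (LINT x:K n|lborel. ?d x)"
      unfolding set_lebesgue_integral_def real_scaleR_def
    proof (rule nn_integral_eq_integral)
      show "integrable lborel (\<lambda>x. indicator (K n) x * ?d x)" using si by (simp add: set_integrable_def)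
      show "AE x in lborel. 0 \<le> indicator (K n) x * ?d x" using AEn by eventually_elim (metis abs_ge_zero)
    qed
    also have "(LINT x:K n|lborel. ?d x) \<le> b - a"
    proof (cases "a + 1 / real (Suc n) \<le> b - 1 / real (Suc n)")
      case True
      have in_ab: "a + 1 / real (Suc n) \<in> {a..b}" "b - 1 / real (Suc n) \<in> {a..b}"
        using True K_in[of n] unfolding atLeastAtMost_iff by linarith+
      show ?thesis unfolding K_def incr[OF K_in(1) True K_in(2)]
        using helly_bounds[OF \<Phi> in_ab(1)] helly_bounds[OF \<Phi> in_ab(2)] by linarith
    next
      case False
      then have "K n = {}" by (simp add: K_def del: of_nat_Suc)
      then show ?thesis using ab by (simp add: set_lebesgue_integral_def)
    qed
    finally show ?thesis by (simp add: ennreal_leI)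
  qed
  have "set_integrable lborel {a<..<b} ?d"
    unfolding set_integrable_def real_scaleR_def
  proof (rule integrableI_bounded)
    show "(\<lambda>x. indicator {a<..<b} x * ?d x) \<in> borel_measurable lborel" using dm by simp
    have "(\<integral>\<^sup>+x. ennreal (norm (indicator {a<..<b} x * ?d x)) \<partial>lborel)
        = (\<integral>\<^sup>+x. liminf (\<lambda>n. ennreal \<bar>indicator (K n) x * ?d x\<bar>) \<partial>lborel)"
    proof (rule nn_integral_cong)
      fix x
      have "(\<lambda>n. ennreal \<bar>indicator (K n) x * ?d x\<bar>) \<longlonglongrightarrow> ennreal \<bar>indicator {a<..<b} x * ?d x\<bar>"
        by (intro tendsto_ennrealI tendsto_rabs tendsto_mult K_lim tendsto_const)
      then show "ennreal (norm (indicator {a<..<b} x * ?d x)) = liminf (\<lambda>n. ennreal \<bar>indicator (K n) x * ?d x\<bar>)"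
        unfolding real_norm_def by (rule lim_imp_Liminf[OF sequentially_bot, symmetric])
    qed
    also have "\<dots> \<le> liminf (\<lambda>n. \<integral>\<^sup>+x. ennreal \<bar>indicator (K n) x * ?d x\<bar> \<partial>lborel)"
    proof (rule nn_integral_liminf)
      fix n
      have "(\<lambda>x. indicator (K n) x * (indicator {a<..<b} x * ?d x)) \<in> borel_measurable borel"
        using dm by (simp add: K_def)
      moreover have "(\<lambda>x. indicator (K n) x * (indicator {a<..<b} x * ?d x)) = (\<lambda>x. indicator (K n) x * ?d x)"
      proof
        fix x
        show "indicator (K n) x * (indicator {a<..<b} x * ?d x) = indicator (K n) x * ?d x"
          using K_sub[of n] by (cases "x \<in> K n") auto
      qed
      ultimately show "(\<lambda>x. ennreal \<bar>indicator (K n) x * ?d x\<bar>) \<in> borel_measurable lborel" by simp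
    qed
    also have "\<dots> \<le> ennreal (b - a)"
      by (rule Liminf_le) (use K_bound in auto)
    finally show "(\<integral>\<^sup>+x. ennreal (norm (indicator {a<..<b} x * ?d x)) \<partial>lborel) < \<infinity>"
      by (rule le_less_trans) simp
  qed
  then show i: "integrable (leb a b) ?d" by (rule integrable_leb_open)
  obtain G where G: "antiderivative_on {a..b} G ?d" "\<And>x. x \<in> {a<..<b} \<Longrightarrow> G x = F x"
    using antiderivative_extend[OF ab F i] by blast
  have Gc: "continuous_on {a..b} G" by (rule antiderivative_continuous_Icc[OF G(1)])
  have "G x = \<Phi> x" if x: "x \<in> {a..b}" for x
  proof -
    consider "x = a" | "x = b" | "x \<in> {a<..<b}" using x by fastforce
    then show ?thesis
    proof cases
      case 1
      have "(G \<longlongrightarrow> G a) (at_right a)"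
        using Gc ab by (auto simp: continuous_on_def at_within_Icc_at_right dest!: bspec[of _ _ a])
      then have "(\<Phi> \<longlongrightarrow> G a) (at_right a)"
        by (rule Lim_transform_eventually)
           (use eq G(2) ab in \<open>auto simp: eventually_at_right[OF ab] intro!: exI[of _ b]\<close>)
      moreover have "(\<Phi> \<longlongrightarrow> \<Phi> a) (at_right a)" using w by (simp add: weakly_differentiable_closed_def)
      ultimately have "G a = \<Phi> a" by (intro tendsto_unique[of "at_right a"]) auto
      then show ?thesis using 1 by simp
    next
      case 2
      have "(G \<longlongrightarrow> G b) (at_left b)"
        using Gc ab by (auto simp: continuous_on_def at_within_Icc_at_left dest!: bspec[of _ _ b])
      then have "(\<Phi> \<longlongrightarrow> G b) (at_left b)"
        by (rule Lim_transform_eventually)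
           (use eq G(2) ab in \<open>auto simp: eventually_at_left[OF ab] intro!: exI[of _ a]\<close>)
      moreover have "(\<Phi> \<longlongrightarrow> \<Phi> b) (at_left b)" using w by (simp add: weakly_differentiable_closed_def)
      ultimately have "G b = \<Phi> b" by (intro tendsto_unique[of "at_left b"]) auto
      then show ?thesis using 2 by simp
    next
      case 3
      then show ?thesis using G(2) eq by simp
    qed
  qed
  then show "antiderivative_on {a..b} \<Phi> ?d"
    using G(1) unfolding antiderivative_on_def by (metis atLeastAtMost_iff order_refl subsetD)
qed

section \<open>The functionals as integrals against a fixed function\<close>

text \<open>On a short interval the increment of \<open>\<bar>W\<bar> + \<bar>P\<bar>\<close> is at most half of its supremum plus a constant, which
  bounds the supremum by the value at any point; the bound does not degenerate at the endpoints.\<close>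

lemma linear_system_bounded:
  assumes ab: "a < b" and W: "antiderivative_on {a<..<b} W w'" and P: "antiderivative_on {a<..<b} P p'"
    and s: "integrable (leb a b) s" and L: "L \<ge> 0"
    and w': "AE x in leb a b. \<bar>w' x\<bar> \<le> L * \<bar>P x\<bar>"
    and p': "AE x in leb a b. \<bar>p' x\<bar> \<le> L * \<bar>W x\<bar> + \<bar>s x\<bar>"
  shows "\<exists>B. \<forall>x\<in>{a<..<b}. \<bar>W x\<bar> + \<bar>P x\<bar> \<le> B"
proof -
  define z where "z x = \<bar>W x\<bar> + \<bar>P x\<bar>" for x
  define S where "S = (\<integral>x. \<bar>s x\<bar> \<partial>leb a b)"
  have S: "S \<ge> 0" by (simp add: S_def)
  have zc: "continuous_on {a<..<b} z"
    unfolding z_def using antiderivative_continuous[OF W] antiderivative_continuous[OF P] by (intro continuous_intros) auto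
  have si: "set_integrable lborel {x..y} (\<lambda>t. \<bar>s t\<bar>)" if "a \<le> x" "y \<le> b" for x y
    by (rule set_integrable_subset[OF set_integrable_abs[OF s[unfolded integrable_leb_iff]]]) (use that in auto)
  have local: "z y \<le> 2 * (z x + S)"
    if pq: "a < p" "q < b" "2 * L * (q - p) \<le> 1" and x: "x \<in> {p..q}" and y: "y \<in> {p..q}" for p q x y
  proof -
    have sub: "{p..q} \<subseteq> {a<..<b}" using pq by auto
    obtain y' where y': "y' \<in> {p..q}" "\<And>t. t \<in> {p..q} \<Longrightarrow> z t \<le> z y'"
      using continuous_attains_sup[of "{p..q}" z] continuous_on_subset[OF zc sub] x by auto
    have M0: "0 \<le> z y'" by (simp add: z_def)
    have incr: "\<bar>W v - W u\<bar> + \<bar>P v - P u\<bar> \<le> z y' / 2 + S" if uv: "u \<in> {p..q}" "v \<in> {p..q}" "u \<le> v" for u v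
    proof -
      have uv_sub: "{u..v} \<subseteq> {a<..<b}" using uv sub by auto
      note i = antiderivative_onD(1)[OF W uv(3) uv_sub] antiderivative_onD(1)[OF P uv(3) uv_sub]
      have ci: "set_integrable lborel {u..v} (\<lambda>t. L * z y')"
        unfolding set_integrable_def
        by (intro integrable_scaleR_left integrable_real_indicator) (auto simp: emeasure_lborel_Icc_eq)
      have su: "set_integrable lborel {u..v} (\<lambda>t. \<bar>s t\<bar>)" using uv pq by (intro si) auto
      have abs_le: "\<bar>LINT t:{u..v}|lborel. f t\<bar> \<le> (LINT t:{u..v}|lborel. \<bar>f t\<bar>)"
        if "set_integrable lborel {u..v} f" for f :: "real \<Rightarrow> real"
      proof -
        have "\<bar>LINT t:{u..v}|lborel. f t\<bar> \<le> (LINT t|lborel. \<bar>indicator {u..v} t *\<^sub>R f t\<bar>)"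
          unfolding set_lebesgue_integral_def by (rule integral_abs_bound)
        also have "\<dots> = (LINT t:{u..v}|lborel. \<bar>f t\<bar>)"
          unfolding set_lebesgue_integral_def by (rule Bochner_Integration.integral_cong) (auto split: split_indicator)
        finally show ?thesis .
      qed
      have "\<bar>W v - W u\<bar> + \<bar>P v - P u\<bar> \<le> (LINT t:{u..v}|lborel. \<bar>w' t\<bar>) + (LINT t:{u..v}|lborel. \<bar>p' t\<bar>)"
        unfolding antiderivative_onD(2)[OF W uv(3) uv_sub] antiderivative_onD(2)[OF P uv(3) uv_sub]
        by (intro add_mono abs_le i)
      also have "\<dots> = (LINT t:{u..v}|lborel. \<bar>w' t\<bar> + \<bar>p' t\<bar>)"
        by (rule set_integral_add(2)[symmetric]) (intro set_integrable_abs i)+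
      also have "\<dots> \<le> (LINT t:{u..v}|lborel. L * z y' + \<bar>s t\<bar>)"
      proof (rule set_integral_mono_AE)
        show "set_integrable lborel {u..v} (\<lambda>t. \<bar>w' t\<bar> + \<bar>p' t\<bar>)"
          by (rule set_integral_add(1)) (intro set_integrable_abs i)+
        show "set_integrable lborel {u..v} (\<lambda>t. L * z y' + \<bar>s t\<bar>)"
          by (rule set_integral_add(1)[OF ci su])
        show "AE t\<in>{u..v} in lborel. \<bar>w' t\<bar> + \<bar>p' t\<bar> \<le> L * z y' + \<bar>s t\<bar>"
          using w' p' unfolding AE_leb_iff
        proof eventually_elim
          case (elim t)
          show ?case
          proof
            assume t: "t \<in> {u..v}"
            then have "t \<in> {a..b}" "t \<in> {p..q}" using uv pq by auto
            then have "\<bar>w' t\<bar> \<le> L * \<bar>P t\<bar>" "\<bar>p' t\<bar> \<le> L * \<bar>W t\<bar> + \<bar>s t\<bar>" "L * z t \<le> L * z y'"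
              using elim y'(2) L by (auto intro!: mult_left_mono)
            then show "\<bar>w' t\<bar> + \<bar>p' t\<bar> \<le> L * z y' + \<bar>s t\<bar>" by (simp add: z_def[of t] distrib_left)
          qed
        qed
      qed
      also have "\<dots> = (LINT t:{u..v}|lborel. L * z y') + (LINT t:{u..v}|lborel. \<bar>s t\<bar>)"
        by (rule set_integral_add(2)[OF ci su])
      also have "(LINT t:{u..v}|lborel. L * z y') = (v - u) * (L * z y')"
        using uv by (simp add: set_lebesgue_integral_def)
      also have "(v - u) * (L * z y') \<le> z y' / 2"
      proof -
        have "(v - u) * L \<le> (q - p) * L" using uv L by (intro mult_right_mono) auto
        also have "\<dots> \<le> 1 / 2" using pq(3) by (simp add: mult_ac)
        finally have "(v - u) * L * z y' \<le> 1 / 2 * z y'" using M0 by (rule mult_right_mono)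
        then show ?thesis by (simp add: mult_ac)
      qed
      also have "(LINT t:{u..v}|lborel. \<bar>s t\<bar>) \<le> S"
        unfolding S_def integral_leb
      proof -
        have "(LINT t:{u..v}|lborel. \<bar>s t\<bar>) \<le> (LINT t:{a..b}|lborel. \<bar>s t\<bar>)"
          unfolding set_lebesgue_integral_def
          by (rule integral_mono) (use su si[of a b] uv pq in \<open>auto simp: set_integrable_def split: split_indicator\<close>)
        then show "(LINT t:{u..v}|lborel. \<bar>s t\<bar>) \<le> (LINT x:{a..b}|lborel. \<bar>s x\<bar>)" .
      qed
      finally show ?thesis by simp
    qed
    have "z y' \<le> z x + (z y' / 2 + S)"
    proof (cases "x \<le> y'")
      case True
      then show ?thesis using incr[OF x y'(1) True] by (simp add: z_def) linarith
    next
      case False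
      then show ?thesis using incr[OF y'(1) x] by (simp add: z_def) linarith
    qed
    then show ?thesis using y'(2)[OF y] by argo
  qed
  \<comment> \<open>This length suits the local bound everywhere, so that two strips at the endpoints remain next to a compact
    interval on which continuity bounds \<open>z\<close>.\<close>
  define h where "h = min (1 / (2 * L + 1)) ((b - a) / 3)"
  have h: "0 < h" "h \<le> (b - a) / 3" "2 * L * h \<le> 1"
  proof -
    show "0 < h" using L ab by (simp add: h_def)
    show "h \<le> (b - a) / 3" unfolding h_def by (rule min.cobounded2)
    have "h \<le> 1 / (2 * L + 1)" unfolding h_def by (rule min.cobounded1)
    then have "2 * L * h \<le> 2 * L * (1 / (2 * L + 1))" using L by (intro mult_left_mono) auto
    also have "\<dots> \<le> 1" using L by (simp add: field_simps)
    finally show "2 * L * h \<le> 1" .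
  qed
  have mid: "{a + h..b - h} \<subseteq> {a<..<b}" using h by auto
  have "bounded (z ` {a + h..b - h})"
    by (intro compact_imp_bounded compact_continuous_image continuous_on_subset[OF zc mid]) auto
  then obtain B where bB: "\<And>y. y \<in> z ` {a + h..b - h} \<Longrightarrow> norm y \<le> B"
    unfolding bounded_iff by auto
  have B: "z x \<le> B" if "x \<in> {a + h..b - h}" for x
    using bB[OF imageI[OF that]] by (simp only: real_norm_def abs_le_iff)
  have "z x \<le> max B (max (2 * (z (a + h) + S)) (2 * (z (b - h) + S)))" if x: "x \<in> {a<..<b}" for x
  proof -
    consider "x \<in> {a + h..b - h}" | "x < a + h" | "b - h < x" by (cases "x < a + h"; cases "b - h < x") auto
    then show ?thesis
    proof cases
      case 1
      then show ?thesis using B[OF 1] by simp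
    next
      case 2
      have "2 * L * (a + h - x) \<le> 2 * L * h" using x L by (intro mult_left_mono) auto
      then have "z x \<le> 2 * (z (a + h) + S)" using 2 x h by (intro local[of x "a + h"]) auto
      then show ?thesis by simp
    next
      case 3
      have "2 * L * (x - (b - h)) \<le> 2 * L * h" using x L by (intro mult_left_mono) auto
      then have "z x \<le> 2 * (z (b - h) + S)" using 3 x h by (intro local[of "b - h" x]) auto
      then show ?thesis by simp
    qed
  qed
  then show ?thesis unfolding z_def by blast
qed

lemma locally_integrable_cong_AE:
  assumes f: "locally_integrable {a<..<b} f" and g: "g \<in> borel_measurable (leb a b)"
    and eq: "AE x in leb a b. f x = g x"
  shows "locally_integrable {a<..<b} g"
  unfolding locally_integrable_def
proof (intro allI impI)
  fix K :: "real set" assume K: "compact K \<and> K \<subseteq> {a<..<b}"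
  have fi: "set_integrable lborel K f" using f K by (simp add: locally_integrable_def)
  have "(\<lambda>x. indicator {a..b} x *\<^sub>R g x) \<in> borel_measurable borel"
    using g unfolding leb_def by (subst (asm) borel_measurable_restrict_space_iff) auto
  moreover have "(indicator K :: real \<Rightarrow> real) \<in> borel_measurable borel"
    using K borel_compact[of K] by (intro borel_measurable_indicator) blast
  ultimately have "(\<lambda>x. indicator K x *\<^sub>R (indicator {a..b} x *\<^sub>R g x)) \<in> borel_measurable borel"
    by (rule borel_measurable_scaleR[rotated])
  moreover have "(\<lambda>x. indicator K x *\<^sub>R (indicator {a..b} x *\<^sub>R g x)) = (\<lambda>x. indicator K x *\<^sub>R g x)"
  proof
    fix x show "indicator K x *\<^sub>R (indicator {a..b} x *\<^sub>R g x) = indicator K x *\<^sub>R g x"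
      using K by (cases "x \<in> K") auto
  qed
  ultimately have gm: "(\<lambda>x. indicator K x *\<^sub>R g x) \<in> borel_measurable lborel" by simp
  have "AE x in lborel. indicator K x *\<^sub>R f x = indicator K x *\<^sub>R g x"
    using AE_open_leb[OF eq] by eventually_elim (use K in \<open>auto split: split_indicator\<close>)
  then show "set_integrable lborel K g"
    using fi gm unfolding set_integrable_def
    by (subst integrable_cong_AE[symmetric, of "\<lambda>x. indicator K x *\<^sub>R f x"]) (auto dest: borel_measurable_integrable)
qed

lemma integrable_AE_bound:
  fixes f g :: "real \<Rightarrow> real"
  assumes "integrable (leb a b) g" "f \<in> borel_measurable (leb a b)" "AE x in leb a b. \<bar>f x\<bar> \<le> g x"
  shows "integrable (leb a b) f"
  by (rule Bochner_Integration.integrable_bound[OF assms(1,2)]) (use assms(3) in \<open>auto elim!: eventually_mono\<close>)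

locale sobolev_density = regularized_density +
  assumes m_wd: "weakly_differentiable {a<..<b} (dens a b \<mu>)"
    and m_deriv: "set_integrable lborel {a<..<b} (weak_deriv {a<..<b} (dens a b \<mu>))"
begin

abbreviation m' where "m' \<equiv> weak_deriv {a<..<b} (dens a b \<mu>)"

lemma m'_integrable: "integrable (leb a b) m'"
  by (rule integrable_leb_open[OF m_deriv])

lemma m_antiderivative:
  obtains N where "antiderivative_on {a..b} N m'" "AE x in leb a b. m x = N x"
proof -
  obtain F where F: "antiderivative_on {a<..<b} F m'" "AE x in lborel. x \<in> {a<..<b} \<longrightarrow> m x = F x"
    by (rule weak_deriv_representative[OF ab weakly_differentiable_weak_deriv[OF m_wd]])
  obtain N where N: "antiderivative_on {a..b} N m'" "\<And>x. x \<in> {a<..<b} \<Longrightarrow> N x = F x"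
    using antiderivative_extend[OF ab F(1) m'_integrable] by blast
  have "AE x in lborel. x \<in> {a<..<b} \<longrightarrow> m x = N x" using F(2) by eventually_elim (simp add: N(2))
  then have "AE x in leb a b. m x = N x" by (rule AE_leb_open)
  then show thesis by (rule that[OF N(1)])
qed

lemma integral_by_parts_leb:
  assumes F: "antiderivative_on {a..b} F f" and G: "antiderivative_on {a..b} G g"
  shows "integrable (leb a b) (\<lambda>x. f x * G x)" "integrable (leb a b) (\<lambda>x. F x * g x)"
    and "(\<integral>x. f x * G x \<partial>leb a b) = F b * G b - F a * G a - (\<integral>x. F x * g x \<partial>leb a b)"
  using antiderivative_by_parts[OF less_imp_le[OF ab] F G] by (simp_all add: integrable_leb_iff integral_leb)

text \<open>With \<open>p = (\<partial>\<^sub>x w) m\<close>, the pair \<open>(w, p)\<close> solves \<open>w' = p / m\<close> and \<open>\<alpha> p' = w m - s\<close> where \<open>s\<close> is the source,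
  a linear system with bounded coefficients. Hence \<open>w\<close> and \<open>p\<close> are bounded and \<open>p\<close> has boundary values,
  and integration by parts identifies the two expressions for the functional.\<close>

lemma f_vel_linear:
  assumes wm: "w \<in> borel_measurable (leb a b)"
    and wd: "\<alpha> > 0 \<longrightarrow> weakly_differentiable {a<..<b} w \<and>
      weakly_differentiable {a<..<b} (\<lambda>x. weak_deriv {a<..<b} w x * dens a b \<mu> x)"
    and s2: "source a b \<alpha> \<mu> w \<in> L2 (leb a b)"
  shows "\<exists>K. \<forall>\<Phi>\<in>helly a b. f_vel a b \<alpha> \<mu> w \<Phi> = (\<integral>x. \<Phi> x * (source a b \<alpha> \<mu> w x + \<alpha> * m' x) \<partial>leb a b) + K"
proof (cases "\<alpha> = 0")
  case True
  have "f_vel a b 0 \<mu> w \<Phi> = (\<integral>x. \<Phi> x * (source a b 0 \<mu> w x + 0 * m' x) \<partial>leb a b) + 0" if \<Phi>: "\<Phi> \<in> helly a b" for \<Phi>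
    using helly_measurable[OF \<Phi>] wm by (simp add: f_vel_def Let_def source_def integral_mu mult.assoc)
  then show ?thesis unfolding True by blast
next
  case False
  with alpha have \<alpha>: "\<alpha> > 0" by simp
  let ?I = "{a<..<b}"
  define dw where "dw = weak_deriv ?I w"
  define p where "p x = dw x * m x" for x
  define p' where "p' = weak_deriv ?I p"
  define s where "s = source a b \<alpha> \<mu> w"
  have s_eq: "s x = w x * m x - \<alpha> * p' x" for x by (simp add: s_def source_def p'_def p_def[abs_def] dw_def)
  have wW: "is_weak_deriv ?I w dw" using wd \<alpha> unfolding dw_def by (intro weakly_differentiable_weak_deriv) auto
  have wP: "is_weak_deriv ?I p p'"
    using wd \<alpha> unfolding p'_def by (intro weakly_differentiable_weak_deriv) (auto simp: p_def[abs_def] dw_def)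
  obtain W where W: "antiderivative_on ?I W dw" and wAE: "AE x in leb a b. w x = W x"
    by (rule weak_deriv_representative[OF ab wW]) (blast intro: AE_leb_open)
  obtain P where P: "antiderivative_on ?I P p'" and pAE: "AE x in leb a b. p x = P x"
    by (rule weak_deriv_representative[OF ab wP]) (blast intro: AE_leb_open)
  have dwm: "dw \<in> borel_measurable (leb a b)" and p'm: "p' \<in> borel_measurable (leb a b)"
    using wW wP by (auto simp: is_weak_deriv_def intro: locally_integrable_measurable_leb)
  have pm: "p \<in> borel_measurable (leb a b)" unfolding p_def[abs_def] using dwm by simp
  have si: "integrable (leb a b) s" using s2 unfolding s_def by (rule L2_integrable[OF finite_measure_leb])
  define L where "L = max (1 / c) (\<bar>C\<bar> / \<alpha>)"
  have L: "L \<ge> 0" "1 / c \<le> L" "\<bar>C\<bar> / \<alpha> \<le> L" using c_pos by (auto simp: L_def le_max_iff_disj)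
  have dw_le: "AE x in leb a b. \<bar>dw x\<bar> \<le> L * \<bar>P x\<bar>"
    using pAE dens_bounds
  proof eventually_elim
    case (elim x)
    have mx: "m x > 0" using elim c_pos by linarith
    have "\<bar>P x\<bar> = \<bar>dw x\<bar> * m x" unfolding elim(1)[symmetric] p_def abs_mult using mx by simp
    then have "\<bar>dw x\<bar> = \<bar>P x\<bar> / m x" using mx by simp
    also have "\<dots> \<le> \<bar>P x\<bar> / c" using elim c_pos by (intro divide_left_mono) auto
    also have "\<dots> = (1 / c) * \<bar>P x\<bar>" by simp
    also have "\<dots> \<le> L * \<bar>P x\<bar>" using L(2) by (rule mult_right_mono) simp
    finally show ?case .
  qed
  have p'_le: "AE x in leb a b. \<bar>p' x\<bar> \<le> L * \<bar>W x\<bar> + \<bar>s x / \<alpha>\<bar>"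
    using wAE dens_bounds
  proof eventually_elim
    case (elim x)
    have "p' x = (W x * m x) / \<alpha> - s x / \<alpha>" using s_eq[of x] elim(1) \<alpha> by (simp add: field_simps)
    then have "\<bar>p' x\<bar> \<le> \<bar>(W x * m x) / \<alpha>\<bar> + \<bar>s x / \<alpha>\<bar>" by linarith
    also have "\<bar>(W x * m x) / \<alpha>\<bar> = \<bar>W x\<bar> * (m x / \<alpha>)" using \<alpha> by (simp add: abs_mult)
    also have "\<dots> \<le> \<bar>W x\<bar> * L"
    proof (rule mult_left_mono)
      have "m x / \<alpha> \<le> \<bar>C\<bar> / \<alpha>" using elim \<alpha> by (intro divide_right_mono) auto
      then show "m x / \<alpha> \<le> L" using L(3) by linarith
    qed simp
    finally show ?case by (simp add: mult.commute)
  qed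
  obtain B where B: "\<And>x. x \<in> ?I \<Longrightarrow> \<bar>W x\<bar> + \<bar>P x\<bar> \<le> B"
  proof -
    have "integrable (leb a b) (\<lambda>x. s x / \<alpha>)" using si by simp
    from linear_system_bounded[OF ab W P this L(1) dw_le p'_le] show thesis using that by blast
  qed
  have Iin: "AE x in leb a b. x \<in> ?I" by (rule AE_leb_open) simp
  interpret Lb: finite_measure "leb a b" by (rule finite_measure_leb)
  have p'i: "integrable (leb a b) p'"
  proof (rule integrable_AE_bound[OF _ p'm])
    show "integrable (leb a b) (\<lambda>x. L * B + \<bar>s x / \<alpha>\<bar>)" using si by simp
    show "AE x in leb a b. \<bar>p' x\<bar> \<le> L * B + \<bar>s x / \<alpha>\<bar>"
      using p'_le Iin
    proof eventually_elim
      case (elim x)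
      have "\<bar>W x\<bar> \<le> B" using B[OF elim(2)] by linarith
      then have "L * \<bar>W x\<bar> \<le> L * B" using L(1) by (rule mult_left_mono)
      then show ?case using elim(1) by linarith
    qed
  qed
  obtain Q where Q: "antiderivative_on {a..b} Q p'" and QP: "\<And>x. x \<in> ?I \<Longrightarrow> Q x = P x"
    using antiderivative_extend[OF ab P p'i] by blast
  have pQ: "AE x in leb a b. p x = Q x" using pAE Iin by eventually_elim (simp add: QP)
  obtain N where N: "antiderivative_on {a..b} N m'" and mN: "AE x in leb a b. m x = N x"
    by (rule m_antiderivative)
  have traces: "trace_left a (\<lambda>x. dw x * m x) = Q a" "trace_right b (\<lambda>x. dw x * m x) = Q b"
    "trace_left a (dens a b \<mu>) = N a" "trace_right b (dens a b \<mu>) = N b"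
    using average_at_endpoints[OF ab antiderivative_continuous_Icc[OF Q] pm pQ]
      average_at_endpoints[OF ab antiderivative_continuous_Icc[OF N] dens_measurable mN] by (simp_all add: p_def[abs_def])
  define K where "K = \<alpha> * (Q b * b - Q a * a) - \<alpha> * (N b * b - N a * a)"
  have "f_vel a b \<alpha> \<mu> w \<Phi> = (\<integral>x. \<Phi> x * (s x + \<alpha> * m' x) \<partial>leb a b) + K" if \<Phi>: "\<Phi> \<in> helly a b" for \<Phi>
  proof (cases "weakly_differentiable_closed a b \<Phi>")
    case False
    have "\<Phi> a = a" "\<Phi> b = b" using \<Phi> by (auto simp: helly_def)
    then show ?thesis using False traces by (simp add: f_vel_def Let_def K_def s_def dw_def)
  next
    case True
    define d where "d = weak_deriv ?I \<Phi>"
    have di: "integrable (leb a b) d" and dA: "antiderivative_on {a..b} \<Phi> d"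
      using helly_antiderivative[OF ab \<Phi> True] by (auto simp: d_def)
    have dm: "d \<in> borel_measurable (leb a b)" using di by (rule borel_measurable_integrable)
    have \<Phi>m: "\<Phi> \<in> borel_measurable (leb a b)" by (rule helly_measurable[OF \<Phi>])
    have ends: "\<Phi> a = a" "\<Phi> b = b" using \<Phi> by (auto simp: helly_def)
    note pQ_parts = integral_by_parts_leb[OF dA Q] and mN_parts = integral_by_parts_leb[OF dA N]
    have Qm: "Q \<in> borel_measurable (leb a b)" and Nm: "N \<in> borel_measurable (leb a b)"
      using antiderivative_continuous_Icc[OF Q] antiderivative_continuous_Icc[OF N]
      by (auto simp: measurable_cong_sets[OF sets_leb refl] borel_measurable_continuous_on_restrict)
    have wi: "integrable (leb a b) (\<lambda>x. w x * m x)"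
    proof -
      have "integrable (leb a b) (\<lambda>x. s x + \<alpha> * p' x)" using si p'i by simp
      then show ?thesis by (simp add: s_eq)
    qed
    have i1: "integrable (leb a b) (\<lambda>x. \<Phi> x * (w x * m x))" by (rule helly_integrable_mult[OF \<Phi> wi])
    have dp: "AE x in leb a b. d x * p x = d x * Q x" using pQ by eventually_elim simp
    have dN: "AE x in leb a b. d x * m x = d x * N x" using mN by eventually_elim simp
    have i2: "integrable (leb a b) (\<lambda>x. d x * p x)"
      using pQ_parts(1) dp dm pm Qm by (subst integrable_cong_AE[of _ _ "\<lambda>x. d x * Q x"]) auto
    have dp_eq: "(\<integral>x. d x * p x \<partial>leb a b) = (\<integral>x. d x * Q x \<partial>leb a b)"
      using dp dm pm Qm by (intro integral_cong_AE) auto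
    have dN_eq: "(\<integral>x. d x * m x \<partial>leb a b) = (\<integral>x. d x * N x \<partial>leb a b)"
      using dN dm Nm by (intro integral_cong_AE) auto
    have "f_vel a b \<alpha> \<mu> w \<Phi> = (\<integral>x. \<Phi> x * w x + \<alpha> * d x * dw x \<partial>\<mu>) - (\<integral>x. \<alpha> * d x \<partial>\<mu>)"
      using True by (simp add: f_vel_def Let_def d_def dw_def)
    also have "(\<integral>x. \<Phi> x * w x + \<alpha> * d x * dw x \<partial>\<mu>) = (\<integral>x. (\<Phi> x * w x + \<alpha> * d x * dw x) * m x \<partial>leb a b)"
      using \<Phi>m wm dm dwm by (intro integral_mu) simp
    also have "\<dots> = (\<integral>x. \<Phi> x * (w x * m x) + \<alpha> * (d x * p x) \<partial>leb a b)"
      by (rule Bochner_Integration.integral_cong) (auto simp: p_def algebra_simps)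
    also have "\<dots> = (\<integral>x. \<Phi> x * (w x * m x) \<partial>leb a b) + \<alpha> * (\<integral>x. d x * p x \<partial>leb a b)"
      using i1 i2 by simp
    also have "(\<integral>x. \<alpha> * d x \<partial>\<mu>) = (\<integral>x. \<alpha> * d x * m x \<partial>leb a b)"
      using dm by (intro integral_mu) simp
    also have "\<dots> = \<alpha> * (\<integral>x. d x * m x \<partial>leb a b)" by (simp add: mult.assoc)
    finally have 1: "f_vel a b \<alpha> \<mu> w \<Phi> = (\<integral>x. \<Phi> x * (w x * m x) \<partial>leb a b)
        + \<alpha> * (b * Q b - a * Q a - (\<integral>x. \<Phi> x * p' x \<partial>leb a b)) - \<alpha> * (b * N b - a * N a - (\<integral>x. \<Phi> x * m' x \<partial>leb a b))"
      unfolding dp_eq dN_eq pQ_parts(3) mN_parts(3) ends by simp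
    have "(\<integral>x. \<Phi> x * (s x + \<alpha> * m' x) \<partial>leb a b)
      = (\<integral>x. \<Phi> x * (w x * m x) - \<alpha> * (\<Phi> x * p' x) + \<alpha> * (\<Phi> x * m' x) \<partial>leb a b)"
      by (rule Bochner_Integration.integral_cong) (auto simp: s_eq algebra_simps)
    also have "\<dots> = (\<integral>x. \<Phi> x * (w x * m x) \<partial>leb a b) - \<alpha> * (\<integral>x. \<Phi> x * p' x \<partial>leb a b) + \<alpha> * (\<integral>x. \<Phi> x * m' x \<partial>leb a b)"
      using i1 pQ_parts(2) mN_parts(2) by simp
    finally show ?thesis unfolding 1 K_def by (simp add: algebra_simps)
  qed
  then show ?thesis by (auto simp: s_def)
qed

text \<open>The source of a scaled or vanishing velocity is known up to a null set only, because weak derivatives are.\<close>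

lemma f_vel_linear_AE:
  assumes wm: "w \<in> borel_measurable (leb a b)"
    and wd: "\<alpha> > 0 \<longrightarrow> weakly_differentiable {a<..<b} w \<and>
      weakly_differentiable {a<..<b} (\<lambda>x. weak_deriv {a<..<b} w x * dens a b \<mu> x)"
    and s: "s \<in> L2 (leb a b)" and eq: "AE x in leb a b. source a b \<alpha> \<mu> w x = s x"
    and sm: "source a b \<alpha> \<mu> w \<in> borel_measurable (leb a b)"
  shows "\<exists>K. \<forall>\<Phi>\<in>helly a b. f_vel a b \<alpha> \<mu> w \<Phi> = (\<integral>x. \<Phi> x * (s x + \<alpha> * m' x) \<partial>leb a b) + K"
proof -
  have sL2: "source a b \<alpha> \<mu> w \<in> L2 (leb a b)"
  proof -
    have "AE x in leb a b. (s x)\<^sup>2 = (source a b \<alpha> \<mu> w x)\<^sup>2" using eq by eventually_elim simp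
    then have "integrable (leb a b) (\<lambda>x. (source a b \<alpha> \<mu> w x)\<^sup>2)"
      using L2D[OF s] sm by (subst integrable_cong_AE[symmetric, of "\<lambda>x. (s x)\<^sup>2"]) auto
    then show ?thesis using sm by (simp add: L2_def)
  qed
  obtain K where K: "\<And>\<Phi>. \<Phi> \<in> helly a b \<Longrightarrow> f_vel a b \<alpha> \<mu> w \<Phi> = (\<integral>x. \<Phi> x * (source a b \<alpha> \<mu> w x + \<alpha> * m' x) \<partial>leb a b) + K"
    using f_vel_linear[OF wm wd sL2] by blast
  have "(\<integral>x. \<Phi> x * (source a b \<alpha> \<mu> w x + \<alpha> * m' x) \<partial>leb a b) = (\<integral>x. \<Phi> x * (s x + \<alpha> * m' x) \<partial>leb a b)"
    if \<Phi>: "\<Phi> \<in> helly a b" for \<Phi>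
  proof (rule integral_cong_AE)
    show "AE x in leb a b. \<Phi> x * (source a b \<alpha> \<mu> w x + \<alpha> * m' x) = \<Phi> x * (s x + \<alpha> * m' x)"
      using eq by eventually_elim simp
  qed (use helly_measurable[OF \<Phi>] sm L2D(1)[OF s] borel_measurable_integrable[OF m'_integrable] in auto)
  then show ?thesis using K by auto
qed

lemma f_var_linear:
  assumes u: "u \<in> admissible a b \<alpha> \<mu>"
  shows "\<exists>K. \<forall>\<Phi>\<in>helly a b. f_var a b \<alpha> \<mu> u t \<Phi> = (\<integral>x. \<Phi> x * (t * source a b \<alpha> \<mu> u x + \<alpha> * m' x) \<partial>leb a b) + K"
  unfolding f_var_def
proof (rule f_vel_linear_AE)
  let ?I = "{a<..<b}"
  have um: "u \<in> borel_measurable (leb a b)" and uL2: "source a b \<alpha> \<mu> u \<in> L2 (leb a b)"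
    using u by (auto simp: admissible_def)
  show "(\<lambda>x. t * u x) \<in> borel_measurable (leb a b)" using um by simp
  show "(\<lambda>x. t * source a b \<alpha> \<mu> u x) \<in> L2 (leb a b)" by (rule L2_scale[OF uL2])
  let ?q = "\<lambda>u x. weak_deriv ?I u x * dens a b \<mu> x"
  have main: "weakly_differentiable ?I (\<lambda>x. t * u x) \<and> is_weak_deriv ?I (?q (\<lambda>x. t * u x)) (\<lambda>x. t * weak_deriv ?I (?q u) x)"
    if \<alpha>: "\<alpha> > 0"
  proof -
    have wu: "is_weak_deriv ?I u (weak_deriv ?I u)" and wq: "is_weak_deriv ?I (?q u) (weak_deriv ?I (?q u))"
      using u \<alpha> by (auto simp: admissible_def intro!: weakly_differentiable_weak_deriv)
    have wtu: "is_weak_deriv ?I (\<lambda>x. t * u x) (\<lambda>x. t * weak_deriv ?I u x)" by (rule is_weak_deriv_scale[OF wu])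
    then have wd: "weakly_differentiable ?I (\<lambda>x. t * u x)" by (auto simp: weakly_differentiable_def)
    note wtu' = weakly_differentiable_weak_deriv[OF wd]
    have eq: "AE x in lborel. x \<in> ?I \<longrightarrow> t * weak_deriv ?I u x = weak_deriv ?I (\<lambda>x. t * u x) x"
      by (rule weak_deriv_unique[OF _ wtu wtu']) simp
    have wtq: "is_weak_deriv ?I (\<lambda>x. t * ?q u x) (\<lambda>x. t * weak_deriv ?I (?q u) x)" by (rule is_weak_deriv_scale[OF wq])
    have eq': "AE x in lborel. x \<in> ?I \<longrightarrow> t * ?q u x = ?q (\<lambda>x. t * u x) x"
      using eq by eventually_elim auto
    have "is_weak_deriv ?I (?q (\<lambda>x. t * u x)) (\<lambda>x. t * weak_deriv ?I (?q u) x)"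
    proof (rule is_weak_deriv_cong[OF wtq _ eq'])
      have dm: "weak_deriv ?I (\<lambda>x. t * u x) \<in> borel_measurable (leb a b)"
        using wtu' by (intro locally_integrable_measurable_leb) (simp add: is_weak_deriv_def)
      show "locally_integrable ?I (?q (\<lambda>x. t * u x))"
        by (rule locally_integrable_cong_AE[OF _ _ AE_leb_open[OF eq']])
           (use wtq dm in \<open>auto simp: is_weak_deriv_def\<close>)
      show "locally_integrable ?I (\<lambda>x. t * weak_deriv ?I (?q u) x)" using wtq by (simp add: is_weak_deriv_def)
    qed simp
    with wd show ?thesis by blast
  qed
  then show "\<alpha> > 0 \<longrightarrow> weakly_differentiable ?I (\<lambda>x. t * u x) \<and> weakly_differentiable ?I (?q (\<lambda>x. t * u x))"
    by (auto simp: weakly_differentiable_def)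
  have wd2: "is_weak_deriv ?I (?q (\<lambda>x. t * u x)) (weak_deriv ?I (?q (\<lambda>x. t * u x)))" if "\<alpha> > 0"
    using main[OF that] by (intro weakly_differentiable_weak_deriv) (auto simp: weakly_differentiable_def)
  show "AE x in leb a b. source a b \<alpha> \<mu> (\<lambda>x. t * u x) x = t * source a b \<alpha> \<mu> u x"
  proof (cases "\<alpha> = 0")
    case True
    then show ?thesis by (simp add: source_def)
  next
    case False
    with alpha have \<alpha>: "\<alpha> > 0" by simp
    have "AE x in lborel. x \<in> ?I \<longrightarrow> weak_deriv ?I (?q (\<lambda>x. t * u x)) x = t * weak_deriv ?I (?q u) x"
      by (rule weak_deriv_unique[OF _ wd2[OF \<alpha>]]) (use main[OF \<alpha>] in auto)
    from AE_leb_open[OF this] show ?thesis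
      by eventually_elim (simp add: source_def algebra_simps)
  qed
  show "source a b \<alpha> \<mu> (\<lambda>x. t * u x) \<in> borel_measurable (leb a b)"
  proof (cases "\<alpha> = 0")
    case True
    then show ?thesis using um by (simp add: source_def[abs_def])
  next
    case False
    with alpha have \<alpha>: "\<alpha> > 0" by simp
    have "weak_deriv ?I (?q (\<lambda>x. t * u x)) \<in> borel_measurable (leb a b)"
      using wd2[OF \<alpha>] by (intro locally_integrable_measurable_leb) (simp add: is_weak_deriv_def)
    then show ?thesis using um by (simp add: source_def[abs_def])
  qed
qed

text \<open>The regularized functional contains the functional of the zero velocity.\<close>

lemma zero_admissible:
  "(\<lambda>x. 0) \<in> admissible a b \<alpha> \<mu>" "AE x in leb a b. source a b \<alpha> \<mu> (\<lambda>x. 0) x = 0"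
proof -
  let ?I = "{a<..<b}" and ?z = "\<lambda>x :: real. 0 :: real"
  let ?q = "\<lambda>x. weak_deriv ?I ?z x * dens a b \<mu> x"
  have wd: "weakly_differentiable ?I ?z" using is_weak_deriv_zero by (auto simp: weakly_differentiable_def)
  note wz = weakly_differentiable_weak_deriv[OF wd]
  have z0: "AE x in lborel. x \<in> ?I \<longrightarrow> 0 = weak_deriv ?I ?z x"
    by (rule weak_deriv_unique[OF _ is_weak_deriv_zero wz]) simp
  have zm: "weak_deriv ?I ?z \<in> borel_measurable (leb a b)"
    using wz by (intro locally_integrable_measurable_leb) (simp add: is_weak_deriv_def)
  have q0: "AE x in lborel. x \<in> ?I \<longrightarrow> 0 = ?q x" using z0 by eventually_elim auto
  have wq: "is_weak_deriv ?I ?q ?z"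
  proof (rule is_weak_deriv_cong[OF is_weak_deriv_zero _ q0 locally_integrable_const])
    show "locally_integrable ?I ?q"
      by (rule locally_integrable_cong_AE[OF locally_integrable_const _ AE_leb_open[OF q0]]) (use zm in simp)
  qed simp
  then have wdq: "weakly_differentiable ?I ?q" by (auto simp: weakly_differentiable_def)
  note wq' = weakly_differentiable_weak_deriv[OF wdq]
  have "AE x in lborel. x \<in> ?I \<longrightarrow> 0 = weak_deriv ?I ?q x" by (rule weak_deriv_unique[OF _ wq wq']) simp
  from AE_leb_open[OF this] show src: "AE x in leb a b. source a b \<alpha> \<mu> ?z x = 0"
    by eventually_elim (simp add: source_def)
  have sm: "source a b \<alpha> \<mu> ?z \<in> borel_measurable (leb a b)"
  proof -
    have "weak_deriv ?I ?q \<in> borel_measurable (leb a b)"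
      using wq' by (intro locally_integrable_measurable_leb) (simp add: is_weak_deriv_def)
    then show ?thesis by (simp add: source_def[abs_def])
  qed
  have "source a b \<alpha> \<mu> ?z \<in> L2 (leb a b)"
    by (rule L2_bounded[OF finite_measure_leb sm, of 0]) (use src in \<open>auto elim!: eventually_mono\<close>)
  then show "?z \<in> admissible a b \<alpha> \<mu>" using wd wdq by (simp add: admissible_def)
qed

lemma f_reg_linear:
  assumes u: "u \<in> admissible_reg a b \<mu>"
  shows "\<exists>K. \<forall>\<Phi>\<in>helly a b. f_reg a b \<alpha> \<mu> u t \<Phi> = (\<integral>x. \<Phi> x * (t * (u x * m x) + \<alpha> * m' x) \<partial>leb a b) + K"
proof -
  have um: "u \<in> borel_measurable (leb a b)" and uL2: "(\<lambda>x. u x * m x) \<in> L2 (leb a b)"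
    using u by (auto simp: admissible_reg_def)
  have z: "(\<lambda>x. 0) \<in> L2 (leb a b)" using L2_scale[OF uL2, of 0] by simp
  obtain K where K: "\<And>\<Phi>. \<Phi> \<in> helly a b \<Longrightarrow> f_vel a b \<alpha> \<mu> (\<lambda>x. 0) \<Phi> = (\<integral>x. \<Phi> x * (0 + \<alpha> * m' x) \<partial>leb a b) + K"
    using f_vel_linear_AE[OF _ _ z zero_admissible(2)] zero_admissible(1) by (auto simp: admissible_def L2_def)
  have "f_reg a b \<alpha> \<mu> u t \<Phi> = (\<integral>x. \<Phi> x * (t * (u x * m x) + \<alpha> * m' x) \<partial>leb a b) + K" if \<Phi>: "\<Phi> \<in> helly a b" for \<Phi>
  proof -
    have "(\<integral>x. u x * \<Phi> x \<partial>\<mu>) = (\<integral>x. u x * \<Phi> x * m x \<partial>leb a b)"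
      using um helly_measurable[OF \<Phi>] by (intro integral_mu) simp
    also have "\<dots> = (\<integral>x. \<Phi> x * (u x * m x) \<partial>leb a b)" by (simp add: mult_ac)
    finally have 1: "(\<integral>x. u x * \<Phi> x \<partial>\<mu>) = (\<integral>x. \<Phi> x * (u x * m x) \<partial>leb a b)" .
    have i: "integrable (leb a b) (\<lambda>x. \<Phi> x * (u x * m x))" "integrable (leb a b) (\<lambda>x. \<Phi> x * m' x)"
      by (intro helly_integrable_mult[OF \<Phi>] L2_integrable[OF finite_measure_leb uL2] m'_integrable)+
    have "(\<integral>x. \<Phi> x * (t * (u x * m x) + \<alpha> * m' x) \<partial>leb a b)
       = (\<integral>x. t * (\<Phi> x * (u x * m x)) + \<alpha> * (\<Phi> x * m' x) \<partial>leb a b)"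
      by (rule Bochner_Integration.integral_cong) (auto simp: algebra_simps)
    also have "\<dots> = t * (\<integral>x. \<Phi> x * (u x * m x) \<partial>leb a b) + \<alpha> * (\<integral>x. \<Phi> x * m' x \<partial>leb a b)"
      using i by simp
    also have "\<alpha> * (\<integral>x. \<Phi> x * m' x \<partial>leb a b) = (\<integral>x. \<Phi> x * (0 + \<alpha> * m' x) \<partial>leb a b)"
      by (simp add: mult.left_commute)
    finally show ?thesis using K[OF \<Phi>] 1 by (simp add: f_reg_def)
  qed
  then show ?thesis by blast
qed

end

section \<open>Solutions and their dependence on the data\<close>

context regularized_density
begin

text \<open>Constants do not affect minimizers.\<close>

lemma minimizer_iff_energy_minimizer:
  assumes f: "\<And>\<Phi>. \<Phi> \<in> helly a b \<Longrightarrow> f \<Phi> = (\<integral>x. \<Phi> x * g x \<partial>leb a b) + K"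
  shows "minimizer a b \<alpha> \<mu> f \<Phi> \<longleftrightarrow> energy_minimizer g \<Phi>"
proof -
  have F: "F_fun a b \<alpha> \<mu> f \<Psi> = energy g \<Psi> - ereal K" if \<Psi>: "\<Psi> \<in> helly a b" for \<Psi>
  proof -
    have "F_fun a b \<alpha> \<mu> f \<Psi> = ereal (\<integral>x. (\<Psi> x - x)\<^sup>2 / 2 \<partial>\<mu>) + entropy_term \<Psi> - ereal ((\<integral>x. \<Psi> x * g x \<partial>leb a b) + K)"
      unfolding F_fun_def entropy_term_def f[OF \<Psi>] ..
    then show ?thesis unfolding energy_def by (cases "entropy_term \<Psi>") auto
  qed
  have cancel: "x - ereal K \<le> y - ereal K \<longleftrightarrow> x \<le> y" for x y :: ereal by (cases x; cases y) auto
  show ?thesis unfolding minimizer_def energy_minimizer_def by (auto simp: F cancel)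
qed

text \<open>The stability estimate bounds the square of the \<open>L\<^sup>2(\<mu>)\<close> distance by a pairing with \<open>\<sigma>\<close> in Lebesgue
  measure; the lower bound \<open>c\<close> of the density mediates between the two norms.\<close>

lemma energy_minimizer_dist:
  assumes \<Phi>: "energy_minimizer g \<Phi>" and \<Psi>: "energy_minimizer h \<Psi>"
    and gi: "integrable (leb a b) g" and hi: "integrable (leb a b) h"
    and \<sigma>: "\<sigma> \<in> L2 (leb a b)" "\<And>x. g x - h x = \<sigma> x"
  shows "c * L2_norm (leb a b) (\<lambda>x. \<Phi> x - \<Psi> x) \<le> 2 * L2_norm (leb a b) \<sigma>"
    and "sqrt c * L2_norm \<mu> (\<lambda>x. \<Phi> x - \<Psi> x) \<le> 2 * L2_norm (leb a b) \<sigma>"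
proof -
  let ?d = "\<lambda>x. \<Phi> x - \<Psi> x"
  have d\<mu>: "?d \<in> L2 \<mu>" using \<Phi> \<Psi> by (intro L2_diff helly_L2) (auto simp: energy_minimizer_def)
  then have d: "?d \<in> L2 (leb a b)" by (simp add: L2_mu_iff)
  define A B S where "A = L2_norm \<mu> ?d" and "B = L2_norm (leb a b) ?d" and "S = L2_norm (leb a b) \<sigma>"
  have pos: "A \<ge> 0" "B \<ge> 0" "S \<ge> 0" by (auto simp: A_def B_def S_def)
  have "A\<^sup>2 \<le> 2 * (\<integral>x. \<sigma> x * ?d x \<partial>leb a b)"
    using energy_minimizer_stability[OF \<Phi> \<Psi> gi hi] by (simp add: A_def L2_norm_power2 \<sigma>(2))
  also have "\<dots> \<le> 2 * (S * B)" using L2_Cauchy_Schwarz[OF \<sigma>(1) d] by (simp add: S_def B_def)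
  finally have 1: "A\<^sup>2 \<le> 2 * S * B" by simp
  have 2: "c * B\<^sup>2 \<le> A\<^sup>2" using L2_norm_leb_le[OF d] by (simp add: A_def B_def)
  have 3: "c * B \<le> 2 * S"
  proof (cases "B = 0")
    case False
    with pos have "B > 0" by simp
    moreover have "(c * B) * B \<le> (2 * S) * B" using 1 2 by (simp add: power2_eq_square mult.assoc)
    ultimately show ?thesis by (simp only: mult_le_cancel_right_pos)
  qed (use pos in simp)
  then show "c * L2_norm (leb a b) ?d \<le> 2 * L2_norm (leb a b) \<sigma>" by (simp add: B_def S_def)
  have "(sqrt c * A)\<^sup>2 = c * A\<^sup>2" using c_pos by (simp add: power_mult_distrib)
  also have "\<dots> \<le> c * (2 * S * B)" using 1 c_pos by (intro mult_left_mono) auto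
  also have "\<dots> = (2 * S) * (c * B)" by simp
  also have "\<dots> \<le> (2 * S) * (2 * S)" using 3 pos by (intro mult_left_mono) auto
  finally have "(sqrt c * A)\<^sup>2 \<le> (2 * S)\<^sup>2" by (simp add: power2_eq_square)
  then have "sqrt c * A \<le> 2 * S" by (rule power2_le_imp_le) (use pos in simp)
  then show "sqrt c * L2_norm \<mu> ?d \<le> 2 * L2_norm (leb a b) \<sigma>" by (simp add: A_def S_def)
qed

lemma energy_minimizer_AE_unique:
  assumes "energy_minimizer g \<Phi>" "energy_minimizer g \<Psi>" "integrable (leb a b) g"
  shows "AE x in \<mu>. \<Phi> x = \<Psi> x"
proof -
  have d: "(\<lambda>x. \<Phi> x - \<Psi> x) \<in> L2 \<mu>"
    using assms by (intro L2_diff helly_L2) (auto simp: energy_minimizer_def)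
  have "(\<integral>x. (\<Phi> x - \<Psi> x)\<^sup>2 \<partial>\<mu>) \<le> 0" using energy_minimizer_stability[OF assms(1,2,3,3)] by simp
  then have "(\<integral>x. (\<Phi> x - \<Psi> x)\<^sup>2 \<partial>\<mu>) = 0" by (intro antisym) auto
  then have "AE x in \<mu>. (\<Phi> x - \<Psi> x)\<^sup>2 = 0"
    using L2D(2)[OF d] by (subst (asm) integral_nonneg_eq_0_iff_AE) auto
  then show ?thesis by eventually_elim simp
qed

text \<open>If the linear part is affine in time, the minimizers depend on time in a Lipschitz way and therefore have a
  weak time derivative. Uniqueness of minimizers and of weak derivatives up to null sets yields uniqueness of
  the push forward and, almost everywhere, of the velocity.\<close>

lemma ex_unique_solution_for:
  assumes s: "s \<in> L2 (leb a b)" and k: "integrable (leb a b) k"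
    and f: "\<And>t. t \<ge> 0 \<Longrightarrow> \<exists>K. \<forall>\<Phi>\<in>helly a b. f t \<Phi> = (\<integral>x. \<Phi> x * (t * s x + k x) \<partial>leb a b) + K"
  shows "ex_unique_solution (solution_for a b \<alpha> \<mu> f)"
proof -
  let ?g = "\<lambda>t x. t * s x + k x"
  have gi: "integrable (leb a b) (?g t)" for t
    using L2_integrable[OF finite_measure_leb s] k by simp
  have min_iff: "minimizer a b \<alpha> \<mu> (f t) \<Phi> \<longleftrightarrow> energy_minimizer (?g t) \<Phi>" if t: "t \<ge> 0" for t \<Phi>
  proof -
    obtain K where "\<And>\<Phi>. \<Phi> \<in> helly a b \<Longrightarrow> f t \<Phi> = (\<integral>x. \<Phi> x * ?g t x \<partial>leb a b) + K" using f[OF t] by blast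
    then show ?thesis by (rule minimizer_iff_energy_minimizer)
  qed
  have "\<forall>t. \<exists>\<Phi>. energy_minimizer (?g t) \<Phi>" using ex_energy_minimizer[OF gi] by blast
  then obtain X where X: "\<And>t. energy_minimizer (?g t) (X t)" by metis
  have Xh: "X t \<in> helly a b" for t using X[of t] by (simp add: energy_minimizer_def)
  have "\<exists>D. is_weak_L2_deriv \<mu> {0<..} X D"
  proof (rule Lipschitz_curve_weak_derivative[OF finite_measure_axioms, where K = "2 * L2_norm (leb a b) s / sqrt c"])
    show "X t \<in> L2 \<mu>" for t by (rule helly_L2[OF Xh])
    fix r t :: real
    have "sqrt c * L2_norm \<mu> (\<lambda>x. X t x - X r x) \<le> 2 * L2_norm (leb a b) (\<lambda>x. (t - r) * s x)"
      by (rule energy_minimizer_dist(2)[OF X X gi gi L2_scale[OF s]]) (simp add: algebra_simps)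
    also have "L2_norm (leb a b) (\<lambda>x. (t - r) * s x) = \<bar>t - r\<bar> * L2_norm (leb a b) s"
      by (simp add: L2_norm_def power_mult_distrib real_sqrt_mult)
    finally show "L2_norm \<mu> (\<lambda>x. X t x - X r x) \<le> 2 * L2_norm (leb a b) s / sqrt c * \<bar>t - r\<bar>"
      using c_pos by (simp add: field_simps)
  qed
  then obtain D where D: "is_weak_L2_deriv \<mu> {0<..} X D" by blast
  have ex: "\<exists>u \<rho>. solution_for a b \<alpha> \<mu> f u \<rho>"
    unfolding solution_for_def
  proof (intro exI conjI allI impI ballI)
    show "minimizer a b \<alpha> \<mu> (f t) (X t)" if "t \<ge> 0" for t using X min_iff[OF that] by simp
    show "is_weak_L2_deriv \<mu> {0<..} X D" by fact
    show "(\<lambda>t. pushforward a b (X t) \<mu>) t = pushforward a b (X t) \<mu>" for t ..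
    show "(\<lambda>y t. velocity a b \<mu> (X t) (D t) y) y t = velocity a b \<mu> (X t) (D t) y" for t y ..
  qed
  show ?thesis
    unfolding ex_unique_solution_def
  proof (intro conjI ex allI impI)
    have sol_iff: "solution_for a b \<alpha> \<mu> f u \<rho> \<longleftrightarrow> (\<exists>\<Phi> D. (\<forall>t\<ge>0. energy_minimizer (?g t) (\<Phi> t)) \<and>
      is_weak_L2_deriv \<mu> {0<..} \<Phi> D \<and> (\<forall>t\<ge>0. \<rho> t = pushforward a b (\<Phi> t) \<mu>) \<and>
      (\<forall>t\<ge>0. \<forall>y\<in>{a..b}. u y t = velocity a b \<mu> (\<Phi> t) (D t) y))" for u \<rho>
      by (simp add: solution_for_def min_iff)
    fix u \<rho> u' \<rho>' assume sol: "solution_for a b \<alpha> \<mu> f u \<rho> \<and> solution_for a b \<alpha> \<mu> f u' \<rho>'"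
    from sol have "solution_for a b \<alpha> \<mu> f u \<rho>" by simp
    then obtain \<Phi> D where "(\<forall>t\<ge>0. energy_minimizer (?g t) (\<Phi> t)) \<and> is_weak_L2_deriv \<mu> {0<..} \<Phi> D \<and>
      (\<forall>t\<ge>0. \<rho> t = pushforward a b (\<Phi> t) \<mu>) \<and> (\<forall>t\<ge>0. \<forall>y\<in>{a..b}. u y t = velocity a b \<mu> (\<Phi> t) (D t) y)"
      unfolding sol_iff by (elim exE) (rule that)
    then have \<Phi>: "\<And>t. t \<ge> 0 \<Longrightarrow> energy_minimizer (?g t) (\<Phi> t)" "is_weak_L2_deriv \<mu> {0<..} \<Phi> D"
        "\<And>t. t \<ge> 0 \<Longrightarrow> \<rho> t = pushforward a b (\<Phi> t) \<mu>"
        "\<And>t y. t \<ge> 0 \<Longrightarrow> y \<in> {a..b} \<Longrightarrow> u y t = velocity a b \<mu> (\<Phi> t) (D t) y" by auto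
    from sol have "solution_for a b \<alpha> \<mu> f u' \<rho>'" by simp
    then obtain \<Psi> E where "(\<forall>t\<ge>0. energy_minimizer (?g t) (\<Psi> t)) \<and> is_weak_L2_deriv \<mu> {0<..} \<Psi> E \<and>
      (\<forall>t\<ge>0. \<rho>' t = pushforward a b (\<Psi> t) \<mu>) \<and> (\<forall>t\<ge>0. \<forall>y\<in>{a..b}. u' y t = velocity a b \<mu> (\<Psi> t) (E t) y)"
      unfolding sol_iff by (elim exE) (rule that)
    then have \<Psi>: "\<And>t. t \<ge> 0 \<Longrightarrow> energy_minimizer (?g t) (\<Psi> t)" "is_weak_L2_deriv \<mu> {0<..} \<Psi> E"
        "\<And>t. t \<ge> 0 \<Longrightarrow> \<rho>' t = pushforward a b (\<Psi> t) \<mu>"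
        "\<And>t y. t \<ge> 0 \<Longrightarrow> y \<in> {a..b} \<Longrightarrow> u' y t = velocity a b \<mu> (\<Psi> t) (E t) y" by auto
    have h: "\<Phi> t \<in> helly a b" "\<Psi> t \<in> helly a b" if "t \<ge> 0" for t
      using \<Phi>(1)[OF that] \<Psi>(1)[OF that] by (auto simp: energy_minimizer_def)
    have eq: "AE x in \<mu>. \<Phi> t x = \<Psi> t x" if "t \<ge> 0" for t
      by (rule energy_minimizer_AE_unique[OF \<Phi>(1)[OF that] \<Psi>(1)[OF that] gi])
    show "\<rho> t = \<rho>' t" if "t \<ge> 0" for t
      using pushforward_cong_AE[OF h[OF that] eq[OF that]] \<Phi>(3)[OF that] \<Psi>(3)[OF that] by simp
    have "AE t in lborel. t > 0 \<longrightarrow> (AE x in \<mu>. D t x = E t x)"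
      by (rule weak_L2_deriv_unique[OF \<Phi>(2) \<Psi>(2)]) (use eq in auto)
    then show "AE t in lborel. t > 0 \<longrightarrow> (AE y in \<rho> t. u y t = u' y t)"
    proof eventually_elim
      case (elim t)
      show ?case
      proof
        assume t: "t > 0"
        then have t0: "t \<ge> 0" by simp
        have "D t \<in> L2 \<mu>" "E t \<in> L2 \<mu>" using \<Phi>(2) \<Psi>(2) t by (auto simp: is_weak_L2_deriv_def)
        note meas = this[THEN L2D(1)]
        have "AE x in \<mu>. D t x = E t x" using elim t by simp
        then have veq: "AE y in \<rho> t. velocity a b \<mu> (\<Phi> t) (D t) y = velocity a b \<mu> (\<Psi> t) (E t) y"
          unfolding \<Phi>(3)[OF t0] by (rule velocity_cong_AE[OF h[OF t0] eq[OF t0] meas])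
        have sp: "space (\<rho> t) = {a..b}"
          using \<Phi>(3)[of t] t by (simp add: pushforward_def space_restrict_space)
        show "AE y in \<rho> t. u y t = u' y t"
          using veq AE_space[of "\<rho> t"]
        proof eventually_elim
          case (elim y)
          then show ?case using \<Phi>(4)[of t y] \<Psi>(4)[of t y] t sp by simp
        qed
      qed
    qed
  qed
qed

lemma minimizer_dist:
  assumes s: "s \<in> L2 (leb a b)" "r \<in> L2 (leb a b)" and k: "integrable (leb a b) k" and t: "t \<ge> 0"
    and f: "\<exists>K. \<forall>\<Phi>\<in>helly a b. f \<Phi> = (\<integral>x. \<Phi> x * (t * s x + k x) \<partial>leb a b) + K"
    and h: "\<exists>K. \<forall>\<Phi>\<in>helly a b. h \<Phi> = (\<integral>x. \<Phi> x * (t * r x + k x) \<partial>leb a b) + K"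
    and \<Phi>: "minimizer a b \<alpha> \<mu> f \<Phi>" and \<Psi>: "minimizer a b \<alpha> \<mu> h \<Psi>"
  shows "L2_norm (leb a b) (\<lambda>x. \<Psi> x - \<Phi> x) \<le> 2 * t / c * L2_norm (leb a b) (\<lambda>x. r x - s x)"
proof -
  have i: "integrable (leb a b) (\<lambda>x. t * s x + k x)" "integrable (leb a b) (\<lambda>x. t * r x + k x)"
    using L2_integrable[OF finite_measure_leb s(1)] L2_integrable[OF finite_measure_leb s(2)] k by auto
  have \<Phi>': "energy_minimizer (\<lambda>x. t * s x + k x) \<Phi>"
    using \<Phi> f minimizer_iff_energy_minimizer[of f "\<lambda>x. t * s x + k x"] by blast
  have \<Psi>': "energy_minimizer (\<lambda>x. t * r x + k x) \<Psi>"
    using \<Psi> h minimizer_iff_energy_minimizer[of h "\<lambda>x. t * r x + k x"] by blast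
  have "c * L2_norm (leb a b) (\<lambda>x. \<Psi> x - \<Phi> x) \<le> 2 * L2_norm (leb a b) (\<lambda>x. t * (r x - s x))"
    by (rule energy_minimizer_dist(1)[OF \<Psi>' \<Phi>' i(2,1) L2_scale[OF L2_diff[OF s(2,1)]]]) (simp add: algebra_simps)
  also have "L2_norm (leb a b) (\<lambda>x. t * (r x - s x)) = t * L2_norm (leb a b) (\<lambda>x. r x - s x)"
    using t by (simp add: L2_norm_def power_mult_distrib real_sqrt_mult)
  finally show ?thesis using c_pos by (simp add: field_simps)
qed

end

lemma (in bounded_density) L2_norm_mult_density_le:
  assumes u: "u \<in> L2 (leb a b)"
  shows "(\<lambda>x. u x * m x) \<in> L2 (leb a b)" "L2_norm (leb a b) (\<lambda>x. u x * m x) \<le> \<bar>C\<bar> * L2_norm (leb a b) u"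
proof -
  have um: "u \<in> borel_measurable (leb a b)" using L2D(1)[OF u] .
  have le: "AE x in leb a b. (u x * m x)\<^sup>2 \<le> C\<^sup>2 * (u x)\<^sup>2"
    using dens_bounds
  proof eventually_elim
    case (elim x)
    have "(m x)\<^sup>2 \<le> C\<^sup>2" using elim c_pos by (intro power_mono) auto
    then have "(u x)\<^sup>2 * (m x)\<^sup>2 \<le> (u x)\<^sup>2 * C\<^sup>2" by (intro mult_left_mono) auto
    then show ?case by (simp add: power_mult_distrib mult.commute)
  qed
  have i: "integrable (leb a b) (\<lambda>x. (u x * m x)\<^sup>2)"
    by (rule Bochner_Integration.integrable_bound[where f = "\<lambda>x. C\<^sup>2 * (u x)\<^sup>2"])
       (use L2D(2)[OF u] um le in \<open>auto elim!: eventually_mono\<close>)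
  then show "(\<lambda>x. u x * m x) \<in> L2 (leb a b)" using um by (simp add: L2_def)
  have "(\<integral>x. (u x * m x)\<^sup>2 \<partial>leb a b) \<le> (\<integral>x. C\<^sup>2 * (u x)\<^sup>2 \<partial>leb a b)"
    by (rule integral_mono_AE[OF i]) (use L2D(2)[OF u] le in auto)
  then have "L2_norm (leb a b) (\<lambda>x. u x * m x) \<le> sqrt (C\<^sup>2 * (\<integral>x. (u x)\<^sup>2 \<partial>leb a b))"
    unfolding L2_norm_def by (intro real_sqrt_le_mono) simp
  then show "L2_norm (leb a b) (\<lambda>x. u x * m x) \<le> \<bar>C\<bar> * L2_norm (leb a b) u"
    by (simp add: L2_norm_def real_sqrt_mult)
qed

text \<open>Division by the density is bounded because of its lower bound.\<close>

lemma (in bounded_density) L2_if_mult_density: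
  assumes um: "u \<in> borel_measurable (leb a b)" and u: "(\<lambda>x. u x * m x) \<in> L2 (leb a b)"
  shows "u \<in> L2 (leb a b)"
proof -
  have "integrable (leb a b) (\<lambda>x. (u x)\<^sup>2)"
  proof (rule Bochner_Integration.integrable_bound[where f = "\<lambda>x. (u x * m x)\<^sup>2 / c\<^sup>2"])
    show "AE x in leb a b. norm ((u x)\<^sup>2) \<le> norm ((u x * m x)\<^sup>2 / c\<^sup>2)"
      using dens_bounds
    proof eventually_elim
      case (elim x)
      have "c\<^sup>2 \<le> (m x)\<^sup>2" using elim c_pos by (intro power_mono) auto
      then have "(u x)\<^sup>2 * c\<^sup>2 \<le> (u x)\<^sup>2 * (m x)\<^sup>2" by (intro mult_left_mono) auto
      then show ?case using c_pos by (simp add: power_mult_distrib pos_le_divide_eq)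
    qed
  qed (use L2D(2)[OF u] um in auto)
  then show ?thesis using um by (simp add: L2_def)
qed

context sobolev_density
begin

lemma variational_solutions:
  assumes u: "u0 \<in> admissible a b \<alpha> \<mu>"
  shows "ex_unique_solution (variational_solution a b \<alpha> \<mu> u0)"
    and "t \<ge> 0 \<Longrightarrow> minimizer_continuous_at a b \<alpha> \<mu> (admissible a b \<alpha> \<mu>) (source a b \<alpha> \<mu>) (\<lambda>v. f_var a b \<alpha> \<mu> v t) u0"
proof -
  have k: "integrable (leb a b) (\<lambda>x. \<alpha> * m' x)" using m'_integrable by simp
  have sL2: "source a b \<alpha> \<mu> v \<in> L2 (leb a b)" if "v \<in> admissible a b \<alpha> \<mu>" for v
    using that by (simp add: admissible_def)
  show "ex_unique_solution (variational_solution a b \<alpha> \<mu> u0)"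
    unfolding variational_solution_def
    by (rule ex_unique_solution_for[OF sL2[OF u] k f_var_linear[OF u]])
  assume t: "t \<ge> 0"
  show "minimizer_continuous_at a b \<alpha> \<mu> (admissible a b \<alpha> \<mu>) (source a b \<alpha> \<mu>) (\<lambda>v. f_var a b \<alpha> \<mu> v t) u0"
    unfolding minimizer_continuous_at_def
  proof (intro allI impI)
    fix e :: real assume e: "e > 0"
    show "\<exists>d>0. \<forall>v\<in>admissible a b \<alpha> \<mu>. L2_norm (leb a b) (\<lambda>x. source a b \<alpha> \<mu> v x - source a b \<alpha> \<mu> u0 x) < d \<longrightarrow>
      (\<forall>\<Phi> \<Psi>. minimizer a b \<alpha> \<mu> (f_var a b \<alpha> \<mu> u0 t) \<Phi> \<and> minimizer a b \<alpha> \<mu> (f_var a b \<alpha> \<mu> v t) \<Psi> \<longrightarrow>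
        L2_norm (leb a b) (\<lambda>x. \<Psi> x - \<Phi> x) < e)"
    proof (intro exI[of _ "e / (2 * t / c + 1)"] conjI ballI impI allI)
      have q: "2 * t / c \<ge> 0" using t c_pos by simp
      show "e / (2 * t / c + 1) > 0" using e q by simp
      fix v \<Phi> \<Psi>
      assume v: "v \<in> admissible a b \<alpha> \<mu>"
        and small: "L2_norm (leb a b) (\<lambda>x. source a b \<alpha> \<mu> v x - source a b \<alpha> \<mu> u0 x) < e / (2 * t / c + 1)"
        and min: "minimizer a b \<alpha> \<mu> (f_var a b \<alpha> \<mu> u0 t) \<Phi> \<and> minimizer a b \<alpha> \<mu> (f_var a b \<alpha> \<mu> v t) \<Psi>"
      have "L2_norm (leb a b) (\<lambda>x. \<Psi> x - \<Phi> x) \<le> 2 * t / c * L2_norm (leb a b) (\<lambda>x. source a b \<alpha> \<mu> v x - source a b \<alpha> \<mu> u0 x)"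
        using min by (intro minimizer_dist[OF sL2[OF u] sL2[OF v] k t f_var_linear[OF u] f_var_linear[OF v]]) auto
      also have "\<dots> \<le> 2 * t / c * (e / (2 * t / c + 1))" using small q by (intro mult_left_mono) auto
      also have "\<dots> < e"
      proof -
        have "y * (e / (y + 1)) < e" if "y \<ge> 0" for y using that e by (simp add: field_simps)
        then show ?thesis using q by blast
      qed
      finally show "L2_norm (leb a b) (\<lambda>x. \<Psi> x - \<Phi> x) < e" .
    qed
  qed
qed

lemma regularized_variational_solutions:
  assumes u: "u0 \<in> admissible_reg a b \<mu>"
  shows "ex_unique_solution (regularized_variational_solution a b \<alpha> \<mu> u0)"
    and "t \<ge> 0 \<Longrightarrow> minimizer_continuous_at a b \<alpha> \<mu> (admissible_reg a b \<mu>) (\<lambda>v. v) (\<lambda>v. f_reg a b \<alpha> \<mu> v t) u0"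
proof -
  have k: "integrable (leb a b) (\<lambda>x. \<alpha> * m' x)" using m'_integrable by simp
  have mL2: "(\<lambda>x. v x * m x) \<in> L2 (leb a b)" and vL2: "v \<in> L2 (leb a b)" if "v \<in> admissible_reg a b \<mu>" for v
    using that by (auto simp: admissible_reg_def intro: L2_if_mult_density)
  show "ex_unique_solution (regularized_variational_solution a b \<alpha> \<mu> u0)"
    unfolding regularized_variational_solution_def
    by (rule ex_unique_solution_for[OF mL2[OF u] k f_reg_linear[OF u]])
  assume t: "t \<ge> 0"
  show "minimizer_continuous_at a b \<alpha> \<mu> (admissible_reg a b \<mu>) (\<lambda>v. v) (\<lambda>v. f_reg a b \<alpha> \<mu> v t) u0"
    unfolding minimizer_continuous_at_def
  proof (intro allI impI)
    fix e :: real assume e: "e > 0"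
    let ?q = "2 * t / c * \<bar>C\<bar>"
    show "\<exists>d>0. \<forall>v\<in>admissible_reg a b \<mu>. L2_norm (leb a b) (\<lambda>x. v x - u0 x) < d \<longrightarrow>
      (\<forall>\<Phi> \<Psi>. minimizer a b \<alpha> \<mu> (f_reg a b \<alpha> \<mu> u0 t) \<Phi> \<and> minimizer a b \<alpha> \<mu> (f_reg a b \<alpha> \<mu> v t) \<Psi> \<longrightarrow>
        L2_norm (leb a b) (\<lambda>x. \<Psi> x - \<Phi> x) < e)"
    proof (intro exI[of _ "e / (?q + 1)"] conjI ballI impI allI)
      have q: "?q \<ge> 0" "2 * t / c \<ge> 0" using t c_pos by auto
      show "e / (?q + 1) > 0" using e q by simp
      fix v \<Phi> \<Psi>
      assume v: "v \<in> admissible_reg a b \<mu>"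
        and small: "L2_norm (leb a b) (\<lambda>x. v x - u0 x) < e / (?q + 1)"
        and min: "minimizer a b \<alpha> \<mu> (f_reg a b \<alpha> \<mu> u0 t) \<Phi> \<and> minimizer a b \<alpha> \<mu> (f_reg a b \<alpha> \<mu> v t) \<Psi>"
      have "L2_norm (leb a b) (\<lambda>x. \<Psi> x - \<Phi> x) \<le> 2 * t / c * L2_norm (leb a b) (\<lambda>x. v x * m x - u0 x * m x)"
        using min by (intro minimizer_dist[OF mL2[OF u] mL2[OF v] k t f_reg_linear[OF u] f_reg_linear[OF v]]) auto
      also have "\<dots> \<le> 2 * t / c * (\<bar>C\<bar> * L2_norm (leb a b) (\<lambda>x. v x - u0 x))"
        using L2_norm_mult_density_le(2)[OF L2_diff[OF vL2[OF v] vL2[OF u]]] q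
        by (intro mult_left_mono) (simp_all add: left_diff_distrib)
      also have "\<dots> = ?q * L2_norm (leb a b) (\<lambda>x. v x - u0 x)" by simp
      also have "\<dots> \<le> ?q * (e / (?q + 1))" using small q by (intro mult_left_mono) auto
      also have "\<dots> < e"
      proof -
        have "y * (e / (y + 1)) < e" if "y \<ge> 0" for y using that e by (simp add: field_simps)
        then show ?thesis using q(1) by blast
      qed
      finally show "L2_norm (leb a b) (\<lambda>x. \<Psi> x - \<Phi> x) < e" .
    qed
  qed
qed

end

theorem theorem2p12:
  fixes a b \<alpha> :: real and \<mu> :: "real measure"
  assumes "a < b" and "\<alpha> \<ge> 0"
    and "prob_space \<mu>" and "sets \<mu> = sets (restrict_space borel {a..b})"
    and "absolutely_continuous (leb a b) \<mu>"
    and "0 < ess_inf (leb a b) (\<lambda>x. ereal (dens a b \<mu> x))"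
    and "esssup (leb a b) (\<lambda>x. ereal (dens a b \<mu> x)) < \<infinity>"
    and "weakly_differentiable {a<..<b} (dens a b \<mu>)"
    and "set_integrable lborel {a<..<b} (weak_deriv {a<..<b} (dens a b \<mu>))"
  shows "(\<forall>u0\<in>admissible a b \<alpha> \<mu>.
            ex_unique_solution (variational_solution a b \<alpha> \<mu> u0) \<and>
            (\<forall>t\<ge>0. minimizer_continuous_at a b \<alpha> \<mu> (admissible a b \<alpha> \<mu>)
                      (source a b \<alpha> \<mu>) (\<lambda>v. f_var a b \<alpha> \<mu> v t) u0))
       \<and> (\<forall>u0\<in>admissible_reg a b \<mu>.
            ex_unique_solution (regularized_variational_solution a b \<alpha> \<mu> u0) \<and>
            (\<forall>t\<ge>0. minimizer_continuous_at a b \<alpha> \<mu> (admissible_reg a b \<mu>)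
                      (\<lambda>v. v) (\<lambda>v. f_reg a b \<alpha> \<mu> v t) u0))"
proof -
  let ?m = "dens a b \<mu>"
  have "\<exists>c>0. AE x in leb a b. c \<le> ?m x"
  proof -
    \<comment> \<open>The essential bounds are replaced by real constants strictly beyond them.\<close>
    obtain c where c: "0 < c" "ereal c < ess_inf (leb a b) (\<lambda>x. ereal (?m x))"
      using ereal_dense2[OF assms(6)] by auto
    have "AE x in leb a b. - ereal (?m x) \<le> esssup (leb a b) (\<lambda>x. - ereal (?m x))" by (rule esssup_AE)
    then have "AE x in leb a b. c \<le> ?m x"
    proof eventually_elim
      case (elim x)
      then have "ess_inf (leb a b) (\<lambda>x. ereal (?m x)) \<le> ereal (?m x)"
        unfolding ess_inf_def by (subst ereal_uminus_le_reorder)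
      with c(2) have "ereal c < ereal (?m x)" by (rule less_le_trans)
      then show ?case by simp
    qed
    with c(1) show ?thesis by blast
  qed
  moreover have "\<exists>C. AE x in leb a b. ?m x \<le> C"
  proof -
    have AE: "AE x in leb a b. ereal (?m x) \<le> esssup (leb a b) (\<lambda>x. ereal (?m x))" by (rule esssup_AE)
    obtain C where C: "esssup (leb a b) (\<lambda>x. ereal (?m x)) < ereal C"
      using ereal_dense2[OF assms(7)] by blast
    have "AE x in leb a b. ?m x \<le> C"
      using AE
    proof eventually_elim
      case (elim x)
      then have "ereal (?m x) < ereal C" using C by (rule le_less_trans)
      then show ?case by simp
    qed
    then show ?thesis by blast
  qed
  ultimately obtain c C where cC: "0 < c" "AE x in leb a b. c \<le> ?m x" "AE x in leb a b. ?m x \<le> C" by blast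
  interpret prob_space \<mu> by fact
  interpret sobolev_density a b \<mu> c C \<alpha>
  proof
    show "AE x in leb a b. c \<le> ?m x \<and> ?m x \<le> C" using cC(2,3) by eventually_elim simp
    show "sets \<mu> = sets (leb a b)" using assms(4) by (simp only: sets_leb)
  qed (fact assms cC(1))+
  show ?thesis
    by (intro conjI ballI allI impI variational_solutions regularized_variational_solutions)
qed

end
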